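(* Let $G$ be a finite group acting on $S_{\mathbf q}(V)$ by graded algebra automorphisms. If $G$ acts diagonally on the chosen basis $x_1,\dots,x_N$ of $V$, then for each $g\in G$, $\operatorname{HH}^{\bullet}(S_{\mathbf q}(V),S_{\mathbf q}(V)_g)$ is the graded vector subspace of $S_{\mathbf q}(V)_g\otimes\bigwedge_{\mathbf q^{-1}}(V^* )$ given by $$\operatorname{HH}^m(S_{\mathbf q}(V),S_{\mathbf q}(V)_g)\cong\bigoplus_{\substack{\beta\in\{0,1\}^N\\|\beta|=m}}\ \bigoplus_{\substack{\alpha\in\mathbb N^N\\\alpha-\beta\in C_g}}\operatorname{span}_{\Bbbk}\{(x^\alpha\#g)\otimes(x^* )^{\wedge\beta}\}$$ for all $m\in\mathbb N$. Therefore $$\operatorname{HH}^m(S_{\mathbf q}(V),S_{\mathbf q}(V)\rtimes G)\cong\bigoplus_{g\in G}\ \bigoplus_{\substack{\beta\in\{0,1\}^N\\|\beta|=m}}\ \bigoplus_{\substack{\alpha\in\mathbb N^N\\\alpha-\beta\in C_g}}\operatorname{span}_{\Bbbk}\{(x^\alpha\#g)\otimes(x^* )^{\wedge\beta}\}$$ for all $m\in\mathbb N$, and $\operatorname{HH}^m(S_{\mathbf q}(V)\rtimes G)$ is (isomorphic to) its $G$-invariant subspace.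
   Context: Let $\Bbbk$ be a field of characteristic $0$; all tensor products are over $\Bbbk$, algebras are associative and unital, and $\mathbb N=\{0,1,2,\dots\}$. Let $N$ be a positive integer and, for $1\le i,j\le N$, let $q_{i,j}\in\Bbbk$ be nonzero scalars with $q_{i,i}=1$ and $q_{j,i}=q_{i,j}^{-1}$; write $\mathbf q=(q_{i,j})$ and $\mathbf q^{-1}=(q_{i,j}^{-1})$. Let $V$ be a vector space with basis $x_1,\dots,x_N$ and dual basis $x_1^*,\dots,x_N^*$ of $V^*$. Put $A=S_{\mathbf q}(V)=\Bbbk\langle x_1,\dots,x_N\mid x_ix_j=q_{i,j}x_jx_i,\ 1\le i,j\le N\rangle$ and $\bigwedge_{\mathbf q^{-1}}(V^* )=T(V^* )/(x_i^*x_j^*+q_{i,j}^{-1}x_j^*x_i^*\mid 1\le i,j\le N)$. For $\alpha\in\mathbb N^N$, $x^\alpha=x_1^{\alpha_1}\cdots x_N^{\alpha_N}$. For $\beta\in\{0,1\}^N$, $|\beta|=\sum_i\beta_i$, and $(x^* )^{\wedge\beta}=x_{j_1}^*\wedge\cdots\wedge x_{j_m}^*$ where $m=|\beta|$ and $j_1<\dots<j_m$ are the indices with $\beta_{j_k}=1$; these with $|\beta|=m$ form a basis of $\bigwedge^m(V^* )$ and of the degree $m$ part of $\bigwedge_{\mathbf q^{-1}}(V^* )$, which are identified as vector spaces. Let $[i]\in\mathbb N^N$ be the $i$-th unit vector. The action of $g\in G$ on $a\in A$ is written ${}^ga$. The action is diagonal if there are scalars $\lambda_{g,i}\in\Bbbk$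 with ${}^gx_i=\lambda_{g,i}x_i$ for all $g\in G$, $1\le i\le N$. The skew group algebra $A\rtimes G=\bigoplus_{g\in G}A_g$, $A_g=\{a\#g\mid a\in A\}$, has multiplication $(a\#g)(b\#h)=a({}^gb)\#gh$. Each $A_g$ is an $A$-bimodule via $a\cdot(c\#g)\cdot b=ac({}^gb)\#g$, and $A\rtimes G=\bigoplus_gA_g$ as $A$-bimodules. Define $$C_g=\Big\{\gamma\in(\mathbb N\cup\{-1\})^N\ \Big|\ \text{for each }i\in\{1,\dots,N\},\ \prod_{s=1}^Nq_{i,s}^{\gamma_s}=\lambda_{g,i}\ \text{or}\ \gamma_i=-1\Big\}.$$ Hochschild cohomology of an algebra $R$ with coefficients in an $R$-bimodule $M$ is $\operatorname{HH}^{\bullet}(R,M)=\operatorname{Ext}^{\bullet}_{R\otimes R^{\mathrm{op}}}(R,M)$, and $\operatorname{HH}^{\bullet}(R)=\operatorname{HH}^{\bullet}(R,R)$. $\operatorname{HH}^{\bullet}(A,A_g)$ is the cohomology of the complex with degree $m$ term $A_g\otimes\bigwedge^m(V^* )$ (obtained from a twisted Koszul resolution of $A$) and differential, for $|\beta|=m-1$, $$d_m^*((a\#g)\otimes(x^* )^{\wedge\beta})=\sum_{i=1}^N\delta_{\beta_i,0}(-1)^{\sum_{s=1}^i\beta_s}\Big[\Big(\Big(\prod_{s=1}^iq_{s,i}^{\beta_s}\Big)x_ia-\Big(\prod_{s=i}^Nq_{i,s}^{\beta_s}\Big)a({}^gx_i)\Big)\#g\Big]\otimes(x^* )^{\wedge(\beta+[i])},$$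 and the elements $(x^\alpha\#g)\otimes(x^* )^{\wedge\beta}$ in the theorem denote the classes of these cochains. The $G$-action on $\operatorname{HH}^{\bullet}(A,A\rtimes G)$ is the standard one, induced on bar cochains $f\in\operatorname{Hom}_{A^e}(A^{\otimes(m+2)},A\rtimes G)$ by $(h\cdot f)(a_0\otimes\cdots\otimes a_{m+1})=(1\#h)\,f({}^{h^{-1}}a_0\otimes\cdots\otimes{}^{h^{-1}}a_{m+1})\,(1\#h^{-1})$ for $h\in G$. *)

theory Defs
  imports "HOL-Algebra.QuotRing" "HOL-Algebra.Module" "HOL-Algebra.Group_Action"
begin

section \<open>Vector spaces with a carrier set\<close>

text \<open>
  The ground field is a type of class \<open>field\<close>. Vector spaces are \<open>module\<close> records over the
  ring below; the fields \<open>mult\<close> and \<open>one\<close> of such a record only matter when it is an algebra.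
\<close>

definition scalars :: "'k::field ring" where
  "scalars = \<lparr>carrier = UNIV, mult = (*), one = 1, zero = 0, add = (+)\<rparr>"

definition lin_hom ::
  "('k::field, 'v, 'x) module_scheme \<Rightarrow> ('k, 'w, 'y) module_scheme \<Rightarrow> ('v \<Rightarrow> 'w) set" where
  "lin_hom V W = {f \<in> carrier V \<rightarrow>\<^sub>E carrier W.
     (\<forall>u\<in>carrier V. \<forall>v\<in>carrier V. f (u \<oplus>\<^bsub>V\<^esub> v) = f u \<oplus>\<^bsub>W\<^esub> f v) \<and>
     (\<forall>c. \<forall>v\<in>carrier V. f (c \<odot>\<^bsub>V\<^esub> v) = c \<odot>\<^bsub>W\<^esub> f v)}"

definition lin_iso ::
  "('k::field, 'v, 'x) module_scheme \<Rightarrow> ('k, 'w, 'y) module_scheme \<Rightarrow> ('v \<Rightarrow> 'w) \<Rightarrow> bool" where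
  "lin_iso V W f \<longleftrightarrow> f \<in> lin_hom V W \<and> bij_betw f (carrier V) (carrier W)"

definition isomorphic ::
  "('k::field, 'v, 'x) module_scheme \<Rightarrow> ('k, 'w, 'y) module_scheme \<Rightarrow> bool"
    (infix \<open>\<cong>\<^sub>k\<close> 50) where
  "V \<cong>\<^sub>k W \<longleftrightarrow> (\<exists>f. lin_iso V W f)"

definition is_basis ::
  "('k::field, 'v, 'x) module_scheme \<Rightarrow> 'j set \<Rightarrow> ('j \<Rightarrow> 'v) \<Rightarrow> bool" where
  "is_basis V J b \<longleftrightarrow> b ` J \<subseteq> carrier V \<and>
     (\<forall>v\<in>carrier V. \<exists>!c. finite {j. c j \<noteq> 0} \<and> {j. c j \<noteq> 0} \<subseteq> J \<and>
        v = (\<Oplus>\<^bsub>V\<^esub>j\<in>{j. c j \<noteq> 0}. c j \<odot>\<^bsub>V\<^esub> b j))"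

text \<open>The span of a single vector.\<close>

definition line :: "('k::field, 'v) module \<Rightarrow> 'v \<Rightarrow> ('k, 'v) module" where
  "line V v = V\<lparr>carrier := {c \<odot>\<^bsub>V\<^esub> v | c. True}\<rparr>"

text \<open>A set \<open>F\<close> of families indexed by \<open>J\<close>, with the pointwise vector space operations.\<close>

definition pointwise ::
  "'j set \<Rightarrow> ('j \<Rightarrow> ('k::field, 'v, 'x) module_scheme) \<Rightarrow> ('j \<Rightarrow> 'v) set \<Rightarrow> ('k, 'j \<Rightarrow> 'v) module"
where
  "pointwise J V F =
    \<lparr>carrier = F, mult = undefined, one = undefined,
     zero = (\<lambda>j\<in>J. \<zero>\<^bsub>V j\<^esub>),
     add = (\<lambda>f g. \<lambda>j\<in>J. f j \<oplus>\<^bsub>V j\<^esub> g j),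
     smult = (\<lambda>c f. \<lambda>j\<in>J. c \<odot>\<^bsub>V j\<^esub> f j)\<rparr>"

definition direct_sum ::
  "'j set \<Rightarrow> ('j \<Rightarrow> ('k::field, 'v, 'x) module_scheme) \<Rightarrow> ('k, 'j \<Rightarrow> 'v) module" where
  "direct_sum J V =
     pointwise J V {f \<in> \<Pi>\<^sub>E j\<in>J. carrier (V j). finite {j \<in> J. f j \<noteq> \<zero>\<^bsub>V j\<^esub>}}"

definition coset_smult ::
  "('k::field, 'v, 'x) module_scheme \<Rightarrow> 'v set \<Rightarrow> 'k \<Rightarrow> 'v set \<Rightarrow> 'v set" where
  "coset_smult V B c X = (\<Union>x\<in>X. B +>\<^bsub>V\<^esub> (c \<odot>\<^bsub>V\<^esub> x))"

text \<open>The quotient \<open>Z / B\<close> of subspaces \<open>B \<subseteq> Z\<close> of \<open>V\<close>.\<close>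

definition quotient_space ::
  "('k::field, 'v, 'x) module_scheme \<Rightarrow> 'v set \<Rightarrow> 'v set \<Rightarrow> ('k, 'v set) module" where
  "quotient_space V Z B =
    \<lparr>carrier = {B +>\<^bsub>V\<^esub> z | z. z \<in> Z}, mult = undefined, one = undefined,
     zero = B, add = set_add V, smult = coset_smult V B\<rparr>"


section \<open>Cochain complexes\<close>

text \<open>A cochain complex is a sequence \<open>C\<close> of spaces with differentials \<open>\<delta> m : C m \<rightarrow> C (m + 1)\<close>.\<close>

definition cocycles ::
  "(nat \<Rightarrow> ('k::field, 'c) module) \<Rightarrow> (nat \<Rightarrow> 'c \<Rightarrow> 'c) \<Rightarrow> nat \<Rightarrow> 'c set" where
  "cocycles C \<delta> m = {z \<in> carrier (C m). \<delta> m z = \<zero>\<^bsub>C (Suc m)\<^esub>}"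

definition coboundaries ::
  "(nat \<Rightarrow> ('k::field, 'c) module) \<Rightarrow> (nat \<Rightarrow> 'c \<Rightarrow> 'c) \<Rightarrow> nat \<Rightarrow> 'c set" where
  "coboundaries C \<delta> m = (case m of 0 \<Rightarrow> {\<zero>\<^bsub>C 0\<^esub>} | Suc n \<Rightarrow> \<delta> n ` carrier (C n))"

definition cohomology ::
  "(nat \<Rightarrow> ('k::field, 'c) module) \<Rightarrow> (nat \<Rightarrow> 'c \<Rightarrow> 'c) \<Rightarrow> nat \<Rightarrow> ('k, 'c set) module" where
  "cohomology C \<delta> m = quotient_space (C m) (cocycles C \<delta> m) (coboundaries C \<delta> m)"

text \<open>The map on cohomology in degree \<open>m\<close> induced by \<open>\<theta> : C m \<rightarrow> C' m\<close>.\<close>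

definition cohomology_map ::
  "(nat \<Rightarrow> ('k::field, 'c) module) \<Rightarrow> (nat \<Rightarrow> 'c \<Rightarrow> 'c) \<Rightarrow>
   (nat \<Rightarrow> ('k, 'd) module) \<Rightarrow> (nat \<Rightarrow> 'd \<Rightarrow> 'd) \<Rightarrow> nat \<Rightarrow> ('c \<Rightarrow> 'd) \<Rightarrow> 'c set \<Rightarrow> 'd set" where
  "cohomology_map C \<delta> C' \<delta>' m \<theta> =
     (\<lambda>X\<in>carrier (cohomology C \<delta> m). \<Union>z\<in>X. coboundaries C' \<delta>' m +>\<^bsub>C' m\<^esub> \<theta> z)"


section \<open>Bimodules\<close>

text \<open>An algebra is a \<open>module\<close> record, using all of its fields.\<close>

record ('k, 'a, 'm) bimodule = "('k, 'm) module" +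
  lact :: "'a \<Rightarrow> 'm \<Rightarrow> 'm"
  ract :: "'m \<Rightarrow> 'a \<Rightarrow> 'm"

text \<open>
  Bimodules over an algebra \<open>R\<close> on which the two scalar actions agree, that is, modules over
  \<open>R \<otimes> R\<^sup>o\<^sup>p\<close>.
\<close>

locale bimodule = M: Module.module scalars M
  for R :: "('k::field, 'a) module" and M :: "('k, 'a, 'm) bimodule" +
  assumes lact_closed:
      "\<lbrakk>r \<in> carrier R; m \<in> carrier M\<rbrakk> \<Longrightarrow> lact M r m \<in> carrier M"
    and ract_closed:
      "\<lbrakk>r \<in> carrier R; m \<in> carrier M\<rbrakk> \<Longrightarrow> ract M m r \<in> carrier M"
    and lact_add:
      "\<lbrakk>r \<in> carrier R; m \<in> carrier M; n \<in> carrier M\<rbrakk> \<Longrightarrow>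
        lact M r (m \<oplus>\<^bsub>M\<^esub> n) = lact M r m \<oplus>\<^bsub>M\<^esub> lact M r n"
    and ract_add:
      "\<lbrakk>r \<in> carrier R; m \<in> carrier M; n \<in> carrier M\<rbrakk> \<Longrightarrow>
        ract M (m \<oplus>\<^bsub>M\<^esub> n) r = ract M m r \<oplus>\<^bsub>M\<^esub> ract M n r"
    and add_lact:
      "\<lbrakk>r \<in> carrier R; s \<in> carrier R; m \<in> carrier M\<rbrakk> \<Longrightarrow>
        lact M (r \<oplus>\<^bsub>R\<^esub> s) m = lact M r m \<oplus>\<^bsub>M\<^esub> lact M s m"
    and add_ract:
      "\<lbrakk>r \<in> carrier R; s \<in> carrier R; m \<in> carrier M\<rbrakk> \<Longrightarrow>
        ract M m (r \<oplus>\<^bsub>R\<^esub> s) = ract M m r \<oplus>\<^bsub>M\<^esub> ract M m s"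
    and lact_mult:
      "\<lbrakk>r \<in> carrier R; s \<in> carrier R; m \<in> carrier M\<rbrakk> \<Longrightarrow>
        lact M (r \<otimes>\<^bsub>R\<^esub> s) m = lact M r (lact M s m)"
    and ract_mult:
      "\<lbrakk>r \<in> carrier R; s \<in> carrier R; m \<in> carrier M\<rbrakk> \<Longrightarrow>
        ract M m (r \<otimes>\<^bsub>R\<^esub> s) = ract M (ract M m r) s"
    and lact_one: "m \<in> carrier M \<Longrightarrow> lact M \<one>\<^bsub>R\<^esub> m = m"
    and ract_one: "m \<in> carrier M \<Longrightarrow> ract M m \<one>\<^bsub>R\<^esub> = m"
    and lact_ract:
      "\<lbrakk>r \<in> carrier R; s \<in> carrier R; m \<in> carrier M\<rbrakk> \<Longrightarrow>
        lact M r (ract M m s) = ract M (lact M r m) s"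
    and smult_lact:
      "\<lbrakk>r \<in> carrier R; m \<in> carrier M\<rbrakk> \<Longrightarrow> lact M (c \<odot>\<^bsub>R\<^esub> r) m = c \<odot>\<^bsub>M\<^esub> lact M r m"
    and lact_smult:
      "\<lbrakk>r \<in> carrier R; m \<in> carrier M\<rbrakk> \<Longrightarrow> lact M r (c \<odot>\<^bsub>M\<^esub> m) = c \<odot>\<^bsub>M\<^esub> lact M r m"
    and smult_ract:
      "\<lbrakk>r \<in> carrier R; m \<in> carrier M\<rbrakk> \<Longrightarrow> ract M m (c \<odot>\<^bsub>R\<^esub> r) = c \<odot>\<^bsub>M\<^esub> ract M m r"
    and ract_smult:
      "\<lbrakk>r \<in> carrier R; m \<in> carrier M\<rbrakk> \<Longrightarrow> ract M (c \<odot>\<^bsub>M\<^esub> m) r = c \<odot>\<^bsub>M\<^esub> ract M m r"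

definition regular :: "('k::field, 'a) module \<Rightarrow> ('k, 'a, 'a) bimodule" where
  "regular R = module.extend R (bimodule.fields (mult R) (mult R))"

definition bimod_hom ::
  "('k::field, 'a) module \<Rightarrow> ('k, 'a, 'm) bimodule \<Rightarrow> ('k, 'a, 'n) bimodule \<Rightarrow> ('m \<Rightarrow> 'n) set" where
  "bimod_hom R M N = {f \<in> lin_hom M N. \<forall>r\<in>carrier R. \<forall>m\<in>carrier M.
     f (lact M r m) = lact N r (f m) \<and> f (ract M m r) = ract N (f m) r}"

definition hom_space ::
  "('k::field, 'a) module \<Rightarrow> ('k, 'a, 'm) bimodule \<Rightarrow> ('k, 'a, 'n) bimodule \<Rightarrow>
   ('k, 'm \<Rightarrow> 'n) module" where
  "hom_space R M N = pointwise (carrier M) (\<lambda>_. N) (bimod_hom R M N)"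

text \<open>
  Every epimorphism onto \<open>P\<close> splits. The epimorphisms range over bimodules with elements in
  \<open>'p \<times> 'a \<times> 'a \<Rightarrow> 'k\<close>; this type is large enough to contain the free bimodule on the set
  \<open>carrier P\<close>, realised as the finitely supported functions on \<open>carrier P \<times> E \<times> E\<close> for a
  \<open>'k\<close>-basis \<open>E\<close> of \<open>R\<close>. So the definition does not depend on the restriction.
\<close>

definition projective ::
  "('k::field, 'a) module \<Rightarrow> ('k, 'a, 'p) bimodule \<Rightarrow> bool" where
  "projective R P \<longleftrightarrow> bimodule R P \<and>
     (\<forall>(E :: ('k, 'a, 'p \<times> 'a \<times> 'a \<Rightarrow> 'k) bimodule) \<pi>.
        bimodule R E \<longrightarrow> \<pi> \<in> bimod_hom R E P \<longrightarrow> \<pi> ` carrier E = carrier P \<longrightarrow>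
        (\<exists>\<sigma>\<in>bimod_hom R P E. \<forall>x\<in>carrier P. \<pi> (\<sigma> x) = x))"

text \<open>\<open>\<dots> \<rightarrow> P 1 \<rightarrow> P 0 \<rightarrow> R \<rightarrow> 0\<close>, with differentials \<open>d n : P (n + 1) \<rightarrow> P n\<close>.\<close>

definition projective_resolution ::
  "('k::field, 'a) module \<Rightarrow> (nat \<Rightarrow> ('k, 'a, 'p) bimodule) \<Rightarrow> (nat \<Rightarrow> 'p \<Rightarrow> 'p) \<Rightarrow>
   ('p \<Rightarrow> 'a) \<Rightarrow> bool" where
  "projective_resolution R P d \<epsilon> \<longleftrightarrow>
     (\<forall>n. projective R (P n)) \<and>
     (\<forall>n. d n \<in> bimod_hom R (P (Suc n)) (P n)) \<and>
     \<epsilon> \<in> bimod_hom R (P 0) (regular R) \<and>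
     \<epsilon> ` carrier (P 0) = carrier R \<and>
     {x \<in> carrier (P 0). \<epsilon> x = \<zero>\<^bsub>R\<^esub>} = d 0 ` carrier (P 1) \<and>
     (\<forall>n. {x \<in> carrier (P (Suc n)). d n x = \<zero>\<^bsub>P n\<^esub>} = d (Suc n) ` carrier (P (Suc (Suc n))))"


section \<open>Hochschild cohomology\<close>

definition hom_complex ::
  "('k::field, 'a) module \<Rightarrow> (nat \<Rightarrow> ('k, 'a, 'p) bimodule) \<Rightarrow> ('k, 'a, 'm) bimodule \<Rightarrow>
   nat \<Rightarrow> ('k, 'p \<Rightarrow> 'm) module" where
  "hom_complex R P M m = hom_space R (P m) M"

definition hom_diff ::
  "(nat \<Rightarrow> ('k::field, 'a, 'p) bimodule) \<Rightarrow> (nat \<Rightarrow> 'p \<Rightarrow> 'p) \<Rightarrow> nat \<Rightarrow> ('p \<Rightarrow> 'm) \<Rightarrow> ('p \<Rightarrow> 'm)" where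
  "hom_diff P d m f = (\<lambda>x\<in>carrier (P (Suc m)). f (d m x))"

text \<open>
  \<open>HH\<^sup>m(R, M) = Ext\<^sup>m(R, M)\<close> over \<open>R \<otimes> R\<^sup>o\<^sup>p\<close>, computed by the projective resolution \<open>(P, d)\<close> of \<open>R\<close>.
  As usual the resolution is arbitrary: statements about \<open>HH\<close> are made for all of them.
\<close>

definition HH ::
  "('k::field, 'a) module \<Rightarrow> (nat \<Rightarrow> ('k, 'a, 'p) bimodule) \<Rightarrow> (nat \<Rightarrow> 'p \<Rightarrow> 'p) \<Rightarrow>
   ('k, 'a, 'm) bimodule \<Rightarrow> nat \<Rightarrow> ('k, ('p \<Rightarrow> 'm) set) module" where
  "HH R P d M m = cohomology (hom_complex R P M) (hom_diff P d) m"


subsection \<open>Bar cochains\<close>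

text \<open>
  The bimodule homomorphisms from the \<open>(m + 2)\<close>-fold tensor power of \<open>R\<close> to \<open>M\<close>, as
  multilinear maps on lists of length \<open>m + 2\<close>.
\<close>

definition bar_args :: "('k::field, 'a) module \<Rightarrow> nat \<Rightarrow> 'a list set" where
  "bar_args R m = {as. length as = m + 2 \<and> set as \<subseteq> carrier R}"

definition bar_cochains ::
  "('k::field, 'a) module \<Rightarrow> ('k, 'a, 'm) bimodule \<Rightarrow> nat \<Rightarrow> ('a list \<Rightarrow> 'm) set" where
  "bar_cochains R M m = {f \<in> bar_args R m \<rightarrow>\<^sub>E carrier M.
     (\<forall>as\<in>bar_args R m. \<forall>i<m + 2. \<forall>a\<in>carrier R. \<forall>b\<in>carrier R.
        f (as[i := a \<oplus>\<^bsub>R\<^esub> b]) = f (as[i := a]) \<oplus>\<^bsub>M\<^esub> f (as[i := b])) \<and>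
     (\<forall>as\<in>bar_args R m. \<forall>i<m + 2. \<forall>a\<in>carrier R. \<forall>c.
        f (as[i := c \<odot>\<^bsub>R\<^esub> a]) = c \<odot>\<^bsub>M\<^esub> f (as[i := a])) \<and>
     (\<forall>as\<in>bar_args R m. \<forall>r\<in>carrier R.
        f (as[0 := r \<otimes>\<^bsub>R\<^esub> as ! 0]) = lact M r (f as) \<and>
        f (as[m + 1 := as ! (m + 1) \<otimes>\<^bsub>R\<^esub> r]) = ract M (f as) r)}"

definition bar_complex ::
  "('k::field, 'a) module \<Rightarrow> ('k, 'a, 'm) bimodule \<Rightarrow> nat \<Rightarrow> ('k, 'a list \<Rightarrow> 'm) module" where
  "bar_complex R M m = pointwise (bar_args R m) (\<lambda>_. M) (bar_cochains R M m)"

definition bar_diff ::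
  "('k::field, 'a) module \<Rightarrow> ('k, 'a, 'm) bimodule \<Rightarrow> nat \<Rightarrow> ('a list \<Rightarrow> 'm) \<Rightarrow> ('a list \<Rightarrow> 'm)" where
  "bar_diff R M m f = (\<lambda>as\<in>bar_args R (Suc m).
     \<Oplus>\<^bsub>M\<^esub>i\<in>{..Suc m}. (-1) ^ i \<odot>\<^bsub>M\<^esub>
       f (take i as @ (as ! i \<otimes>\<^bsub>R\<^esub> as ! Suc i) # drop (i + 2) as))"

text \<open>
  A chain map from the bar resolution to \<open>(P, d, \<epsilon>)\<close> over the identity of \<open>R\<close>: its component
  in degree \<open>m\<close> is a bar cochain \<open>\<psi> m\<close> with values in \<open>P m\<close>. By the comparison theorem such a
  \<open>\<psi>\<close> is unique up to homotopy, so \<open>to_bar\<close> is the canonical identification of \<open>HH\<close> with the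
  cohomology of the bar complex.
\<close>

definition bar_comparison ::
  "('k::field, 'a) module \<Rightarrow> (nat \<Rightarrow> ('k, 'a, 'p) bimodule) \<Rightarrow> (nat \<Rightarrow> 'p \<Rightarrow> 'p) \<Rightarrow>
   ('p \<Rightarrow> 'a) \<Rightarrow> (nat \<Rightarrow> 'a list \<Rightarrow> 'p) \<Rightarrow> bool" where
  "bar_comparison R P d \<epsilon> \<psi> \<longleftrightarrow>
     (\<forall>m. \<psi> m \<in> bar_cochains R (P m) m) \<and>
     (\<forall>a\<in>carrier R. \<forall>b\<in>carrier R. \<epsilon> (\<psi> 0 [a, b]) = a \<otimes>\<^bsub>R\<^esub> b) \<and>
     (\<forall>m. \<forall>as\<in>bar_args R (Suc m). d m (\<psi> (Suc m) as) = bar_diff R (P m) m (\<psi> m) as)"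

definition to_bar ::
  "('k::field, 'a) module \<Rightarrow> (nat \<Rightarrow> ('k, 'a, 'p) bimodule) \<Rightarrow> (nat \<Rightarrow> 'p \<Rightarrow> 'p) \<Rightarrow>
   (nat \<Rightarrow> 'a list \<Rightarrow> 'p) \<Rightarrow> ('k, 'a, 'm) bimodule \<Rightarrow> nat \<Rightarrow> ('p \<Rightarrow> 'm) set \<Rightarrow> ('a list \<Rightarrow> 'm) set" where
  "to_bar R P d \<psi> M m =
     cohomology_map (hom_complex R P M) (hom_diff P d) (bar_complex R M) (bar_diff R M) m
       (\<lambda>f. \<lambda>as\<in>bar_args R m. f (\<psi> m as))"


section \<open>Quantum symmetric algebras\<close>

text \<open>
  The index set \<open>{1, \<dots>, N}\<close> is a finite linearly ordered type \<open>'n\<close>. Elements of the free algebra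
  are finitely supported functions on words.
\<close>

definition free_algebra :: "('k::field, 'n list \<Rightarrow> 'k) module" where
  "free_algebra =
    \<lparr>carrier = {f. finite {w. f w \<noteq> 0}},
     mult = (\<lambda>f g w. \<Sum>i\<le>length w. f (take i w) * g (drop i w)),
     one = (\<lambda>w. if w = [] then 1 else 0),
     zero = (\<lambda>w. 0),
     add = (\<lambda>f g w. f w + g w),
     smult = (\<lambda>c f w. c * f w)\<rparr>"

definition gen :: "'n \<Rightarrow> 'n list \<Rightarrow> 'k::field" where
  "gen i = (\<lambda>w. if w = [i] then 1 else 0)"

definition qsym_ideal :: "('n \<Rightarrow> 'n \<Rightarrow> 'k::field) \<Rightarrow> ('n list \<Rightarrow> 'k) set" where
  "qsym_ideal q = Idl\<^bsub>free_algebra\<^esub>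
     {gen i \<otimes>\<^bsub>free_algebra\<^esub> gen j \<ominus>\<^bsub>free_algebra\<^esub>
        q i j \<odot>\<^bsub>free_algebra\<^esub> (gen j \<otimes>\<^bsub>free_algebra\<^esub> gen i) | i j. True}"

definition qsym :: "('n \<Rightarrow> 'n \<Rightarrow> 'k::field) \<Rightarrow> ('k, ('n list \<Rightarrow> 'k) set) module" where
  "qsym q = ring.extend (free_algebra Quot qsym_ideal q)
     (module.fields (coset_smult free_algebra (qsym_ideal q)))"

definition qvar :: "('n \<Rightarrow> 'n \<Rightarrow> 'k::field) \<Rightarrow> 'n \<Rightarrow> ('n list \<Rightarrow> 'k) set" where
  "qvar q i = qsym_ideal q +>\<^bsub>free_algebra\<^esub> gen i"

definition qmonom ::
  "('n::{finite,linorder} \<Rightarrow> 'n \<Rightarrow> 'k::field) \<Rightarrow> ('n \<Rightarrow> nat) \<Rightarrow> ('n list \<Rightarrow> 'k) set" where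
  "qmonom q \<alpha> = foldr (\<lambda>i y. qvar q i [^]\<^bsub>qsym q\<^esub> \<alpha> i \<otimes>\<^bsub>qsym q\<^esub> y)
     (sorted_list_of_set UNIV) \<one>\<^bsub>qsym q\<^esub>"

definition qsym_degree :: "('n \<Rightarrow> 'n \<Rightarrow> 'k::field) \<Rightarrow> nat \<Rightarrow> ('n list \<Rightarrow> 'k) set set" where
  "qsym_degree q n = {qsym_ideal q +>\<^bsub>free_algebra\<^esub> f | f.
     f \<in> carrier free_algebra \<and> (\<forall>w. f w \<noteq> 0 \<longrightarrow> length w = n)}"

definition graded_action ::
  "('n \<Rightarrow> 'n \<Rightarrow> 'k::field) \<Rightarrow> 'g monoid \<Rightarrow> ('g \<Rightarrow> ('n list \<Rightarrow> 'k) set \<Rightarrow> ('n list \<Rightarrow> 'k) set) \<Rightarrow> bool"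
where
  "graded_action q G act \<longleftrightarrow> group_action G (carrier (qsym q)) act \<and>
     (\<forall>h\<in>carrier G. act h \<in> ring_hom (qsym q) (qsym q) \<inter> lin_hom (qsym q) (qsym q) \<and>
        (\<forall>n. act h ` qsym_degree q n = qsym_degree q n))"


section \<open>Skew group algebras\<close>

text \<open>An element \<open>\<Sum>\<^sub>g a\<^sub>g # g\<close> is the family \<open>(a\<^sub>g)\<close>; the group is finite.\<close>

definition hash :: "'g monoid \<Rightarrow> ('k::field, 'a) module \<Rightarrow> 'a \<Rightarrow> 'g \<Rightarrow> ('g \<Rightarrow> 'a)" where
  "hash G A a g = (\<lambda>h\<in>carrier G. if h = g then a else \<zero>\<^bsub>A\<^esub>)"

text \<open>In the product \<open>(a # h)(b # h')\<close> contributes to the component \<open>k = hh'\<close>, so \<open>h' = h\<^sup>-\<^sup>1k\<close>.\<close>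

definition skew ::
  "'g monoid \<Rightarrow> ('k::field, 'a) module \<Rightarrow> ('g \<Rightarrow> 'a \<Rightarrow> 'a) \<Rightarrow> ('k, 'g \<Rightarrow> 'a) module" where
  "skew G A act = (direct_sum (carrier G) (\<lambda>_. A))
    \<lparr>mult := (\<lambda>\<phi> \<psi>. \<lambda>k\<in>carrier G.
        \<Oplus>\<^bsub>A\<^esub>h\<in>carrier G. \<phi> h \<otimes>\<^bsub>A\<^esub> act h (\<psi> (inv\<^bsub>G\<^esub> h \<otimes>\<^bsub>G\<^esub> k))),
     one := hash G A \<one>\<^bsub>A\<^esub> \<one>\<^bsub>G\<^esub>\<rparr>"

text \<open>The bimodule structure \<open>a \<cdot> (c # g) \<cdot> b = ac(\<^sup>gb) # g\<close> on the skew group algebra.\<close>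

definition skew_bimod ::
  "'g monoid \<Rightarrow> ('k::field, 'a) module \<Rightarrow> ('g \<Rightarrow> 'a \<Rightarrow> 'a) \<Rightarrow> ('k, 'a, 'g \<Rightarrow> 'a) bimodule" where
  "skew_bimod G A act = module.extend (skew G A act)
    (bimodule.fields
      (\<lambda>a \<phi>. \<lambda>g\<in>carrier G. a \<otimes>\<^bsub>A\<^esub> \<phi> g)
      (\<lambda>\<phi> b. \<lambda>g\<in>carrier G. \<phi> g \<otimes>\<^bsub>A\<^esub> act g b))"

definition skew_component ::
  "'g monoid \<Rightarrow> ('k::field, 'a) module \<Rightarrow> ('g \<Rightarrow> 'a \<Rightarrow> 'a) \<Rightarrow> 'g \<Rightarrow> ('k, 'a, 'g \<Rightarrow> 'a) bimodule" where
  "skew_component G A act g =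
     (skew_bimod G A act)\<lparr>carrier := {hash G A a g | a. a \<in> carrier A}\<rparr>"

definition bar_action ::
  "'g monoid \<Rightarrow> ('k::field, 'a) module \<Rightarrow> ('g \<Rightarrow> 'a \<Rightarrow> 'a) \<Rightarrow> 'g \<Rightarrow> nat \<Rightarrow>
   ('a list \<Rightarrow> 'g \<Rightarrow> 'a) \<Rightarrow> ('a list \<Rightarrow> 'g \<Rightarrow> 'a)" where
  "bar_action G A act h m f = (\<lambda>as\<in>bar_args A m.
     hash G A \<one>\<^bsub>A\<^esub> h \<otimes>\<^bsub>skew G A act\<^esub> f (map (act (inv\<^bsub>G\<^esub> h)) as)
       \<otimes>\<^bsub>skew G A act\<^esub> hash G A \<one>\<^bsub>A\<^esub> (inv\<^bsub>G\<^esub> h))"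

text \<open>
  The \<open>G\<close>-invariant classes in \<open>HH\<^sup>m(A, A \<rtimes> G)\<close>. The action of \<open>h\<close> on a class of bar cochains,
  which is a coset, is the image of that coset.
\<close>

definition HH_invariants ::
  "'g monoid \<Rightarrow> ('k::field, 'a) module \<Rightarrow> ('g \<Rightarrow> 'a \<Rightarrow> 'a) \<Rightarrow>
   (nat \<Rightarrow> ('k, 'a, 'p) bimodule) \<Rightarrow> (nat \<Rightarrow> 'p \<Rightarrow> 'p) \<Rightarrow> (nat \<Rightarrow> 'a list \<Rightarrow> 'p) \<Rightarrow> nat \<Rightarrow>
   ('k, ('p \<Rightarrow> 'g \<Rightarrow> 'a) set) module" where
  "HH_invariants G A act P d \<psi> m = (HH A P d (skew_bimod G A act) m)
    \<lparr>carrier := {X \<in> carrier (HH A P d (skew_bimod G A act) m). \<forall>h\<in>carrier G.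
       bar_action G A act h m ` to_bar A P d \<psi> (skew_bimod G A act) m X =
       to_bar A P d \<psi> (skew_bimod G A act) m X}\<rparr>"


section \<open>The twisted Koszul complex\<close>

definition ext_exponents :: "nat \<Rightarrow> ('n::finite \<Rightarrow> nat) set" where
  "ext_exponents m = {\<beta>. (\<forall>i. \<beta> i \<in> {0, 1}) \<and> (\<Sum>i\<in>UNIV. \<beta> i) = m}"

text \<open>
  \<open>M \<otimes> \<Lambda>\<^sup>m(V\<^sup>*)\<close>, where \<open>\<Lambda>\<^sup>m(V\<^sup>*)\<close> has the basis \<open>(x\<^sup>*)\<^sup>\<beta>\<close>, \<open>|\<beta>| = m\<close>: a cochain
  \<open>\<Sum>\<^sub>\<beta> u\<^sub>\<beta> \<otimes> (x\<^sup>*)\<^sup>\<beta>\<close> is the family \<open>(u\<^sub>\<beta>)\<close>.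
\<close>

definition koszul_complex ::
  "('k::field, 'a, 'm) bimodule \<Rightarrow> nat \<Rightarrow> ('k, ('n::finite \<Rightarrow> nat) \<Rightarrow> 'm) module" where
  "koszul_complex M m = direct_sum (ext_exponents m) (\<lambda>_. M)"

definition ext_tensor ::
  "('k::field, 'a, 'm) bimodule \<Rightarrow> nat \<Rightarrow> 'm \<Rightarrow> ('n::finite \<Rightarrow> nat) \<Rightarrow> (('n \<Rightarrow> nat) \<Rightarrow> 'm)" where
  "ext_tensor M m v \<beta> = (\<lambda>\<beta>'\<in>ext_exponents m. if \<beta>' = \<beta> then v else \<zero>\<^bsub>M\<^esub>)"

text \<open>
  The summand for \<open>i\<close> of the differential of \<open>v \<otimes> (x\<^sup>*)\<^sup>\<beta>\<close> with \<open>\<beta> i = 0\<close> lies over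
  \<open>\<beta>' = \<beta> + [i]\<close>; conversely \<open>\<beta> = \<beta>'(i := 0)\<close>. For \<open>v = a # g\<close> in \<open>A\<^sub>g\<close> one has
  \<open>x\<^sub>i \<cdot> v = x\<^sub>ia # g\<close> and \<open>v \<cdot> x\<^sub>i = a(\<^sup>gx\<^sub>i) # g\<close>.
\<close>

definition koszul_diff ::
  "('n::{finite,linorder} \<Rightarrow> 'n \<Rightarrow> 'k::field) \<Rightarrow> ('k, ('n list \<Rightarrow> 'k) set, 'm) bimodule \<Rightarrow> nat \<Rightarrow>
   (('n \<Rightarrow> nat) \<Rightarrow> 'm) \<Rightarrow> (('n \<Rightarrow> nat) \<Rightarrow> 'm)" where
  "koszul_diff q M m u = (\<lambda>\<beta>'\<in>ext_exponents (Suc m).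
     \<Oplus>\<^bsub>M\<^esub>i\<in>{i. \<beta>' i = 1}. let \<beta> = \<beta>'(i := 0) in
       (-1) ^ (\<Sum>s\<in>{..i}. \<beta> s) \<odot>\<^bsub>M\<^esub>
         ((\<Prod>s\<in>{..i}. q s i ^ \<beta> s) \<odot>\<^bsub>M\<^esub> lact M (qvar q i) (u \<beta>) \<ominus>\<^bsub>M\<^esub>
          (\<Prod>s\<in>{i..}. q i s ^ \<beta> s) \<odot>\<^bsub>M\<^esub> ract M (u \<beta>) (qvar q i)))"

definition koszul_cohomology ::
  "('n::{finite,linorder} \<Rightarrow> 'n \<Rightarrow> 'k::field) \<Rightarrow> ('k, ('n list \<Rightarrow> 'k) set, 'm) bimodule \<Rightarrow> nat \<Rightarrow>
   ('k, (('n \<Rightarrow> nat) \<Rightarrow> 'm) set) module" where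
  "koszul_cohomology q M m = cohomology (koszul_complex M) (koszul_diff q M) m"

definition koszul_class ::
  "('n::{finite,linorder} \<Rightarrow> 'n \<Rightarrow> 'k::field) \<Rightarrow> ('k, ('n list \<Rightarrow> 'k) set, 'm) bimodule \<Rightarrow> nat \<Rightarrow>
   (('n \<Rightarrow> nat) \<Rightarrow> 'm) \<Rightarrow> (('n \<Rightarrow> nat) \<Rightarrow> 'm) set" where
  "koszul_class q M m u =
     coboundaries (koszul_complex M) (koszul_diff q M) m +>\<^bsub>koszul_complex M m\<^esub> u"

text \<open>
  A chain map from the twisted Koszul resolution of \<open>A\<close> to \<open>(P, d, \<epsilon>)\<close> over the identity of
  \<open>A\<close>. The Koszul resolution is free, with generators indexed by \<open>\<beta>\<close> in degree \<open>|\<beta>|\<close>, and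
  \<open>p m \<beta>\<close> is the image of the generator; so \<open>p m\<close> is a Koszul cochain with values in \<open>P m\<close>.
  Again \<open>p\<close> is unique up to homotopy, and \<open>to_koszul\<close> is the canonical identification of
  \<open>HH\<^sup>m(A, M)\<close> with the cohomology of the Koszul complex.
\<close>

definition koszul_comparison ::
  "('n::{finite,linorder} \<Rightarrow> 'n \<Rightarrow> 'k::field) \<Rightarrow>
   (nat \<Rightarrow> ('k, ('n list \<Rightarrow> 'k) set, 'p) bimodule) \<Rightarrow> (nat \<Rightarrow> 'p \<Rightarrow> 'p) \<Rightarrow>
   ('p \<Rightarrow> ('n list \<Rightarrow> 'k) set) \<Rightarrow> (nat \<Rightarrow> ('n \<Rightarrow> nat) \<Rightarrow> 'p) \<Rightarrow> bool" where
  "koszul_comparison q P d \<epsilon> p \<longleftrightarrow>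
     (\<forall>m. p m \<in> carrier (koszul_complex (P m) m)) \<and>
     \<epsilon> (p 0 (\<lambda>i. 0)) = \<one>\<^bsub>qsym q\<^esub> \<and>
     (\<forall>m. \<forall>\<beta>\<in>ext_exponents (Suc m). d m (p (Suc m) \<beta>) = koszul_diff q (P m) m (p m) \<beta>)"

definition to_koszul ::
  "('n::{finite,linorder} \<Rightarrow> 'n \<Rightarrow> 'k::field) \<Rightarrow>
   (nat \<Rightarrow> ('k, ('n list \<Rightarrow> 'k) set, 'p) bimodule) \<Rightarrow> (nat \<Rightarrow> 'p \<Rightarrow> 'p) \<Rightarrow>
   (nat \<Rightarrow> ('n \<Rightarrow> nat) \<Rightarrow> 'p) \<Rightarrow> ('k, ('n list \<Rightarrow> 'k) set, 'm) bimodule \<Rightarrow> nat \<Rightarrow>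
   ('p \<Rightarrow> 'm) set \<Rightarrow> (('n \<Rightarrow> nat) \<Rightarrow> 'm) set" where
  "to_koszul q P d p M m =
     cohomology_map (hom_complex (qsym q) P M) (hom_diff P d) (koszul_complex M) (koszul_diff q M) m
       (\<lambda>f. \<lambda>\<beta>\<in>ext_exponents m. f (p m \<beta>))"

definition C_set ::
  "('n::finite \<Rightarrow> 'n \<Rightarrow> 'k::field) \<Rightarrow> ('g \<Rightarrow> 'n \<Rightarrow> 'k) \<Rightarrow> 'g \<Rightarrow> ('n \<Rightarrow> int) set" where
  "C_set q lam g = {\<gamma>. \<forall>i. \<gamma> i \<ge> -1 \<and>
     ((\<Prod>s\<in>UNIV. q i s powi \<gamma> s) = lam g i \<or> \<gamma> i = -1)}"

definition sym_exponents ::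
  "('n::finite \<Rightarrow> 'n \<Rightarrow> 'k::field) \<Rightarrow> ('g \<Rightarrow> 'n \<Rightarrow> 'k) \<Rightarrow> 'g \<Rightarrow> ('n \<Rightarrow> nat) \<Rightarrow> ('n \<Rightarrow> nat) set" where
  "sym_exponents q lam g \<beta> = {\<alpha>. (\<lambda>i. int (\<alpha> i) - int (\<beta> i)) \<in> C_set q lam g}"

text \<open>The cochain \<open>(x\<^sup>\<alpha> # g) \<otimes> (x\<^sup>*)\<^sup>\<beta>\<close>, in \<open>(A \<rtimes> G) \<otimes> \<Lambda>\<^sup>m(V\<^sup>*)\<close> and in its subspace \<open>A\<^sub>g \<otimes> \<Lambda>\<^sup>m(V\<^sup>*)\<close>.\<close>

definition monomial_cochain ::
  "('n::{finite,linorder} \<Rightarrow> 'n \<Rightarrow> 'k::field) \<Rightarrow> 'g monoid \<Rightarrow>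
   ('g \<Rightarrow> ('n list \<Rightarrow> 'k) set \<Rightarrow> ('n list \<Rightarrow> 'k) set) \<Rightarrow> nat \<Rightarrow> 'g \<Rightarrow> ('n \<Rightarrow> nat) \<Rightarrow> ('n \<Rightarrow> nat) \<Rightarrow>
   ('n \<Rightarrow> nat) \<Rightarrow> 'g \<Rightarrow> ('n list \<Rightarrow> 'k) set" where
  "monomial_cochain q G act m g \<beta> \<alpha> =
     ext_tensor (skew_bimod G (qsym q) act) m (hash G (qsym q) (qmonom q \<alpha>) g) \<beta>"

end

theory Submission
 imports Defs
begin

text \<open>
 By the comparison theorem, \<open>HH\<close> may be computed with two free resolutions of \<open>A\<close>: the bar resolution
 and the twisted Koszul resolution, which is exact because it can be contracted one variable at a time.

 The Koszul complex with coefficients in \<open>A\<^sub>g\<close> is graded by \<open>\<gamma> = \<alpha> - \<beta>\<close>. In degree \<open>\<gamma>\<close> the differential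
 has one weight for each variable, which vanishes iff \<open>\<Prod>\<^sub>s q\<^sub>i\<^sub>s\<^bsup>\<gamma>\<^sub>s\<^esup> = \<lambda>\<^sub>g\<^sub>i\<close>. If \<open>\<gamma> \<in> C\<^sub>g\<close>, all
 summands of the differential vanish; otherwise some \<open>i\<close> with nonzero weight and \<open>\<gamma>\<^sub>i \<noteq> -1\<close> gives a contraction.

 Let \<open>S = A # G\<close>. A \<open>G\<close>-invariant bar cochain \<open>f\<close> of \<open>A\<close> extends to \<open>S\<close> by
 \<open>f(a\<^sub>0 # g\<^sub>0, a\<^sub>1 # g\<^sub>1, \<dots>) = f(a\<^sub>0, \<^sup>g\<^sup>0a\<^sub>1, \<dots>)g\<^sub>0g\<^sub>1\<dots>\<close>. Restriction to \<open>A\<close>, averaging over \<open>G\<close> and extension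
 compose to an endomorphism induced by a chain map of the bar resolution of \<open>S\<close> over the identity; so it is
 the identity on cohomology, and restriction identifies \<open>HH(S)\<close> with the invariant classes.
\<close>

section \<open>Linear algebra\<close>

text \<open>The two resolutions serve different statements: the basis is read off the Koszul
  complex, but the action of \<open>G\<close> is given on bar cochains only, so an arbitrary
  \<open>P\<close> is compared with both. The obstacle in reaching \<open>P\<close> is that
  \<open>projective\<close> tests epimorphisms from bimodules of one element type; a lift against
  other types passes through a free bimodule that has this type. For this reason free objects are
  finitely supported functions, and identities are checked on basis vectors.

  Exactness of the Koszul resolution reduces to a commutative polynomial ring:
  \<open>x^a x^be x^b\<close> is a scalar multiple of \<open>x^(a+be+b)\<close>, and multiplying
  coordinates by this scalar removes all \<open>q\<close> from the differential.

  For \<open>S\<close>, averaging and extension are natural in the coefficient bimodule. Evaluated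
  at the universal bar cochain they become a chain map, so uniqueness up to homotopy takes the place
  of a spectral sequence or of an explicit homotopy. Characteristic 0 makes the order of
  \<open>G\<close> invertible.\<close>

abbreviation vsp :: "('k::field, 'v, 'x) module_scheme => bool" where
 "vsp V \<equiv> Module.module scalars V"

lemma scalars_simps [simp]:
 "carrier scalars = UNIV" "x \<otimes>\<^bsub>scalars\<^esub> y = x * y" "x \<oplus>\<^bsub>scalars\<^esub> y = x + y"
 "\<one>\<^bsub>scalars\<^esub> = 1" "\<zero>\<^bsub>scalars\<^esub> = 0"
 by (simp_all add: scalars_def)

lemma scalars_cring: "cring (scalars :: 'k::field ring)"
proof (rule cringI)
 show "abelian_group (scalars :: 'k ring)"
  by (rule abelian_groupI) (auto simp: ac_simps intro: exI[of _ "- x" for x])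
 show "Group.comm_monoid (scalars :: 'k ring)"
  by (rule comm_monoidI) (auto simp: ac_simps)
qed (auto simp: algebra_simps)

lemma vsp_abelian_group: "vsp V ==> abelian_group V"
 by (simp add: Module.module_def)

lemma vspI:
 assumes "abelian_group V"
  and "\<And>a x. x \<in> carrier V ==> a \<odot>\<^bsub>V\<^esub> x \<in> carrier V"
  and "\<And>a b x. x \<in> carrier V ==> (a + b) \<odot>\<^bsub>V\<^esub> x = a \<odot>\<^bsub>V\<^esub> x \<oplus>\<^bsub>V\<^esub> b \<odot>\<^bsub>V\<^esub> x"
  and "\<And>a x y. x \<in> carrier V ==> y \<in> carrier V ==>
   a \<odot>\<^bsub>V\<^esub> (x \<oplus>\<^bsub>V\<^esub> y) = a \<odot>\<^bsub>V\<^esub> x \<oplus>\<^bsub>V\<^esub> a \<odot>\<^bsub>V\<^esub> y"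
  and "\<And>a b x. x \<in> carrier V ==> (a * b) \<odot>\<^bsub>V\<^esub> x = a \<odot>\<^bsub>V\<^esub> (b \<odot>\<^bsub>V\<^esub> x)"
  and "\<And>x. x \<in> carrier V ==> 1 \<odot>\<^bsub>V\<^esub> x = x"
 shows "vsp V"
 using assms by (intro moduleI scalars_cring) auto

context
 fixes V :: "('k::field, 'v, 'x) module_scheme" (structure)
 assumes V: "vsp V"
begin

interpretation V: Module.module scalars V by (rule V)

lemma vs_zero [simp]: "\<zero> \<in> carrier V" by simp
lemma vs_add [simp]: "x \<in> carrier V ==> y \<in> carrier V ==> x \<oplus> y \<in> carrier V" by simp
lemma vs_minus [simp]: "x \<in> carrier V ==> y \<in> carrier V ==> x \<ominus> y \<in> carrier V" by simp
lemma vs_neg [simp]: "x \<in> carrier V ==> \<ominus> x \<in> carrier V" by simp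
lemma vs_smult [simp]: "x \<in> carrier V ==> c \<odot> x \<in> carrier V" using V.smult_closed by simp
lemma vs_assoc: "x \<in> carrier V ==> y \<in> carrier V ==> z \<in> carrier V ==> (x \<oplus> y) \<oplus> z = x \<oplus> (y \<oplus> z)"
 by (rule V.a_assoc)
lemma vs_comm: "x \<in> carrier V ==> y \<in> carrier V ==> x \<oplus> y = y \<oplus> x" by (rule V.a_comm)
lemma vs_lcomm: "x \<in> carrier V ==> y \<in> carrier V ==> z \<in> carrier V ==> x \<oplus> (y \<oplus> z) = y \<oplus> (x \<oplus> z)"
 by (rule V.a_lcomm)
lemma vs_zero_left [simp]: "x \<in> carrier V ==> \<zero> \<oplus> x = x" by simp
lemma vs_zero_right [simp]: "x \<in> carrier V ==> x \<oplus> \<zero> = x" by simp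
lemma vs_smult_l_distr: "x \<in> carrier V ==> (a + b) \<odot> x = a \<odot> x \<oplus> b \<odot> x"
 using V.smult_l_distr by simp
lemma vs_smult_r_distr: "x \<in> carrier V ==> y \<in> carrier V ==> a \<odot> (x \<oplus> y) = a \<odot> x \<oplus> a \<odot> y"
 using V.smult_r_distr by simp
lemma vs_smult_smult: "x \<in> carrier V ==> a \<odot> (b \<odot> x) = (a * b) \<odot> x"
 using V.smult_assoc1[of a b x] by simp
lemma vs_smult_one [simp]: "x \<in> carrier V ==> 1 \<odot> x = x" using V.smult_one by simp
lemma vs_smult_zero [simp]: "x \<in> carrier V ==> 0 \<odot> x = \<zero>" using V.smult_l_null by simp
lemma vs_smult_zero_right [simp]: "c \<odot> \<zero> = \<zero>" using V.smult_r_null by simp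

lemma vs_neg_eq: "x \<in> carrier V ==> \<ominus> x = (- 1) \<odot> x"
proof -
 assume x: "x \<in> carrier V"
 have "(-1) \<odot> x \<oplus> x = (-1 + 1) \<odot> x" using x by (subst vs_smult_l_distr) auto
 then have "(-1) \<odot> x \<oplus> x = \<zero>" using x by simp
 then show ?thesis using x V.minus_equality by (metis vs_smult)
qed

lemma vs_minus_eq: "x \<in> carrier V ==> y \<in> carrier V ==> x \<ominus> y = x \<oplus> (- 1) \<odot> y"
 by (simp add: a_minus_def vs_neg_eq)

lemma vs_cancel: "x \<in> carrier V ==> y \<in> carrier V ==> z \<in> carrier V ==> x \<oplus> y = x \<oplus> z \<longleftrightarrow> y = z"
 by simp

lemma vs_minus_self [simp]: "x \<in> carrier V ==> x \<ominus> x = \<zero>"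
 by (simp add: V.r_neg a_minus_def)

lemma vs_eq_minus_iff: "x \<in> carrier V ==> y \<in> carrier V ==> z \<in> carrier V ==> z = x \<ominus> y \<longleftrightarrow> z \<oplus> y = x"
 using V.minus_eq V.add.inv_solve_right by metis

lemma vs_minus_add_cancel [simp]:
 "x \<in> carrier V ==> y \<in> carrier V ==> (x \<ominus> y) \<oplus> y = x"
 "x \<in> carrier V ==> y \<in> carrier V ==> y \<oplus> (x \<ominus> y) = x"
 "x \<in> carrier V ==> y \<in> carrier V ==> (x \<oplus> y) \<ominus> y = x"
 "x \<in> carrier V ==> y \<in> carrier V ==> (y \<oplus> x) \<ominus> y = x"
 by (metis vs_eq_minus_iff vs_minus vs_add vs_comm)+

lemma vs_finsum [simp]: "f \<in> A \<rightarrow> carrier V ==> finsum V f A \<in> carrier V" by (rule V.finsum_closed)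

lemma vs_finsum_add: "f \<in> A \<rightarrow> carrier V ==> g \<in> A \<rightarrow> carrier V ==>
  (\<Oplus>i\<in>A. f i \<oplus> g i) = finsum V f A \<oplus> finsum V g A"
 by (rule V.finsum_addf)

lemma vs_finsum_smult: "f \<in> A \<rightarrow> carrier V ==> (\<Oplus>i\<in>A. c \<odot> f i) = c \<odot> finsum V f A"
 by (cases "finite A") (simp_all add: V.finsum_smult_ldistr V.finsum_infinite)

lemma vs_finsum_cong: "(\<And>i. i \<in> A ==> f i = g i) ==> g \<in> A \<rightarrow> carrier V ==> finsum V f A = finsum V g A"
 by (rule V.finsum_cong') auto

lemma vs_finsum_insert: "finite A ==> a \<notin> A ==> f a \<in> carrier V ==> f \<in> A \<rightarrow> carrier V ==>
  finsum V f (insert a A) = f a \<oplus> finsum V f A"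
 by (rule V.finsum_insert)

lemma vs_finsum_empty [simp]: "finsum V f {} = \<zero>" by (rule V.finsum_empty)

lemma vs_finsum_zero: "(\<And>i. i \<in> A ==> f i = \<zero>) ==> finsum V f A = \<zero>"
 using vs_finsum_cong[of A f "\<lambda>_. \<zero>"] by (simp add: V.finsum_zero)

lemma vs_finsum_mono: "finite B ==> A \<subseteq> B ==> (\<And>i. i \<in> B - A ==> f i = \<zero>) ==> f \<in> B \<rightarrow> carrier V ==>
  finsum V f A = finsum V f B"
 by (rule V.add.finprod_mono_neutral_cong_left) (auto simp: simp_implies_def)

lemma vs_finsum_single: "finite A ==> a \<in> A ==> (\<And>i. i \<in> A ==> i \<noteq> a ==> f i = \<zero>) ==> f a \<in> carrier V ==>
  finsum V f A = f a"
proof -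
 assume *: "finite A" "a \<in> A" "\<And>i. i \<in> A ==> i \<noteq> a ==> f i = \<zero>" "f a \<in> carrier V"
 have "f i \<in> carrier V" if "i \<in> A" for i using * that by (cases "i = a") auto
 then have "finsum V f {a} = finsum V f A"
  by (intro vs_finsum_mono) (use * in auto)
 then show ?thesis using * vs_finsum_insert[of "{}" a f] by simp
qed

lemma vs_finsum_reindex: "f \<in> h ` A \<rightarrow> carrier V ==> inj_on h A ==> finsum V f (h ` A) = (\<Oplus>x\<in>A. f (h x))"
 by (rule V.finsum_reindex)

lemma vs_finsum_scalars: "finite A ==> x \<in> carrier V ==> (\<Oplus>i\<in>A. c i \<odot> x) = (\<Sum>i\<in>A. c i) \<odot> x"
 by (induction rule: finite_induct) (auto simp: vs_finsum_insert vs_smult_l_distr)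

end

text \<open>Linearity without the extensionality demanded by \<open>lin_hom\<close>, so that
  composites, sums and lambda terms are linear as they stand; \<open>lin_homI\<close> restricts them
  at the end.\<close>

definition lin :: "('k::field, 'v, 'x) module_scheme => ('k, 'w, 'y) module_scheme => ('v => 'w) => bool" where
 "lin V W f \<longleftrightarrow> f \<in> carrier V \<rightarrow> carrier W \<and>
   (\<forall>u\<in>carrier V. \<forall>v\<in>carrier V. f (u \<oplus>\<^bsub>V\<^esub> v) = f u \<oplus>\<^bsub>W\<^esub> f v) \<and>
   (\<forall>c. \<forall>v\<in>carrier V. f (c \<odot>\<^bsub>V\<^esub> v) = c \<odot>\<^bsub>W\<^esub> f v)"

lemma linI:
 assumes "\<And>v. v \<in> carrier V ==> f v \<in> carrier W"
  and "\<And>u v. u \<in> carrier V ==> v \<in> carrier V ==> f (u \<oplus>\<^bsub>V\<^esub> v) = f u \<oplus>\<^bsub>W\<^esub> f v"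
  and "\<And>c v. v \<in> carrier V ==> f (c \<odot>\<^bsub>V\<^esub> v) = c \<odot>\<^bsub>W\<^esub> f v"
 shows "lin V W f"
 using assms by (auto simp: lin_def)

lemma lin_closed: "lin V W f ==> v \<in> carrier V ==> f v \<in> carrier W" by (auto simp: lin_def)
lemma lin_add: "lin V W f ==> u \<in> carrier V ==> v \<in> carrier V ==> f (u \<oplus>\<^bsub>V\<^esub> v) = f u \<oplus>\<^bsub>W\<^esub> f v"
 by (auto simp: lin_def)
lemma lin_smult: "lin V W f ==> v \<in> carrier V ==> f (c \<odot>\<^bsub>V\<^esub> v) = c \<odot>\<^bsub>W\<^esub> f v" by (auto simp: lin_def)

lemma lin_zero: "vsp V ==> vsp W ==> lin V W f ==> f \<zero>\<^bsub>V\<^esub> = \<zero>\<^bsub>W\<^esub>"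
 using lin_smult[of V W f "\<zero>\<^bsub>V\<^esub>" 0] lin_closed[of V W f "\<zero>\<^bsub>V\<^esub>"] by simp

lemma lin_minus: "vsp V ==> vsp W ==> lin V W f ==> u \<in> carrier V ==> v \<in> carrier V ==>
  f (u \<ominus>\<^bsub>V\<^esub> v) = f u \<ominus>\<^bsub>W\<^esub> f v"
 by (simp add: vs_minus_eq lin_add lin_smult lin_closed)

lemma lin_finsum:
 assumes V: "vsp V" and W: "vsp W" and f: "lin V W f" and v: "v \<in> A \<rightarrow> carrier V"
 shows "f (finsum V v A) = finsum W (\<lambda>i. f (v i)) A"
proof (cases "finite A")
 case True
 then show ?thesis using v
  by (induction rule: finite_induct)
   (simp_all add: V W lin_zero[OF V W f] vs_finsum_insert lin_add[OF f] lin_closed[OF f] Pi_iff)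
next
 case False
 then show ?thesis
  using lin_zero[OF V W f] abelian_monoid.finsum_infinite
   vsp_abelian_group[OF V] vsp_abelian_group[OF W] abelian_group.axioms(1) by metis
qed

lemma lin_comp: "lin U V f ==> lin V W g ==> lin U W (\<lambda>x. g (f x))"
 by (auto simp: lin_def Pi_iff)

lemma lin_id: "lin V V (\<lambda>x. x)" by (auto simp: lin_def)

lemma lin_const_zero: "vsp W ==> lin V W (\<lambda>x. \<zero>\<^bsub>W\<^esub>)"
 by (auto simp: lin_def)

lemma lin_cong: "vsp V ==> lin V W f ==> (\<And>x. x \<in> carrier V ==> g x = f x) ==> lin V W g"
 by (auto simp: lin_def)

lemma lin_plus: "vsp W ==> lin V W f ==> lin V W g ==> lin V W (\<lambda>x. f x \<oplus>\<^bsub>W\<^esub> g x)"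
 by (auto simp: lin_def Pi_iff vs_assoc vs_comm vs_lcomm vs_smult_r_distr)

lemma lin_scale: "vsp W ==> lin V W f ==> lin V W (\<lambda>x. c \<odot>\<^bsub>W\<^esub> f x)"
 by (auto simp: lin_def Pi_iff vs_smult_r_distr vs_smult_smult mult.commute)

lemma lin_diff: "vsp V ==> vsp W ==> lin V W f ==> lin V W g ==> lin V W (\<lambda>x. f x \<ominus>\<^bsub>W\<^esub> g x)"
 by (rule lin_cong[OF _ lin_plus[OF _ _ lin_scale[of _ _ g "-1"]]])
  (auto simp: vs_minus_eq lin_closed)

lemma lin_sum: "vsp V ==> vsp W ==> (\<And>i. i \<in> A ==> lin V W (f i)) ==> lin V W (\<lambda>x. \<Oplus>\<^bsub>W\<^esub>i\<in>A. f i x)"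
proof -
 assume V: "vsp V" and W: "vsp W" and f: "\<And>i. i \<in> A ==> lin V W (f i)"
 have c: "f i x \<in> carrier W" if "i \<in> A" "x \<in> carrier V" for i x using that lin_closed[OF f] by auto
 show ?thesis
 proof (rule linI)
  fix u v assume "u \<in> carrier V" "v \<in> carrier V"
  then show "(\<Oplus>\<^bsub>W\<^esub>i\<in>A. f i (u \<oplus>\<^bsub>V\<^esub> v)) = (\<Oplus>\<^bsub>W\<^esub>i\<in>A. f i u) \<oplus>\<^bsub>W\<^esub> (\<Oplus>\<^bsub>W\<^esub>i\<in>A. f i v)"
   using c W by (subst vs_finsum_add[symmetric, OF W]) (auto simp: lin_add[OF f] intro!: vs_finsum_cong)
 next
  fix k v assume "v \<in> carrier V"
  then show "(\<Oplus>\<^bsub>W\<^esub>i\<in>A. f i (k \<odot>\<^bsub>V\<^esub> v)) = k \<odot>\<^bsub>W\<^esub> (\<Oplus>\<^bsub>W\<^esub>i\<in>A. f i v)"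
   using c W by (subst vs_finsum_smult[symmetric, OF W]) (auto simp: lin_smult[OF f] intro!: vs_finsum_cong)
 qed (use c W in auto)
qed

lemma lin_hom_lin: "f \<in> lin_hom V W ==> lin V W f"
 by (auto simp: lin_hom_def lin_def)

lemma lin_homI: "vsp V ==> lin V W f ==> (\<lambda>x\<in>carrier V. f x) \<in> lin_hom V W"
 by (auto simp: lin_hom_def lin_def)

lemma lin_hom_iff: "f \<in> lin_hom V W \<longleftrightarrow> lin V W f \<and> f \<in> extensional (carrier V)"
 by (auto simp: lin_hom_def lin_def PiE_def)

lemma lin_isoI: "vsp V ==> lin V W f ==> bij_betw f (carrier V) (carrier W) ==>
  lin_iso V W (\<lambda>x\<in>carrier V. f x)"
 unfolding lin_iso_def using lin_homI bij_betw_restrict_eq by blast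

lemma isomorphicI: "vsp V ==> lin V W f ==> bij_betw f (carrier V) (carrier W) ==> V \<cong>\<^sub>k W"
 unfolding isomorphic_def using lin_isoI by blast

lemma isomorphicE:
 assumes "V \<cong>\<^sub>k W"
 obtains f where "lin V W f" "bij_betw f (carrier V) (carrier W)"
 using assms that unfolding isomorphic_def lin_iso_def by (blast dest: lin_hom_lin)

lemma isomorphic_trans: "vsp U ==> U \<cong>\<^sub>k V ==> V \<cong>\<^sub>k W ==> U \<cong>\<^sub>k W"
 by (elim isomorphicE, rule isomorphicI)
  (auto intro: lin_comp bij_betw_trans[unfolded comp_def])

lemma lin_inv:
 assumes V: "vsp V" and f: "lin V W f" and bij: "bij_betw f (carrier V) (carrier W)"
 shows "lin W V (inv_into (carrier V) f)"
proof -
 let ?g = "inv_into (carrier V) f"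
 have g: "?g w \<in> carrier V" "f (?g w) = w" if "w \<in> carrier W" for w
  using that bij by (auto simp: bij_betw_def inv_into_into f_inv_into_f)
 have inj: "f x = f y ==> x \<in> carrier V ==> y \<in> carrier V ==> x = y" for x y
  using bij by (auto simp: bij_betw_def inj_on_def)
 have W: "f u \<oplus>\<^bsub>W\<^esub> f v = f (u \<oplus>\<^bsub>V\<^esub> v)" "c \<odot>\<^bsub>W\<^esub> f u = f (c \<odot>\<^bsub>V\<^esub> u)"
  if "u \<in> carrier V" "v \<in> carrier V" for u v c
  using f that by (auto simp: lin_add lin_smult)
 have inv: "?g (f x) = x" if "x \<in> carrier V" for x
  using that bij by (auto simp: bij_betw_def)
 show ?thesis
 proof (rule linI)
  fix u v assume uv: "u \<in> carrier W" "v \<in> carrier W"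
  show "?g (u \<oplus>\<^bsub>W\<^esub> v) = ?g u \<oplus>\<^bsub>V\<^esub> ?g v"
   using inv[of "?g u \<oplus>\<^bsub>V\<^esub> ?g v"] W(1)[of "?g u" "?g v"] g uv V by simp
 next
  fix c v assume v: "v \<in> carrier W"
  show "?g (c \<odot>\<^bsub>W\<^esub> v) = c \<odot>\<^bsub>V\<^esub> ?g v"
   using inv[of "c \<odot>\<^bsub>V\<^esub> ?g v"] W(2)[of "?g v" "?g v" c] g v V by simp
 qed (use g in auto)
qed

text \<open>The axioms pass to the image of a subspace under any map that respects the operations.
  This supplies the structure on quotients, on records with a changed carrier and on spaces of bar
  cochains.\<close>

lemma vsp_image:
 assumes V: "vsp V" and Z: "Z \<subseteq> carrier V" "\<zero>\<^bsub>V\<^esub> \<in> Z"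
  "\<And>x y. x \<in> Z ==> y \<in> Z ==> x \<oplus>\<^bsub>V\<^esub> y \<in> Z" "\<And>c x. x \<in> Z ==> c \<odot>\<^bsub>V\<^esub> x \<in> Z"
  and W: "carrier W = \<pi> ` Z" "\<zero>\<^bsub>W\<^esub> = \<pi> \<zero>\<^bsub>V\<^esub>"
  "\<And>x y. x \<in> Z ==> y \<in> Z ==> \<pi> x \<oplus>\<^bsub>W\<^esub> \<pi> y = \<pi> (x \<oplus>\<^bsub>V\<^esub> y)"
  "\<And>c x. x \<in> Z ==> c \<odot>\<^bsub>W\<^esub> \<pi> x = \<pi> (c \<odot>\<^bsub>V\<^esub> x)"
 shows "vsp W"
proof -
 have c: "x \<in> carrier V" if "x \<in> Z" for x using that Z by auto
 have neg: "(- 1) \<odot>\<^bsub>V\<^esub> x \<oplus>\<^bsub>V\<^esub> x = \<zero>\<^bsub>V\<^esub>" if "x \<in> carrier V" for x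
  using vs_smult_l_distr[OF V that, of "-1" 1] that V by simp
 have "abelian_group W"
 proof (rule abelian_groupI)
  fix x assume "x \<in> carrier W"
  then obtain z where z: "z \<in> Z" "x = \<pi> z" using W by auto
  have "\<pi> ((- 1) \<odot>\<^bsub>V\<^esub> z) \<oplus>\<^bsub>W\<^esub> x = \<zero>\<^bsub>W\<^esub>" using z W Z c neg by simp
  then show "\<exists>y\<in>carrier W. y \<oplus>\<^bsub>W\<^esub> x = \<zero>\<^bsub>W\<^esub>" using W Z z by (metis imageI)
 qed (use Z W V c in \<open>auto simp: vs_assoc vs_comm vs_lcomm\<close>)
 then show ?thesis
  by (rule vspI)
   (use Z W V c in \<open>auto simp: vs_smult_l_distr vs_smult_r_distr vs_smult_smult\<close>)
qed

subsection \<open>Families of vectors\<close>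

lemma pointwise_simps [simp]:
 "carrier (pointwise J V F) = F"
 "\<zero>\<^bsub>pointwise J V F\<^esub> = (\<lambda>j\<in>J. \<zero>\<^bsub>V j\<^esub>)"
 "f \<oplus>\<^bsub>pointwise J V F\<^esub> g = (\<lambda>j\<in>J. f j \<oplus>\<^bsub>V j\<^esub> g j)"
 "c \<odot>\<^bsub>pointwise J V F\<^esub> f = (\<lambda>j\<in>J. c \<odot>\<^bsub>V j\<^esub> f j)"
 by (simp_all add: pointwise_def)

lemma vsp_pointwise:
 assumes V: "\<And>j. j \<in> J ==> vsp (V j)"
  and F: "F \<subseteq> (\<Pi>\<^sub>E j\<in>J. carrier (V j))" "(\<lambda>j\<in>J. \<zero>\<^bsub>V j\<^esub>) \<in> F"
   "\<And>f g. f \<in> F ==> g \<in> F ==> (\<lambda>j\<in>J. f j \<oplus>\<^bsub>V j\<^esub> g j) \<in> F"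
   "\<And>c f. f \<in> F ==> (\<lambda>j\<in>J. c \<odot>\<^bsub>V j\<^esub> f j) \<in> F"
 shows "vsp (pointwise J V F)"
proof -
 have c: "f j \<in> carrier (V j)" if "f \<in> F" "j \<in> J" for f j using that F by auto
 have e: "f = (\<lambda>j\<in>J. f j)" if "f \<in> F" for f
  using that F(1) by (metis PiE_restrict subsetD)
 have neg: "(- 1) \<odot>\<^bsub>V j\<^esub> x \<oplus>\<^bsub>V j\<^esub> x = \<zero>\<^bsub>V j\<^esub>" if "x \<in> carrier (V j)" "j \<in> J" for x j
  using vs_smult_l_distr[OF V that(1), of "-1" 1] that V by simp
 have "abelian_group (pointwise J V F)"
 proof (rule abelian_groupI)
  fix x assume x: "x \<in> carrier (pointwise J V F)"
  have "(\<lambda>j\<in>J. (- 1) \<odot>\<^bsub>V j\<^esub> x j) \<oplus>\<^bsub>pointwise J V F\<^esub> x = \<zero>\<^bsub>pointwise J V F\<^esub>"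
   using x c neg by (auto intro!: restrict_ext)
  then show "\<exists>y\<in>carrier (pointwise J V F). y \<oplus>\<^bsub>pointwise J V F\<^esub> x = \<zero>\<^bsub>pointwise J V F\<^esub>"
   using F(4)[of x "-1"] x by (auto simp del: pointwise_simps(2,3))
 next
  fix x assume x: "x \<in> carrier (pointwise J V F)"
  then have "x = (\<lambda>j\<in>J. x j)" using e by simp
  also have "\<dots> = \<zero>\<^bsub>pointwise J V F\<^esub> \<oplus>\<^bsub>pointwise J V F\<^esub> x"
   using x by (auto intro!: restrict_ext simp: V c)
  finally show "\<zero>\<^bsub>pointwise J V F\<^esub> \<oplus>\<^bsub>pointwise J V F\<^esub> x = x" by simp
 qed (use F V c in \<open>auto simp: vs_assoc vs_comm vs_lcomm intro!: restrict_ext\<close>)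
 then show ?thesis
 proof (rule vspI)
  fix x assume x: "x \<in> carrier (pointwise J V F)"
  then have "x = (\<lambda>j\<in>J. x j)" using e by simp
  also have "\<dots> = 1 \<odot>\<^bsub>pointwise J V F\<^esub> x"
   using x by (auto intro!: restrict_ext simp: V c)
  finally show "1 \<odot>\<^bsub>pointwise J V F\<^esub> x = x" by simp
 qed (use F V c in \<open>auto simp: vs_smult_l_distr vs_smult_r_distr vs_smult_smult intro!: restrict_ext\<close>)
qed

lemma vsp_direct_sum:
 assumes V: "\<And>j. j \<in> J ==> vsp (V j)"
 shows "vsp (direct_sum J V)"
 unfolding direct_sum_def
proof (rule vsp_pointwise[OF V], goal_cases)
 case (4 f g)
 have "{j \<in> J. (\<lambda>j\<in>J. f j \<oplus>\<^bsub>V j\<^esub> g j) j \<noteq> \<zero>\<^bsub>V j\<^esub>} \<subseteq> {j \<in> J. f j \<noteq> \<zero>\<^bsub>V j\<^esub>} \<union> {j \<in> J. g j \<noteq> \<zero>\<^bsub>V j\<^esub>}"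
  using V by auto
 then have "finite {j \<in> J. (\<lambda>j\<in>J. f j \<oplus>\<^bsub>V j\<^esub> g j) j \<noteq> \<zero>\<^bsub>V j\<^esub>}"
  by (rule finite_subset) (use 4 in auto)
 moreover have "f j \<oplus>\<^bsub>V j\<^esub> g j \<in> carrier (V j)" if "j \<in> J" for j
  using 4 V that by (intro vs_add) auto
 ultimately show ?case by simp
next
 case (5 c f)
 have "{j \<in> J. (\<lambda>j\<in>J. c \<odot>\<^bsub>V j\<^esub> f j) j \<noteq> \<zero>\<^bsub>V j\<^esub>} \<subseteq> {j \<in> J. f j \<noteq> \<zero>\<^bsub>V j\<^esub>}"
  using V by auto
 then have "finite {j \<in> J. (\<lambda>j\<in>J. c \<odot>\<^bsub>V j\<^esub> f j) j \<noteq> \<zero>\<^bsub>V j\<^esub>}"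
  by (rule finite_subset) (use 5 in auto)
 moreover have "c \<odot>\<^bsub>V j\<^esub> f j \<in> carrier (V j)" if "j \<in> J" for j
  using 5 V that by (intro vs_smult) auto
 ultimately show ?case by simp
qed (use V in auto)

subsection \<open>Finitely supported functions\<close>

text \<open>The free vector space on \<open>I\<close>. Its elements are total functions vanishing
  off \<open>I\<close>, so \<open>FS I\<close> lies in \<open>FS J\<close> whenever \<open>I\<close>
  lies in \<open>J\<close>, and evaluation needs no side condition.\<close>

definition fsm :: "'i set => ('k::field, 'i => 'k) module" where
 "fsm I = \<lparr>carrier = {f. finite {i. f i \<noteq> 0} \<and> {i. f i \<noteq> 0} \<subseteq> I}, mult = undefined, one = undefined,
   zero = (\<lambda>i. 0), add = (\<lambda>f g i. f i + g i), smult = (\<lambda>c f i. c * f i)\<rparr>"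

abbreviation FS where "FS I \<equiv> carrier (fsm I)"

definition dl :: "'i => 'i => 'k::field" where
 "dl i = (\<lambda>j. if j = i then 1 else 0)"

text \<open>The linear extension of \<open>v\<close> to finitely supported functions. The sum runs
  over the support of \<open>f\<close>, so one term serves every index set that contains it.\<close>

definition lext :: "('k::field, 'v, 'x) module_scheme => ('i => 'v) => ('i => 'k) => 'v" where
 "lext M v f = (\<Oplus>\<^bsub>M\<^esub>i\<in>{i. f i \<noteq> 0}. f i \<odot>\<^bsub>M\<^esub> v i)"

lemma fsm_simps [simp]:
 "\<zero>\<^bsub>fsm I\<^esub> = (\<lambda>i. 0)" "f \<oplus>\<^bsub>fsm I\<^esub> g = (\<lambda>i. f i + g i)" "c \<odot>\<^bsub>fsm I\<^esub> f = (\<lambda>i. c * f i)"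
 by (simp_all add: fsm_def)

lemma carrier_fsm: "FS I = {f. finite {i. f i \<noteq> 0} \<and> {i. f i \<noteq> 0} \<subseteq> I}"
 by (simp add: fsm_def)

lemma fsmD: "f \<in> FS I ==> finite {i. f i \<noteq> 0}" "f \<in> FS I ==> f i \<noteq> 0 ==> i \<in> I"
 by (auto simp: carrier_fsm)

lemma fsmI: "finite A ==> A \<subseteq> I ==> (\<And>i. f i \<noteq> 0 ==> i \<in> A) ==> f \<in> FS I"
 by (auto simp: carrier_fsm intro: finite_subset)

lemma vsp_fsm [simp]: "vsp (fsm I :: ('k::field, 'i => 'k) module)" (is "vsp ?V")
proof (rule vspI)
 show "abelian_group ?V"
 proof (rule abelian_groupI)
  fix x y assume "x \<in> carrier ?V" "y \<in> carrier ?V"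
  then show "x \<oplus>\<^bsub>fsm I\<^esub> y \<in> FS I"
   by (intro fsmI[of "{i. x i \<noteq> 0} \<union> {i. y i \<noteq> 0}"]) (auto simp: carrier_fsm)
 next
  fix x assume "x \<in> carrier ?V"
  then show "\<exists>y\<in>FS I. y \<oplus>\<^bsub>fsm I\<^esub> x = \<zero>\<^bsub>fsm I\<^esub>"
   by (intro bexI[of _ "\<lambda>i. - x i"]) (auto simp: carrier_fsm)
 qed (auto simp: carrier_fsm algebra_simps)
next
 fix c :: 'k and x assume "x \<in> carrier ?V"
 then show "c \<odot>\<^bsub>fsm I\<^esub> x \<in> FS I"
  by (intro fsmI[of "{i. x i \<noteq> 0}"]) (auto simp: carrier_fsm)
qed (auto simp: algebra_simps)

lemma dl_simps [simp]: "dl i i = 1" "i \<noteq> j ==> dl i j = 0" "i \<noteq> j ==> dl j i = 0"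
 by (auto simp: dl_def)

lemma supp_dl [simp]: "{j. dl i j \<noteq> (0::'k::field)} = {i}"
 by (auto simp: dl_def)

lemma dl_in [simp]: "dl i \<in> FS I \<longleftrightarrow> i \<in> I"
 by (simp add: carrier_fsm)

lemma finsum_fsm: "finite A ==> f \<in> A \<rightarrow> FS I ==> finsum (fsm I) f A = (\<lambda>i. \<Sum>a\<in>A. f a i)"
 by (induction rule: finite_induct) (auto simp: vs_finsum_insert)

text \<open>Indices off the support contribute zero. Additivity of \<open>lext\<close> depends on
  this, because two functions have to be summed over a common finite set.\<close>

lemma lext_superset:
 assumes M: "vsp M" and v: "v \<in> I \<rightarrow> carrier M" and A: "finite A" "A \<subseteq> I" "\<And>i. f i \<noteq> 0 ==> i \<in> A"
 shows "lext M v f = (\<Oplus>\<^bsub>M\<^esub>i\<in>A. f i \<odot>\<^bsub>M\<^esub> v i)"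
 unfolding lext_def
proof (rule vs_finsum_mono[OF M])
 fix i assume "i \<in> A - {i. f i \<noteq> 0}"
 moreover have "v i \<in> carrier M" if "i \<in> A" for i using that A v by blast
 ultimately show "f i \<odot>\<^bsub>M\<^esub> v i = \<zero>\<^bsub>M\<^esub>" using M by auto
next
 show "(\<lambda>i. f i \<odot>\<^bsub>M\<^esub> v i) \<in> A \<rightarrow> carrier M" using M A v by (blast intro: vs_smult)
qed (use A in auto)

lemma lin_lext:
 fixes v :: "'i => 'v" and M :: "('k::field, 'v, 'x) module_scheme"
 assumes M: "vsp M" and v: "v \<in> I \<rightarrow> carrier M"
 shows "lin (fsm I) M (lext M v)"
proof (rule linI)
 fix f g :: "'i => 'k" assume fg: "f \<in> FS I" "g \<in> FS I"
 define A where "A = {i. f i \<noteq> 0} \<union> {i. g i \<noteq> 0}"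
 have A: "finite A" "A \<subseteq> I" using fg by (auto simp: A_def carrier_fsm)
 have vA: "v i \<in> carrier M" if "i \<in> A" for i using that A v by auto
 have "lext M v (f \<oplus>\<^bsub>fsm I\<^esub> g) = (\<Oplus>\<^bsub>M\<^esub>i\<in>A. f i \<odot>\<^bsub>M\<^esub> v i \<oplus>\<^bsub>M\<^esub> g i \<odot>\<^bsub>M\<^esub> v i)"
  using vA by (subst lext_superset[OF M v A])
   (auto simp: A_def vs_smult_l_distr[OF M] M intro!: vs_finsum_cong[OF M])
 also have "\<dots> = lext M v f \<oplus>\<^bsub>M\<^esub> lext M v g"
  using vA M by (subst vs_finsum_add[OF M]) (auto simp: lext_superset[OF M v A] A_def)
 finally show "lext M v (f \<oplus>\<^bsub>fsm I\<^esub> g) = lext M v f \<oplus>\<^bsub>M\<^esub> lext M v g" .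
next
 fix f :: "'i => 'k" and c assume f: "f \<in> FS I"
 have A: "finite {i. f i \<noteq> 0}" "{i. f i \<noteq> 0} \<subseteq> I" using f by (auto simp: carrier_fsm)
 have vA: "v i \<in> carrier M" if "f i \<noteq> 0" for i using that A v by auto
 show "lext M v (c \<odot>\<^bsub>fsm I\<^esub> f) = c \<odot>\<^bsub>M\<^esub> lext M v f"
  using vA M by (subst lext_superset[OF M v A])
   (auto simp: lext_def vs_finsum_smult[symmetric] vs_smult_smult intro!: vs_finsum_cong[OF M])
next
 fix f :: "'i => 'k" assume "f \<in> FS I"
 then show "lext M v f \<in> carrier M"
  using M v by (force simp: lext_def carrier_fsm intro!: vs_finsum)
qed

lemma lext_closed: "vsp M ==> v \<in> I \<rightarrow> carrier M ==> f \<in> FS I ==> lext M v f \<in> carrier M"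
 by (rule lin_closed[OF lin_lext])

lemma lext_dl [simp]: "vsp M ==> v i \<in> carrier M ==> lext M v (dl i) = v i"
 by (simp add: lext_def vs_finsum_insert)

lemma lext_fsm: "v \<in> I \<rightarrow> FS J ==> f \<in> FS I ==>
  lext (fsm J) v f = (\<lambda>j. \<Sum>i\<in>{i. f i \<noteq> 0}. f i * v i j)"
 unfolding lext_def
 by (subst finsum_fsm[of _ _ J]) (auto simp: Pi_iff simp del: fsm_simps dest: fsmD intro!: vs_smult, simp_all)

lemma fsm_expand:
 assumes f: "f \<in> FS I"
 shows "f = (\<Oplus>\<^bsub>fsm I\<^esub>i\<in>{i. f i \<noteq> 0}. f i \<odot>\<^bsub>fsm I\<^esub> dl i)"
proof -
 have "(\<Oplus>\<^bsub>fsm I\<^esub>i\<in>{i. f i \<noteq> 0}. f i \<odot>\<^bsub>fsm I\<^esub> dl i) = (\<lambda>j. \<Sum>i\<in>{i. f i \<noteq> 0}. f i * dl i j)"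
  using f by (subst finsum_fsm[of _ _ I]) (auto simp: carrier_fsm dl_def split: if_splits)
 also have "\<dots> = f"
 proof
  fix j
  have "(\<Sum>i\<in>{i. f i \<noteq> 0}. f i * dl i j) = (\<Sum>i\<in>{i. f i \<noteq> 0}. if i = j then f i else 0)"
   by (intro sum.cong) (auto simp: dl_def)
  also have "\<dots> = f j" using f by (simp add: carrier_fsm)
  finally show "(\<Sum>i\<in>{i. f i \<noteq> 0}. f i * dl i j) = f j" .
 qed
 finally show ?thesis by simp
qed

lemma lin_fsm_eq_lext:
 assumes M: "vsp M" and F: "lin (fsm I) M F" and f: "f \<in> FS I"
 shows "F f = lext M (\<lambda>i. F (dl i)) f"
proof -
 have d: "dl i \<in> FS I" if "f i \<noteq> 0" for i using f that by (auto simp: carrier_fsm)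
 have "F f = F (\<Oplus>\<^bsub>fsm I\<^esub>i\<in>{i. f i \<noteq> 0}. f i \<odot>\<^bsub>fsm I\<^esub> dl i)" using fsm_expand[OF f] by simp
 also have "\<dots> = (\<Oplus>\<^bsub>M\<^esub>i\<in>{i. f i \<noteq> 0}. F (f i \<odot>\<^bsub>fsm I\<^esub> dl i))"
  by (rule lin_finsum[OF vsp_fsm M F]) (use d in \<open>auto simp del: fsm_simps simp: Pi_iff\<close>)
 also have "\<dots> = lext M (\<lambda>i. F (dl i)) f"
  unfolding lext_def
  by (rule vs_finsum_cong[OF M])
   (use d M in \<open>auto simp del: fsm_simps simp: Pi_iff lin_smult[OF F] lin_closed[OF F]\<close>)
 finally show ?thesis .
qed

text \<open>The basis principle to which almost every identity between maps out of a free object is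
  reduced, directly or through one of its versions for algebras, tensors, bar lists or group
  elements.\<close>

lemma lin_fsm_eqI:
 assumes M: "vsp M" and F: "lin (fsm I) M F" and G: "lin (fsm I) M G"
  and eq: "\<And>i. i \<in> I ==> F (dl i) = G (dl i)" and f: "f \<in> FS I"
 shows "F f = G f"
proof -
 have "lext M (\<lambda>i. F (dl i)) f = lext M (\<lambda>i. G (dl i)) f"
  unfolding lext_def
  by (rule vs_finsum_cong[OF M])
   (use f eq M lin_closed[OF G] in \<open>auto simp: Pi_iff dest: fsmD\<close>)
 then show ?thesis using lin_fsm_eq_lext[OF M F f] lin_fsm_eq_lext[OF M G f] by simp
qed

section \<open>Cohomology of complexes\<close>

definition subsp :: "('k::field, 'v, 'x) module_scheme => 'v set => bool" where
 "subsp V B \<longleftrightarrow> B \<subseteq> carrier V \<and> \<zero>\<^bsub>V\<^esub> \<in> B \<and> (\<forall>x\<in>B. \<forall>y\<in>B. x \<oplus>\<^bsub>V\<^esub> y \<in> B) \<and> (\<forall>c. \<forall>x\<in>B. c \<odot>\<^bsub>V\<^esub> x \<in> B)"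

lemma subsp_minus: "vsp V ==> subsp V B ==> x \<in> B ==> y \<in> B ==> x \<ominus>\<^bsub>V\<^esub> y \<in> B"
 by (auto simp: subsp_def vs_minus_eq subset_iff)

lemma a_r_coset_eq: "B +>\<^bsub>V\<^esub> z = (\<lambda>b. b \<oplus>\<^bsub>V\<^esub> z) ` B"
 by (auto simp: a_r_coset_def')

lemma coset_eq_iff:
 assumes V: "vsp V" and B: "subsp V B" and z: "z \<in> carrier V" "z' \<in> carrier V"
 shows "B +>\<^bsub>V\<^esub> z = B +>\<^bsub>V\<^esub> z' \<longleftrightarrow> z \<ominus>\<^bsub>V\<^esub> z' \<in> B"
proof
 assume eq: "B +>\<^bsub>V\<^esub> z = B +>\<^bsub>V\<^esub> z'"
 have "\<zero>\<^bsub>V\<^esub> \<oplus>\<^bsub>V\<^esub> z \<in> B +>\<^bsub>V\<^esub> z" using B unfolding a_r_coset_eq subsp_def by blast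
 then obtain b where "b \<in> B" "z = b \<oplus>\<^bsub>V\<^esub> z'" using eq z V unfolding a_r_coset_eq by auto
 then show "z \<ominus>\<^bsub>V\<^esub> z' \<in> B" using B z V by (auto simp: subsp_def)
next
 assume b: "z \<ominus>\<^bsub>V\<^esub> z' \<in> B"
 have sub: "B +>\<^bsub>V\<^esub> u \<subseteq> B +>\<^bsub>V\<^esub> v" if uv: "u \<ominus>\<^bsub>V\<^esub> v \<in> B" "u \<in> carrier V" "v \<in> carrier V" for u v
 proof
  fix x assume "x \<in> B +>\<^bsub>V\<^esub> u"
  then obtain c where c: "c \<in> B" "x = c \<oplus>\<^bsub>V\<^esub> u" by (auto simp: a_r_coset_eq)
  have cV: "c \<in> carrier V" using c B by (auto simp: subsp_def)
  have "x = (c \<oplus>\<^bsub>V\<^esub> (u \<ominus>\<^bsub>V\<^esub> v)) \<oplus>\<^bsub>V\<^esub> v" using c cV V uv by (simp add: vs_assoc)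
  moreover have "c \<oplus>\<^bsub>V\<^esub> (u \<ominus>\<^bsub>V\<^esub> v) \<in> B" using B c uv by (auto simp: subsp_def)
  ultimately show "x \<in> B +>\<^bsub>V\<^esub> v" by (auto simp: a_r_coset_eq)
 qed
 have "z' \<ominus>\<^bsub>V\<^esub> z = (- 1) \<odot>\<^bsub>V\<^esub> (z \<ominus>\<^bsub>V\<^esub> z')"
  using V z by (simp add: vs_minus_eq vs_smult_r_distr vs_smult_smult vs_comm)
 then have "z' \<ominus>\<^bsub>V\<^esub> z \<in> B" using b B by (auto simp: subsp_def)
 then show "B +>\<^bsub>V\<^esub> z = B +>\<^bsub>V\<^esub> z'" using sub b z by blast
qed

context
 fixes V :: "('k::field, 'v, 'x) module_scheme" and Z B
 assumes V: "vsp V" and Z: "subsp V Z" and B: "subsp V B" and BZ: "B \<subseteq> Z"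
begin

lemma coset_add: "z \<in> Z ==> z' \<in> Z ==>
  (B +>\<^bsub>V\<^esub> z) \<oplus>\<^bsub>quotient_space V Z B\<^esub> (B +>\<^bsub>V\<^esub> z') = B +>\<^bsub>V\<^esub> (z \<oplus>\<^bsub>V\<^esub> z')"
proof -
 assume z: "z \<in> Z" "z' \<in> Z"
 have c: "z \<in> carrier V" "z' \<in> carrier V" "\<And>b. b \<in> B ==> b \<in> carrier V"
  using z Z BZ by (auto simp: subsp_def)
 have "(B +>\<^bsub>V\<^esub> z) \<oplus>\<^bsub>quotient_space V Z B\<^esub> (B +>\<^bsub>V\<^esub> z') =
   {(b \<oplus>\<^bsub>V\<^esub> z) \<oplus>\<^bsub>V\<^esub> (b' \<oplus>\<^bsub>V\<^esub> z') | b b'. b \<in> B \<and> b' \<in> B}"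
  by (auto simp: quotient_space_def set_add_def' a_r_coset_eq)
 also have "\<dots> = {(b \<oplus>\<^bsub>V\<^esub> b') \<oplus>\<^bsub>V\<^esub> (z \<oplus>\<^bsub>V\<^esub> z') | b b'. b \<in> B \<and> b' \<in> B}"
 proof -
  have "(b \<oplus>\<^bsub>V\<^esub> z) \<oplus>\<^bsub>V\<^esub> (b' \<oplus>\<^bsub>V\<^esub> z') = (b \<oplus>\<^bsub>V\<^esub> b') \<oplus>\<^bsub>V\<^esub> (z \<oplus>\<^bsub>V\<^esub> z')" if "b \<in> B" "b' \<in> B" for b b'
   using c that V by (simp add: vs_assoc vs_lcomm)
  then show ?thesis by (auto, metis+)
 qed
 also have "\<dots> = B +>\<^bsub>V\<^esub> (z \<oplus>\<^bsub>V\<^esub> z')"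
 proof -
  have "{b \<oplus>\<^bsub>V\<^esub> b' | b b'. b \<in> B \<and> b' \<in> B} = B"
  proof -
   have "\<exists>b b'. x = b \<oplus>\<^bsub>V\<^esub> b' \<and> b \<in> B \<and> b' \<in> B" if "x \<in> B" for x
    using B c V that unfolding subsp_def by (intro exI[of _ x] exI[of _ "\<zero>\<^bsub>V\<^esub>"]) auto
   then show ?thesis using B by (auto simp: subsp_def)
  qed
  moreover have "{(b \<oplus>\<^bsub>V\<^esub> b') \<oplus>\<^bsub>V\<^esub> (z \<oplus>\<^bsub>V\<^esub> z') | b b'. b \<in> B \<and> b' \<in> B} =
    (\<lambda>b. b \<oplus>\<^bsub>V\<^esub> (z \<oplus>\<^bsub>V\<^esub> z')) ` {b \<oplus>\<^bsub>V\<^esub> b' | b b'. b \<in> B \<and> b' \<in> B}"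
   by blast
  ultimately show ?thesis unfolding a_r_coset_eq by simp
 qed
 finally show ?thesis .
qed

lemma coset_smult: "z \<in> Z ==> c \<odot>\<^bsub>quotient_space V Z B\<^esub> (B +>\<^bsub>V\<^esub> z) = B +>\<^bsub>V\<^esub> (c \<odot>\<^bsub>V\<^esub> z)"
proof -
 assume z: "z \<in> Z"
 have c: "z \<in> carrier V" "\<And>b. b \<in> B ==> b \<in> carrier V" using z Z BZ by (auto simp: subsp_def)
 have "B +>\<^bsub>V\<^esub> (c \<odot>\<^bsub>V\<^esub> x) = B +>\<^bsub>V\<^esub> (c \<odot>\<^bsub>V\<^esub> z)" if x: "x \<in> B +>\<^bsub>V\<^esub> z" for x
 proof -
  obtain b where b: "b \<in> B" "x = b \<oplus>\<^bsub>V\<^esub> z" using x unfolding a_r_coset_eq by blast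
  have "c \<odot>\<^bsub>V\<^esub> x \<ominus>\<^bsub>V\<^esub> c \<odot>\<^bsub>V\<^esub> z = c \<odot>\<^bsub>V\<^esub> b" using b c V by (simp add: vs_smult_r_distr)
  then show ?thesis using b c V B by (subst coset_eq_iff[OF V B]) (auto simp: subsp_def)
 qed
 moreover have "B +>\<^bsub>V\<^esub> z \<noteq> {}" using B by (auto simp: a_r_coset_eq subsp_def)
 ultimately show ?thesis by (auto simp: quotient_space_def coset_smult_def)
qed

lemma quotient_space_carrier: "carrier (quotient_space V Z B) = (\<lambda>z. B +>\<^bsub>V\<^esub> z) ` Z"
 by (auto simp: quotient_space_def)

lemma coset_zero: "\<zero>\<^bsub>quotient_space V Z B\<^esub> = B +>\<^bsub>V\<^esub> \<zero>\<^bsub>V\<^esub>"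
proof -
 have "(\<lambda>b. b \<oplus>\<^bsub>V\<^esub> \<zero>\<^bsub>V\<^esub>) ` B = (\<lambda>b. b) ` B" using B V by (intro image_cong) (auto simp: subsp_def)
 then show ?thesis by (simp add: quotient_space_def a_r_coset_eq)
qed

lemma vsp_quotient_space: "vsp (quotient_space V Z B)"
 using Z by (intro vsp_image[OF V, of Z, where \<pi> = "\<lambda>z. B +>\<^bsub>V\<^esub> z"])
  (auto simp: quotient_space_carrier coset_zero coset_add coset_smult subsp_def)

end

definition cplx :: "(nat => ('k::field, 'c) module) => (nat => 'c => 'c) => bool" where
 "cplx C \<delta> \<longleftrightarrow> (\<forall>m. vsp (C m)) \<and> (\<forall>m. lin (C m) (C (Suc m)) (\<delta> m)) \<and>
   (\<forall>m. \<forall>x\<in>carrier (C m). \<delta> (Suc m) (\<delta> m x) = \<zero>\<^bsub>C (Suc (Suc m))\<^esub>)"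

lemma subsp_cocycles: "cplx C \<delta> ==> subsp (C m) (cocycles C \<delta> m)"
proof -
 assume C: "cplx C \<delta>"
 have v: "vsp (C m)" for m using C by (auto simp: cplx_def)
 have l: "lin (C m) (C (Suc m)) (\<delta> m)" using C by (auto simp: cplx_def)
 show ?thesis
  by (auto simp: subsp_def cocycles_def v lin_zero[OF v v l] lin_add[OF l] lin_smult[OF l])
qed

lemma subsp_coboundaries: "cplx C \<delta> ==> subsp (C m) (coboundaries C \<delta> m)"
proof -
 assume C: "cplx C \<delta>"
 have v: "vsp (C m)" for m using C by (auto simp: cplx_def)
 have l: "lin (C m) (C (Suc m)) (\<delta> m)" for m using C by (auto simp: cplx_def)
 show ?thesis
 proof (cases m)
  case 0 then show ?thesis using v by (auto simp: subsp_def coboundaries_def)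
 next
  case (Suc n)
  have "\<zero>\<^bsub>C (Suc n)\<^esub> = \<delta> n \<zero>\<^bsub>C n\<^esub>" using lin_zero[OF v v l] by simp
  then show ?thesis using Suc v[of n] l[of n]
   by (auto simp: subsp_def coboundaries_def lin_closed lin_add[OF l, symmetric] lin_smult[OF l, symmetric])
 qed
qed

lemma coboundaries_cocycles: "cplx C \<delta> ==> coboundaries C \<delta> m \<subseteq> cocycles C \<delta> m"
proof -
 assume C: "cplx C \<delta>"
 have v: "vsp (C m)" for m using C by (auto simp: cplx_def)
 have l: "lin (C m) (C (Suc m)) (\<delta> m)" for m using C by (auto simp: cplx_def)
 show ?thesis using C
  by (cases m) (auto simp: coboundaries_def cocycles_def cplx_def lin_closed[OF l] v lin_zero[OF v v l])
qed

lemma cocyclesD: "z \<in> cocycles C \<delta> m ==> z \<in> carrier (C m)" by (auto simp: cocycles_def)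

lemma coboundariesD: "cplx C \<delta> ==> z \<in> coboundaries C \<delta> m ==> z \<in> carrier (C m)"
 using subsp_coboundaries[of C \<delta> m] by (auto simp: subsp_def)

context
 fixes C :: "nat => ('k::field, 'c) module" and \<delta>
 assumes C: "cplx C \<delta>"
begin

lemma cplx_vsp: "vsp (C m)" using C by (simp add: cplx_def)
lemma cplx_lin: "lin (C m) (C (Suc m)) (\<delta> m)" using C by (simp add: cplx_def)
lemma cplx_sq: "x \<in> carrier (C m) ==> \<delta> (Suc m) (\<delta> m x) = \<zero>\<^bsub>C (Suc (Suc m))\<^esub>"
 using C by (simp add: cplx_def)

lemmas cplx_quot = cplx_vsp subsp_cocycles[OF C] subsp_coboundaries[OF C] coboundaries_cocycles[OF C]

lemma vsp_cohomology: "vsp (cohomology C \<delta> m)"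
 unfolding cohomology_def by (rule vsp_quotient_space[OF cplx_quot])

lemma cohomology_carrier:
 "carrier (cohomology C \<delta> m) = (\<lambda>z. coboundaries C \<delta> m +>\<^bsub>C m\<^esub> z) ` cocycles C \<delta> m"
 unfolding cohomology_def by (rule quotient_space_carrier[OF cplx_quot])

lemma cohomology_add: "z \<in> cocycles C \<delta> m ==> z' \<in> cocycles C \<delta> m ==>
  (coboundaries C \<delta> m +>\<^bsub>C m\<^esub> z) \<oplus>\<^bsub>cohomology C \<delta> m\<^esub> (coboundaries C \<delta> m +>\<^bsub>C m\<^esub> z') =
  coboundaries C \<delta> m +>\<^bsub>C m\<^esub> (z \<oplus>\<^bsub>C m\<^esub> z')"
 unfolding cohomology_def by (rule coset_add[OF cplx_quot])

lemma cohomology_smult: "z \<in> cocycles C \<delta> m ==>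
  c \<odot>\<^bsub>cohomology C \<delta> m\<^esub> (coboundaries C \<delta> m +>\<^bsub>C m\<^esub> z) = coboundaries C \<delta> m +>\<^bsub>C m\<^esub> (c \<odot>\<^bsub>C m\<^esub> z)"
 unfolding cohomology_def by (rule coset_smult[OF cplx_quot])

lemma cohomology_eq_iff: "z \<in> cocycles C \<delta> m ==> z' \<in> cocycles C \<delta> m ==>
  coboundaries C \<delta> m +>\<^bsub>C m\<^esub> z = coboundaries C \<delta> m +>\<^bsub>C m\<^esub> z' \<longleftrightarrow> z \<ominus>\<^bsub>C m\<^esub> z' \<in> coboundaries C \<delta> m"
 by (intro coset_eq_iff[OF cplx_vsp subsp_coboundaries[OF C]] cocyclesD)

end

text \<open>Exactly the conditions in one degree that make the induced map on cohomology well
  defined, injective and surjective. They are phrased with cochains, so such maps can be composed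
  before any quotient is formed.\<close>

definition quasi ::
 "(nat => ('k::field, 'c) module) => (nat => 'c => 'c) =>
  (nat => ('k, 'd) module) => (nat => 'd => 'd) => nat => ('c => 'd) => bool" where
 "quasi C \<delta> C' \<delta>' m \<theta> \<longleftrightarrow> lin (C m) (C' m) \<theta> \<and>
   (\<forall>z\<in>cocycles C \<delta> m. \<theta> z \<in> cocycles C' \<delta>' m) \<and>
   (\<forall>z\<in>coboundaries C \<delta> m. \<theta> z \<in> coboundaries C' \<delta>' m) \<and>
   (\<forall>z\<in>cocycles C \<delta> m. \<theta> z \<in> coboundaries C' \<delta>' m --> z \<in> coboundaries C \<delta> m) \<and>
   (\<forall>z'\<in>cocycles C' \<delta>' m. \<exists>z\<in>cocycles C \<delta> m. z' \<ominus>\<^bsub>C' m\<^esub> \<theta> z \<in> coboundaries C' \<delta>' m)"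

text \<open>The union in \<open>cohomology_map\<close> collapses: members of one coset differ by
  coboundaries, so they all have the same image coset.\<close>

lemma cohomology_map_eq:
 assumes C: "cplx C \<delta>" and C': "cplx C' \<delta>'" and \<theta>: "lin (C m) (C' m) \<theta>"
  and B: "\<And>z. z \<in> coboundaries C \<delta> m ==> \<theta> z \<in> coboundaries C' \<delta>' m"
  and z: "z \<in> cocycles C \<delta> m"
 shows "cohomology_map C \<delta> C' \<delta>' m \<theta> (coboundaries C \<delta> m +>\<^bsub>C m\<^esub> z) = coboundaries C' \<delta>' m +>\<^bsub>C' m\<^esub> \<theta> z"
proof -
 let ?B = "coboundaries C \<delta> m" and ?B' = "coboundaries C' \<delta>' m"
 note v = cplx_vsp[OF C, of m] cplx_vsp[OF C', of m]
 note zc = cocyclesD[OF z]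
 have "?B' +>\<^bsub>C' m\<^esub> \<theta> x = ?B' +>\<^bsub>C' m\<^esub> \<theta> z" if x: "x \<in> ?B +>\<^bsub>C m\<^esub> z" for x
 proof -
  obtain b where b: "b \<in> ?B" "x = b \<oplus>\<^bsub>C m\<^esub> z" using x by (auto simp: a_r_coset_eq)
  note bc = coboundariesD[OF C b(1)]
  have "\<theta> x \<ominus>\<^bsub>C' m\<^esub> \<theta> z = \<theta> b" using b bc zc v lin_closed[OF \<theta>] by (simp add: lin_add[OF \<theta>])
  then show ?thesis using B[OF b(1)] b bc zc v lin_closed[OF \<theta>]
   by (subst coset_eq_iff[OF v(2) subsp_coboundaries[OF C']]) auto
 qed
 moreover have "?B +>\<^bsub>C m\<^esub> z \<noteq> {}" using subsp_coboundaries[OF C, of m] by (auto simp: a_r_coset_eq subsp_def)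
 moreover have "?B +>\<^bsub>C m\<^esub> z \<in> carrier (cohomology C \<delta> m)" using z by (simp add: cohomology_carrier[OF C])
 ultimately show ?thesis by (auto simp: cohomology_map_def)
qed

lemma quasi_lin_iso:
 assumes C: "cplx C \<delta>" and C': "cplx C' \<delta>'" and q: "quasi C \<delta> C' \<delta>' m \<theta>"
 shows "lin_iso (cohomology C \<delta> m) (cohomology C' \<delta>' m) (cohomology_map C \<delta> C' \<delta>' m \<theta>)"
proof -
 let ?Z = "cocycles C \<delta> m" and ?Z' = "cocycles C' \<delta>' m"
 let ?B = "coboundaries C \<delta> m" and ?B' = "coboundaries C' \<delta>' m"
 let ?F = "cohomology_map C \<delta> C' \<delta>' m \<theta>"
 note v = cplx_vsp[OF C, of m] cplx_vsp[OF C', of m]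
 have \<theta>: "lin (C m) (C' m) \<theta>" and BB: "\<And>z. z \<in> ?B ==> \<theta> z \<in> ?B'" and ZZ: "\<And>z. z \<in> ?Z ==> \<theta> z \<in> ?Z'"
  using q by (auto simp: quasi_def)
 note F = cohomology_map_eq[OF C C' \<theta> BB]
 note Zc = cocyclesD[of _ C \<delta> m]
 have Zadd: "x \<oplus>\<^bsub>C m\<^esub> y \<in> ?Z" "c \<odot>\<^bsub>C m\<^esub> x \<in> ?Z" "x \<ominus>\<^bsub>C m\<^esub> y \<in> ?Z" if "x \<in> ?Z" "y \<in> ?Z" for x y c
  using that subsp_cocycles[OF C, of m] subsp_minus[OF v(1)] by (auto simp: subsp_def)
 have "lin (cohomology C \<delta> m) (cohomology C' \<delta>' m) ?F"
  by (rule linI)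
   (auto simp: cohomology_carrier[OF C] cohomology_carrier[OF C'] F ZZ cohomology_add[OF C] cohomology_add[OF C']
    cohomology_smult[OF C] cohomology_smult[OF C'] Zadd lin_add[OF \<theta>] lin_smult[OF \<theta>] Zc)
 moreover have "?F \<in> extensional (carrier (cohomology C \<delta> m))"
  by (simp add: cohomology_map_def)
 moreover have "inj_on ?F (carrier (cohomology C \<delta> m))"
 proof (rule inj_onI, unfold cohomology_carrier[OF C], elim imageE, clarify)
  fix x y assume xy: "x \<in> ?Z" "y \<in> ?Z" and "?F (?B +>\<^bsub>C m\<^esub> x) = ?F (?B +>\<^bsub>C m\<^esub> y)"
  then have "\<theta> x \<ominus>\<^bsub>C' m\<^esub> \<theta> y \<in> ?B'" by (simp add: F cohomology_eq_iff[OF C'] ZZ)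
  then have "\<theta> (x \<ominus>\<^bsub>C m\<^esub> y) \<in> ?B'" using xy Zc by (simp add: lin_minus[OF v \<theta>])
  then have "x \<ominus>\<^bsub>C m\<^esub> y \<in> ?B" using q xy Zadd by (auto simp: quasi_def)
  then show "?B +>\<^bsub>C m\<^esub> x = ?B +>\<^bsub>C m\<^esub> y" using xy by (simp add: cohomology_eq_iff[OF C])
 qed
 moreover have "?F ` carrier (cohomology C \<delta> m) = carrier (cohomology C' \<delta>' m)"
 proof
  show "carrier (cohomology C' \<delta>' m) \<subseteq> ?F ` carrier (cohomology C \<delta> m)"
  proof
   fix X assume "X \<in> carrier (cohomology C' \<delta>' m)"
   then obtain z' where z': "z' \<in> ?Z'" "X = ?B' +>\<^bsub>C' m\<^esub> z'" by (auto simp: cohomology_carrier[OF C'])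
   then obtain z where z: "z \<in> ?Z" "z' \<ominus>\<^bsub>C' m\<^esub> \<theta> z \<in> ?B'" using q by (auto simp: quasi_def)
   have "X = ?F (?B +>\<^bsub>C m\<^esub> z)" using z z' by (simp add: F cohomology_eq_iff[OF C'] ZZ)
   then show "X \<in> ?F ` carrier (cohomology C \<delta> m)" using z by (auto simp: cohomology_carrier[OF C])
  qed
 qed (auto simp: cohomology_carrier[OF C] cohomology_carrier[OF C'] F ZZ)
 ultimately show ?thesis by (auto simp: lin_iso_def lin_hom_iff bij_betw_def)
qed

lemma quasi_comp:
 assumes v: "vsp (C m)" "cplx C' \<delta>'" "cplx C'' \<delta>''"
  and 1: "quasi C \<delta> C' \<delta>' m \<theta>" and 2: "quasi C' \<delta>' C'' \<delta>'' m \<eta>"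
 shows "quasi C \<delta> C'' \<delta>'' m (\<lambda>x. \<eta> (\<theta> x))"
proof -
 let ?B'' = "coboundaries C'' \<delta>'' m"
 note V = cplx_vsp[OF v(2), of m] cplx_vsp[OF v(3), of m]
 have l: "lin (C m) (C' m) \<theta>" "lin (C' m) (C'' m) \<eta>" using 1 2 by (auto simp: quasi_def)
 have "\<exists>z\<in>cocycles C \<delta> m. z'' \<ominus>\<^bsub>C'' m\<^esub> \<eta> (\<theta> z) \<in> ?B''" if z'': "z'' \<in> cocycles C'' \<delta>'' m" for z''
 proof -
  obtain z' where z': "z' \<in> cocycles C' \<delta>' m" "z'' \<ominus>\<^bsub>C'' m\<^esub> \<eta> z' \<in> ?B''"
   using z'' 2 by (auto simp: quasi_def)
  obtain z where z: "z \<in> cocycles C \<delta> m" "z' \<ominus>\<^bsub>C' m\<^esub> \<theta> z \<in> coboundaries C' \<delta>' m"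
   using z' 1 by (auto simp: quasi_def)
  have c: "z'' \<in> carrier (C'' m)" "z' \<in> carrier (C' m)" "\<theta> z \<in> carrier (C' m)"
   using z z' z'' lin_closed[OF l(1)] cocyclesD by metis+
  have "\<eta> (z' \<ominus>\<^bsub>C' m\<^esub> \<theta> z) \<in> ?B''" using 2 z by (auto simp: quasi_def)
  then have "\<eta> z' \<ominus>\<^bsub>C'' m\<^esub> \<eta> (\<theta> z) \<in> ?B''" using c by (simp add: lin_minus[OF V l(2)])
  \<comment> \<open>Telescoping: the error left by \<open>\<eta>\<close> plus the image of the error
    left by \<open>\<theta>\<close>.\<close>
  then have "(z'' \<ominus>\<^bsub>C'' m\<^esub> \<eta> z') \<oplus>\<^bsub>C'' m\<^esub> (\<eta> z' \<ominus>\<^bsub>C'' m\<^esub> \<eta> (\<theta> z)) \<in> ?B''"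
   using z' subsp_coboundaries[OF v(3), of m] by (auto simp: subsp_def)
  moreover have "(z'' \<ominus>\<^bsub>C'' m\<^esub> \<eta> z') \<oplus>\<^bsub>C'' m\<^esub> (\<eta> z' \<ominus>\<^bsub>C'' m\<^esub> \<eta> (\<theta> z)) = z'' \<ominus>\<^bsub>C'' m\<^esub> \<eta> (\<theta> z)"
   using c V lin_closed[OF l(2)] by (simp add: vs_eq_minus_iff vs_assoc)
  ultimately show ?thesis using z by auto
 qed
 moreover have "\<forall>z\<in>cocycles C \<delta> m. \<eta> (\<theta> z) \<in> ?B'' --> z \<in> coboundaries C \<delta> m"
  using 1 2 unfolding quasi_def by metis
 moreover have "\<forall>z\<in>cocycles C \<delta> m. \<eta> (\<theta> z) \<in> cocycles C'' \<delta>'' m"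
  "\<forall>z\<in>coboundaries C \<delta> m. \<eta> (\<theta> z) \<in> ?B''"
  using 1 2 by (simp_all add: quasi_def)
 ultimately show ?thesis using lin_comp[OF l] unfolding quasi_def by blast
qed

text \<open>An isomorphism of graded spaces that intertwines the differentials transports
  everything, including the fact that the differential squares to zero. Hence the bar and Koszul
  cochain complexes need no computation of their own for this.\<close>

lemma quasi_iso:
 assumes C: "cplx C \<delta>" and C': "\<And>m. vsp (C' m)"
  and \<theta>: "\<And>m. lin (C m) (C' m) (\<theta> m)" "\<And>m. bij_betw (\<theta> m) (carrier (C m)) (carrier (C' m))"
  and comm: "\<And>m x. x \<in> carrier (C m) ==> \<theta> (Suc m) (\<delta> m x) = \<delta>' m (\<theta> m x)"
 shows "cplx C' \<delta>'" "quasi C \<delta> C' \<delta>' m (\<theta> m)"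
proof -
 have inj: "\<theta> m x = \<theta> m y ==> x \<in> carrier (C m) ==> y \<in> carrier (C m) ==> x = y" for m x y
  using \<theta>(2)[of m] by (auto simp: bij_betw_def inj_on_def)
 have surj: "\<exists>x\<in>carrier (C m). y = \<theta> m x" if "y \<in> carrier (C' m)" for m y
  using \<theta>(2)[of m] that by (auto simp: bij_betw_def)
 note v = cplx_vsp[OF C] and cl = lin_closed[OF \<theta>(1)] and dcl = lin_closed[OF cplx_lin[OF C]]
 note z = lin_zero[OF v C' \<theta>(1)]
 show c': "cplx C' \<delta>'"
  unfolding cplx_def
 proof (intro conjI allI ballI C')
  fix m
  show "lin (C' m) (C' (Suc m)) (\<delta>' m)"
  proof (rule linI)
   fix x assume "x \<in> carrier (C' m)"
   then obtain x' where x': "x' \<in> carrier (C m)" "x = \<theta> m x'" using surj by blast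
   then show "\<delta>' m x \<in> carrier (C' (Suc m))" by (simp flip: comm add: dcl cl)
   show "\<delta>' m (c \<odot>\<^bsub>C' m\<^esub> x) = c \<odot>\<^bsub>C' (Suc m)\<^esub> \<delta>' m x" for c
    using x' v by (simp flip: comm lin_smult[OF \<theta>(1)] lin_smult[OF cplx_lin[OF C]] add: dcl)
   fix y assume "y \<in> carrier (C' m)"
   then obtain y' where y': "y' \<in> carrier (C m)" "y = \<theta> m y'" using surj by blast
   show "\<delta>' m (x \<oplus>\<^bsub>C' m\<^esub> y) = \<delta>' m x \<oplus>\<^bsub>C' (Suc m)\<^esub> \<delta>' m y"
    using x' y' v by (simp flip: comm lin_add[OF \<theta>(1)] lin_add[OF cplx_lin[OF C]] add: dcl)
  qed
  fix x assume "x \<in> carrier (C' m)"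
  then obtain x' where x': "x' \<in> carrier (C m)" "x = \<theta> m x'" using surj by blast
  then show "\<delta>' (Suc m) (\<delta>' m x) = \<zero>\<^bsub>C' (Suc (Suc m))\<^esub>"
   by (simp flip: comm add: dcl cplx_sq[OF C] z)
 qed
 have Z: "\<theta> m x \<in> cocycles C' \<delta>' m \<longleftrightarrow> x \<in> cocycles C \<delta> m" if "x \<in> carrier (C m)" for x
  using that inj[of "Suc m" "\<delta> m x" "\<zero>\<^bsub>C (Suc m)\<^esub>"]
  by (auto simp: cocycles_def cl comm[symmetric] z dcl v)
 have B: "\<theta> m x \<in> coboundaries C' \<delta>' m \<longleftrightarrow> x \<in> coboundaries C \<delta> m" if x: "x \<in> carrier (C m)" for x
 proof (cases m)
  case 0
  then show ?thesis using x inj[of 0 x "\<zero>\<^bsub>C 0\<^esub>"] by (auto simp: coboundaries_def z v)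
 next
  case (Suc n)
  show ?thesis
  proof
   assume "\<theta> m x \<in> coboundaries C' \<delta>' m"
   then obtain y where "y \<in> carrier (C' n)" "\<theta> m x = \<delta>' n y" by (auto simp: coboundaries_def Suc)
   then obtain y' where y': "y' \<in> carrier (C n)" "\<theta> m x = \<delta>' n (\<theta> n y')" using surj by blast
   then have "x = \<delta> n y'" using inj[of m x "\<delta> n y'"] x Suc by (simp flip: comm add: dcl)
   then show "x \<in> coboundaries C \<delta> m" using y' by (auto simp: coboundaries_def Suc)
  next
   assume "x \<in> coboundaries C \<delta> m"
   then show "\<theta> m x \<in> coboundaries C' \<delta>' m" by (auto simp: coboundaries_def Suc comm cl)
  qed
 qed
 note Bc = coboundariesD[OF C]
 have "\<exists>z\<in>cocycles C \<delta> m. z' \<ominus>\<^bsub>C' m\<^esub> \<theta> m z \<in> coboundaries C' \<delta>' m" if z': "z' \<in> cocycles C' \<delta>' m" for z'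
 proof -
  have "z' \<in> carrier (C' m)" using z' by (auto simp: cocycles_def)
  then obtain x where "x \<in> carrier (C m)" "z' = \<theta> m x" using surj by blast
  then show ?thesis using z' Z subsp_coboundaries[OF c', of m] cl
   by (intro bexI[of _ x]) (auto simp: C' subsp_def)
 qed
 then show "quasi C \<delta> C' \<delta>' m (\<theta> m)"
  using \<theta>(1) Z B Bc cocyclesD[of _ C \<delta> m] by (auto simp: quasi_def)
qed

lemma quasi_cong:
 assumes C: "cplx C \<delta>" and q: "quasi C \<delta> C' \<delta>' m \<theta>"
  and eq: "\<And>x. x \<in> carrier (C m) ==> \<theta>' x = \<theta> x"
 shows "quasi C \<delta> C' \<delta>' m \<theta>'"
proof -
 have "lin (C m) (C' m) \<theta>'" using q eq lin_cong[OF cplx_vsp[OF C]] by (metis quasi_def)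
 moreover have "\<theta>' z = \<theta> z" if "z \<in> cocycles C \<delta> m \<or> z \<in> coboundaries C \<delta> m" for z
  using eq that cocyclesD[of z C \<delta> m] coboundariesD[OF C, of z m] by blast
 ultimately show ?thesis using q by (simp add: quasi_def)
qed

section \<open>Bimodules\<close>

lemma bim_vsp: "bimodule R M ==> vsp M"
 by (simp add: bimodule_def)

lemmas bim_closed = bimodule.lact_closed bimodule.ract_closed

lemma lin_lact: "bimodule R M ==> r \<in> carrier R ==> lin M M (lact M r)"
 by (rule linI) (simp_all add: bimodule.lact_closed bimodule.lact_add bimodule.lact_smult)

lemma lin_ract: "bimodule R M ==> r \<in> carrier R ==> lin M M (\<lambda>m. ract M m r)"
 by (rule linI) (simp_all add: bimodule.ract_closed bimodule.ract_add bimodule.ract_smult)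

lemma lin_lact_left: "bimodule R M ==> m \<in> carrier M ==> lin R M (\<lambda>r. lact M r m)"
 by (rule linI) (simp_all add: bimodule.lact_closed bimodule.add_lact bimodule.smult_lact)

lemma lin_ract_right: "bimodule R M ==> m \<in> carrier M ==> lin R M (\<lambda>r. ract M m r)"
 by (rule linI) (simp_all add: bimodule.ract_closed bimodule.add_ract bimodule.smult_ract)

text \<open>Related to \<open>bimod_hom\<close> as \<open>lin\<close> is to \<open>lin_hom\<close>:
  extensionality is dropped.\<close>

definition bhom ::
 "('k::field, 'a) module => ('k, 'a, 'm) bimodule => ('k, 'a, 'n) bimodule => ('m => 'n) => bool" where
 "bhom R M N f \<longleftrightarrow> lin M N f \<and> (\<forall>r\<in>carrier R. \<forall>m\<in>carrier M.
   f (lact M r m) = lact N r (f m) \<and> f (ract M m r) = ract N (f m) r)"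

lemma bimod_hom_iff: "f \<in> bimod_hom R M N \<longleftrightarrow> bhom R M N f \<and> f \<in> extensional (carrier M)"
 by (auto simp: bimod_hom_def bhom_def lin_hom_iff)

lemma bhom_lin: "bhom R M N f ==> lin M N f" by (simp add: bhom_def)
lemma bhom_closed: "bhom R M N f ==> m \<in> carrier M ==> f m \<in> carrier N" by (rule lin_closed[OF bhom_lin])
lemma bhom_lact: "bhom R M N f ==> r \<in> carrier R ==> m \<in> carrier M ==> f (lact M r m) = lact N r (f m)"
 by (simp add: bhom_def)
lemma bhom_ract: "bhom R M N f ==> r \<in> carrier R ==> m \<in> carrier M ==> f (ract M m r) = ract N (f m) r"
 by (simp add: bhom_def)

lemma bhomI: "lin M N f ==>
  (\<And>r m. r \<in> carrier R ==> m \<in> carrier M ==> f (lact M r m) = lact N r (f m)) ==>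
  (\<And>r m. r \<in> carrier R ==> m \<in> carrier M ==> f (ract M m r) = ract N (f m) r) ==> bhom R M N f"
 by (simp add: bhom_def)

lemma bimod_hom_bhom: "f \<in> bimod_hom R M N ==> bhom R M N f"
 by (simp add: bimod_hom_iff)

lemma bhom_cong: "bimodule R M ==> bhom R M N f ==> (\<And>m. m \<in> carrier M ==> g m = f m) ==> bhom R M N g"
 using lin_cong[OF bim_vsp] unfolding bhom_def
 by (metis bimodule.lact_closed bimodule.ract_closed)

lemma bimod_homI: "bimodule R M ==> bhom R M N f ==> (\<lambda>x\<in>carrier M. f x) \<in> bimod_hom R M N"
 by (auto simp: bimod_hom_iff intro: bhom_cong)

lemma bhom_comp: "bhom R L M f ==> bhom R M N g ==> bhom R L N (\<lambda>x. g (f x))"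
 by (auto simp: bhom_def lin_closed intro: lin_comp)

lemma bhom_id: "bhom R M M (\<lambda>x. x)"
 by (simp add: bhom_def lin_id)

lemma bhom_zero: "bimodule R M ==> bimodule R N ==> bhom R M N (\<lambda>x. \<zero>\<^bsub>N\<^esub>)"
proof -
 assume M: "bimodule R M" and N: "bimodule R N"
 note v = bim_vsp[OF N]
 show ?thesis
  by (rule bhomI) (simp_all add: lin_const_zero[OF v] lin_zero[OF v v lin_lact[OF N]]
    lin_zero[OF v v lin_ract[OF N]])
qed

lemma bhom_add: "bimodule R N ==> bhom R M N f ==> bhom R M N g ==> bhom R M N (\<lambda>x. f x \<oplus>\<^bsub>N\<^esub> g x)"
 by (rule bhomI)
  (simp_all add: bhom_lin lin_plus bim_vsp bhom_closed bhom_lact bhom_ract bimodule.lact_add bimodule.ract_add)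

lemma bhom_smult: "bimodule R N ==> bhom R M N f ==> bhom R M N (\<lambda>x. c \<odot>\<^bsub>N\<^esub> f x)"
 by (rule bhomI)
  (simp_all add: bhom_lin lin_scale bim_vsp bhom_closed bhom_lact bhom_ract bimodule.lact_smult bimodule.ract_smult)

lemma bhom_minus: "bimodule R M ==> bimodule R N ==> bhom R M N f ==> bhom R M N g ==>
  bhom R M N (\<lambda>x. f x \<ominus>\<^bsub>N\<^esub> g x)"
 by (rule bhom_cong[OF _ bhom_add[OF _ _ bhom_smult[where c = "-1"]]])
  (simp_all add: bim_vsp vs_minus_eq bhom_closed)

lemma hom_space_simps [simp]:
 "carrier (hom_space R M N) = bimod_hom R M N"
 "\<zero>\<^bsub>hom_space R M N\<^esub> = (\<lambda>x\<in>carrier M. \<zero>\<^bsub>N\<^esub>)"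
 "f \<oplus>\<^bsub>hom_space R M N\<^esub> g = (\<lambda>x\<in>carrier M. f x \<oplus>\<^bsub>N\<^esub> g x)"
 "c \<odot>\<^bsub>hom_space R M N\<^esub> f = (\<lambda>x\<in>carrier M. c \<odot>\<^bsub>N\<^esub> f x)"
 by (simp_all add: hom_space_def)

lemma vsp_hom_space: "bimodule R M ==> bimodule R N ==> vsp (hom_space R M N)"
 unfolding hom_space_def
proof (rule vsp_pointwise, goal_cases)
 case 2
 then show ?case by (auto simp: bimod_hom_iff PiE_def bhom_closed)
qed (simp_all add: bim_vsp bimod_homI bhom_zero bhom_add bhom_smult bimod_hom_bhom)

definition bimod :: "('k::field, 'm) module => ('a => 'm => 'm) => ('m => 'a => 'm) => ('k, 'a, 'm) bimodule" where
 "bimod V l r = module.extend V (bimodule.fields l r)"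

lemma bimod_simps [simp]:
 "carrier (bimod V l r) = carrier V" "\<zero>\<^bsub>bimod V l r\<^esub> = \<zero>\<^bsub>V\<^esub>"
 "x \<oplus>\<^bsub>bimod V l r\<^esub> y = x \<oplus>\<^bsub>V\<^esub> y" "c \<odot>\<^bsub>bimod V l r\<^esub> x = c \<odot>\<^bsub>V\<^esub> x"
 "lact (bimod V l r) = l" "ract (bimod V l r) = r"
 by (simp_all add: bimod_def module.defs bimodule.defs)

lemma vsp_cong:
 assumes "vsp V" "carrier W = carrier V" "\<zero>\<^bsub>W\<^esub> = \<zero>\<^bsub>V\<^esub>"
  "\<And>x y. x \<in> carrier V ==> y \<in> carrier V ==> x \<oplus>\<^bsub>W\<^esub> y = x \<oplus>\<^bsub>V\<^esub> y"
  "\<And>c x. x \<in> carrier V ==> c \<odot>\<^bsub>W\<^esub> x = c \<odot>\<^bsub>V\<^esub> x"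
 shows "vsp W"
 by (rule vsp_image[OF assms(1), of "carrier V" W "\<lambda>x. x"]) (use assms in auto)

lemma vsp_bimod [simp]: "vsp V ==> vsp (bimod V l r)"
 by (rule vsp_cong) auto

text \<open>\<open>finsum\<close> takes its operations from the record; here it is enough that two
  records agree on the carrier.\<close>

lemma finsum_cong_struct:
 assumes V: "vsp V" and W: "vsp W" and eq: "carrier W = carrier V" "\<zero>\<^bsub>W\<^esub> = \<zero>\<^bsub>V\<^esub>"
  "\<And>x y. x \<in> carrier V ==> y \<in> carrier V ==> x \<oplus>\<^bsub>W\<^esub> y = x \<oplus>\<^bsub>V\<^esub> y"
  and f: "f \<in> A \<rightarrow> carrier V"
 shows "finsum W f A = finsum V f A"
proof (cases "finite A")
 case True
 then show ?thesis using f
  by (induction rule: finite_induct) (use V W eq in \<open>auto simp: vs_finsum_insert Pi_iff\<close>)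
next
 case False
 then show ?thesis using eq(2) abelian_monoid.finsum_infinite
   vsp_abelian_group[OF V] vsp_abelian_group[OF W] abelian_group.axioms(1) by metis
qed

lemma lin_bimod [simp]: "lin (bimod V l r) W f = lin V W f" "lin U (bimod V l r) g = lin U V g"
 by (simp_all add: lin_def)

section \<open>Algebras with a basis and free bimodules\<close>

text \<open>An algebra with a basis \<open>b\<close> together with its coordinate map
  \<open>co\<close>. Fixing \<open>co\<close> makes coordinates of tensors explicit. The instances
  are the quantum symmetric algebra with its monomials and the skew group algebra with the elements
  \<open>x^al # g\<close>.\<close>

locale based_algebra =
 fixes R :: "('k::field, 'a) module" (structure) and J :: "'j set" and b :: "'j => 'a" and co :: "'a => 'j => 'k"
 assumes ring: "Ring.ring R" and vs: "vsp R"
  and smult_mult: "r \<in> carrier R ==> s \<in> carrier R ==> (c \<odot> r) \<otimes> s = c \<odot> (r \<otimes> s)"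
  and mult_smult: "r \<in> carrier R ==> s \<in> carrier R ==> r \<otimes> (c \<odot> s) = c \<odot> (r \<otimes> s)"
  and b: "j \<in> J ==> b j \<in> carrier R"
  and co_lin: "lin R (fsm J) co"
  and co_b: "j \<in> J ==> co (b j) = dl j"
  and lext_co: "r \<in> carrier R ==> lext R b (co r) = r"
begin

sublocale Ring.ring R by (rule ring)

lemma R_eqI:
 assumes M: "vsp M" and F: "lin R M F" "lin R M G" and eq: "\<And>j. j \<in> J ==> F (b j) = G (b j)"
  and r: "r \<in> carrier R"
 shows "F r = G r"
proof -
 have l: "lin (fsm J) R (lext R b)" using vs b by (intro lin_lext) auto
 have "F (lext R b (co r)) = G (lext R b (co r))"
 proof (rule lin_fsm_eqI[OF M, of J "\<lambda>f. F (lext R b f)" "\<lambda>f. G (lext R b f)"])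
  show "co r \<in> FS J" using co_lin r by (rule lin_closed)
 qed (use F l vs b eq in \<open>auto intro: lin_comp\<close>)
 then show ?thesis using r by (simp add: lext_co)
qed

lemma co_fsm: "r \<in> carrier R ==> co r \<in> FS J"
 by (rule lin_closed[OF co_lin])

lemma co_add: "r \<in> carrier R ==> s \<in> carrier R ==> co (r \<oplus> s) j = co r j + co s j"
 by (simp add: lin_add[OF co_lin])

lemma co_smult: "r \<in> carrier R ==> co (c \<odot> r) j = c * co r j"
 by (simp add: lin_smult[OF co_lin])

lemma co_zero: "co \<zero> j = 0"
 using lin_zero[OF vs vsp_fsm co_lin] by simp

lemma b_inj: "inj_on b J"
proof (rule inj_onI)
 fix i j assume "i \<in> J" "j \<in> J" "b i = b j"
 then have "dl i = (dl j :: 'j => 'k)" by (metis co_b)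
 then show "i = j" by (metis dl_simps(1,2) one_neq_zero)
qed

lemma lin_mult_left: "r \<in> carrier R ==> lin R R (\<lambda>s. r \<otimes> s)"
 by (rule linI) (simp_all add: r_distr mult_smult)

lemma lin_mult_right: "r \<in> carrier R ==> lin R R (\<lambda>s. s \<otimes> r)"
 by (rule linI) (simp_all add: l_distr smult_mult)

lemma bimodule_regular: "bimodule R (regular R)"
proof -
 have [simp]: "regular R = bimod R (mult R) (mult R)" by (simp add: regular_def bimod_def)
 show ?thesis
  by (intro bimodule.intro bimodule_axioms.intro)
   (simp_all add: vs l_distr r_distr m_assoc smult_mult mult_smult)
qed

text \<open>Indexing the basis by its own elements makes \<open>'a\<close> the index type. The free
  bimodule on \<open>carrier P\<close> then has exactly the element type over which
  \<open>projective\<close> quantifies.\<close>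

lemma based_self: "\<exists>co'. based_algebra R (b ` J) (\<lambda>x. x) co'"
proof
 define co' where "co' r = (\<lambda>a. if a \<in> b ` J then co r (inv_into J b a) else 0)" for r
 have inv: "inv_into J b (b j) = j" if "j \<in> J" for j using b_inj that by simp
 have supp: "{a. co' r a \<noteq> 0} = b ` {j. co r j \<noteq> 0}" if "r \<in> carrier R" for r
  using fsmD(2)[OF co_fsm[OF that]] inv by (force simp: co'_def)
 show "based_algebra R (b ` J) (\<lambda>x. x) co'"
 proof (intro based_algebra.intro ring vs)
  show "lin R (fsm (b ` J)) co'"
  proof (rule linI)
   fix r assume r: "r \<in> carrier R"
   have "finite (b ` {j. co r j \<noteq> 0})" "b ` {j. co r j \<noteq> 0} \<subseteq> b ` J"
    using fsmD[OF co_fsm[OF r]] by auto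
   then show "co' r \<in> FS (b ` J)" unfolding carrier_fsm by (simp add: supp[OF r])
  qed (auto simp: co'_def co_add co_smult)
  show "co' a = dl a" if "a \<in> b ` J" for a
   using that by (auto simp: co'_def co_b inv dl_def fun_eq_iff)
  fix r assume r: "r \<in> carrier R"
  have j: "j \<in> J" if "co r j \<noteq> 0" for j using fsmD(2)[OF co_fsm[OF r] that] .
  have "lext R (\<lambda>x. x) (co' r) = (\<Oplus>j\<in>{j. co r j \<noteq> 0}. co' r (b j) \<odot> b j)"
   unfolding lext_def supp[OF r] using j b vs
   by (intro vs_finsum_reindex) (auto intro: inj_on_subset[OF b_inj])
  also have "\<dots> = lext R b (co r)"
   unfolding lext_def using j b vs
   by (intro vs_finsum_cong) (auto simp: co'_def inv)
  finally show "lext R (\<lambda>x. x) (co' r) = r" using r by (simp add: lext_co)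
 qed (auto simp: vs smult_mult mult_smult b)
qed

section \<open>Free bimodules in coordinates\<close>

definition ten :: "'x => 'a => 'a => 'x \<times> 'j \<times> 'j => 'k" where
 "ten x r s = (\<lambda>(y, c, c'). if y = x then co r c * co s c' else 0)"

text \<open>This is \<open>R \<otimes> kX \<otimes> R\<close>, with \<open>ten x r s\<close> in the
  role of \<open>r \<otimes> x \<otimes> s\<close>; no tensor product is formed. Both actions are
  prescribed on basis vectors, and \<open>free_lact_ten\<close> and \<open>free_ract_ten\<close>
  recover the expected formulas on all tensors.\<close>

definition free_bim :: "'x set => ('k, 'a, 'x \<times> 'j \<times> 'j => 'k) bimodule" where
 "free_bim X = bimod (fsm (X \<times> J \<times> J))
   (\<lambda>r. lext (fsm (X \<times> J \<times> J)) (\<lambda>(x, j, j'). ten x (r \<otimes> b j) (b j')))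
   (\<lambda>f r. lext (fsm (X \<times> J \<times> J)) (\<lambda>(x, j, j'). ten x (b j) (b j' \<otimes> r)) f)"

text \<open>The bimodule map out of \<open>free_bim X\<close> that sends the generator
  \<open>ten x \<one> \<one>\<close> to \<open>\<phi> x\<close>.\<close>

definition fext :: "('k, 'a, 'm) bimodule => ('x => 'm) => ('x \<times> 'j \<times> 'j => 'k) => 'm" where
 "fext M \<phi> = lext M (\<lambda>(x, j, j'). ract M (lact M (b j) (\<phi> x)) (b j'))"

context
 fixes X :: "'x set"
begin

lemma free_simps [simp]:
 "carrier (free_bim X) = FS (X \<times> J \<times> J)"
 "\<zero>\<^bsub>free_bim X\<^esub> = (\<lambda>_. 0)" "f \<oplus>\<^bsub>free_bim X\<^esub> g = (\<lambda>i. f i + g i)" "c \<odot>\<^bsub>free_bim X\<^esub> f = (\<lambda>i. c * f i)"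
 by (simp_all add: free_bim_def)

lemma lin_free [simp]: "lin (free_bim X) M f = lin (fsm (X \<times> J \<times> J)) M f"
 "lin N (free_bim X) g = lin N (fsm (X \<times> J \<times> J)) g"
 by (simp_all add: free_bim_def)

lemma vsp_free [simp]: "vsp (free_bim X)" by (simp add: free_bim_def)

lemma ten_closed: "x \<in> X ==> r \<in> carrier R ==> s \<in> carrier R ==> ten x r s \<in> FS (X \<times> J \<times> J)"
 by (rule fsmI[of "{x} \<times> {j. co r j \<noteq> 0} \<times> {j. co s j \<noteq> 0}"])
  (auto simp: ten_def fsmD[OF co_fsm] split: if_splits)

lemma ten_b: "j \<in> J ==> j' \<in> J ==> ten x (b j) (b j') = dl (x, j, j')"
 by (auto simp: ten_def co_b dl_def fun_eq_iff)

lemma lin_ten_left: "x \<in> X ==> s \<in> carrier R ==> lin R (fsm (X \<times> J \<times> J)) (\<lambda>r. ten x r s)"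
 by (rule linI) (simp_all add: ten_closed, simp_all add: ten_def case_prod_unfold co_add co_smult distrib_right fun_eq_iff)

lemma lin_ten_right: "x \<in> X ==> r \<in> carrier R ==> lin R (fsm (X \<times> J \<times> J)) (\<lambda>s. ten x r s)"
 by (rule linI) (simp_all add: ten_closed, simp_all add: ten_def case_prod_unfold co_add co_smult distrib_left fun_eq_iff)

lemma free_eqI:
 assumes "vsp M" "lin (fsm (X \<times> J \<times> J)) M f" "lin (fsm (X \<times> J \<times> J)) M g"
  and "\<And>x j j'. x \<in> X ==> j \<in> J ==> j' \<in> J ==> f (ten x (b j) (b j')) = g (ten x (b j) (b j'))"
  and "z \<in> FS (X \<times> J \<times> J)"
 shows "f z = g z"
proof (rule lin_fsm_eqI[OF assms(1-3) _ assms(5)])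
 fix i assume "i \<in> X \<times> J \<times> J"
 then obtain x j j' where i: "i = (x, j, j')" "x \<in> X" "j \<in> J" "j' \<in> J" by auto
 show "f (dl i) = g (dl i)" using assms(4)[OF i(2-4)] unfolding i(1) ten_b[OF i(3,4)] .
qed

text \<open>Stands in for the universal property of the tensor product: linearity in one slot at a
  time reduces bilinear identities to basis elements.\<close>

lemma ten_eqI:
 assumes M: "vsp M"
  and f: "\<And>s. s \<in> carrier R ==> lin R M (\<lambda>r. f r s)" "\<And>r. r \<in> carrier R ==> lin R M (f r)"
  and g: "\<And>s. s \<in> carrier R ==> lin R M (\<lambda>r. g r s)" "\<And>r. r \<in> carrier R ==> lin R M (g r)"
  and eq: "\<And>j j'. j \<in> J ==> j' \<in> J ==> f (b j) (b j') = g (b j) (b j')"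
  and rs: "r \<in> carrier R" "s \<in> carrier R"
 shows "f r s = g r s"
proof (rule R_eqI[OF M, of "f r" "g r"])
 show "f r (b j') = g r (b j')" if "j' \<in> J" for j'
  by (rule R_eqI[OF M, of "\<lambda>r. f r (b j')" "\<lambda>r. g r (b j')"]) (use f g eq b that rs in auto)
qed (use f g rs in auto)

lemma lin_free_lact: "r \<in> carrier R ==> lin (fsm (X \<times> J \<times> J)) (fsm (X \<times> J \<times> J)) (lact (free_bim X) r)"
 by (auto simp: free_bim_def b intro!: lin_lext ten_closed)

lemma lin_free_ract: "r \<in> carrier R ==> lin (fsm (X \<times> J \<times> J)) (fsm (X \<times> J \<times> J)) (\<lambda>f. ract (free_bim X) f r)"
 by (auto simp: free_bim_def b intro!: lin_lext ten_closed)

lemma free_lact_ten: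
 assumes x: "x \<in> X" and t: "t \<in> carrier R" and "r \<in> carrier R" "s \<in> carrier R"
 shows "lact (free_bim X) t (ten x r s) = ten x (t \<otimes> r) s"
proof (rule ten_eqI[of "fsm (X \<times> J \<times> J)" "\<lambda>r s. lact (free_bim X) t (ten x r s)" "\<lambda>r s. ten x (t \<otimes> r) s"])
 fix j j' assume "j \<in> J" "j' \<in> J"
 then show "lact (free_bim X) t (ten x (b j) (b j')) = ten x (t \<otimes> b j) (b j')"
  using x t by (subst ten_b) (auto simp: free_bim_def b ten_closed)
qed (use assms in \<open>auto intro: lin_comp[OF lin_ten_left lin_free_lact] lin_comp[OF lin_ten_right lin_free_lact]
  lin_comp[OF lin_mult_left lin_ten_left] lin_ten_right\<close>)

lemma free_ract_ten:
 assumes x: "x \<in> X" and t: "t \<in> carrier R" and "r \<in> carrier R" "s \<in> carrier R"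
 shows "ract (free_bim X) (ten x r s) t = ten x r (s \<otimes> t)"
proof (rule ten_eqI[of "fsm (X \<times> J \<times> J)" "\<lambda>r s. ract (free_bim X) (ten x r s) t" "\<lambda>r s. ten x r (s \<otimes> t)"])
 fix j j' assume "j \<in> J" "j' \<in> J"
 then show "ract (free_bim X) (ten x (b j) (b j')) t = ten x (b j) (b j' \<otimes> t)"
  using x t by (subst ten_b) (auto simp: free_bim_def b ten_closed)
qed (use assms in \<open>auto intro: lin_comp[OF lin_ten_left lin_free_ract] lin_comp[OF lin_ten_right lin_free_ract]
  lin_comp[OF lin_mult_right lin_ten_right] lin_ten_left\<close>)

text \<open>The axioms that are not linearity of the actions in \<open>m\<close> are identities
  between maps linear in \<open>m\<close>. On \<open>ten x (b j) (b j')\<close> they become axioms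
  of the algebra \<open>R\<close>.\<close>

lemma bimodule_free: "bimodule R (free_bim X)"
proof (intro bimodule.intro bimodule_axioms.intro vsp_free, goal_cases)
 let ?V = "fsm (X \<times> J \<times> J)"
 note eq = free_eqI[OF vsp_fsm] and l = lin_free_lact and r = lin_free_ract
 note act = free_lact_ten free_ract_ten b ten_closed
 {
  case 1 then show ?case using lin_closed[OF l] by simp
 next
  case 2 then show ?case using lin_closed[OF r] by simp
 next
  case 3 then show ?case using lin_add[OF l] by simp
 next
  case 4 then show ?case using lin_add[OF r] by simp
 next
  case (5 s t m)
  have "lact (free_bim X) (s \<oplus> t) m = lact (free_bim X) s m \<oplus>\<^bsub>?V\<^esub> lact (free_bim X) t m"
   by (rule eq[where f = "lact (free_bim X) (s \<oplus> t)"])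
    (use 5 in \<open>auto intro!: lin_plus l simp: act l_distr lin_add[OF lin_ten_left] simp del: fsm_simps\<close>)
  then show ?case by simp
 next
  case (6 s t m)
  have "ract (free_bim X) m (s \<oplus> t) = ract (free_bim X) m s \<oplus>\<^bsub>?V\<^esub> ract (free_bim X) m t"
   by (rule eq[where f = "\<lambda>m. ract (free_bim X) m (s \<oplus> t)"])
    (use 6 in \<open>auto intro!: lin_plus r simp: act r_distr lin_add[OF lin_ten_right] simp del: fsm_simps\<close>)
  then show ?case by simp
 next
  case (7 s t m)
  show ?case
   by (rule eq[where f = "lact (free_bim X) (s \<otimes> t)"])
    (use 7 in \<open>auto intro!: l lin_comp[OF l l] simp: act m_assoc\<close>)
 next
  case (8 s t m)
  show ?case
   by (rule eq[where f = "\<lambda>m. ract (free_bim X) m (s \<otimes> t)"])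
    (use 8 in \<open>auto intro!: r lin_comp[OF r r] simp: act m_assoc\<close>)
 next
  case (9 m)
  show ?case
   by (rule eq[where f = "lact (free_bim X) \<one>" and g = "\<lambda>m. m"]) (use 9 in \<open>auto intro!: l lin_id simp: act\<close>)
 next
  case (10 m)
  show ?case
   by (rule eq[where f = "\<lambda>m. ract (free_bim X) m \<one>" and g = "\<lambda>m. m"]) (use 10 in \<open>auto intro!: r lin_id simp: act\<close>)
 next
  case (11 s t m)
  show ?case
   by (rule eq[where f = "\<lambda>m. lact (free_bim X) s (ract (free_bim X) m t)"])
    (use 11 in \<open>auto intro!: lin_comp[OF r l] lin_comp[OF l r] simp: act\<close>)
 next
  case (12 s m c)
  have "lact (free_bim X) (c \<odot> s) m = c \<odot>\<^bsub>?V\<^esub> lact (free_bim X) s m"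
   by (rule eq[where f = "lact (free_bim X) (c \<odot> s)"])
    (use 12 vs in \<open>auto intro!: lin_scale l simp: act smult_mult lin_smult[OF lin_ten_left] simp del: fsm_simps\<close>)
  then show ?case by simp
 next
  case 13 then show ?case using lin_smult[OF l] by simp
 next
  case (14 s m c)
  have "ract (free_bim X) m (c \<odot> s) = c \<odot>\<^bsub>?V\<^esub> ract (free_bim X) m s"
   by (rule eq[where f = "\<lambda>m. ract (free_bim X) m (c \<odot> s)"])
    (use 14 vs in \<open>auto intro!: lin_scale r simp: act mult_smult lin_smult[OF lin_ten_right] simp del: fsm_simps\<close>)
  then show ?case by simp
 next
  case 15 then show ?case using lin_smult[OF r] by simp
 }
qed

context
 fixes M :: "('k, 'a, 'm) bimodule" and \<phi> :: "'x => 'm"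
 assumes M: "bimodule R M" and \<phi>: "\<phi> \<in> X \<rightarrow> carrier M"
begin

lemma \<phi>_closed: "x \<in> X ==> \<phi> x \<in> carrier M" using \<phi> by auto

lemma lin_fext: "lin (fsm (X \<times> J \<times> J)) M (fext M \<phi>)"
 unfolding fext_def
 by (rule lin_lext) (auto simp: bim_vsp[OF M] intro!: bim_closed[OF M] b \<phi>_closed)

lemma fext_ten:
 assumes x: "x \<in> X" and "r \<in> carrier R" "s \<in> carrier R"
 shows "fext M \<phi> (ten x r s) = ract M (lact M r (\<phi> x)) s"
proof (rule ten_eqI[of M "\<lambda>r s. fext M \<phi> (ten x r s)" "\<lambda>r s. ract M (lact M r (\<phi> x)) s"])
 fix j j' assume "j \<in> J" "j' \<in> J"
 then show "fext M \<phi> (ten x (b j) (b j')) = ract M (lact M (b j) (\<phi> x)) (b j')"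
  using x by (simp add: ten_b fext_def bim_vsp[OF M] bim_closed[OF M] b \<phi>_closed)
qed (use assms in \<open>auto intro: lin_comp[OF lin_ten_left lin_fext] lin_comp[OF lin_ten_right lin_fext] bim_vsp[OF M]
  lin_comp[OF lin_lact_left[OF M] lin_ract[OF M]] lin_ract_right[OF M] bim_closed[OF M] \<phi>_closed\<close>)

lemma fext_gen: "x \<in> X ==> fext M \<phi> (ten x \<one> \<one>) = \<phi> x"
 by (simp add: fext_ten bimodule.lact_one[OF M] bimodule.ract_one[OF M] \<phi>_closed)

lemma bhom_fext: "bhom R (free_bim X) M (fext M \<phi>)"
proof (rule bhomI)
 fix t m assume t: "t \<in> carrier R" and "m \<in> carrier (free_bim X)"
 then have m: "m \<in> FS (X \<times> J \<times> J)" by simp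
 note simps = free_lact_ten free_ract_ten fext_ten b t bim_closed[OF M] \<phi>_closed
 show "fext M \<phi> (lact (free_bim X) t m) = lact M t (fext M \<phi> m)"
  by (rule free_eqI[OF bim_vsp[OF M] lin_comp[OF lin_free_lact lin_fext] lin_comp[OF lin_fext lin_lact[OF M]]])
   (use t m in \<open>auto simp: simps bimodule.lact_mult[OF M] bimodule.lact_ract[OF M]\<close>)
 show "fext M \<phi> (ract (free_bim X) m t) = ract M (fext M \<phi> m) t"
  by (rule free_eqI[OF bim_vsp[OF M] lin_comp[OF lin_free_ract lin_fext] lin_comp[OF lin_fext lin_ract[OF M]]])
   (use t m in \<open>auto simp: simps bimodule.ract_mult[OF M]\<close>)
qed (simp add: lin_fext)

end

lemma gen_closed: "x \<in> X ==> ten x \<one> \<one> \<in> FS (X \<times> J \<times> J)"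
 by (simp add: ten_closed)

lemma ten_gen: "x \<in> X ==> r \<in> carrier R ==> s \<in> carrier R ==>
  ten x r s = ract (free_bim X) (lact (free_bim X) r (ten x \<one> \<one>)) s"
 by (simp add: free_lact_ten free_ract_ten)

lemma free_hom_eqI:
 assumes M: "bimodule R M" and f: "bhom R (free_bim X) M f" and g: "bhom R (free_bim X) M g"
  and eq: "\<And>x. x \<in> X ==> f (ten x \<one> \<one>) = g (ten x \<one> \<one>)"
  and z: "z \<in> FS (X \<times> J \<times> J)"
 shows "f z = g z"
proof (rule free_eqI[OF bim_vsp[OF M]])
 fix x j j' assume x: "x \<in> X" and j: "j \<in> J" "j' \<in> J"
 note c = bimodule.lact_closed[OF bimodule_free] gen_closed
 show "f (ten x (b j) (b j')) = g (ten x (b j) (b j'))"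
  using x j b eq c by (simp add: ten_gen[OF x b[OF j(1)] b[OF j(2)]]
   bhom_lact[OF f] bhom_lact[OF g] bhom_ract[OF f] bhom_ract[OF g])
qed (use f g z bhom_lin[of R "free_bim X" M] in auto)

text \<open>Preimages of the generators can be chosen arbitrarily, and homomorphisms that agree on
  generators are equal. The element type of \<open>E\<close> is unrestricted, which is what
  \<open>projective_lift\<close> exploits.\<close>

lemma free_lift:
 assumes E: "bimodule R E" and F: "bimodule R F" and \<pi>: "bhom R E F \<pi>" and f: "bhom R (free_bim X) F f"
  and im: "\<And>x. x \<in> X ==> f (ten x \<one> \<one>) \<in> \<pi> ` carrier E"
 shows "\<exists>g. bhom R (free_bim X) E g \<and> (\<forall>z\<in>carrier (free_bim X). \<pi> (g z) = f z)"
proof -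
 have "\<forall>x\<in>X. \<exists>e. e \<in> carrier E \<and> f (ten x \<one> \<one>) = \<pi> e" using im by blast
 then obtain \<phi> where \<phi>: "\<And>x. x \<in> X ==> \<phi> x \<in> carrier E \<and> f (ten x \<one> \<one>) = \<pi> (\<phi> x)"
  using bchoice[of X "\<lambda>x e. e \<in> carrier E \<and> f (ten x \<one> \<one>) = \<pi> e"] by blast
 then have p: "\<phi> \<in> X \<rightarrow> carrier E" by auto
 have "\<pi> (fext E \<phi> z) = f z" if "z \<in> FS (X \<times> J \<times> J)" for z
  by (rule free_hom_eqI[OF F bhom_comp[OF bhom_fext[OF E p] \<pi>] f _ that]) (simp add: fext_gen[OF E p] \<phi>)
 then show ?thesis using bhom_fext[OF E p] by auto
qed

lemma projective_free: "projective R (free_bim X)"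
 unfolding projective_def
proof (intro conjI allI impI)
 show "bimodule R (free_bim X)" by (rule bimodule_free)
 fix E :: "('k, 'a, ('x \<times> 'j \<times> 'j => 'k) \<times> 'a \<times> 'a => 'k) bimodule" and \<pi>
 assume E: "bimodule R E" and \<pi>: "\<pi> \<in> bimod_hom R E (free_bim X)" "\<pi> ` carrier E = carrier (free_bim X)"
 obtain g where "bhom R (free_bim X) E g" "\<forall>z\<in>carrier (free_bim X). \<pi> (g z) = z"
  using free_lift[OF E bimodule_free bimod_hom_bhom[OF \<pi>(1)] bhom_id] \<pi>(2) gen_closed by auto
 then show "\<exists>\<sigma>\<in>bimod_hom R (free_bim X) E. \<forall>x\<in>carrier (free_bim X). \<pi> (\<sigma> x) = x"
  by (intro bexI[of _ "\<lambda>x\<in>carrier (free_bim X). g x"] bimod_homI bimodule_free) simp_all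
qed

end

end

text \<open>\<open>projective\<close> speaks of one element type, while lifts are wanted for all.
  The free bimodule on \<open>carrier P\<close> has that type, so its map \<open>p\<close> onto
  \<open>P\<close> is split by some \<open>\<sigma>\<close>. A lift over the free bimodule exists
  for any type of \<open>E\<close>, and composing it with \<open>\<sigma>\<close> gives the lift
  over \<open>P\<close>. The condition \<open>im\<close> is the form in which exactness of a
  resolution delivers its information.\<close>

lemma (in based_algebra) projective_lift:
 fixes P :: "('k, 'a, 'p) bimodule"
 assumes P: "projective R P" and E: "bimodule R E" and F: "bimodule R F"
  and \<pi>: "bhom R E F \<pi>" and f: "bhom R P F f" and im: "f ` carrier P \<subseteq> \<pi> ` carrier E"
 shows "\<exists>g\<in>bimod_hom R P E. \<forall>x\<in>carrier P. \<pi> (g x) = f x"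
proof -
 obtain co' where "based_algebra R (b ` J) (\<lambda>x. x) co'" using based_self by blast
 then interpret S: based_algebra R "b ` J" "\<lambda>x. x" co' .
 have bP: "bimodule R P" using P by (simp add: projective_def)
 let ?L = "S.free_bim (carrier P)"
 have id: "(\<lambda>x. x) \<in> carrier P \<rightarrow> carrier P" by simp
 define p where "p = (\<lambda>x\<in>carrier ?L. S.fext P (\<lambda>x. x) x)"
 have p: "p \<in> bimod_hom R ?L P" unfolding p_def by (intro bimod_homI S.bimodule_free S.bhom_fext[OF bP id])
 have "p ` carrier ?L = carrier P"
 proof
  show "carrier P \<subseteq> p ` carrier ?L"
  proof
   fix x assume x: "x \<in> carrier P"
   then have "p (S.ten x \<one> \<one>) = x" by (simp add: p_def S.gen_closed S.fext_gen[OF bP id])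
   then show "x \<in> p ` carrier ?L" using S.gen_closed[OF x] by force
  qed
 qed (use bimod_hom_bhom[OF p] bhom_closed in fast)
 then obtain \<sigma> where \<sigma>: "\<sigma> \<in> bimod_hom R P ?L" "\<And>x. x \<in> carrier P ==> p (\<sigma> x) = x"
  using P p S.bimodule_free unfolding projective_def by blast
 note p' = bimod_hom_bhom[OF p] and s' = bimod_hom_bhom[OF \<sigma>(1)]
 obtain h where h: "bhom R ?L E h" "\<And>z. z \<in> carrier ?L ==> \<pi> (h z) = f (p z)"
 proof -
  have "\<exists>g. bhom R ?L E g \<and> (\<forall>z\<in>carrier ?L. \<pi> (g z) = f (p z))"
   by (rule S.free_lift[OF E F \<pi> bhom_comp[OF p' f]]) (use im bhom_closed[OF p'] S.gen_closed in force)
  then show ?thesis using that by blast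
 qed
 show ?thesis
  by (rule bexI[OF _ bimod_homI[OF bP bhom_comp[OF s' h(1)]]]) (simp add: h(2) \<sigma>(2) bhom_closed[OF s', simplified])
qed

section \<open>Comparison of resolutions\<close>

text \<open>Exactness separated from projectivity: in a comparison the source is projective and the
  target exact.\<close>

definition resolution ::
 "('k::field, 'a) module => (nat => ('k, 'a, 'p) bimodule) => (nat => 'p => 'p) => ('p => 'a) => bool" where
 "resolution R P d \<epsilon> \<longleftrightarrow>
   (\<forall>n. bimodule R (P n)) \<and> (\<forall>n. bhom R (P (Suc n)) (P n) (d n)) \<and> bhom R (P 0) (regular R) \<epsilon> \<and>
   \<epsilon> ` carrier (P 0) = carrier R \<and>
   {x \<in> carrier (P 0). \<epsilon> x = \<zero>\<^bsub>R\<^esub>} = d 0 ` carrier (P 1) \<and>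
   (\<forall>n. {x \<in> carrier (P (Suc n)). d n x = \<zero>\<^bsub>P n\<^esub>} = d (Suc n) ` carrier (P (Suc (Suc n))))"

lemma projective_resolutionD:
 assumes "projective_resolution R P d \<epsilon>"
 shows "resolution R P d \<epsilon>" "projective R (P n)"
 using assms unfolding projective_resolution_def resolution_def projective_def
 by (auto simp: bimod_hom_bhom)

context
 fixes R :: "('k::field, 'a) module" and P :: "nat => ('k, 'a, 'p) bimodule" and d \<epsilon>
 assumes res: "resolution R P d \<epsilon>"
begin

lemma res_bim: "bimodule R (P n)" using res by (simp add: resolution_def)
lemma res_d: "bhom R (P (Suc n)) (P n) (d n)" using res by (simp add: resolution_def)
lemma res_aug: "bhom R (P 0) (regular R) \<epsilon>" using res by (simp add: resolution_def)
lemma res_surj: "\<epsilon> ` carrier (P 0) = carrier R" using res by (simp add: resolution_def)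

lemma res_exact0: "x \<in> carrier (P 0) ==> \<epsilon> x = \<zero>\<^bsub>R\<^esub> ==> x \<in> d 0 ` carrier (P (Suc 0))"
 using res unfolding resolution_def by auto

lemma res_exact: "x \<in> carrier (P (Suc n)) ==> d n x = \<zero>\<^bsub>P n\<^esub> ==> x \<in> d (Suc n) ` carrier (P (Suc (Suc n)))"
 using res unfolding resolution_def by blast

lemma res_dd0: "x \<in> carrier (P (Suc 0)) ==> \<epsilon> (d 0 x) = \<zero>\<^bsub>R\<^esub>"
 using res unfolding resolution_def by auto

lemma res_dd: "x \<in> carrier (P (Suc (Suc n))) ==> d n (d (Suc n) x) = \<zero>\<^bsub>P n\<^esub>"
 using res unfolding resolution_def by blast

lemma res_d_closed: "x \<in> carrier (P (Suc n)) ==> d n x \<in> carrier (P n)"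
 by (rule bhom_closed[OF res_d])

lemma hom_cplx:
 assumes M: "bimodule R M"
 shows "cplx (hom_complex R P M) (hom_diff P d)"
 unfolding cplx_def
proof (intro conjI allI ballI)
 fix m
 show "vsp (hom_complex R P M m)" unfolding hom_complex_def by (rule vsp_hom_space[OF res_bim M])
 have c: "(\<lambda>x\<in>carrier (P (Suc m)). f (d m x)) \<in> bimod_hom R (P (Suc m)) M" if "f \<in> bimod_hom R (P m) M" for f
  by (intro bimod_homI[OF res_bim] bhom_comp[OF res_d bimod_hom_bhom[OF that]])
 show "lin (hom_complex R P M m) (hom_complex R P M (Suc m)) (hom_diff P d m)"
  by (rule linI) (auto simp: hom_complex_def hom_diff_def c res_d_closed intro!: restrict_ext)
 fix f assume "f \<in> carrier (hom_complex R P M m)"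
 then have f: "bhom R (P m) M f" by (simp add: hom_complex_def bimod_hom_bhom)
 show "hom_diff P d (Suc m) (hom_diff P d m f) = \<zero>\<^bsub>hom_complex R P M (Suc (Suc m))\<^esub>"
  using lin_zero[OF bim_vsp[OF res_bim] bim_vsp[OF M] bhom_lin[OF f]]
  by (auto simp: hom_diff_def hom_complex_def res_d_closed res_dd intro!: restrict_ext)
qed

end

lemma regular_simps [simp]:
 "carrier (regular R) = carrier R" "\<zero>\<^bsub>regular R\<^esub> = \<zero>\<^bsub>R\<^esub>"
 "x \<oplus>\<^bsub>regular R\<^esub> y = x \<oplus>\<^bsub>R\<^esub> y" "c \<odot>\<^bsub>regular R\<^esub> x = c \<odot>\<^bsub>R\<^esub> x"
 "lact (regular R) r x = r \<otimes>\<^bsub>R\<^esub> x" "ract (regular R) x r = x \<otimes>\<^bsub>R\<^esub> r"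
 by (simp_all add: regular_def module.defs bimodule.defs)

definition chain_map where
 "chain_map R P d \<epsilon> X e \<eta> \<phi> \<longleftrightarrow> (\<forall>n. bhom R (P n) (X n) (\<phi> n)) \<and>
   (\<forall>x\<in>carrier (P 0). \<eta> (\<phi> 0 x) = \<epsilon> x) \<and>
   (\<forall>n. \<forall>x\<in>carrier (P (Suc n)). e n (\<phi> (Suc n) x) = \<phi> n (d n x))"

lemma chain_map_id: "chain_map R P d \<epsilon> P d \<epsilon> (\<lambda>n x. x)"
 by (simp add: chain_map_def bhom_id)

lemma chain_map_comp: "chain_map R P d \<epsilon> X e \<eta> \<phi> ==> chain_map R X e \<eta> Y f \<theta> \<psi> ==>
  chain_map R P d \<epsilon> Y f \<theta> (\<lambda>n x. \<psi> n (\<phi> n x))"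
proof -
 assume 1: "chain_map R P d \<epsilon> X e \<eta> \<phi>" and 2: "chain_map R X e \<eta> Y f \<theta> \<psi>"
 then have b: "bhom R (P n) (X n) (\<phi> n)" "bhom R (X n) (Y n) (\<psi> n)" for n by (simp_all add: chain_map_def)
 show ?thesis using 1 2 bhom_closed[OF b(1)] bhom_comp[OF b] by (simp add: chain_map_def)
qed

definition pull where "pull P \<phi> m f = (\<lambda>x\<in>carrier (P m). f (\<phi> m x))"

lemma pull_cocycle:
 assumes P: "resolution R P d \<epsilon>" and X: "resolution R X e \<eta>" and M: "bimodule R M"
  and \<phi>: "chain_map R P d \<epsilon> X e \<eta> \<phi>" and f: "f \<in> cocycles (hom_complex R X M) (hom_diff X e) m"
 shows "pull P \<phi> m f \<in> cocycles (hom_complex R P M) (hom_diff P d) m"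
proof -
 have f': "bhom R (X m) M f" "\<And>x. x \<in> carrier (X (Suc m)) ==> f (e m x) = \<zero>\<^bsub>M\<^esub>"
  using f by (auto simp: cocycles_def hom_complex_def hom_diff_def bimod_hom_bhom fun_eq_iff restrict_def split: if_splits)
 have p: "bhom R (P n) (X n) (\<phi> n)" "\<And>x. x \<in> carrier (P (Suc n)) ==> \<phi> n (d n x) = e n (\<phi> (Suc n) x)" for n
  using \<phi> by (auto simp: chain_map_def)
 show ?thesis
  by (auto simp: cocycles_def hom_complex_def hom_diff_def pull_def res_d_closed[OF P] p(2) f'(2) bhom_closed[OF p(1)]
    intro!: bimod_homI res_bim[OF P] bhom_comp[OF p(1) f'(1)] restrict_ext)
qed

lemma pull_coboundary:
 assumes P: "resolution R P d \<epsilon>" and X: "resolution R X e \<eta>" and M: "bimodule R M"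
  and \<phi>: "chain_map R P d \<epsilon> X e \<eta> \<phi>" and f: "f \<in> coboundaries (hom_complex R X M) (hom_diff X e) m"
 shows "pull P \<phi> m f \<in> coboundaries (hom_complex R P M) (hom_diff P d) m"
proof -
 have p: "bhom R (P n) (X n) (\<phi> n)" "\<And>x. x \<in> carrier (P (Suc n)) ==> \<phi> n (d n x) = e n (\<phi> (Suc n) x)" for n
  using \<phi> by (auto simp: chain_map_def)
 show ?thesis
 proof (cases m)
  case 0
  then show ?thesis using f
   by (auto simp: coboundaries_def hom_complex_def pull_def bhom_closed[OF p(1)] intro!: restrict_ext)
 next
  case (Suc n)
  then obtain g where g: "g \<in> bimod_hom R (X n) M" "f = hom_diff X e n g"
   using f by (auto simp: coboundaries_def hom_complex_def)
  have "pull P \<phi> m f = hom_diff P d n (pull P \<phi> n g)"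
   by (auto simp: g(2) Suc hom_diff_def pull_def res_d_closed[OF P] p(2) bhom_closed[OF p(1)] intro!: restrict_ext)
  moreover have "pull P \<phi> n g \<in> bimod_hom R (P n) M"
   unfolding pull_def by (intro bimod_homI res_bim[OF P] bhom_comp[OF p(1) bimod_hom_bhom[OF g(1)]])
  ultimately show ?thesis by (auto simp: coboundaries_def hom_complex_def Suc)
 qed
qed

context based_algebra
begin

lemma chain_map_exists:
 assumes P: "resolution R P d \<epsilon>" and proj: "\<And>n. projective R (P n)" and X: "resolution R X e \<eta>"
 shows "\<exists>\<phi>. chain_map R P d \<epsilon> X e \<eta> \<phi>"
proof -
 \<comment> \<open>The last clause is what the next lift consumes: \<open>\<phi>\<close> after
   \<open>d\<close> lands in the image of \<open>e\<close>. Carrying it in the invariant makes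
   degree 0, where exactness concerns the augmentation, and the higher degrees look alike.\<close>
 define Pr where "Pr n \<phi> \<longleftrightarrow> bhom R (P n) (X n) \<phi> \<and> (n = 0 --> (\<forall>x\<in>carrier (P 0). \<eta> (\<phi> x) = \<epsilon> x)) \<and>
  (\<forall>x\<in>carrier (P (Suc n)). \<phi> (d n x) \<in> e n ` carrier (X (Suc n)))" for n \<phi>
 have "\<exists>\<phi>. \<forall>n. Pr n (\<phi> n) \<and> (\<forall>x\<in>carrier (P (Suc n)). e n (\<phi> (Suc n) x) = \<phi> n (d n x))"
 proof (rule dependent_nat_choice)
  obtain \<phi> where \<phi>: "\<phi> \<in> bimod_hom R (P 0) (X 0)" "\<And>x. x \<in> carrier (P 0) ==> \<eta> (\<phi> x) = \<epsilon> x"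
   using projective_lift[OF proj res_bim[OF X] bimodule_regular res_aug[OF X] res_aug[OF P]]
    res_surj[OF P] res_surj[OF X] by auto
  have "\<phi> (d 0 x) \<in> e 0 ` carrier (X (Suc 0))" if "x \<in> carrier (P (Suc 0))" for x
   using res_exact0[OF X bhom_closed[OF bimod_hom_bhom[OF \<phi>(1)]]] res_d_closed[OF P that] res_dd0[OF P that] \<phi>(2)
   by simp
  then show "\<exists>\<phi>. Pr 0 \<phi>" using \<phi> by (intro exI[of _ \<phi>]) (simp add: Pr_def bimod_hom_bhom)
 next
  fix \<phi> n assume \<phi>: "Pr n \<phi>"
  then have b: "bhom R (P n) (X n) \<phi>" and im: "\<And>x. x \<in> carrier (P (Suc n)) ==> \<phi> (d n x) \<in> e n ` carrier (X (Suc n))"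
   by (auto simp: Pr_def)
  obtain \<psi> where \<psi>: "\<psi> \<in> bimod_hom R (P (Suc n)) (X (Suc n))"
    "\<And>x. x \<in> carrier (P (Suc n)) ==> e n (\<psi> x) = \<phi> (d n x)"
   using projective_lift[OF proj res_bim[OF X] res_bim[OF X] res_d[OF X] bhom_comp[OF res_d[OF P] b]] im by blast
  have "\<psi> (d (Suc n) x) \<in> e (Suc n) ` carrier (X (Suc (Suc n)))" if x: "x \<in> carrier (P (Suc (Suc n)))" for x
  proof (rule res_exact[OF X bhom_closed[OF bimod_hom_bhom[OF \<psi>(1)] res_d_closed[OF P x]]])
   show "e n (\<psi> (d (Suc n) x)) = \<zero>\<^bsub>X n\<^esub>"
    using lin_zero[OF bim_vsp[OF res_bim[OF P]] bim_vsp[OF res_bim[OF X]] bhom_lin[OF b]]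
    by (simp add: \<psi>(2) res_d_closed[OF P x] res_dd[OF P x])
  qed
  then show "\<exists>\<psi>. Pr (Suc n) \<psi> \<and> (\<forall>x\<in>carrier (P (Suc n)). e n (\<psi> x) = \<phi> (d n x))"
   using \<psi> by (intro exI[of _ \<psi>]) (simp add: Pr_def bimod_hom_bhom)
 qed
 then obtain \<phi> where \<phi>: "\<And>n. Pr n (\<phi> n)" "\<And>n x. x \<in> carrier (P (Suc n)) ==> e n (\<phi> (Suc n) x) = \<phi> n (d n x)"
  by blast
 have "\<forall>x\<in>carrier (P 0). \<eta> (\<phi> 0 x) = \<epsilon> x" using \<phi>(1)[of 0] by (simp add: Pr_def)
 then show ?thesis using \<phi> unfolding chain_map_def Pr_def by blast
qed

lemma null_homotopy:
 assumes P: "resolution R P d \<epsilon>" and proj: "\<And>n. projective R (P n)" and X: "resolution R X e \<eta>"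
  and \<psi>: "\<And>n. bhom R (P n) (X n) (\<psi> n)" "\<And>x. x \<in> carrier (P 0) ==> \<eta> (\<psi> 0 x) = \<zero>"
   "\<And>n x. x \<in> carrier (P (Suc n)) ==> e n (\<psi> (Suc n) x) = \<psi> n (d n x)"
 shows "\<exists>s. (\<forall>n. bhom R (P n) (X (Suc n)) (s n)) \<and> (\<forall>x\<in>carrier (P 0). \<psi> 0 x = e 0 (s 0 x)) \<and>
  (\<forall>n. \<forall>x\<in>carrier (P (Suc n)). \<psi> (Suc n) x = e (Suc n) (s (Suc n) x) \<oplus>\<^bsub>X (Suc n)\<^esub> s n (d n x))"
proof -
 \<comment> \<open>Again the image condition for the next lift belongs to the invariant:
   \<open>\<psi> - s d\<close> lies in the image of \<open>e\<close>, by exactness, since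
   \<open>e\<close> annihilates it.\<close>
 define Pr where "Pr n s \<longleftrightarrow> bhom R (P n) (X (Suc n)) s \<and> (n = 0 --> (\<forall>x\<in>carrier (P 0). e 0 (s x) = \<psi> 0 x)) \<and>
  (\<forall>x\<in>carrier (P (Suc n)). \<psi> (Suc n) x \<ominus>\<^bsub>X (Suc n)\<^esub> s (d n x) \<in> e (Suc n) ` carrier (X (Suc (Suc n))))" for n s
 note v = bim_vsp[OF res_bim[OF X]] and vP = bim_vsp[OF res_bim[OF P]]
 note c = bhom_closed[OF \<psi>(1)] res_d_closed[OF P]
 have "\<exists>s. \<forall>n. Pr n (s n) \<and>
   (\<forall>x\<in>carrier (P (Suc n)). e (Suc n) (s (Suc n) x) = \<psi> (Suc n) x \<ominus>\<^bsub>X (Suc n)\<^esub> s n (d n x))"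
 proof (rule dependent_nat_choice)
  have "\<psi> 0 ` carrier (P 0) \<subseteq> e 0 ` carrier (X (Suc 0))"
   using res_exact0[OF X] \<psi>(2) c by blast
  then have "\<exists>s\<in>bimod_hom R (P 0) (X (Suc 0)). \<forall>x\<in>carrier (P 0). e 0 (s x) = \<psi> 0 x"
   by (rule projective_lift[OF proj res_bim[OF X] res_bim[OF X] res_d[OF X] \<psi>(1)])
  then obtain s where s: "s \<in> bimod_hom R (P 0) (X (Suc 0))" "\<And>x. x \<in> carrier (P 0) ==> e 0 (s x) = \<psi> 0 x"
   by blast
  have "\<psi> (Suc 0) x \<ominus>\<^bsub>X (Suc 0)\<^esub> s (d 0 x) \<in> e (Suc 0) ` carrier (X (Suc (Suc 0)))" if x: "x \<in> carrier (P (Suc 0))" for x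
  proof (rule res_exact[OF X])
   note sc = bhom_closed[OF bimod_hom_bhom[OF s(1)] c(2)[OF x]] c(1)[OF x]
   show "\<psi> (Suc 0) x \<ominus>\<^bsub>X (Suc 0)\<^esub> s (d 0 x) \<in> carrier (X (Suc 0))" using sc v by simp
   show "e 0 (\<psi> (Suc 0) x \<ominus>\<^bsub>X (Suc 0)\<^esub> s (d 0 x)) = \<zero>\<^bsub>X 0\<^esub>"
    using sc c(1)[OF c(2)[OF x]]
    by (simp add: lin_minus[OF v v bhom_lin[OF res_d[OF X]]] \<psi>(3)[OF x] s(2)[OF c(2)[OF x]] vs_minus_self[OF v])
  qed
  then show "\<exists>s. Pr 0 s" using s by (intro exI[of _ s]) (simp add: Pr_def bimod_hom_bhom)
 next
  fix s n assume "Pr n s"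
  then have s: "bhom R (P n) (X (Suc n)) s"
   and im: "\<And>x. x \<in> carrier (P (Suc n)) ==> \<psi> (Suc n) x \<ominus>\<^bsub>X (Suc n)\<^esub> s (d n x) \<in> e (Suc n) ` carrier (X (Suc (Suc n)))"
   by (auto simp: Pr_def)
  have b: "bhom R (P (Suc n)) (X (Suc n)) (\<lambda>x. \<psi> (Suc n) x \<ominus>\<^bsub>X (Suc n)\<^esub> s (d n x))"
   by (intro bhom_minus res_bim[OF P] res_bim[OF X] \<psi> bhom_comp[OF res_d[OF P] s])
  obtain t where t: "t \<in> bimod_hom R (P (Suc n)) (X (Suc (Suc n)))"
    "\<And>x. x \<in> carrier (P (Suc n)) ==> e (Suc n) (t x) = \<psi> (Suc n) x \<ominus>\<^bsub>X (Suc n)\<^esub> s (d n x)"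
   using projective_lift[OF proj res_bim[OF X] res_bim[OF X] res_d[OF X] b] im by blast
  have s0: "s \<zero>\<^bsub>P n\<^esub> = \<zero>\<^bsub>X (Suc n)\<^esub>" by (rule lin_zero[OF vP v bhom_lin[OF s]])
  have "\<psi> (Suc (Suc n)) x \<ominus>\<^bsub>X (Suc (Suc n))\<^esub> t (d (Suc n) x) \<in> e (Suc (Suc n)) ` carrier (X (Suc (Suc (Suc n))))"
   if x: "x \<in> carrier (P (Suc (Suc n)))" for x
  proof (rule res_exact[OF X])
   note tc = bhom_closed[OF bimod_hom_bhom[OF t(1)]]
   have "e (Suc n) (\<psi> (Suc (Suc n)) x \<ominus>\<^bsub>X (Suc (Suc n))\<^esub> t (d (Suc n) x)) =
     \<psi> (Suc n) (d (Suc n) x) \<ominus>\<^bsub>X (Suc n)\<^esub> (\<psi> (Suc n) (d (Suc n) x) \<ominus>\<^bsub>X (Suc n)\<^esub> s (d n (d (Suc n) x)))"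
    using x c tc by (simp add: lin_minus[OF v v bhom_lin[OF res_d[OF X]]] \<psi>(3) t(2))
   \<comment> \<open>What remains after cancelling is \<open>s d d\<close>, which is zero.\<close>
   also have "\<dots> = \<zero>\<^bsub>X (Suc n)\<^esub>"
    using x c[of "d (Suc n) x" "Suc n"] c(2)[of x "Suc n"] v[of "Suc n"]
    by (simp add: res_dd[OF P x] s0 vs_minus_eq)
   finally show "e (Suc n) (\<psi> (Suc (Suc n)) x \<ominus>\<^bsub>X (Suc (Suc n))\<^esub> t (d (Suc n) x)) = \<zero>\<^bsub>X (Suc n)\<^esub>" .
   show "\<psi> (Suc (Suc n)) x \<ominus>\<^bsub>X (Suc (Suc n))\<^esub> t (d (Suc n) x) \<in> carrier (X (Suc (Suc n)))"
    using x c tc v by simp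
  qed
  then show "\<exists>t. Pr (Suc n) t \<and> (\<forall>x\<in>carrier (P (Suc n)). e (Suc n) (t x) = \<psi> (Suc n) x \<ominus>\<^bsub>X (Suc n)\<^esub> s (d n x))"
   using t by (intro exI[of _ t]) (simp add: Pr_def bimod_hom_bhom)
 qed
 then obtain s where s: "\<And>n. Pr n (s n)"
   "\<And>n x. x \<in> carrier (P (Suc n)) ==> e (Suc n) (s (Suc n) x) = \<psi> (Suc n) x \<ominus>\<^bsub>X (Suc n)\<^esub> s n (d n x)"
  by blast
 have b: "bhom R (P n) (X (Suc n)) (s n)" for n using s(1)[of n] by (simp add: Pr_def)
 have "e 0 (s 0 x) = \<psi> 0 x" if "x \<in> carrier (P 0)" for x using s(1)[of 0] that by (simp add: Pr_def)
 moreover have "\<psi> (Suc n) x = e (Suc n) (s (Suc n) x) \<oplus>\<^bsub>X (Suc n)\<^esub> s n (d n x)" if "x \<in> carrier (P (Suc n))" for n x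
  using that v c bhom_closed[OF b] by (simp add: s(2))
 ultimately show ?thesis using b by (intro exI[of _ s]) auto
qed

lemma pull_difference:
 assumes P: "resolution R P d \<epsilon>" and proj: "\<And>n. projective R (P n)" and X: "resolution R X e \<eta>"
  and \<phi>: "chain_map R P d \<epsilon> X e \<eta> \<phi>" and \<psi>: "chain_map R P d \<epsilon> X e \<eta> \<psi>" and M: "bimodule R M"
  and f: "f \<in> cocycles (hom_complex R X M) (hom_diff X e) m"
 shows "pull P \<phi> m f \<ominus>\<^bsub>hom_complex R P M m\<^esub> pull P \<psi> m f \<in> coboundaries (hom_complex R P M) (hom_diff P d) m"
proof -
 note v = bim_vsp[OF res_bim[OF X]] and vM = bim_vsp[OF M]
 have ph: "bhom R (P n) (X n) (\<phi> n)" "bhom R (P n) (X n) (\<psi> n)" for n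
  using \<phi> \<psi> by (auto simp: chain_map_def)
 have d: "e n (\<phi> (Suc n) x) = \<phi> n (d n x)" "e n (\<psi> (Suc n) x) = \<psi> n (d n x)" if "x \<in> carrier (P (Suc n))" for n x
  using \<phi> \<psi> that by (auto simp: chain_map_def)
 note c = bhom_closed[OF ph(1)] bhom_closed[OF ph(2)] res_d_closed[OF P]
 have "\<exists>s. (\<forall>n. bhom R (P n) (X (Suc n)) (s n)) \<and> (\<forall>x\<in>carrier (P 0). \<phi> 0 x \<ominus>\<^bsub>X 0\<^esub> \<psi> 0 x = e 0 (s 0 x)) \<and>
  (\<forall>n. \<forall>x\<in>carrier (P (Suc n)). \<phi> (Suc n) x \<ominus>\<^bsub>X (Suc n)\<^esub> \<psi> (Suc n) x = e (Suc n) (s (Suc n) x) \<oplus>\<^bsub>X (Suc n)\<^esub> s n (d n x))"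
 proof (rule null_homotopy[OF P proj X])
  fix x assume x: "x \<in> carrier (P 0)"
  have "\<eta> (\<phi> 0 x) = \<epsilon> x" "\<eta> (\<psi> 0 x) = \<epsilon> x" using x \<phi> \<psi> by (auto simp: chain_map_def)
  moreover have "\<epsilon> x \<in> carrier R" using bhom_closed[OF res_aug[OF P] x] by simp
  ultimately show "\<eta> (\<phi> 0 x \<ominus>\<^bsub>X 0\<^esub> \<psi> 0 x) = \<zero>"
   using x c lin_minus[OF v bim_vsp[OF bimodule_regular] bhom_lin[OF res_aug[OF X]]]
    vs_minus_self[OF bim_vsp[OF bimodule_regular]] by simp
 next
  fix n x assume x: "x \<in> carrier (P (Suc n))"
  then show "e n (\<phi> (Suc n) x \<ominus>\<^bsub>X (Suc n)\<^esub> \<psi> (Suc n) x) = \<phi> n (d n x) \<ominus>\<^bsub>X n\<^esub> \<psi> n (d n x)"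
   using c by (simp add: lin_minus[OF v v bhom_lin[OF res_d[OF X]]] d)
 qed (intro bhom_minus res_bim[OF P] res_bim[OF X] ph)
 then obtain s where s: "\<And>n. bhom R (P n) (X (Suc n)) (s n)"
   "\<And>x. x \<in> carrier (P 0) ==> \<phi> 0 x \<ominus>\<^bsub>X 0\<^esub> \<psi> 0 x = e 0 (s 0 x)"
   "\<And>n x. x \<in> carrier (P (Suc n)) ==>
    \<phi> (Suc n) x \<ominus>\<^bsub>X (Suc n)\<^esub> \<psi> (Suc n) x = e (Suc n) (s (Suc n) x) \<oplus>\<^bsub>X (Suc n)\<^esub> s n (d n x)"
  by blast
 have f': "bhom R (X m) M f" "\<And>x. x \<in> carrier (X (Suc m)) ==> f (e m x) = \<zero>\<^bsub>M\<^esub>"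
  using f by (auto simp: cocycles_def hom_complex_def hom_diff_def bimod_hom_bhom fun_eq_iff restrict_def split: if_splits)
 have hc: "pull P \<phi> m f \<in> carrier (hom_complex R P M m)" "pull P \<psi> m f \<in> carrier (hom_complex R P M m)"
  unfolding pull_def hom_complex_def hom_space_simps
  by (intro bimod_homI res_bim[OF P] bhom_comp[OF ph(1) f'(1)] bhom_comp[OF ph(2) f'(1)])+
 have diff: "pull P \<phi> m f \<ominus>\<^bsub>hom_complex R P M m\<^esub> pull P \<psi> m f = (\<lambda>x\<in>carrier (P m). f (\<phi> m x \<ominus>\<^bsub>X m\<^esub> \<psi> m x))"
  unfolding vs_minus_eq[OF cplx_vsp[OF hom_cplx[OF P M]] hc]
  using c bhom_closed[OF f'(1)]
  by (auto simp: pull_def hom_complex_def lin_minus[OF v vM bhom_lin[OF f'(1)]] vs_minus_eq[OF vM] intro!: restrict_ext)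
 show ?thesis
 proof (cases m)
  case 0
  have "(\<lambda>x\<in>carrier (P m). f (\<phi> m x \<ominus>\<^bsub>X m\<^esub> \<psi> m x)) = \<zero>\<^bsub>hom_complex R P M 0\<^esub>"
   using 0 f'(2) bhom_closed[OF s(1)] by (auto simp: hom_complex_def s(2) intro!: restrict_ext)
  then show ?thesis using diff by (simp add: coboundaries_def 0)
 next
  case (Suc n)
  \<comment> \<open>The homotopy splits the difference into \<open>f (e (s x))\<close> and
    \<open>f (s (d x))\<close>; the first vanishes because \<open>f\<close> is a cocycle.\<close>
  have "f (\<phi> m x \<ominus>\<^bsub>X m\<^esub> \<psi> m x) = f (s n (d n x))" if x: "x \<in> carrier (P m)" for x
   using x Suc f'(2)[OF bhom_closed[OF s(1)], of x] bhom_closed[OF s(1)] c bhom_closed[OF f'(1)] vM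
   by (simp add: s(3) lin_add[OF bhom_lin[OF f'(1)[unfolded Suc]]] bhom_closed[OF res_d[OF X]])
  then have "(\<lambda>x\<in>carrier (P m). f (\<phi> m x \<ominus>\<^bsub>X m\<^esub> \<psi> m x)) = hom_diff P d n (\<lambda>x\<in>carrier (P n). f (s n x))"
   using c by (auto simp: hom_diff_def Suc intro!: restrict_ext)
  moreover have "(\<lambda>x\<in>carrier (P n). f (s n x)) \<in> bimod_hom R (P n) M"
   using f'(1) Suc by (intro bimod_homI res_bim[OF P] bhom_comp[OF s(1)]) simp
  ultimately have "(\<lambda>x\<in>carrier (P m). f (\<phi> m x \<ominus>\<^bsub>X m\<^esub> \<psi> m x)) \<in> coboundaries (hom_complex R P M) (hom_diff P d) m"
   by (auto simp: coboundaries_def hom_complex_def Suc)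
  then show ?thesis by (simp only: diff)
 qed
qed

text \<open>Lifting in the other direction gives \<open>\<psi>\<close>. Both composites of
  \<open>\<phi>\<close> and \<open>\<psi>\<close> lie over the identity, so on cocycles each differs
  from the identity by coboundaries; one composite gives injectivity, the other
  surjectivity.\<close>

theorem comparison_quasi:
 assumes P: "resolution R P d \<epsilon>" and Pp: "\<And>n. projective R (P n)"
  and K: "resolution R K e \<eta>" and Kp: "\<And>n. projective R (K n)"
  and \<phi>: "chain_map R K e \<eta> P d \<epsilon> \<phi>" and M: "bimodule R M"
 shows "quasi (hom_complex R P M) (hom_diff P d) (hom_complex R K M) (hom_diff K e) m (pull K \<phi> m)"
proof -
 obtain \<psi> where \<psi>: "chain_map R P d \<epsilon> K e \<eta> \<psi>" using chain_map_exists[OF P Pp K] by blast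
 have ph: "bhom R (K m) (P m) (\<phi> m)" using \<phi> by (auto simp: chain_map_def)
 have ps: "bhom R (P m) (K m) (\<psi> m)" using \<psi> by (auto simp: chain_map_def)
 have cP: "cplx (hom_complex R P M) (hom_diff P d)" and cK: "cplx (hom_complex R K M) (hom_diff K e)"
  by (rule hom_cplx[OF P M] hom_cplx[OF K M])+
 have pid: "pull Y (\<lambda>n x. x) m f = f" if "f \<in> carrier (hom_complex R Y M m)"
  for Y :: "nat => ('k, 'a, 'y) bimodule" and f
  using that by (auto simp: pull_def hom_complex_def bimod_hom_iff extensional_restrict)
 have pp1: "pull P (\<lambda>n x. \<phi> n (\<psi> n x)) m f = pull P \<psi> m (pull K \<phi> m f)" for f :: "'b => 'd"
  by (auto simp: pull_def bhom_closed[OF ps] intro!: restrict_ext)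
 have pp2: "pull K (\<lambda>n x. \<psi> n (\<phi> n x)) m f = pull K \<phi> m (pull P \<psi> m f)" for f :: "'c => 'd"
  by (auto simp: pull_def bhom_closed[OF ph] intro!: restrict_ext)
 show ?thesis
  unfolding quasi_def
 proof (intro conjI ballI impI)
  show "lin (hom_complex R P M m) (hom_complex R K M m) (pull K \<phi> m)"
   by (rule linI)
    (auto simp: hom_complex_def pull_def bhom_closed[OF ph] intro!: restrict_ext bimod_homI res_bim[OF K]
     bhom_comp[OF ph bimod_hom_bhom])
 next
  fix z assume "z \<in> cocycles (hom_complex R P M) (hom_diff P d) m"
  then show "pull K \<phi> m z \<in> cocycles (hom_complex R K M) (hom_diff K e) m" by (rule pull_cocycle[OF K P M \<phi>])
 next
  fix z assume "z \<in> coboundaries (hom_complex R P M) (hom_diff P d) m"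
  then show "pull K \<phi> m z \<in> coboundaries (hom_complex R K M) (hom_diff K e) m" by (rule pull_coboundary[OF K P M \<phi>])
 next
  fix z assume z: "z \<in> cocycles (hom_complex R P M) (hom_diff P d) m"
   and "pull K \<phi> m z \<in> coboundaries (hom_complex R K M) (hom_diff K e) m"
  then have 1: "pull P \<psi> m (pull K \<phi> m z) \<in> coboundaries (hom_complex R P M) (hom_diff P d) m"
   by (intro pull_coboundary[OF P K M \<psi>])
  have "pull P (\<lambda>n x. x) m z \<ominus>\<^bsub>hom_complex R P M m\<^esub> pull P (\<lambda>n x. \<phi> n (\<psi> n x)) m z
    \<in> coboundaries (hom_complex R P M) (hom_diff P d) m"
   by (rule pull_difference[OF P Pp P chain_map_id chain_map_comp[OF \<psi> \<phi>] M z])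
  then have "(z \<ominus>\<^bsub>hom_complex R P M m\<^esub> pull P \<psi> m (pull K \<phi> m z)) \<oplus>\<^bsub>hom_complex R P M m\<^esub> pull P \<psi> m (pull K \<phi> m z)
    \<in> coboundaries (hom_complex R P M) (hom_diff P d) m"
   using 1 subsp_coboundaries[OF cP, of m] by (simp add: pid cocyclesD[OF z] pp1 subsp_def)
  then show "z \<in> coboundaries (hom_complex R P M) (hom_diff P d) m"
   using cplx_vsp[OF cP] cocyclesD[OF z] coboundariesD[OF cP 1] by simp
 next
  fix z assume z: "z \<in> cocycles (hom_complex R K M) (hom_diff K e) m"
  have "pull K (\<lambda>n x. x) m z \<ominus>\<^bsub>hom_complex R K M m\<^esub> pull K (\<lambda>n x. \<psi> n (\<phi> n x)) m z
    \<in> coboundaries (hom_complex R K M) (hom_diff K e) m"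
   by (rule pull_difference[OF K Kp K chain_map_id chain_map_comp[OF \<phi> \<psi>] M z])
  then show "\<exists>y\<in>cocycles (hom_complex R P M) (hom_diff P d) m.
    z \<ominus>\<^bsub>hom_complex R K M m\<^esub> pull K \<phi> m y \<in> coboundaries (hom_complex R K M) (hom_diff K e) m"
   using pull_cocycle[OF P K M \<psi> z] by (intro bexI[of _ "pull P \<psi> m z"]) (simp_all add: pid cocyclesD[OF z] pp2)
 qed
qed

end

section \<open>The bar resolution\<close>

text \<open>Multilinearity alone, apart from the bimodule conditions on the two ends of a bar
  cochain. Thus functions with shifted, merged or twisted arguments can be handled before they are
  known to be cochains.\<close>

definition mlin :: "('k::field, 'a) module => nat => ('k, 'm, 'x) module_scheme => ('a list => 'm) => bool" where
 "mlin R n M f \<longleftrightarrow> (\<forall>as i. length as = n --> set as \<subseteq> carrier R --> i < n --> lin R M (\<lambda>a. f (as[i := a])))"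

definition face :: "('k::field, 'a) module => nat => 'a list => 'a list" where
 "face R i as = take i as @ (as ! i \<otimes>\<^bsub>R\<^esub> as ! Suc i) # drop (i + 2) as"

lemma bar_args_iff: "as \<in> bar_args R m \<longleftrightarrow> length as = m + 2 \<and> (\<forall>i<m + 2. as ! i \<in> carrier R)"
 by (auto simp: bar_args_def subset_eq all_set_conv_all_nth)

lemma bar_args_update: "as \<in> bar_args R m ==> a \<in> carrier R ==> as[i := a] \<in> bar_args R m"
 by (auto simp: bar_args_def dest!: set_update_subset_insert[THEN subsetD])

lemma mlin_lin: "mlin R (m + 2) M f ==> as \<in> bar_args R m ==> i < m + 2 ==> lin R M (\<lambda>a. f (as[i := a]))"
 by (auto simp: mlin_def bar_args_def)

lemma mlin_closed: "mlin R (m + 2) M f ==> as \<in> bar_args R m ==> f as \<in> carrier M"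
 using lin_closed[OF mlin_lin[of R m M f as 0], of "as ! 0"] by (simp add: bar_args_iff)

lemma bar_cochains_iff:
 assumes R: "vsp R"
 shows "f \<in> bar_cochains R M m \<longleftrightarrow> f \<in> extensional (bar_args R m) \<and> mlin R (m + 2) M f \<and>
  (\<forall>as\<in>bar_args R m. \<forall>r\<in>carrier R. f (as[0 := r \<otimes>\<^bsub>R\<^esub> as ! 0]) = lact M r (f as) \<and>
   f (as[m + 1 := as ! (m + 1) \<otimes>\<^bsub>R\<^esub> r]) = ract M (f as) r)" (is "?l \<longleftrightarrow> ?r")
proof
 assume l: ?l
 then have "mlin R (m + 2) M f"
  unfolding mlin_def by (auto intro!: linI simp: bar_cochains_def bar_args_def dest!: set_update_subset_insert[THEN subsetD])
 then show ?r using l by (auto simp: bar_cochains_def PiE_def)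
next
 assume r: ?r
 then have "lin R M (\<lambda>a. f (as[i := a]))" if "as \<in> bar_args R m" "i < m + 2" for as i
  using mlin_lin that by blast
 then show ?l using r mlin_closed[of R m M f]
  by (auto simp: bar_cochains_def PiE_def lin_def)
qed

lemma fsm_scale: "f \<in> FS I ==> (\<lambda>i. c * f i) \<in> FS I"
 using vs_smult[OF vsp_fsm, of f I c] by simp

lemma face_length: "length as = Suc n ==> i < n ==> length (face R i as) = n"
 by (simp add: face_def)

lemma face_nth: "length as = Suc n ==> i < n ==> l < n ==>
  face R i as ! l = (if l < i then as ! l else if l = i then as ! i \<otimes>\<^bsub>R\<^esub> as ! Suc i else as ! Suc l)"
proof -
 assume l: "length as = Suc n" "i < n" "l < n"
 show ?thesis
 proof (cases "l \<le> i")
  case True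
  then show ?thesis using l by (auto simp: face_def nth_append)
 next
  case False
  then obtain k where "l = Suc (i + k)" by (metis less_imp_Suc_add not_le)
  then show ?thesis using l by (simp add: face_def nth_append)
 qed
qed

lemma face_args:
 "Ring.ring R ==> as \<in> bar_args R (Suc m) ==> i \<le> Suc m ==> face R i as \<in> bar_args R m"
 using face_length[of as "m + 2" i R] face_nth[of as "m + 2" i _ R] Ring.ring.ring_simprules(5)[of R]
 by (auto simp: bar_args_iff)

text \<open>A changed entry lies before the merged pair, is its left or right member, or lies after
  it. In each case the face changes in one entry, linearly in \<open>a\<close>, which makes every
  face of a multilinear function multilinear.\<close>

lemma face_update:
 assumes "length as = Suc n" "i < n" "k \<le> n"
 shows "face R i (as[k := a]) =
  (if k < i then (face R i as)[k := a] else if k = i then (face R i as)[i := a \<otimes>\<^bsub>R\<^esub> as ! Suc i]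
   else if k = Suc i then (face R i as)[i := as ! i \<otimes>\<^bsub>R\<^esub> a] else (face R i as)[k - 1 := a])"
 using assms by (intro nth_equalityI) (auto simp: face_length[of _ n] face_nth[of _ n] nth_list_update)

lemma bar_diff_face:
 "bar_diff R M m f = (\<lambda>as\<in>bar_args R (Suc m). \<Oplus>\<^bsub>M\<^esub>i\<in>{..Suc m}. (-1) ^ i \<odot>\<^bsub>M\<^esub> f (face R i as))"
 by (simp add: bar_diff_def face_def)

context based_algebra
begin

lemma mlin_eqI:
 assumes M: "vsp M" and f: "mlin R (m + 2) M f" and g: "mlin R (m + 2) M g"
  and eq: "\<And>v. length v = m + 2 ==> set v \<subseteq> J ==> f (map b v) = g (map b v)"
  and as: "as \<in> bar_args R m"
 shows "f as = g as"
proof -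
 \<comment> \<open>The first \<open>k\<close> entries are arbitrary and the remaining ones are basis
   elements; each step of the induction frees one more entry by linearity.\<close>
 have "f as = g as" if "k \<le> m + 2" "as \<in> bar_args R m" "\<And>i. k \<le> i ==> i < m + 2 ==> as ! i \<in> b ` J" for k as
  using that
 proof (induction k arbitrary: as)
  case 0
  define v where "v = map (inv_into J b) as"
  have "as = map b v" "length v = m + 2" "set v \<subseteq> J"
   using 0 by (auto simp: v_def bar_args_iff f_inv_into_f inv_into_into in_set_conv_nth intro!: nth_equalityI)
  then show ?case using eq by simp
 next
  case (Suc k)
  have "f (as[k := as ! k]) = g (as[k := as ! k])"
  proof (rule R_eqI[OF M mlin_lin[OF f] mlin_lin[OF g]])
   fix j assume "j \<in> J"
   then show "f (as[k := b j]) = g (as[k := b j])"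
    using Suc.prems b by (intro Suc.IH bar_args_update) (auto simp: nth_list_update bar_args_iff)
  qed (use Suc.prems in \<open>auto simp: bar_args_iff\<close>)
  then show ?case by simp
 qed
 from this[of "m + 2" as] show ?thesis using as by simp
qed

lemma mlin_comp: "mlin R n M f ==> lin M N g ==> mlin R n N (\<lambda>as. g (f as))"
 unfolding mlin_def by (intro allI impI lin_comp[of R M _ N g]) auto

lemma mlin_cong:
 assumes f: "mlin R (m + 2) M f" and eq: "\<And>as. as \<in> bar_args R m ==> g as = f as"
 shows "mlin R (m + 2) M g"
 unfolding mlin_def
proof (intro allI impI)
 fix as i assume "length as = m + 2" "set as \<subseteq> carrier R" and i: "i < m + 2"
 then have as: "as \<in> bar_args R m" by (simp add: bar_args_def)
 show "lin R M (\<lambda>a. g (as[i := a]))"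
  by (rule lin_cong[OF vs mlin_lin[OF f as i]]) (simp add: eq bar_args_update as)
qed

lemma args_act:
 assumes "as \<in> bar_args R m" "r \<in> carrier R"
 shows "as[0 := r \<otimes> as ! 0] \<in> bar_args R m" "as[m + 1 := as ! (m + 1) \<otimes> r] \<in> bar_args R m"
proof -
 have "as ! 0 \<in> carrier R" "as ! (m + 1) \<in> carrier R" using assms by (auto simp: bar_args_iff)
 then show "as[0 := r \<otimes> as ! 0] \<in> bar_args R m" "as[m + 1 := as ! (m + 1) \<otimes> r] \<in> bar_args R m"
  using assms by (intro bar_args_update m_closed; simp)+
qed

lemma restrict_cochain:
 assumes "mlin R (m + 2) M f"
  and "\<And>as r. as \<in> bar_args R m ==> r \<in> carrier R ==> f (as[0 := r \<otimes> as ! 0]) = lact M r (f as)"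
  and "\<And>as r. as \<in> bar_args R m ==> r \<in> carrier R ==> f (as[m + 1 := as ! (m + 1) \<otimes> r]) = ract M (f as) r"
 shows "(\<lambda>as\<in>bar_args R m. f as) \<in> bar_cochains R M m"
 unfolding bar_cochains_iff[OF vs]
 using mlin_cong[OF assms(1)] assms(2,3) args_act by auto

lemma bar_cochainsD:
 assumes "f \<in> bar_cochains R M m"
 shows "mlin R (m + 2) M f"
  and "as \<in> bar_args R m ==> r \<in> carrier R ==> f (as[0 := r \<otimes> as ! 0]) = lact M r (f as)"
  and "as \<in> bar_args R m ==> r \<in> carrier R ==> f (as[m + 1 := as ! (m + 1) \<otimes> r]) = ract M (f as) r"
  and "f \<in> extensional (bar_args R m)"
 using assms unfolding bar_cochains_iff[OF vs] by blast+

lemma mlin_slot: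
 assumes f: "mlin R n M f" and g: "lin R R g" and k: "k < n"
 shows "mlin R n M (\<lambda>as. f (as[k := g (as ! k)]))"
 unfolding mlin_def
proof (intro allI impI)
 fix as i assume as: "length as = n" "set as \<subseteq> carrier R" and i: "i < n"
 have gk: "g (as ! k) \<in> carrier R" using as k by (intro lin_closed[OF g]) auto
 show "lin R M (\<lambda>a. f ((as[i := a])[k := g ((as[i := a]) ! k)]))"
 proof (cases "i = k")
  case True
  have "lin R M (\<lambda>a. f (as[k := a]))" using f as k by (auto simp: mlin_def)
  then show ?thesis using True as k lin_comp[OF g] by simp
 next
  case False
  have "set (as[k := g (as ! k)]) \<subseteq> carrier R"
   using as(2) gk set_update_subset_insert[of as k "g (as ! k)"] by auto
  then have "lin R M (\<lambda>a. f (as[k := g (as ! k), i := a]))" using f as i by (auto simp: mlin_def)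
  then show ?thesis using False by (simp add: list_update_swap)
 qed
qed

lemma mlin_cons:
 assumes f: "mlin R (Suc n) M f" and r: "r \<in> carrier R"
 shows "mlin R n M (\<lambda>as. f (r # as))"
 unfolding mlin_def
proof (intro allI impI)
 fix as i assume "length as = n" "set as \<subseteq> carrier R" "i < n"
 then have "lin R M (\<lambda>a. f ((r # as)[Suc i := a]))"
  using r by (intro f[unfolded mlin_def, rule_format]) auto
 then show "lin R M (\<lambda>a. f (r # as[i := a]))" by simp
qed

lemma mlin_face:
 assumes M: "vsp M" and f: "mlin R (m + 2) M f" and i: "i \<le> Suc m"
 shows "mlin R (m + 3) M (\<lambda>as. f (face R i as))"
 unfolding mlin_def
proof (intro allI impI)
 fix as k assume as: "length as = m + 3" "set as \<subseteq> carrier R" and k: "k < m + 3"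
 then have "as \<in> bar_args R (Suc m)" by (simp add: bar_args_def)
 then have F: "face R i as \<in> bar_args R m" using i by (rule face_args[OF ring])
 have c: "as ! l \<in> carrier R" if "l < m + 3" for l using as that by auto
 have u: "face R i (as[k := a]) =
  (if k < i then (face R i as)[k := a] else if k = i then (face R i as)[i := a \<otimes> as ! Suc i]
   else if k = Suc i then (face R i as)[i := as ! i \<otimes> a] else (face R i as)[k - 1 := a])" for a
  using as i k by (intro face_update[of _ "m + 2"]) auto
 note l = mlin_lin[OF f F]
 consider "k < i" | "k = i" | "k = Suc i" | "Suc i < k" by linarith
 then show "lin R M (\<lambda>a. f (face R i (as[k := a])))"
 proof cases
  case 1 then show ?thesis unfolding u using l[of k] k i by simp
 next
  case 2 then show ?thesis unfolding u using lin_comp[OF lin_mult_right l[of i]] c[of "Suc i"] i by simp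
 next
  case 3 then show ?thesis unfolding u using lin_comp[OF lin_mult_left l[of i]] c[of i] i by simp
 next
  case 4 then show ?thesis unfolding u using l[of "k - 1"] k i by simp
 qed
qed

text \<open>Every face by itself is compatible with the outer actions: an end entry is either left
  alone by the face or multiplied with its neighbour, and then associativity applies.\<close>

lemma bar_diff_cochain:
 assumes M: "bimodule R M" and f: "f \<in> bar_cochains R M m"
 shows "bar_diff R M m f \<in> bar_cochains R M (Suc m)"
proof -
 note vM = bim_vsp[OF M]
 note ml = bar_cochainsD(1)[OF f] and act = bar_cochainsD(2,3)[OF f]
 define D where "D as = (\<Oplus>\<^bsub>M\<^esub>i\<in>{..Suc m}. (-1) ^ i \<odot>\<^bsub>M\<^esub> f (face R i as))" for as
 have fc: "f (face R i as) \<in> carrier M" if "as \<in> bar_args R (Suc m)" "i \<le> Suc m" for as i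
  by (rule mlin_closed[OF ml face_args[OF ring that]])
 have "mlin R (m + 3) M D"
  unfolding D_def mlin_def
  using mlin_face[OF vM ml] by (intro allI impI lin_sum vs vM lin_scale) (auto simp: mlin_def)
 then have "mlin R (Suc m + 2) M D" by (simp add: numeral_3_eq_3)
 moreover have "D (as[0 := r \<otimes> as ! 0]) = lact M r (D as)"
  and "D (as[m + 2 := as ! (m + 2) \<otimes> r]) = ract M (D as) r"
  if as: "as \<in> bar_args R (Suc m)" and r: "r \<in> carrier R" for as r
 proof -
  have c: "as ! l \<in> carrier R" if "l < m + 3" for l using as that by (simp add: bar_args_iff)
  have len: "length as = m + 3" using as by (simp add: bar_args_iff)
  have len': "length (face R i as) = m + 2" if "i \<le> Suc m" for i using len that by (simp add: face_length[of _ "m + 2"])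
  have "face R i (as[0 := r \<otimes> as ! 0]) = (face R i as)[0 := r \<otimes> face R i as ! 0]" if "i \<le> Suc m" for i
   using len that c[of 0] c[of 1] r by (subst face_update[of _ "m + 2"]) (auto simp: face_nth[of _ "m + 2"] m_assoc)
  then have 1: "f (face R i (as[0 := r \<otimes> as ! 0])) = lact M r (f (face R i as))" if "i \<le> Suc m" for i
   using that act(1)[OF face_args[OF ring as that] r] by simp
  have "face R i (as[m + 2 := as ! (m + 2) \<otimes> r]) = (face R i as)[m + 1 := face R i as ! (m + 1) \<otimes> r]"
   if "i \<le> Suc m" for i
   using len that c[of "m + 1"] c[of "m + 2"] r
   by (subst face_update[of _ "m + 2"]) (auto simp: face_nth[of _ "m + 2"] m_assoc)
  then have 2: "f (face R i (as[m + 2 := as ! (m + 2) \<otimes> r])) = ract M (f (face R i as)) r" if "i \<le> Suc m" for i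
   using that act(2)[OF face_args[OF ring as that] r] by simp
  show "D (as[0 := r \<otimes> as ! 0]) = lact M r (D as)"
   unfolding D_def using fc[OF as] r vM
   by (subst lin_finsum[OF vM vM lin_lact[OF M r]])
    (auto simp: 1 lin_smult[OF lin_lact[OF M r]] bim_closed[OF M] intro!: vs_finsum_cong)
  show "D (as[m + 2 := as ! (m + 2) \<otimes> r]) = ract M (D as) r"
   unfolding D_def using fc[OF as] r vM
   by (subst lin_finsum[OF vM vM lin_ract[OF M r]])
    (auto simp: 2[simplified] lin_smult[OF lin_ract[OF M r]] bim_closed[OF M] intro!: vs_finsum_cong)
 qed
 ultimately have "(\<lambda>as\<in>bar_args R (Suc m). D as) \<in> bar_cochains R M (Suc m)"
  by (intro restrict_cochain) simp_all
 then show ?thesis by (simp add: bar_diff_face D_def)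
qed

lemma bar_cochain_comp:
 assumes M: "bimodule R M" and f: "f \<in> bar_cochains R M m" and g: "bhom R M N g"
 shows "(\<lambda>as\<in>bar_args R m. g (f as)) \<in> bar_cochains R N m"
proof -
 note f' = bar_cochainsD[OF f]
 show ?thesis
  by (rule restrict_cochain[OF mlin_comp[OF f'(1) bhom_lin[OF g]]])
   (simp_all only: f'(2,3) bhom_lact[OF g] bhom_ract[OF g] mlin_closed[OF f'(1)])
qed

lemma bar_diff_comp:
 assumes M: "bimodule R M" and N: "bimodule R N" and f: "f \<in> bar_cochains R M m" and g: "bhom R M N g"
  and as: "as \<in> bar_args R (Suc m)"
 shows "bar_diff R N m (\<lambda>as\<in>bar_args R m. g (f as)) as = g (bar_diff R M m f as)"
proof -
 note ml = bar_cochainsD(1)[OF f]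
 have fc: "f (face R i as) \<in> carrier M" if "i \<le> Suc m" for i
  by (rule mlin_closed[OF ml face_args[OF ring as that]])
 show ?thesis using as fc bim_vsp[OF M] bim_vsp[OF N] face_args[OF ring as]
  by (auto simp: bar_diff_face lin_finsum[OF bim_vsp[OF M] bim_vsp[OF N] bhom_lin[OF g]] lin_smult[OF bhom_lin[OF g]]
    bhom_closed[OF g] intro!: vs_finsum_cong[OF bim_vsp[OF N]])
qed

section \<open>The bar resolution in coordinates\<close>

definition words :: "nat => 'j list set" where
 "words m = {w. length w = m \<and> set w \<subseteq> J}"

text \<open>The \<open>(m + 2)\<close>-fold tensor power as a free bimodule: a word labels a basis
  vector of the \<open>m\<close> middle factors, the other two coordinates belong to the
  ends.\<close>

definition bar_mod :: "nat => ('k, 'a, 'j list \<times> 'j \<times> 'j => 'k) bimodule" where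
 "bar_mod m = free_bim (words m)"

text \<open>The tensor \<open>a\<^sub>0 \<otimes> \<dots> \<otimes> a\<^bsub>m+1\<^esub>\<close> in coordinates.\<close>

definition ub :: "nat => 'a list => 'j list \<times> 'j \<times> 'j => 'k" where
 "ub m as = (\<lambda>(w, c, c'). if length w = m then \<Prod>i<m + 2. co (as ! i) ((c # w @ [c']) ! i) else 0)"

lemma ub_closed:
 assumes as: "as \<in> bar_args R m"
 shows "ub m as \<in> FS (words m \<times> J \<times> J)"
proof -
 \<comment> \<open>Finitely many coordinates occur in the entries of \<open>as\<close>, and only
   finitely many words of the right length can be formed from them.\<close>
 define S where "S = (\<Union>i<m + 2. {j. co (as ! i) j \<noteq> 0})"
 have c: "as ! i \<in> carrier R" if "i < m + 2" for i using as that by (auto simp: bar_args_iff)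
 have S: "finite S" "S \<subseteq> J" using fsmD[OF co_fsm[OF c]] by (auto simp: S_def)
 define A where "A = (\<lambda>v. (butlast (tl v), hd v, last v)) ` {v. set v \<subseteq> S \<and> length v = m + 2}"
 show ?thesis
 proof (rule fsmI[of A])
  show "finite A" unfolding A_def by (intro finite_imageI finite_lists_length_eq S)
  have "butlast (tl v) \<in> words m \<and> hd v \<in> J \<and> last v \<in> J" if vS: "set v \<subseteq> S" "length v = m + 2" for v
  proof -
   obtain c v' where v: "v = c # v'" using vS(2) by (metis Suc_length_conv add_2_eq_Suc')
   then have "v' \<noteq> []" using vS by auto
   then obtain w c' where "v' = w @ [c']" by (metis rev_exhaust)
   then show ?thesis using vS v S by (auto simp: words_def)
  qed
  then show "A \<subseteq> words m \<times> J \<times> J" by (auto simp: A_def)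
  fix i assume i: "ub m as i \<noteq> 0"
  obtain w c c' where e: "i = (w, c, c')" by (metis prod_cases3)
  then have w: "length w = m" and p: "(\<Prod>i<m + 2. co (as ! i) ((c # w @ [c']) ! i)) \<noteq> 0"
   using i by (auto simp: ub_def split: if_splits)
  have "co (as ! l) ((c # w @ [c']) ! l) \<noteq> 0" if "l < m + 2" for l
   using p that by (simp add: prod_zero_iff del: prod.lessThan_Suc)
  then have "(c # w @ [c']) ! l \<in> S" if "l < m + 2" for l using that by (auto simp: S_def)
  moreover have "length (c # w @ [c']) = m + 2" using w by simp
  ultimately have "set (c # w @ [c']) \<subseteq> S" by (metis in_set_conv_nth subsetI)
  then show "i \<in> A" unfolding A_def e using w by (intro image_eqI[of _ _ "c # w @ [c']"]) auto
 qed
qed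

lemma mlin_ub: "mlin R (m + 2) (bar_mod m) (ub m)"
 unfolding mlin_def
proof (intro allI impI)
 fix as i assume as: "length as = m + 2" "set as \<subseteq> carrier R" and i: "i < m + 2"
 have u: "ub m (as[i := a]) (w, c, c') = (if length w = m then co a ((c # w @ [c']) ! i) *
   (\<Prod>k\<in>{..<m + 2} - {i}. co (as ! k) ((c # w @ [c']) ! k)) else 0)" for a w c c'
 proof -
  have "(\<Prod>k<m + 2. co (as[i := a] ! k) ((c # w @ [c']) ! k)) =
    co (as[i := a] ! i) ((c # w @ [c']) ! i) * (\<Prod>k\<in>{..<m + 2} - {i}. co (as[i := a] ! k) ((c # w @ [c']) ! k))"
   using i by (intro prod.remove) auto
  also have "(\<Prod>k\<in>{..<m + 2} - {i}. co (as[i := a] ! k) ((c # w @ [c']) ! k)) =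
    (\<Prod>k\<in>{..<m + 2} - {i}. co (as ! k) ((c # w @ [c']) ! k))"
   by (intro prod.cong) auto
  finally show ?thesis using as i by (simp add: ub_def del: prod.lessThan_Suc)
 qed
 have "as \<in> bar_args R m" using as by (simp add: bar_args_def)
 then have cl: "a \<in> carrier R ==> ub m (as[i := a]) \<in> carrier (bar_mod m)" for a
  by (simp add: bar_mod_def ub_closed bar_args_update)
 show "lin R (bar_mod m) (\<lambda>a. ub m (as[i := a]))"
  by (rule linI[OF cl])
   (auto simp: bar_mod_def u co_add co_smult distrib_right fun_eq_iff)
qed

text \<open>If the middle entries are basis elements, the product of their coordinates is 1 at the
  word \<open>w\<close> and 0 elsewhere, so only the two ends remain.\<close>

lemma ub_word:
 assumes "length w = m" "set w \<subseteq> J"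
 shows "ub m (a # map b w @ [a']) = ten w a a'"
proof (rule ext)
 fix i :: "'j list \<times> 'j \<times> 'j"
 obtain v c c' where i: "i = (v, c, c')" by (metis prod_cases3)
 show "ub m (a # map b w @ [a']) i = ten w a a' i"
 proof (cases "length v = m")
  case True
  have split: "(\<Prod>i<m + 2. F i) = F 0 * (\<Prod>i<m. F (Suc i)) * F (Suc m)" for F :: "nat => 'k"
   using prod.lessThan_Suc_shift[of F "Suc m"] by (simp add: mult.assoc)
  have "(\<Prod>i<m + 2. co ((a # map b w @ [a']) ! i) ((c # v @ [c']) ! i)) =
    co a c * (\<Prod>i<m. co ((map b w @ [a']) ! i) ((v @ [c']) ! i)) * co a' c'"
   unfolding split using assms True by (simp add: nth_append)
  also have "(\<Prod>i<m. co ((map b w @ [a']) ! i) ((v @ [c']) ! i)) = (\<Prod>i<m. if v ! i = w ! i then 1 else 0)"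
   using assms True by (intro prod.cong) (auto simp: nth_append co_b dl_def subset_iff)
  also have "\<dots> = (if v = w then 1 else 0)"
  proof (cases "v = w")
   case False
   then obtain l where "l < m" "v ! l \<noteq> w ! l" using assms True nth_equalityI by metis
   then show ?thesis using False by (auto intro!: prod_zero)
  qed simp
  finally show ?thesis using True by (simp add: i ub_def ten_def del: prod.lessThan_Suc)
 qed (use assms in \<open>auto simp: i ub_def ten_def\<close>)
qed

lemma word_args: "length w = m ==> set w \<subseteq> J ==> a \<in> carrier R ==> a' \<in> carrier R ==> a # map b w @ [a'] \<in> bar_args R m"
 using b by (auto simp: bar_args_def)

lemma split_word:
 assumes "length v = m + 2" "set v \<subseteq> J"
 obtains c w c' where "v = c # w @ [c']" "length w = m" "set w \<subseteq> J" "c \<in> J" "c' \<in> J"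
proof -
 obtain c v' where v: "v = c # v'" using assms(1) by (metis Suc_length_conv add_2_eq_Suc')
 then have "v' \<noteq> []" using assms by auto
 then obtain w c' where "v' = w @ [c']" by (metis rev_exhaust)
 then show ?thesis using assms v by (intro that[of c w c']) auto
qed

lemma bimodule_bar: "bimodule R (bar_mod m)" by (simp add: bar_mod_def bimodule_free)
lemma carrier_bar: "carrier (bar_mod m) = FS (words m \<times> J \<times> J)" by (simp add: bar_mod_def)
lemma vsp_bar: "vsp (bar_mod m)" by (simp add: bar_mod_def)

lemma bar_lin_eqI:
 assumes M: "vsp M" and f: "lin (bar_mod m) M f" "lin (bar_mod m) M g"
  and eq: "\<And>as. as \<in> bar_args R m ==> f (ub m as) = g (ub m as)" and z: "z \<in> carrier (bar_mod m)"
 shows "f z = g z"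
proof (rule free_eqI[OF M])
 fix w j j' assume w: "w \<in> words m" and j: "j \<in> J" "j' \<in> J"
 have "f (ub m (b j # map b w @ [b j'])) = g (ub m (b j # map b w @ [b j']))"
  using w j b by (intro eq word_args) (auto simp: words_def)
 then show "f (ten w (b j) (b j')) = g (ten w (b j) (b j'))" using w by (simp add: ub_word words_def)
qed (use f z in \<open>auto simp: bar_mod_def\<close>)

text \<open>The universal bar cochain: \<open>bext_ub\<close> shows that each bar cochain factors
  through it by a bimodule map.\<close>

lemma ub_cochain: "(\<lambda>as\<in>bar_args R m. ub m as) \<in> bar_cochains R (bar_mod m) m"
proof -
 note v = vsp_bar[of m] and ml = mlin_ub[of m]
 have "ub m (as[0 := r \<otimes> as ! 0]) = lact (bar_mod m) r (ub m as)"
  and "ub m (as[m + 1 := as ! (m + 1) \<otimes> r]) = ract (bar_mod m) (ub m as) r"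
  if as: "as \<in> bar_args R m" and r: "r \<in> carrier R" for as r
 proof -
  show "ub m (as[0 := r \<otimes> as ! 0]) = lact (bar_mod m) r (ub m as)"
  proof (rule mlin_eqI[OF v mlin_slot[OF ml lin_mult_left[OF r]] mlin_comp[OF ml lin_lact[OF bimodule_bar r]] _ as])
   fix v assume "length v = m + 2" "set v \<subseteq> J"
   then obtain c w c' where "v = c # w @ [c']" "length w = m" "set w \<subseteq> J" "c \<in> J" "c' \<in> J" by (rule split_word)
   then show "ub m ((map b v)[0 := r \<otimes> map b v ! 0]) = lact (bar_mod m) r (ub m (map b v))"
    using r b by (simp add: ub_word bar_mod_def free_lact_ten words_def)
  qed simp
  show "ub m (as[m + 1 := as ! (m + 1) \<otimes> r]) = ract (bar_mod m) (ub m as) r"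
  proof (rule mlin_eqI[OF v mlin_slot[OF ml lin_mult_right[OF r]] mlin_comp[OF ml lin_ract[OF bimodule_bar r]] _ as])
   fix v assume "length v = m + 2" "set v \<subseteq> J"
   then obtain c w c' where "v = c # w @ [c']" "length w = m" "set w \<subseteq> J" "c \<in> J" "c' \<in> J" by (rule split_word)
   then show "ub m ((map b v)[m + 1 := map b v ! (m + 1) \<otimes> r]) = ract (bar_mod m) (ub m (map b v)) r"
    using r b by (simp add: ub_word bar_mod_def free_ract_ten words_def nth_append list_update_append)
  qed simp
 qed
 then show ?thesis by (rule restrict_cochain[OF ml])
qed

text \<open>A cochain is determined by its values on lists with both ends 1, which prescribe the
  images of the free generators.\<close>

definition bext where "bext M f = fext M (\<lambda>w. f (\<one> # map b w @ [\<one>]))" for M :: "('k, 'a, 'm) bimodule"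

lemma
 assumes M: "bimodule R M" and f: "f \<in> bar_cochains R M m"
 shows bhom_bext: "bhom R (bar_mod m) M (bext M f)"
  and bext_ub: "as \<in> bar_args R m ==> bext M f (ub m as) = f as"
proof -
 note ml = bar_cochainsD(1)[OF f] and act = bar_cochainsD(2,3)[OF f]
 have c: "(\<lambda>w. f (\<one> # map b w @ [\<one>])) \<in> words m \<rightarrow> carrier M"
  using mlin_closed[OF ml word_args] by (auto simp: words_def)
 show b': "bhom R (bar_mod m) M (bext M f)"
  unfolding bext_def bar_mod_def by (rule bhom_fext[OF M c])
 assume as: "as \<in> bar_args R m"
 show "bext M f (ub m as) = f as"
 proof (rule mlin_eqI[OF bim_vsp[OF M] mlin_comp[OF mlin_ub bhom_lin[OF b']] ml _ as])
  fix v assume "length v = m + 2" "set v \<subseteq> J"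
  then obtain e w e' where v: "v = e # w @ [e']" "length w = m" "set w \<subseteq> J" "e \<in> J" "e' \<in> J" by (rule split_word)
  note wa = word_args[OF v(2,3)]
  have "f (map b v) = ract M (f (b e # map b w @ [\<one>])) (b e')"
   using act(2)[OF wa[OF b[OF v(4)] one_closed] b[OF v(5)]] v b by (simp add: nth_append list_update_append)
  also have "f (b e # map b w @ [\<one>]) = lact M (b e) (f (\<one> # map b w @ [\<one>]))"
   using act(1)[OF wa[OF one_closed one_closed] b[OF v(4)]] v b by simp
  finally show "bext M f (ub m (map b v)) = f (map b v)"
   using v b by (simp add: ub_word bext_def fext_ten[OF M c] words_def)
 qed
qed

text \<open>The cochain differential applied to the universal cochain. In this form the boundary is
  a bimodule map at once, and statements about it turn into statements about
  \<open>bar_diff\<close>.\<close>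

definition bd where "bd m = bext (bar_mod m) (bar_diff R (bar_mod m) m (\<lambda>as\<in>bar_args R m. ub m as))"
definition baug where "baug = bext (regular R) (\<lambda>as\<in>bar_args R 0. as ! 0 \<otimes> as ! 1)"

lemma bhom_bd: "bhom R (bar_mod (Suc m)) (bar_mod m) (bd m)"
 unfolding bd_def by (rule bhom_bext[OF bimodule_bar bar_diff_cochain[OF bimodule_bar ub_cochain]])

lemma bd_ub: "as \<in> bar_args R (Suc m) ==> bd m (ub (Suc m) as) = bar_diff R (bar_mod m) m (\<lambda>as\<in>bar_args R m. ub m as) as"
 unfolding bd_def by (rule bext_ub[OF bimodule_bar bar_diff_cochain[OF bimodule_bar ub_cochain]])

lemma bd_ub': "as \<in> bar_args R (Suc m) ==> bd m (ub (Suc m) as) = (\<lambda>x. \<Sum>i\<le>Suc m. (-1) ^ i * ub m (face R i as) x)"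
proof -
 assume as: "as \<in> bar_args R (Suc m)"
 have c: "ub m (face R i as) \<in> FS (words m \<times> J \<times> J)" if "i \<le> Suc m" for i
  using ub_closed face_args[OF ring as that] by blast
 have "bd m (ub (Suc m) as) = (\<Oplus>\<^bsub>bar_mod m\<^esub>i\<in>{..Suc m}. (-1) ^ i \<odot>\<^bsub>bar_mod m\<^esub> ub m (face R i as))"
  using as face_args[OF ring as] c
  by (auto simp: bd_ub bar_diff_face carrier_bar vs_smult[OF vsp_bar, unfolded carrier_bar] intro!: vs_finsum_cong[OF vsp_bar])
 also have "\<dots> = (\<Oplus>\<^bsub>fsm (words m \<times> J \<times> J)\<^esub>i\<in>{..Suc m}. (-1) ^ i \<odot>\<^bsub>fsm (words m \<times> J \<times> J)\<^esub> ub m (face R i as))"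
  unfolding bar_mod_def using c by (subst finsum_cong_struct[OF vsp_fsm vsp_free]) (auto intro!: fsm_scale)
 also have "\<dots> = (\<lambda>x. \<Sum>i\<le>Suc m. (-1) ^ i * ub m (face R i as) x)"
  using c by (subst finsum_fsm[where I = "words m \<times> J \<times> J"]) (auto intro!: fsm_scale)
 finally show ?thesis .
qed

lemma baug_cochain: "(\<lambda>as\<in>bar_args R 0. as ! 0 \<otimes> as ! 1) \<in> bar_cochains R (regular R) 0"
proof -
 have lin: "lin R (regular R) f = lin R R f" for f by (simp add: lin_def)
 show ?thesis
 proof (rule restrict_cochain)
  show "mlin R (0 + 2) (regular R) (\<lambda>as. as ! 0 \<otimes> as ! 1)"
   unfolding mlin_def
  proof (intro allI impI)
   fix as i assume as: "length as = 0 + 2" "set as \<subseteq> carrier R" and i: "i < (0::nat) + 2"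
   have "i = 0 \<or> i = 1" using i by auto
   then show "lin R (regular R) (\<lambda>a. (as[i := a]) ! 0 \<otimes> (as[i := a]) ! 1)"
   proof -
    have "as ! 0 \<in> carrier R" "as ! 1 \<in> carrier R" using as nth_mem[of 0 as] nth_mem[of 1 as] by auto
    then show ?thesis
     using as \<open>i = 0 \<or> i = 1\<close> lin_mult_left[of "as ! 0"] lin_mult_right[of "as ! 1"] by (auto simp: lin)
   qed
  qed
 qed (auto simp: bar_args_iff m_assoc)
qed

lemma bhom_baug: "bhom R (bar_mod 0) (regular R) baug"
 unfolding baug_def by (rule bhom_bext[OF bimodule_regular baug_cochain])

lemma baug_ub: "as \<in> bar_args R 0 ==> baug (ub 0 as) = as ! 0 \<otimes> as ! 1"
 using bext_ub[OF bimodule_regular baug_cochain, of as] by (simp add: baug_def)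

text \<open>The contracting homotopy \<open>a\<^sub>0 \<otimes> \<dots> \<otimes> a\<^bsub>m+1\<^esub> \<mapsto> 1 \<otimes> a\<^sub>0 \<otimes> \<dots> \<otimes> a\<^bsub>m+1\<^esub>\<close>.\<close>

definition bs :: "nat => ('j list \<times> 'j \<times> 'j => 'k) => ('j list \<times> 'j \<times> 'j => 'k)" where
 "bs m = lext (fsm (words (Suc m) \<times> J \<times> J)) (\<lambda>(w, c, c'). ub (Suc m) (\<one> # map b (c # w @ [c'])))"

lemma cons_args: "as \<in> bar_args R m ==> a \<in> carrier R ==> a # as \<in> bar_args R (Suc m)"
 by (simp add: bar_args_def)

lemma lin_bs: "lin (bar_mod m) (bar_mod (Suc m)) (bs m)"
proof -
 have "ub (Suc m) (\<one> # map b (c # w @ [c'])) \<in> FS (words (Suc m) \<times> J \<times> J)"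
  if "w \<in> words m" "c \<in> J" "c' \<in> J" for w c c'
  using that b by (intro ub_closed cons_args) (auto simp: bar_args_def words_def)
 then show ?thesis unfolding bs_def bar_mod_def by (auto intro!: lin_lext)
qed

lemma bs_ub:
 assumes as: "as \<in> bar_args R m"
 shows "bs m (ub m as) = ub (Suc m) (\<one> # as)"
proof (rule mlin_eqI[OF vsp_bar mlin_comp[OF mlin_ub lin_bs] _ _ as])
 show "mlin R (m + 2) (bar_mod (Suc m)) (\<lambda>as. ub (Suc m) (\<one> # as))"
  using mlin_ub[of "Suc m"] by (intro mlin_cons) simp_all
 fix v assume "length v = m + 2" "set v \<subseteq> J"
 then obtain c w c' where v: "v = c # w @ [c']" "length w = m" "set w \<subseteq> J" "c \<in> J" "c' \<in> J" by (rule split_word)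
 have "map b v \<in> bar_args R m" using v b by (auto simp: bar_args_def)
 then have "ub (Suc m) (\<one> # map b v) \<in> FS (words (Suc m) \<times> J \<times> J)"
  by (intro ub_closed cons_args) simp_all
 then show "bs m (ub m (map b v)) = ub (Suc m) (\<one> # map b v)"
  using v by (simp add: ub_word ten_b bs_def)
qed

lemma face_cons: "face R (Suc i) (a # as) = a # face R i as"
 by (simp add: face_def)

lemma face_one: "as \<in> bar_args R m ==> face R 0 (\<one> # as) = as"
 by (cases as) (auto simp: face_def bar_args_def)

lemma sum_fun_lin: "lin (fsm I) (fsm K) f ==> finite A ==> (\<And>a. a \<in> A ==> g a \<in> FS I) ==>
  f (\<lambda>x. \<Sum>a\<in>A. k a * g a x) = (\<lambda>x. \<Sum>a\<in>A. k a * f (g a) x)"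
proof -
 assume f: "lin (fsm I) (fsm K) f" and A: "finite A" and g: "\<And>a. a \<in> A ==> g a \<in> FS I"
 have "(\<lambda>x. \<Sum>a\<in>A. k a * g a x) = (\<Oplus>\<^bsub>fsm I\<^esub>a\<in>A. k a \<odot>\<^bsub>fsm I\<^esub> g a)"
  using A g by (subst finsum_fsm[where I = I]) (auto intro!: fsm_scale)
 then have "f (\<lambda>x. \<Sum>a\<in>A. k a * g a x) = (\<Oplus>\<^bsub>fsm K\<^esub>a\<in>A. k a \<odot>\<^bsub>fsm K\<^esub> f (g a))"
  using g by (auto simp: lin_finsum[OF vsp_fsm vsp_fsm f] lin_smult[OF f] lin_closed[OF f] simp del: fsm_simps(3)
    intro!: vs_finsum_cong[OF vsp_fsm] vs_smult[OF vsp_fsm])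
 also have "\<dots> = (\<lambda>x. \<Sum>a\<in>A. k a * f (g a) x)"
  using A g lin_closed[OF f] by (subst finsum_fsm[where I = K]) (auto intro!: fsm_scale)
 finally show ?thesis .
qed

text \<open>Face 0 of \<open>\<one> # as\<close> is \<open>as\<close>. The remaining faces are
  \<open>\<one> # face R i as\<close> with opposite signs and cancel against the second
  term.\<close>

lemma bs_homotopy:
 assumes z: "z \<in> carrier (bar_mod (Suc m))"
 shows "bd (Suc m) (bs (Suc m) z) \<oplus>\<^bsub>bar_mod (Suc m)\<^esub> bs m (bd m z) = z"
proof (rule bar_lin_eqI[OF vsp_bar _ lin_id _ z])
 show "lin (bar_mod (Suc m)) (bar_mod (Suc m)) (\<lambda>z. bd (Suc m) (bs (Suc m) z) \<oplus>\<^bsub>bar_mod (Suc m)\<^esub> bs m (bd m z))"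
  by (intro lin_plus vsp_bar lin_comp[OF lin_bs bhom_lin[OF bhom_bd]] lin_comp[OF bhom_lin[OF bhom_bd] lin_bs])
 fix as assume as: "as \<in> bar_args R (Suc m)"
 have "bs m (bd m (ub (Suc m) as)) = (\<lambda>x. \<Sum>i\<le>Suc m. (-1) ^ i * ub (Suc m) (\<one> # face R i as) x)"
  unfolding bd_ub'[OF as] using face_args[OF ring as] lin_bs[of m]
  by (subst sum_fun_lin[of "words m \<times> J \<times> J" "words (Suc m) \<times> J \<times> J"])
   (auto simp: bar_mod_def bs_ub ub_closed intro!: sum.cong)
 moreover have "bd (Suc m) (bs (Suc m) (ub (Suc m) as)) =
   (\<lambda>x. ub (Suc m) as x - (\<Sum>i\<le>Suc m. (-1) ^ i * ub (Suc m) (\<one> # face R i as) x))"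
  using as by (auto simp: bs_ub bd_ub' cons_args face_one face_cons sum.atMost_Suc_shift[of _ "Suc m"] sum_negf
    simp del: sum.atMost_Suc)
 ultimately show "bd (Suc m) (bs (Suc m) (ub (Suc m) as)) \<oplus>\<^bsub>bar_mod (Suc m)\<^esub> bs m (bd m (ub (Suc m) as)) = ub (Suc m) as"
  by (simp add: bar_mod_def)
qed

text \<open>At the end of the complex the second term uses the section
  \<open>r \<mapsto> 1 \<otimes> r\<close> of the augmentation.\<close>

lemma bs_homotopy0:
 assumes z: "z \<in> carrier (bar_mod 0)"
 shows "bd 0 (bs 0 z) \<oplus>\<^bsub>bar_mod 0\<^esub> ub 0 [\<one>, baug z] = z"
proof (rule bar_lin_eqI[OF vsp_bar _ lin_id _ z])
 have "lin R (bar_mod 0) (\<lambda>r. ub 0 ([\<one>, \<one>][1 := r]))"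
  using mlin_ub[of 0] by (intro mlin_lin) (simp_all add: bar_args_def)
 then have "lin (bar_mod 0) (bar_mod 0) (\<lambda>z. ub 0 [\<one>, baug z])"
  using bhom_lin[OF bhom_baug] lin_comp[of "bar_mod 0" R baug "bar_mod 0" "\<lambda>r. ub 0 [\<one>, r]"] by (simp add: lin_def)
 then show "lin (bar_mod 0) (bar_mod 0) (\<lambda>z. bd 0 (bs 0 z) \<oplus>\<^bsub>bar_mod 0\<^esub> ub 0 [\<one>, baug z])"
  by (intro lin_plus vsp_bar lin_comp[OF lin_bs bhom_lin[OF bhom_bd]])
 fix as assume as: "as \<in> bar_args R 0"
 then obtain x y where xy: "as = [x, y]" "x \<in> carrier R" "y \<in> carrier R"
  by (auto simp: bar_args_def numeral_2_eq_2 length_Suc_conv)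
 show "bd 0 (bs 0 (ub 0 as)) \<oplus>\<^bsub>bar_mod 0\<^esub> ub 0 [\<one>, baug (ub 0 as)] = ub 0 as"
  using as xy by (auto simp: bs_ub bd_ub' cons_args baug_ub) (simp add: face_def bar_mod_def)
qed

lemma baug_bd: "z \<in> carrier (bar_mod 1) ==> baug (bd 0 z) = \<zero>"
proof -
 assume z: "z \<in> carrier (bar_mod 1)"
 have "baug (bd 0 z) = \<zero>\<^bsub>regular R\<^esub>"
 proof (rule bar_lin_eqI[OF bim_vsp[OF bimodule_regular] _ lin_const_zero[OF bim_vsp[OF bimodule_regular]] _ z])
  show "lin (bar_mod 1) (regular R) (\<lambda>z. baug (bd 0 z))"
   using lin_comp[OF bhom_lin[OF bhom_bd] bhom_lin[OF bhom_baug]] by simp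
  fix as assume as: "as \<in> bar_args R 1"
  then obtain x y z where xyz: "as = [x, y, z]" "x \<in> carrier R" "y \<in> carrier R" "z \<in> carrier R"
   by (auto simp: bar_args_def numeral_3_eq_3 length_Suc_conv)
  have args: "[x \<otimes> y, z] \<in> bar_args R 0" "[x, y \<otimes> z] \<in> bar_args R 0"
   using xyz by (auto simp: bar_args_def)
  have "bd 0 (ub 1 as) = ub 0 [x \<otimes> y, z] \<ominus>\<^bsub>bar_mod 0\<^esub> ub 0 [x, y \<otimes> z]"
   using bd_ub'[of as 0] as xyz args by (subst vs_minus_eq[OF vsp_bar]) (auto simp: carrier_bar ub_closed, simp add: face_def bar_mod_def)
  then show "baug (bd 0 (ub 1 as)) = \<zero>\<^bsub>regular R\<^esub>"
   using args xyz by (simp add: lin_minus[OF vsp_bar bim_vsp[OF bimodule_regular] bhom_lin[OF bhom_baug]] carrier_bar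
     ub_closed baug_ub m_assoc vs_minus_self[OF bim_vsp[OF bimodule_regular]] del: regular_simps(2)) 
 qed
 then show ?thesis by simp
qed

text \<open>The homotopy identity gives \<open>dd = 0\<close> by induction, because \<open>bar_mod (m + 1)\<close> is generated as a
 left module by the image of the homotopy.\<close>

lemma bd_bd: "z \<in> carrier (bar_mod (Suc (Suc m))) ==> bd m (bd (Suc m) z) = \<zero>\<^bsub>bar_mod m\<^esub>"
proof (induction m arbitrary: z)
 case (0 z)
 note l = bhom_lin[OF bhom_bd] and c = bhom_closed[OF bhom_bd] lin_closed[OF lin_bs]
 have *: "bd 0 (bd 1 (bs 1 y)) = \<zero>\<^bsub>bar_mod 0\<^esub>" if y: "y \<in> carrier (bar_mod 1)" for y
 proof -
  have y': "y \<in> carrier (bar_mod (Suc 0))" using y by simp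
  have "bd 1 (bs 1 y) = y \<ominus>\<^bsub>bar_mod 1\<^esub> bs 0 (bd 0 y)"
   using bs_homotopy[OF y'] y' c by (simp add: vs_eq_minus_iff[OF vsp_bar])
  moreover have "bd 0 (bs 0 (bd 0 y)) \<oplus>\<^bsub>bar_mod 0\<^esub> ub 0 [\<one>, \<zero>] = bd 0 y"
   using bs_homotopy0[OF c(1)[OF y']] baug_bd[OF y] by simp
  moreover have "ub 0 [\<one>, \<zero>] = \<zero>\<^bsub>bar_mod 0\<^esub>"
   by (auto simp: ub_def bar_mod_def co_zero)
  ultimately show ?thesis using y' c by (simp add: lin_minus[OF vsp_bar vsp_bar l] vs_minus_self[OF vsp_bar] vs_zero_right[OF vsp_bar])
 qed
 show ?case
 proof (rule bar_lin_eqI[OF vsp_bar lin_comp[OF l l] lin_const_zero[OF vsp_bar] _ 0])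
  fix as assume as: "as \<in> bar_args R (Suc (Suc 0))"
  then obtain a as' where a: "as = a # as'" "a \<in> carrier R" "as' \<in> bar_args R 1"
   by (cases as) (auto simp: bar_args_def)
  have "ub (Suc (Suc 0)) as = lact (bar_mod (Suc (Suc 0))) a (bs 1 (ub 1 as'))"
   using a cons_args[OF a(3) one_closed] ub_cochain[of "Suc (Suc 0)"]
   by (auto simp: bs_ub bar_cochains_iff[OF vs] cons_args dest!: bspec[of _ _ "\<one> # as'"])
  then show "bd 0 (bd (Suc 0) (ub (Suc (Suc 0)) as)) = \<zero>\<^bsub>bar_mod 0\<^esub>"
   using a *[of "ub 1 as'"] c lin_closed[OF lin_bs[of 1]]
   by (simp add: bhom_lact[OF bhom_bd] carrier_bar ub_closed lin_zero[OF vsp_bar vsp_bar lin_lact[OF bimodule_bar]])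
 qed
next
 case (Suc m z)
 note l = bhom_lin[OF bhom_bd] and c = bhom_closed[OF bhom_bd] lin_closed[OF lin_bs]
 have *: "bd (Suc m) (bd (Suc (Suc m)) (bs (Suc (Suc m)) y)) = \<zero>\<^bsub>bar_mod (Suc m)\<^esub>"
  if y: "y \<in> carrier (bar_mod (Suc (Suc m)))" for y
 proof -
  have "bd (Suc (Suc m)) (bs (Suc (Suc m)) y) = y \<ominus>\<^bsub>bar_mod (Suc (Suc m))\<^esub> bs (Suc m) (bd (Suc m) y)"
   using bs_homotopy[OF y] y c by (simp add: vs_eq_minus_iff[OF vsp_bar])
  moreover have "bd (Suc m) (bs (Suc m) (bd (Suc m) y)) = bd (Suc m) y"
   using bs_homotopy[OF c(1)[OF y]] Suc.IH[OF y] y c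
   by (simp add: lin_zero[OF vsp_bar vsp_bar lin_bs] vs_zero_right[OF vsp_bar])
  ultimately show ?thesis using y c by (simp add: lin_minus[OF vsp_bar vsp_bar l] vs_minus_self[OF vsp_bar])
 qed
 show ?case
 proof (rule bar_lin_eqI[OF vsp_bar lin_comp[OF l l] lin_const_zero[OF vsp_bar] _ Suc.prems])
  fix as assume as: "as \<in> bar_args R (Suc (Suc (Suc m)))"
  then obtain a as' where a: "as = a # as'" "a \<in> carrier R" "as' \<in> bar_args R (Suc (Suc m))"
   by (cases as) (auto simp: bar_args_def)
  have "ub (Suc (Suc (Suc m))) as = lact (bar_mod (Suc (Suc (Suc m)))) a (bs (Suc (Suc m)) (ub (Suc (Suc m)) as'))"
   using a cons_args[OF a(3) one_closed] ub_cochain[of "Suc (Suc (Suc m))"]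
   by (auto simp: bs_ub bar_cochains_iff[OF vs] cons_args dest!: bspec[of _ _ "\<one> # as'"])
  then show "bd (Suc m) (bd (Suc (Suc m)) (ub (Suc (Suc (Suc m))) as)) = \<zero>\<^bsub>bar_mod (Suc m)\<^esub>"
   using a *[of "ub (Suc (Suc m)) as'"] c
   by (simp add: bhom_lact[OF bhom_bd] carrier_bar ub_closed lin_zero[OF vsp_bar vsp_bar lin_lact[OF bimodule_bar]])
 qed
qed

lemma resolution_bar: "resolution R bar_mod bd baug"
proof -
 note c = bhom_closed[OF bhom_bd] lin_closed[OF lin_bs]
 have 1: "baug ` carrier (bar_mod 0) = carrier R"
 proof
  show "carrier R \<subseteq> baug ` carrier (bar_mod 0)"
  proof
   fix r assume r: "r \<in> carrier R"
   then have "[\<one>, r] \<in> bar_args R 0" by (simp add: bar_args_def)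
   then show "r \<in> baug ` carrier (bar_mod 0)"
    using r by (intro image_eqI[of _ _ "ub 0 [\<one>, r]"]) (simp_all add: baug_ub carrier_bar ub_closed)
  qed
 qed (use bhom_closed[OF bhom_baug] in auto)
 have "z \<in> bd 0 ` carrier (bar_mod 1)" if z: "z \<in> carrier (bar_mod 0)" "baug z = \<zero>" for z
 proof -
  have "ub 0 [\<one>, \<zero>] = \<zero>\<^bsub>bar_mod 0\<^esub>"
   by (auto simp: ub_def bar_mod_def co_zero)
  then have "z = bd 0 (bs 0 z)" using bs_homotopy0[OF z(1)] z c by (simp add: vs_zero_right[OF vsp_bar])
  then show ?thesis using c(2)[OF z(1)] by (metis One_nat_def imageI)
 qed
 then have 2: "{z \<in> carrier (bar_mod 0). baug z = \<zero>} = bd 0 ` carrier (bar_mod 1)"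
  using baug_bd c(1)[of _ 0] by auto
 have "z \<in> bd (Suc n) ` carrier (bar_mod (Suc (Suc n)))"
  if z: "z \<in> carrier (bar_mod (Suc n))" "bd n z = \<zero>\<^bsub>bar_mod n\<^esub>" for n z
 proof -
  have "z = bd (Suc n) (bs (Suc n) z)"
   using bs_homotopy[OF z(1)] z c by (simp add: lin_zero[OF vsp_bar vsp_bar lin_bs] vs_zero_right[OF vsp_bar])
  then show ?thesis using c(2)[OF z(1)] by (metis imageI)
 qed
 then have 3: "{z \<in> carrier (bar_mod (Suc n)). bd n z = \<zero>\<^bsub>bar_mod n\<^esub>} = bd (Suc n) ` carrier (bar_mod (Suc (Suc n)))" for n
  using bd_bd[of _ n] c(1) by auto
 show ?thesis
  unfolding resolution_def using bimodule_bar bhom_bd bhom_baug 1 2 3 by simp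
qed

end

section \<open>Bar cochains as homomorphisms from the bar resolution\<close>

context based_algebra
begin

lemma projective_bar: "projective R (bar_mod m)"
 unfolding bar_mod_def by (rule projective_free)

definition beval where "beval m f = (\<lambda>as\<in>bar_args R m. f (ub m as))"

lemma bar_complex_simps [simp]:
 "carrier (bar_complex R M m) = bar_cochains R M m"
 "\<zero>\<^bsub>bar_complex R M m\<^esub> = (\<lambda>x\<in>bar_args R m. \<zero>\<^bsub>M\<^esub>)"
 "f \<oplus>\<^bsub>bar_complex R M m\<^esub> g = (\<lambda>x\<in>bar_args R m. f x \<oplus>\<^bsub>M\<^esub> g x)"
 "c \<odot>\<^bsub>bar_complex R M m\<^esub> f = (\<lambda>x\<in>bar_args R m. c \<odot>\<^bsub>M\<^esub> f x)"
 by (simp_all add: bar_complex_def)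

lemma beval_closed: "f \<in> bimod_hom R (bar_mod m) M ==> beval m f \<in> bar_cochains R M m"
 using bar_cochain_comp[OF bimodule_bar ub_cochain bimod_hom_bhom]
 by (simp add: beval_def cong: restrict_cong)

lemma beval_bij:
 assumes M: "bimodule R M"
 shows "bij_betw (beval m) (bimod_hom R (bar_mod m) M) (bar_cochains R M m)"
proof (rule bij_betw_imageI)
 show "inj_on (beval m) (bimod_hom R (bar_mod m) M)"
 proof (rule inj_onI)
  fix f g assume f: "f \<in> bimod_hom R (bar_mod m) M" and g: "g \<in> bimod_hom R (bar_mod m) M" and eq: "beval m f = beval m g"
  have "f z = g z" if "z \<in> carrier (bar_mod m)" for z
  proof (rule bar_lin_eqI[OF bim_vsp[OF M] _ _ _ that])
   fix as assume "as \<in> bar_args R m"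
   then show "f (ub m as) = g (ub m as)" using fun_cong[OF eq, of as] by (simp add: beval_def)
  qed (use f g in \<open>auto intro: bhom_lin bimod_hom_bhom\<close>)
  then show "f = g" using f g by (intro extensionalityI[of f "carrier (bar_mod m)"]) (auto simp: bimod_hom_iff)
 qed
 show "beval m ` bimod_hom R (bar_mod m) M = bar_cochains R M m"
 proof
  show "bar_cochains R M m \<subseteq> beval m ` bimod_hom R (bar_mod m) M"
  proof
   fix f assume f: "f \<in> bar_cochains R M m"
   have "f = beval m (\<lambda>x\<in>carrier (bar_mod m). bext M f x)"
    using f by (intro extensionalityI[of f "bar_args R m"])
     (auto simp: beval_def bar_cochains_iff[OF vs] carrier_bar ub_closed bext_ub[OF M f])
   then show "f \<in> beval m ` bimod_hom R (bar_mod m) M"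
    using bimod_homI[OF bimodule_bar bhom_bext[OF M f]] by blast
  qed
 qed (auto simp: beval_closed)
qed

text \<open>Transported along the bijection \<open>beval\<close> from a space of homomorphisms, in
  place of a direct check that cochains are closed under the operations.\<close>

lemma vsp_bar_complex:
 assumes M: "bimodule R M"
 shows "vsp (bar_complex R M m)"
 using cplx_vsp[OF hom_cplx[OF resolution_bar M], of m] beval_bij[OF M, of m] vs_zero[OF cplx_vsp[OF hom_cplx[OF resolution_bar M], of m]]
  vs_add[OF cplx_vsp[OF hom_cplx[OF resolution_bar M], of m]] vs_smult[OF cplx_vsp[OF hom_cplx[OF resolution_bar M], of m]]
 by (intro vsp_image[of "hom_complex R bar_mod M m" "bimod_hom R (bar_mod m) M" _ "beval m"])
  (auto simp: hom_complex_def bij_betw_def beval_def carrier_bar ub_closed intro!: restrict_ext)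

lemma beval_lin: "bimodule R M ==> lin (hom_complex R bar_mod M m) (bar_complex R M m) (beval m)"
 by (rule linI) (auto simp: hom_complex_def beval_closed, auto simp: beval_def carrier_bar ub_closed intro!: restrict_ext)

lemma beval_diff:
 assumes M: "bimodule R M" and f: "f \<in> bimod_hom R (bar_mod m) M"
 shows "beval (Suc m) (hom_diff bar_mod bd m f) = bar_diff R M m (beval m f)"
proof (rule extensionalityI[of _ "bar_args R (Suc m)"])
 fix as assume as: "as \<in> bar_args R (Suc m)"
 have "bar_diff R M m (beval m f) as = f (bar_diff R (bar_mod m) m (\<lambda>as\<in>bar_args R m. ub m as) as)"
  using bar_diff_comp[OF bimodule_bar M ub_cochain bimod_hom_bhom[OF f] as] by (simp add: beval_def cong: restrict_cong)
 then show "beval (Suc m) (hom_diff bar_mod bd m f) as = bar_diff R M m (beval m f) as"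
  using as by (simp add: beval_def hom_diff_def carrier_bar ub_closed bd_ub)
qed (auto simp: beval_def bar_diff_def)

lemma
 assumes M: "bimodule R M"
 shows bar_cplx: "cplx (bar_complex R M) (bar_diff R M)"
  and beval_quasi: "quasi (hom_complex R bar_mod M) (hom_diff bar_mod bd) (bar_complex R M) (bar_diff R M) m (beval m)"
proof -
 note C = hom_cplx[OF resolution_bar M]
 have 1: "bij_betw (beval m) (carrier (hom_complex R bar_mod M m)) (carrier (bar_complex R M m))" for m
  using beval_bij[OF M] by (simp add: hom_complex_def)
 have 2: "beval (Suc m) (hom_diff bar_mod bd m x) = bar_diff R M m (beval m x)" if "x \<in> carrier (hom_complex R bar_mod M m)" for m x
  using that beval_diff[OF M] by (simp add: hom_complex_def)
 show "cplx (bar_complex R M) (bar_diff R M)" "quasi (hom_complex R bar_mod M) (hom_diff bar_mod bd) (bar_complex R M) (bar_diff R M) m (beval m)"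
  by (rule quasi_iso[where C = "hom_complex R bar_mod M" and \<delta> = "hom_diff bar_mod bd" and \<theta> = beval];
    intro C vsp_bar_complex[OF M] beval_lin[OF M] 1 2; assumption)+
qed

text \<open>\<open>\<psi>\<close> consists of the images of the universal cochains under one chain
  map and is chosen before \<open>M\<close>, so a single \<open>\<psi>\<close> identifies the
  cohomology with different coefficients.\<close>

theorem bar_comparison_iso:
 assumes P: "projective_resolution R P d \<epsilon>"
 shows "\<exists>\<psi>. bar_comparison R P d \<epsilon> \<psi> \<and> (\<forall>M. bimodule R M --> (\<forall>m. lin_iso (HH R P d M m)
  (cohomology (bar_complex R M) (bar_diff R M) m) (to_bar R P d \<psi> M m)))"
proof -
 note res = projective_resolutionD(1)[OF P] and proj = projective_resolutionD(2)[OF P]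
 obtain \<phi> where \<phi>: "chain_map R bar_mod bd baug P d \<epsilon> \<phi>"
  using chain_map_exists[OF resolution_bar projective_bar res] by blast
 then have ph: "bhom R (bar_mod m) (P m) (\<phi> m)" for m by (simp add: chain_map_def)
 define \<psi> where "\<psi> m = (\<lambda>as\<in>bar_args R m. \<phi> m (ub m as))" for m
 have \<psi>': "\<psi> m = (\<lambda>as\<in>bar_args R m. \<phi> m ((\<lambda>as\<in>bar_args R m. ub m as) as))" for m
  by (simp add: \<psi>_def cong: restrict_cong)
 have "bar_comparison R P d \<epsilon> \<psi>"
  unfolding bar_comparison_def
 proof (intro conjI allI ballI)
  show "\<psi> m \<in> bar_cochains R (P m) m" for m
   unfolding \<psi>' by (rule bar_cochain_comp[OF bimodule_bar ub_cochain ph])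
  fix r s assume "r \<in> carrier R" "s \<in> carrier R"
  then have rs: "[r, s] \<in> bar_args R 0" by (simp add: bar_args_def)
  then show "\<epsilon> (\<psi> 0 [r, s]) = r \<otimes> s"
   using \<phi> by (simp add: \<psi>_def chain_map_def carrier_bar ub_closed baug_ub)
 next
  fix m as assume as: "as \<in> bar_args R (Suc m)"
  show "d m (\<psi> (Suc m) as) = bar_diff R (P m) m (\<psi> m) as"
   using \<phi> as bar_diff_comp[OF bimodule_bar res_bim[OF res] ub_cochain ph as]
   by (simp add: \<psi>'[of m] bd_ub[symmetric]) (simp add: \<psi>_def chain_map_def carrier_bar ub_closed)
 qed
 moreover have "lin_iso (HH R P d M m) (cohomology (bar_complex R M) (bar_diff R M) m) (to_bar R P d \<psi> M m)"
  if M: "bimodule R M" for M :: "('k, 'a, 'm) bimodule" and m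
  unfolding HH_def to_bar_def
 proof (rule quasi_lin_iso[OF hom_cplx[OF res M] bar_cplx[OF M] quasi_cong[OF hom_cplx[OF res M]]])
  show "quasi (hom_complex R P M) (hom_diff P d) (bar_complex R M) (bar_diff R M) m (\<lambda>f. beval m (pull bar_mod \<phi> m f))"
   by (rule quasi_comp[OF cplx_vsp[OF hom_cplx[OF res M]] hom_cplx[OF resolution_bar M] bar_cplx[OF M]
      comparison_quasi[OF res proj resolution_bar projective_bar \<phi> M] beval_quasi[OF M]])
 qed (auto simp: beval_def pull_def \<psi>_def carrier_bar ub_closed intro!: restrict_ext)
 ultimately show ?thesis by blast
qed

end

section \<open>Quantum symmetric algebras\<close>

abbreviation FA where "FA \<equiv> free_algebra"

lemma free_algebra_simps [simp]:
 "carrier FA = FS UNIV"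
 "\<zero>\<^bsub>FA\<^esub> = (\<lambda>w. 0)" "f \<oplus>\<^bsub>FA\<^esub> g = (\<lambda>w. f w + g w)" "c \<odot>\<^bsub>FA\<^esub> f = (\<lambda>w. c * f w)"
 by (simp_all add: free_algebra_def carrier_fsm)

lemma free_algebra_mult: "f \<otimes>\<^bsub>FA\<^esub> g = (\<lambda>w. \<Sum>i\<le>length w. f (take i w) * g (drop i w))"
 by (simp add: free_algebra_def)

lemma free_algebra_one: "\<one>\<^bsub>FA\<^esub> = dl []"
 by (auto simp: free_algebra_def dl_def)

lemma vsp_free_algebra: "vsp FA"
 by (rule vsp_cong[of "fsm UNIV"]) simp_all

lemma lin_free_algebra [simp]: "lin FA M f = lin (fsm UNIV) M f" "lin N FA g = lin N (fsm UNIV) g"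
 by (simp_all add: lin_def)

lemma fsm_plus: "f \<in> FS I ==> g \<in> FS I ==> (\<lambda>i. f i + g i) \<in> FS I"
 using vs_add[OF vsp_fsm, of f I g] by simp

lemma free_algebra_mult_closed:
 assumes "f \<in> FS UNIV" "g \<in> FS UNIV"
 shows "f \<otimes>\<^bsub>FA\<^esub> g \<in> FS UNIV"
proof (rule fsmI[of "(\<lambda>(u, v). u @ v) ` ({u. f u \<noteq> 0} \<times> {v. g v \<noteq> 0})"])
 fix w assume "(f \<otimes>\<^bsub>FA\<^esub> g) w \<noteq> 0"
 then obtain i where "f (take i w) * g (drop i w) \<noteq> 0"
  unfolding free_algebra_mult by (metis (no_types, lifting) sum.neutral)
 then show "w \<in> (\<lambda>(u, v). u @ v) ` ({u. f u \<noteq> 0} \<times> {v. g v \<noteq> 0})"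
  by (intro image_eqI[of _ _ "(take i w, drop i w)"]) auto
qed (use assms in \<open>auto simp: carrier_fsm\<close>)

lemma free_algebra_assoc:
 "(f \<otimes>\<^bsub>FA\<^esub> g) \<otimes>\<^bsub>FA\<^esub> h = f \<otimes>\<^bsub>FA\<^esub> (g \<otimes>\<^bsub>FA\<^esub> h)"
proof
 fix w :: "'a list"
 let ?n = "length w"
 have "((f \<otimes>\<^bsub>FA\<^esub> g) \<otimes>\<^bsub>FA\<^esub> h) w =
   (\<Sum>i\<le>?n. \<Sum>j\<le>i. f (take j w) * g (take (i - j) (drop j w)) * h (drop i w))"
  unfolding free_algebra_mult
 proof (rule sum.cong[OF refl])
  fix i assume i: "i \<in> {..?n}"
  then have "length (take i w) = i" by simp
  moreover have "f (take j (take i w)) * g (drop j (take i w)) = f (take j w) * g (take (i - j) (drop j w))"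
   if "j \<le> i" for j using that by (simp add: min.absorb1 drop_take)
  ultimately show "(\<Sum>j\<le>length (take i w). f (take j (take i w)) * g (drop j (take i w))) * h (drop i w) =
    (\<Sum>j\<le>i. f (take j w) * g (take (i - j) (drop j w)) * h (drop i w))"
   unfolding sum_distrib_right by (intro sum.cong) auto
 qed
 also have "\<dots> = (\<Sum>(i, j)\<in>(SIGMA i:{..?n}. {..i}). f (take j w) * g (take (i - j) (drop j w)) * h (drop i w))"
  by (rule sum.Sigma) auto
 \<comment> \<open>Two cut points \<open>j \<le> i\<close> are recorded instead by the lengths
   \<open>j\<close> and \<open>i - j\<close> of the first two pieces.\<close>
 also have "\<dots> = (\<Sum>(j, l)\<in>(SIGMA j:{..?n}. {..?n - j}). f (take j w) * (g (take l (drop j w)) * h (drop l (drop j w))))"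
  by (rule sum.reindex_bij_witness[of _ "\<lambda>(j, l). (j + l, j)" "\<lambda>(i, j). (j, i - j)"])
   (auto simp: mult.assoc)
 also have "\<dots> = (\<Sum>j\<le>?n. \<Sum>l\<le>?n - j. f (take j w) * (g (take l (drop j w)) * h (drop l (drop j w))))"
  by (rule sum.Sigma[symmetric]) auto
 also have "\<dots> = (f \<otimes>\<^bsub>FA\<^esub> (g \<otimes>\<^bsub>FA\<^esub> h)) w"
  by (simp add: free_algebra_mult sum_distrib_left)
 finally show "((f \<otimes>\<^bsub>FA\<^esub> g) \<otimes>\<^bsub>FA\<^esub> h) w = (f \<otimes>\<^bsub>FA\<^esub> (g \<otimes>\<^bsub>FA\<^esub> h)) w" .
qed

lemma dl_mult_left: "(dl u \<otimes>\<^bsub>FA\<^esub> f) w = (if take (length u) w = u then f (drop (length u) w) else 0)"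
proof -
 have "(dl u \<otimes>\<^bsub>FA\<^esub> f) w = (\<Sum>i\<le>length w. if i = length u then (if take i w = u then f (drop i w) else 0) else 0)"
  unfolding free_algebra_mult by (rule sum.cong) (auto simp: dl_def)
 also have "\<dots> = (if take (length u) w = u then f (drop (length u) w) else 0)"
  by (cases "length u \<le> length w") auto
 finally show ?thesis .
qed

lemma dl_mult_right: "(f \<otimes>\<^bsub>FA\<^esub> dl []) w = f w"
proof -
 have "(f \<otimes>\<^bsub>FA\<^esub> dl []) w = (\<Sum>i\<le>length w. if i = length w then f (take i w) else 0)"
  unfolding free_algebra_mult by (rule sum.cong) (auto simp: dl_def)
 then show ?thesis by simp
qed

lemma dl_mult: "dl u \<otimes>\<^bsub>FA\<^esub> dl v = dl (u @ v)"
proof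
 fix w
 have "take (length u) w = u \<and> drop (length u) w = v \<longleftrightarrow> w = u @ v"
  by (metis append_eq_conv_conj append_take_drop_id)
 then show "(dl u \<otimes>\<^bsub>FA\<^esub> dl v) w = dl (u @ v) w"
  by (simp add: dl_mult_left) (auto simp: dl_def)
qed

lemma free_algebra_distrib:
 "(f \<oplus>\<^bsub>FA\<^esub> g) \<otimes>\<^bsub>FA\<^esub> h = f \<otimes>\<^bsub>FA\<^esub> h \<oplus>\<^bsub>FA\<^esub> g \<otimes>\<^bsub>FA\<^esub> h"
 "h \<otimes>\<^bsub>FA\<^esub> (f \<oplus>\<^bsub>FA\<^esub> g) = h \<otimes>\<^bsub>FA\<^esub> f \<oplus>\<^bsub>FA\<^esub> h \<otimes>\<^bsub>FA\<^esub> g"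
 "(c \<odot>\<^bsub>FA\<^esub> f) \<otimes>\<^bsub>FA\<^esub> h = c \<odot>\<^bsub>FA\<^esub> (f \<otimes>\<^bsub>FA\<^esub> h)"
 "f \<otimes>\<^bsub>FA\<^esub> (c \<odot>\<^bsub>FA\<^esub> h) = c \<odot>\<^bsub>FA\<^esub> (f \<otimes>\<^bsub>FA\<^esub> h)"
 by (simp_all add: free_algebra_mult sum.distrib distrib_left distrib_right sum_distrib_left mult.assoc mult.left_commute)

lemma ring_free_algebra: "Ring.ring (FA :: ('k::field, 'n list => 'k) module)"
proof (rule ringI)
 show "abelian_group (FA :: ('k, 'n list => 'k) module)" by (rule vsp_abelian_group[OF vsp_free_algebra])
 show "Group.monoid (FA :: ('k, 'n list => 'k) module)"
  by (rule monoidI)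
   (auto simp: free_algebra_mult_closed free_algebra_assoc free_algebra_one dl_mult_left dl_mult_right fun_eq_iff)
qed (rule free_algebra_distrib)+

definition unitv :: "'n => 'n => nat" where
 "unitv i = (\<lambda>j. if j = i then 1 else 0)"

definition cnt :: "'n list => 'n => nat" where
 "cnt w = (\<lambda>i. count_list w i)"

definition plusv :: "('n => nat) => ('n => nat) => 'n => nat" where
 "plusv al be = (\<lambda>i. al i + be i)"

lemma cnt_simps: "cnt [] = (\<lambda>i. 0)" "cnt (i # w) = plusv (unitv i) (cnt w)" "cnt (u @ w) = plusv (cnt u) (cnt w)"
 by (auto simp: cnt_def plusv_def unitv_def fun_eq_iff)

text \<open>Allows a monomial to be replaced by a word with the same content; products of words are
  concatenations.\<close>

lemma ex_cnt: "\<exists>w. cnt w = (al :: 'n::finite => nat)"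
proof -
 have r: "count_list (replicate n i) j = (if i = j then n else 0)" for n and i j :: 'n
  by (induction n) auto
 have "count_list (concat (map (\<lambda>i. replicate (al i) i) xs)) j = (if j \<in> set xs then al j else 0)"
  if "distinct xs" for xs j
  using that by (induction xs) (auto simp: r)
 moreover obtain xs :: "'n list" where "set xs = UNIV" "distinct xs"
  using finite_distinct_list[of "UNIV :: 'n set"] by auto
 ultimately have "cnt (concat (map (\<lambda>i. replicate (al i) i) xs)) = al" by (auto simp: cnt_def)
 then show ?thesis by blast
qed

text \<open>The bicharacter with \<open>x\<^sup>\<alpha> x\<^sup>\<beta> = sig q \<alpha> \<beta> \<cdot> x\<^bsup>\<alpha>+\<beta>\<^esup>\<close>.\<close>

definition sig :: "('n::{finite,linorder} => 'n => 'k::field) => ('n => nat) => ('n => nat) => 'k" where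
 "sig q al be = (\<Prod>i\<in>UNIV. \<Prod>j\<in>{..<i}. q i j ^ (al i * be j))"

text \<open>The scalar produced by sorting a word: in \<open>A\<close> the word \<open>w\<close> is
  \<open>tau q w\<close> times the monomial with exponent \<open>cnt w\<close>, as
  \<open>qp_word\<close> confirms.\<close>

primrec tau :: "('n::{finite,linorder} => 'n => 'k::field) => 'n list => 'k" where
 "tau q [] = 1"
| "tau q (i # w) = sig q (unitv i) (cnt w) * tau q w"

locale quantum =
 fixes q :: "'n::{finite,linorder} => 'n => 'k::field"
 assumes q_nonzero: "q i j \<noteq> 0" and q_diag: "q i i = 1" and q_inverse: "q j i = inverse (q i j)"
begin

lemma sig_plus: "sig q (plusv al al') be = sig q al be * sig q al' be" "sig q al (plusv be be') = sig q al be * sig q al be'"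
 by (simp_all add: sig_def plusv_def prod.distrib[symmetric] power_add add_mult_distrib add_mult_distrib2)

lemma sig_zero: "sig q (\<lambda>i. 0) be = 1" "sig q al (\<lambda>i. 0) = 1"
 by (simp_all add: sig_def)

lemma sig_nonzero: "sig q al be \<noteq> 0"
 by (simp add: sig_def q_nonzero)

lemma sig_unit_left: "sig q (unitv i) be = (\<Prod>j\<in>{..<i}. q i j ^ be j)"
proof -
 have "sig q (unitv i) be = (\<Prod>i'\<in>UNIV. if i' = i then (\<Prod>j\<in>{..<i}. q i j ^ be j) else 1)"
  unfolding sig_def by (rule prod.cong) (auto simp: unitv_def)
 then show ?thesis by simp
qed

lemma sig_unit_right: "sig q al (unitv j) = (\<Prod>i\<in>{j<..}. q i j ^ al i)"
proof -
 have "sig q al (unitv j) = (\<Prod>i\<in>UNIV. if j < i then q i j ^ al i else 1)"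
  unfolding sig_def
 proof (rule prod.cong)
  fix i
  have "(\<Prod>j'\<in>{..<i}. q i j' ^ (al i * unitv j j')) = (\<Prod>j'\<in>{..<i}. if j' = j then q i j ^ al i else 1)"
   by (rule prod.cong) (auto simp: unitv_def)
  then show "(\<Prod>j'\<in>{..<i}. q i j' ^ (al i * unitv j j')) = (if j < i then q i j ^ al i else 1)" by simp
 qed simp
 also have "\<dots> = (\<Prod>i\<in>{j<..}. q i j ^ al i)"
  by (rule prod.mono_neutral_cong_right) auto
 finally show ?thesis .
qed

lemma tau_append: "tau q (u @ w) = tau q u * tau q w * sig q (cnt u) (cnt w)"
 by (induction u) (simp_all add: cnt_simps sig_plus sig_zero)

lemma tau_nonzero: "tau q w \<noteq> 0"
 by (induction w) (simp_all add: sig_nonzero)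

text \<open>The expected normal form, defined on the free algebra, where no relation has to be
  respected. That it kills the ideal (\<open>Phi_ideal\<close>) is the linear independence of the
  monomials.\<close>

definition Phi :: "('n list => 'k) => ('n => nat) => 'k" where
 "Phi = lext (fsm UNIV) (\<lambda>w al. tau q w * dl (cnt w) al)"

lemma tau_dl_fsm: "(\<lambda>al. c * dl be al) \<in> FS UNIV"
 by (rule fsm_scale) simp

lemma lin_Phi: "lin (fsm UNIV) (fsm UNIV) Phi"
 unfolding Phi_def by (rule lin_lext) (simp_all add: tau_dl_fsm)

lemma Phi_dl: "Phi (dl w) = (\<lambda>al. tau q w * dl (cnt w) al)"
 unfolding Phi_def by (rule lext_dl) (simp_all add: tau_dl_fsm)

text \<open>Since \<open>sig\<close> is multiplicative in both arguments, multiplication by a word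
  acts on normal forms as a scaled shift \<open>S\<close>. So \<open>Phi\<close> of the product is
  \<open>S (Phi f)\<close>, and the kernel of \<open>Phi\<close> is a two-sided ideal.\<close>

lemma Phi_mult_zero:
 assumes f: "f \<in> FS UNIV" "Phi f = (\<lambda>_. 0)" and g: "g \<in> FS UNIV"
 shows "Phi (g \<otimes>\<^bsub>FA\<^esub> f) = (\<lambda>_. 0)" "Phi (f \<otimes>\<^bsub>FA\<^esub> g) = (\<lambda>_. 0)"
proof -
 have mult: "lin (fsm UNIV) (fsm UNIV) (\<lambda>f. h \<otimes>\<^bsub>FA\<^esub> f)" "lin (fsm UNIV) (fsm UNIV) (\<lambda>f. f \<otimes>\<^bsub>FA\<^esub> h)"
  if "h \<in> FS UNIV" for h :: "'n list => 'k"
  using that free_algebra_distrib[where h = h] free_algebra_distrib(3)[where h = h] free_algebra_distrib(4)[where f = h]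
  by (auto intro!: linI simp: free_algebra_mult_closed)
 have zero: "lin (fsm UNIV) (fsm UNIV) (\<lambda>f. \<lambda>_. 0)" using lin_const_zero[OF vsp_fsm] by simp
 have shift: "\<exists>S. lin (fsm UNIV) (fsm UNIV) S \<and> (\<forall>al. S (dl al) = (\<lambda>\<gamma>. k al * dl (plusv be al) \<gamma>))" for k :: "('n => nat) => 'k" and be
  by (intro exI[of _ "lext (fsm UNIV) (\<lambda>al \<gamma>. k al * dl (plusv be al) \<gamma>)"] conjI allI lin_lext lext_dl)
   (simp_all add: tau_dl_fsm)
 have word: "Phi (dl v \<otimes>\<^bsub>FA\<^esub> f) = (\<lambda>_. 0) \<and> Phi (f \<otimes>\<^bsub>FA\<^esub> dl v) = (\<lambda>_. 0)" for v
 proof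
  obtain S where S: "lin (fsm UNIV) (fsm UNIV) S" "\<And>al. S (dl al) = (\<lambda>\<gamma>. (tau q v * sig q (cnt v) al) * dl (plusv (cnt v) al) \<gamma>)"
   using shift[of "\<lambda>al. tau q v * sig q (cnt v) al" "cnt v"] by auto
  have "Phi (dl v \<otimes>\<^bsub>FA\<^esub> f) = S (Phi f)"
   by (rule lin_fsm_eqI[OF vsp_fsm lin_comp[OF mult(1) lin_Phi] lin_comp[OF lin_Phi S(1)] _ f(1)])
    (use lin_smult[OF S(1)] in \<open>auto simp: dl_mult Phi_dl S(2) tau_append cnt_simps\<close>)
  then show "Phi (dl v \<otimes>\<^bsub>FA\<^esub> f) = (\<lambda>_. 0)" using f(2) lin_zero[OF vsp_fsm vsp_fsm S(1)] by simp
  obtain S where S: "lin (fsm UNIV) (fsm UNIV) S" "\<And>al. S (dl al) = (\<lambda>\<gamma>. (tau q v * sig q al (cnt v)) * dl (plusv (cnt v) al) \<gamma>)"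
   using shift[of "\<lambda>al. tau q v * sig q al (cnt v)" "cnt v"] by auto
  have "plusv (cnt w) (cnt v) = plusv (cnt v) (cnt w)" for w by (simp add: plusv_def add.commute)
  then have "Phi (f \<otimes>\<^bsub>FA\<^esub> dl v) = S (Phi f)"
   by (intro lin_fsm_eqI[OF vsp_fsm lin_comp[OF mult(2) lin_Phi] lin_comp[OF lin_Phi S(1)] _ f(1)])
    (use lin_smult[OF S(1)] in \<open>auto simp: dl_mult Phi_dl S(2) tau_append cnt_simps\<close>)
  then show "Phi (f \<otimes>\<^bsub>FA\<^esub> dl v) = (\<lambda>_. 0)" using f(2) lin_zero[OF vsp_fsm vsp_fsm S(1)] by simp
 qed
 show "Phi (g \<otimes>\<^bsub>FA\<^esub> f) = (\<lambda>_. 0)"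
  by (rule lin_fsm_eqI[OF vsp_fsm lin_comp[OF mult(2)[OF f(1)] lin_Phi] zero _ g]) (use word in simp)
 show "Phi (f \<otimes>\<^bsub>FA\<^esub> g) = (\<lambda>_. 0)"
  by (rule lin_fsm_eqI[OF vsp_fsm lin_comp[OF mult(1)[OF f(1)] lin_Phi] zero _ g]) (use word in simp)
qed

lemma gen_dl: "gen i = dl [i]"
 by (simp add: gen_def dl_def)

definition rels where
 "rels = {gen i \<otimes>\<^bsub>FA\<^esub> gen j \<ominus>\<^bsub>FA\<^esub>
    q i j \<odot>\<^bsub>FA\<^esub> (gen j \<otimes>\<^bsub>FA\<^esub> gen i) | i j. True}"

lemma rels_eq: "rels = {(\<lambda>w. dl [i, j] w - q i j * dl [j, i] w) | i j. True}"
proof -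
 have "gen i \<otimes>\<^bsub>FA\<^esub> gen j \<ominus>\<^bsub>FA\<^esub> q i j \<odot>\<^bsub>FA\<^esub> (gen j \<otimes>\<^bsub>FA\<^esub> gen i) =
   (\<lambda>w. dl [i, j] w - q i j * dl [j, i] w)" for i j
  by (subst vs_minus_eq[OF vsp_free_algebra]) (auto simp: gen_dl dl_mult fsm_scale)
 then show ?thesis by (simp add: rels_def)
qed

lemma dl_diff_fsm: "(\<lambda>w. dl u w - c * dl v w) \<in> FS UNIV"
 by (rule fsmI[of "{u, v}"]) (auto simp: dl_def split: if_splits)

lemma rels_carrier: "rels \<subseteq> carrier FA"
 by (auto simp: rels_eq dl_diff_fsm)

lemma ideal_qsym: "ideal (qsym_ideal q) FA"
 using ring.genideal_ideal[OF ring_free_algebra rels_carrier] by (simp add: qsym_ideal_def rels_def)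

lemma sig_unit_unit: "sig q (unitv i) (unitv j) = (if j < i then q i j else 1)"
proof -
 have "(\<Prod>j'\<in>{..<i}. q i j' ^ unitv j j') = (\<Prod>j'\<in>{..<i}. if j' = j then q i j else 1)"
  by (rule prod.cong) (auto simp: unitv_def)
 then show ?thesis by (simp add: sig_unit_left)
qed

lemma Phi_ideal: "f \<in> qsym_ideal q ==> Phi f = (\<lambda>_. 0)"
proof -
 define K where "K = {f \<in> FS UNIV. Phi f = (\<lambda>_. 0)}"
 have add: "Phi (\<lambda>w. f w + g w) = (\<lambda>al. Phi f al + Phi g al)" "Phi (\<lambda>w. c * f w) = (\<lambda>al. c * Phi f al)"
  if "f \<in> FS UNIV" "g \<in> FS UNIV" for f g c
  using lin_add[OF lin_Phi that] lin_smult[OF lin_Phi that(1)] by simp_all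
 have "ideal K FA"
 proof (rule idealI[OF ring_free_algebra])
  show "subgroup K (add_monoid FA)"
  proof (rule group.subgroupI)
   show "Group.group (add_monoid (FA :: ('k, 'n list => 'k) module))"
    using vsp_abelian_group[OF vsp_free_algebra] abelian_group.a_group by blast
   show "K \<noteq> {}" using lin_zero[OF vsp_fsm vsp_fsm lin_Phi] vs_zero[OF vsp_fsm, of UNIV] by (auto simp: K_def)
  next
   fix f assume f: "f \<in> K"
   then have "\<ominus>\<^bsub>FA\<^esub> f = (\<lambda>w. - 1 * f w)" using vs_neg_eq[OF vsp_free_algebra, of f] by (simp add: K_def)
   moreover have "(\<lambda>w. - 1 * f w) \<in> K" using f add(2)[of f f "-1"] fsm_scale[of f UNIV "-1"] by (simp add: K_def)
   ultimately show "inv\<^bsub>add_monoid FA\<^esub> f \<in> K" by (simp add: a_inv_def)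
  next
   fix f g assume fg: "f \<in> K" "g \<in> K"
   then show "f \<otimes>\<^bsub>add_monoid FA\<^esub> g \<in> K"
    using add(1)[of f g] vs_add[OF vsp_fsm, of f UNIV g] by (simp add: K_def)
  qed (auto simp: K_def)
 qed (auto simp: K_def Phi_mult_zero free_algebra_mult_closed)
 moreover have "rels \<subseteq> K"
 proof -
  have "Phi (\<lambda>w. dl [i, j] w - q i j * dl [j, i] w) = (\<lambda>_. 0)" for i j
  proof -
   have "Phi (\<lambda>w. dl [i, j] w - q i j * dl [j, i] w) = (\<lambda>al. Phi (dl [i, j]) al - q i j * Phi (dl [j, i]) al)"
    using add(1)[of "dl [i, j]" "\<lambda>w. - q i j * dl [j, i] w"] add(2)[of "dl [j, i]" "dl [j, i]" "- q i j"]
     fsm_scale[of "dl [j, i]" UNIV "- q i j"]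
    by simp
   moreover have "cnt [i, j] = cnt [j, i]" by (simp add: cnt_def fun_eq_iff)
   moreover have "tau q [k, l] = (if l < k then q k l else 1)" for k l
   proof -
    have "cnt [l] = unitv l" by (auto simp: cnt_def unitv_def)
    then show ?thesis by (simp add: sig_unit_unit) (simp add: cnt_simps(1) sig_zero)
   qed
   \<comment> \<open>The two words have the same content; their sorting scalars differ by the factor
     \<open>q i j\<close>, because \<open>q j i\<close> is its inverse or, for \<open>i = j\<close>,
     because it is 1.\<close>
   moreover have "(if j < i then q i j else 1) = q i j * (if i < j then q j i else 1)"
    using q_inverse[of j i] q_nonzero[of j i] q_diag by (cases i j rule: linorder_cases) auto
   ultimately show ?thesis by (simp only: Phi_dl) (simp add: fun_eq_iff)
  qed
  then show ?thesis by (auto simp: rels_eq K_def dl_diff_fsm)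
 qed
 ultimately have "qsym_ideal q \<subseteq> K"
  using ring.genideal_minimal[OF ring_free_algebra] by (simp add: qsym_ideal_def rels_def)
 then show "f \<in> qsym_ideal q ==> Phi f = (\<lambda>_. 0)" by (auto simp: K_def)
qed

section \<open>The quotient algebra and its monomial basis\<close>

abbreviation qA :: "('k, ('n list => 'k) set) module" where "qA \<equiv> qsym q"

definition qp :: "('n list => 'k) => ('n list => 'k) set" where
 "qp f = qsym_ideal q +>\<^bsub>FA\<^esub> f"

text \<open>A ring ideal is closed under scalars because \<open>c f\<close> is the product of
  \<open>c 1\<close> with \<open>f\<close>.\<close>

lemma subsp_ideal: "subsp FA (qsym_ideal q)"
proof -
 interpret ideal "qsym_ideal q" FA by (rule ideal_qsym)
 have "c \<odot>\<^bsub>FA\<^esub> f \<in> qsym_ideal q" if f: "f \<in> qsym_ideal q" for c f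
 proof -
  have 1: "c \<odot>\<^bsub>FA\<^esub> \<one>\<^bsub>FA\<^esub> \<in> carrier (FA :: ('k, 'n list => 'k) module)"
   using vs_smult[OF vsp_free_algebra one_closed] .
  have "(c \<odot>\<^bsub>FA\<^esub> \<one>\<^bsub>FA\<^esub>) \<otimes>\<^bsub>FA\<^esub> f = c \<odot>\<^bsub>FA\<^esub> f"
   unfolding free_algebra_distrib(3) using a_Hcarr[OF f] by (subst l_one) simp_all
  then show ?thesis using I_l_closed[OF f 1] by simp
 qed
 moreover have "f \<oplus>\<^bsub>FA\<^esub> g \<in> qsym_ideal q" if "f \<in> qsym_ideal q" "g \<in> qsym_ideal q" for f g
  using that by (rule additive_subgroup.a_closed[OF is_additive_subgroup])
 ultimately show ?thesis
  using a_subset additive_subgroup.zero_closed[OF is_additive_subgroup]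
  unfolding subsp_def by blast
qed

lemma subsp_carrier: "vsp V ==> subsp V (carrier V)"
 by (simp add: subsp_def)

lemma ideal_carrier: "qsym_ideal q \<subseteq> carrier FA"
 using subsp_ideal by (simp add: subsp_def)

lemmas quot_facts = vsp_free_algebra subsp_carrier[OF vsp_free_algebra] subsp_ideal ideal_carrier

lemma qsym_simps:
 "carrier qA = qp ` FS UNIV"
 "\<zero>\<^bsub>qA\<^esub> = qp (\<lambda>_. 0)"
 "f \<in> FS UNIV ==> g \<in> FS UNIV ==> qp f \<oplus>\<^bsub>qA\<^esub> qp g = qp (\<lambda>w. f w + g w)"
 "f \<in> FS UNIV ==> c \<odot>\<^bsub>qA\<^esub> qp f = qp (\<lambda>w. c * f w)"
 "f \<in> FS UNIV ==> g \<in> FS UNIV ==> qp f \<otimes>\<^bsub>qA\<^esub> qp g = qp (f \<otimes>\<^bsub>FA\<^esub> g)"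
 "\<one>\<^bsub>qA\<^esub> = qp (dl [])"
proof -
 show "carrier qA = qp ` FS UNIV"
  by (auto simp: qsym_def ring.defs module.defs FactRing_def A_RCOSETS_def' qp_def)
 show "\<zero>\<^bsub>qA\<^esub> = qp (\<lambda>_. 0)"
  using coset_zero[OF quot_facts] by (simp add: qsym_def ring.defs module.defs FactRing_def qp_def quotient_space_def)
 show "\<one>\<^bsub>qA\<^esub> = qp (dl [])"
  by (simp add: qsym_def ring.defs module.defs FactRing_def qp_def free_algebra_one)
 show "qp f \<oplus>\<^bsub>qA\<^esub> qp g = qp (\<lambda>w. f w + g w)" if "f \<in> FS UNIV" "g \<in> FS UNIV"
  using coset_add[OF quot_facts, of f g] that
  by (simp add: qsym_def ring.defs module.defs FactRing_def qp_def quotient_space_def)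
 show "c \<odot>\<^bsub>qA\<^esub> qp f = qp (\<lambda>w. c * f w)" if "f \<in> FS UNIV"
  using coset_smult[OF quot_facts, of f c] that
  by (simp add: qsym_def ring.defs module.defs FactRing_def qp_def quotient_space_def)
 show "qp f \<otimes>\<^bsub>qA\<^esub> qp g = qp (f \<otimes>\<^bsub>FA\<^esub> g)" if "f \<in> FS UNIV" "g \<in> FS UNIV"
  using ideal.rcoset_mult_add[OF ideal_qsym, of f g] that
  by (simp add: qsym_def ring.defs module.defs FactRing_def qp_def)
qed

lemma qp_eq: "f \<in> FS UNIV ==> g \<in> FS UNIV ==> qp f = qp g \<longleftrightarrow> (\<lambda>w. f w - g w) \<in> qsym_ideal q"
 using coset_eq_iff[OF vsp_free_algebra subsp_ideal, of f g] vs_minus_eq[OF vsp_free_algebra, of f g] by (simp add: qp_def)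

lemma vsp_qsym: "vsp qA"
 by (rule vsp_image[OF vsp_fsm[of UNIV], of "FS UNIV" _ qp])
  (use vs_add[OF vsp_fsm] vs_smult[OF vsp_fsm] in \<open>auto simp: qsym_simps carrier_fsm\<close>)

lemma lin_qp: "lin (fsm UNIV) qA qp"
 by (rule linI) (auto simp: qsym_simps)

lemma ring_qsym: "Ring.ring qA"
proof (rule ringI)
 show "abelian_group qA" by (rule vsp_abelian_group[OF vsp_qsym])
 have "dl [] \<otimes>\<^bsub>FA\<^esub> f = f" "f \<otimes>\<^bsub>FA\<^esub> dl [] = f" for f :: "'n list => 'k"
  by (auto simp: dl_mult_left dl_mult_right fun_eq_iff)
 then show "Group.monoid qA"
  by (intro monoidI) (auto simp: qsym_simps free_algebra_mult_closed free_algebra_assoc)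
 fix x y z assume "x \<in> carrier qA" "y \<in> carrier qA" "z \<in> carrier qA"
 then obtain f g h where fgh: "f \<in> FS UNIV" "g \<in> FS UNIV" "h \<in> FS UNIV"
   "x = qp f" "y = qp g" "z = qp h" by (auto simp: qsym_simps)
 then show "(x \<oplus>\<^bsub>qA\<^esub> y) \<otimes>\<^bsub>qA\<^esub> z = x \<otimes>\<^bsub>qA\<^esub> z \<oplus>\<^bsub>qA\<^esub> y \<otimes>\<^bsub>qA\<^esub> z"
  "z \<otimes>\<^bsub>qA\<^esub> (x \<oplus>\<^bsub>qA\<^esub> y) = z \<otimes>\<^bsub>qA\<^esub> x \<oplus>\<^bsub>qA\<^esub> z \<otimes>\<^bsub>qA\<^esub> y"
  using free_algebra_distrib(1)[of f g h] free_algebra_distrib(2)[of h f g] fsm_plus[OF fgh(1,2)]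
  by (simp_all add: qsym_simps free_algebra_mult_closed)
qed

sublocale A: Ring.ring "qsym q" by (rule ring_qsym)

lemma qsym_smult_mult:
 assumes "r \<in> carrier qA" "s \<in> carrier qA"
 shows "(c \<odot>\<^bsub>qA\<^esub> r) \<otimes>\<^bsub>qA\<^esub> s = c \<odot>\<^bsub>qA\<^esub> (r \<otimes>\<^bsub>qA\<^esub> s)" "r \<otimes>\<^bsub>qA\<^esub> (c \<odot>\<^bsub>qA\<^esub> s) = c \<odot>\<^bsub>qA\<^esub> (r \<otimes>\<^bsub>qA\<^esub> s)"
proof -
 obtain f g where fg: "f \<in> FS UNIV" "g \<in> FS UNIV" "r = qp f" "s = qp g"
  using assms by (auto simp: qsym_simps)
 then show "(c \<odot>\<^bsub>qA\<^esub> r) \<otimes>\<^bsub>qA\<^esub> s = c \<odot>\<^bsub>qA\<^esub> (r \<otimes>\<^bsub>qA\<^esub> s)" "r \<otimes>\<^bsub>qA\<^esub> (c \<odot>\<^bsub>qA\<^esub> s) = c \<odot>\<^bsub>qA\<^esub> (r \<otimes>\<^bsub>qA\<^esub> s)"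
  using free_algebra_distrib(3)[of c f g] free_algebra_distrib(4)[of f c g]
  by (simp_all add: qsym_simps fsm_scale free_algebra_mult_closed)
qed

abbreviation X :: "'n => ('n list => 'k) set" where "X i \<equiv> qvar q i"

lemma X_eq: "X i = qp (dl [i])"
 by (simp add: qvar_def qp_def gen_dl)

lemma X_closed [simp]: "X i \<in> carrier qA"
 by (simp add: X_eq qsym_simps)

lemma X_comm: "X i \<otimes>\<^bsub>qA\<^esub> X j = q i j \<odot>\<^bsub>qA\<^esub> (X j \<otimes>\<^bsub>qA\<^esub> X i)"
proof -
 have "(\<lambda>w. dl [i, j] w - q i j * dl [j, i] w) \<in> qsym_ideal q"
 proof -
  have "qsym_ideal q = Idl\<^bsub>FA\<^esub> rels" by (simp only: qsym_ideal_def rels_def)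
  then show ?thesis using ring.genideal_self[OF ring_free_algebra rels_carrier] unfolding rels_eq by auto
 qed
 then have "qp (dl [i, j]) = qp (\<lambda>w. q i j * dl [j, i] w)"
  by (subst qp_eq) (simp_all add: fsm_scale)
 then show ?thesis by (simp add: X_eq qsym_simps dl_mult)
qed

lemma X_pow_comm: "X i \<otimes>\<^bsub>qA\<^esub> (X j [^]\<^bsub>qA\<^esub> n) = q i j ^ n \<odot>\<^bsub>qA\<^esub> ((X j [^]\<^bsub>qA\<^esub> n) \<otimes>\<^bsub>qA\<^esub> X i)" for n :: nat
proof (induction n)
 case 0
 then show ?case using vs_smult_one[OF vsp_qsym] by simp
next
 case (Suc n)
 let ?p = "X j [^]\<^bsub>qA\<^esub> n"
 have "X i \<otimes>\<^bsub>qA\<^esub> (?p \<otimes>\<^bsub>qA\<^esub> X j) = (X i \<otimes>\<^bsub>qA\<^esub> ?p) \<otimes>\<^bsub>qA\<^esub> X j"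
  by (simp add: A.m_assoc)
 also have "\<dots> = q i j ^ n \<odot>\<^bsub>qA\<^esub> (?p \<otimes>\<^bsub>qA\<^esub> (X i \<otimes>\<^bsub>qA\<^esub> X j))"
  by (simp add: Suc qsym_smult_mult A.m_assoc)
 also have "\<dots> = q i j ^ Suc n \<odot>\<^bsub>qA\<^esub> ((?p \<otimes>\<^bsub>qA\<^esub> X j) \<otimes>\<^bsub>qA\<^esub> X i)"
  by (simp add: X_comm[of i j] qsym_smult_mult A.m_assoc vs_smult_smult[OF vsp_qsym] mult.commute)
 finally show ?case by simp
qed

text \<open>The monomial over an arbitrary list of variables, which makes induction along the sorted
  list of all indices possible.\<close>

definition lmon :: "'n list => ('n => nat) => ('n list => 'k) set" where
 "lmon xs al = foldr (\<lambda>i y. (X i [^]\<^bsub>qA\<^esub> al i) \<otimes>\<^bsub>qA\<^esub> y) xs \<one>\<^bsub>qA\<^esub>"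

lemma lmon_closed [simp]: "lmon xs al \<in> carrier qA"
 by (induction xs) (auto simp: lmon_def)

lemma lmon_cong: "(\<And>i. i \<in> set xs ==> al i = be i) ==> lmon xs al = lmon xs be"
 unfolding lmon_def by (rule foldr_cong) auto

text \<open>\<open>X i\<close> passes the powers of the smaller variables, paying
  \<open>q i j ^ al j\<close> for each, and stops at its own place in the sorted list.\<close>

lemma X_lmon:
 assumes "sorted xs" "distinct xs" "i \<in> set xs"
 shows "X i \<otimes>\<^bsub>qA\<^esub> lmon xs al = (\<Prod>j\<in>{j \<in> set xs. j < i}. q i j ^ al j) \<odot>\<^bsub>qA\<^esub> lmon xs (plusv (unitv i) al)"
 using assms
proof (induction xs)
 case (Cons a xs)
 have l: "lmon (a # xs) be = (X a [^]\<^bsub>qA\<^esub> be a) \<otimes>\<^bsub>qA\<^esub> lmon xs be" for be by (simp add: lmon_def)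
 show ?case
 proof (cases "a = i")
  case True
  then have e: "{j \<in> set (a # xs). j < i} = {}" using Cons.prems by auto
  have "lmon xs (plusv (unitv i) al) = lmon xs al"
   using Cons.prems True by (intro lmon_cong) (auto simp: plusv_def unitv_def)
  moreover have "plusv (unitv i) al i = Suc (al i)" by (simp add: plusv_def unitv_def)
  ultimately show ?thesis
   unfolding e l using True vs_smult_one[OF vsp_qsym] A.nat_pow_Suc2[of "X i" "al i"]
   by (simp add: A.m_assoc del: A.nat_pow_Suc)
 next
  case False
  then have i: "i \<in> set xs" "a < i" "a \<notin> set xs" using Cons.prems by (auto simp: less_le)
  have e: "{j \<in> set (a # xs). j < i} = insert a {j \<in> set xs. j < i}" using i by auto
  have p: "plusv (unitv i) al a = al a" using False by (simp add: plusv_def unitv_def)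
  let ?p = "X a [^]\<^bsub>qA\<^esub> al a"
  have "X i \<otimes>\<^bsub>qA\<^esub> (?p \<otimes>\<^bsub>qA\<^esub> lmon xs al) = (X i \<otimes>\<^bsub>qA\<^esub> ?p) \<otimes>\<^bsub>qA\<^esub> lmon xs al" by (simp add: A.m_assoc)
  also have "\<dots> = q i a ^ al a \<odot>\<^bsub>qA\<^esub> (?p \<otimes>\<^bsub>qA\<^esub> (X i \<otimes>\<^bsub>qA\<^esub> lmon xs al))"
   by (simp add: X_pow_comm qsym_smult_mult A.m_assoc)
  also have "X i \<otimes>\<^bsub>qA\<^esub> lmon xs al = (\<Prod>j\<in>{j \<in> set xs. j < i}. q i j ^ al j) \<odot>\<^bsub>qA\<^esub> lmon xs (plusv (unitv i) al)"
   using Cons i by simp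
  finally show ?thesis
   unfolding e l p using i by (simp add: qsym_smult_mult vs_smult_smult[OF vsp_qsym])
 qed
qed simp

lemma qmonom_lmon: "qmonom q al = lmon (sorted_list_of_set UNIV) al"
 by (simp add: qmonom_def lmon_def)

lemma qmonom_closed [simp]: "qmonom q al \<in> carrier qA"
 by (simp add: qmonom_lmon)

lemma X_qmonom: "X i \<otimes>\<^bsub>qA\<^esub> qmonom q al = sig q (unitv i) al \<odot>\<^bsub>qA\<^esub> qmonom q (plusv (unitv i) al)"
 using X_lmon[of "sorted_list_of_set UNIV" i al]
 by (simp add: qmonom_lmon sig_unit_left lessThan_def)

lemma qmonom_zero: "qmonom q (\<lambda>i. 0) = \<one>\<^bsub>qA\<^esub>"
proof -
 have "lmon xs (\<lambda>i. 0) = \<one>\<^bsub>qA\<^esub>" for xs by (induction xs) (simp_all add: lmon_def)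
 then show ?thesis by (simp add: qmonom_lmon)
qed

lemma qp_word: "qp (dl w) = tau q w \<odot>\<^bsub>qA\<^esub> qmonom q (cnt w)"
proof (induction w)
 case Nil
 then show ?case using vs_smult_one[OF vsp_qsym] by (simp add: cnt_simps qmonom_zero qsym_simps)
next
 case (Cons i w)
 have "qp (dl (i # w)) = X i \<otimes>\<^bsub>qA\<^esub> qp (dl w)" by (simp add: X_eq qsym_simps dl_mult)
 then show ?case
  by (simp add: Cons qsym_smult_mult X_qmonom vs_smult_smult[OF vsp_qsym] cnt_simps mult.commute)
qed

lemma qmonom_word: "qmonom q (cnt w) = inverse (tau q w) \<odot>\<^bsub>qA\<^esub> qp (dl w)"
 using vs_smult_one[OF vsp_qsym] by (simp add: qp_word vs_smult_smult[OF vsp_qsym] tau_nonzero)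

lemma qp_closed: "f \<in> FS UNIV ==> qp f \<in> carrier qA" by (simp add: qsym_simps)

lemma qmonom_mult: "qmonom q al \<otimes>\<^bsub>qA\<^esub> qmonom q be = sig q al be \<odot>\<^bsub>qA\<^esub> qmonom q (plusv al be)"
proof -
 obtain u w where uw: "al = cnt u" "be = cnt w" using ex_cnt by metis
 have "qp (dl u) \<otimes>\<^bsub>qA\<^esub> qp (dl w) = tau q (u @ w) \<odot>\<^bsub>qA\<^esub> qmonom q (plusv al be)"
  by (simp add: qsym_simps(5) dl_mult qp_word[of "u @ w"] cnt_simps uw)
 moreover have "inverse (tau q w) * (inverse (tau q u) * tau q (u @ w)) = sig q (cnt u) (cnt w)"
  by (simp add: tau_append tau_nonzero field_simps)
 ultimately show ?thesis
  unfolding uw by (simp add: qmonom_word[of u] qmonom_word[of w] qsym_smult_mult qp_closed vs_smult_smult[OF vsp_qsym]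
    vs_smult[OF vsp_qsym])
qed

lemma qmonom_unitv: "qmonom q (unitv i) = X i"
 using qmonom_word[of "[i]"] vs_smult_one[OF vsp_qsym]
 by (simp add: cnt_simps plusv_def sig_zero X_eq qp_closed)

text \<open>Any representative will do, because \<open>Phi\<close> vanishes on the ideal.\<close>

definition qco :: "('n list => 'k) set => ('n => nat) => 'k" where
 "qco r = Phi (SOME f. f \<in> FS UNIV \<and> qp f = r)"

lemma qco_qp:
 assumes f: "f \<in> FS UNIV"
 shows "qco (qp f) = Phi f"
proof -
 let ?P = "\<lambda>g. g \<in> FS UNIV \<and> qp g = qp f"
 have g: "?P (SOME g. ?P g)" using f by (intro someI[of ?P f]) simp
 then have "(\<lambda>w. (SOME g. ?P g) w - f w) \<in> qsym_ideal q" using f qp_eq by blast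
 then have "Phi (\<lambda>w. (SOME g. ?P g) w - f w) = (\<lambda>_. 0)" by (rule Phi_ideal)
 moreover have "Phi (\<lambda>w. (SOME g. ?P g) w - f w) = (\<lambda>al. Phi (SOME g. ?P g) al - Phi f al)"
  using lin_add[OF lin_Phi, of "SOME g. ?P g" "\<lambda>w. - 1 * f w"] lin_smult[OF lin_Phi f, of "-1"] g f fsm_scale[OF f, of "-1"]
  by simp
 ultimately show ?thesis unfolding qco_def by (auto simp: fun_eq_iff)
qed

lemma lin_qco: "lin qA (fsm UNIV) qco"
proof (rule linI)
 fix r s assume "r \<in> carrier qA" "s \<in> carrier qA"
 then obtain f g where fg: "f \<in> FS UNIV" "g \<in> FS UNIV" "r = qp f" "s = qp g"
  by (auto simp: qsym_simps)
 then show "qco (r \<oplus>\<^bsub>qA\<^esub> s) = qco r \<oplus>\<^bsub>fsm UNIV\<^esub> qco s"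
  using lin_add[OF lin_Phi fg(1,2)] by (simp add: qsym_simps qco_qp fsm_plus)
next
 fix r c assume "r \<in> carrier qA"
 then show "qco (c \<odot>\<^bsub>qA\<^esub> r) = c \<odot>\<^bsub>fsm UNIV\<^esub> qco r"
  using lin_smult[OF lin_Phi] by (auto simp: qsym_simps qco_qp fsm_scale)
qed (use lin_closed[OF lin_Phi] in \<open>auto simp: qsym_simps qco_qp\<close>)

lemma qco_qmonom: "qco (qmonom q al) = dl al"
proof -
 obtain w where w: "al = cnt w" using ex_cnt by metis
 have "qco (qmonom q al) = (\<lambda>be. inverse (tau q w) * Phi (dl w) be)"
  using lin_smult[OF lin_qco qp_closed[of "dl w"]] by (simp add: w qmonom_word qco_qp)
 then show ?thesis by (simp add: Phi_dl w tau_nonzero field_simps)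
qed

text \<open>Words span the algebra and are multiples of monomials, while \<open>qco\<close>
  separates the monomials.\<close>

sublocale A: based_algebra "qsym q" UNIV "qmonom q" qco
proof (intro based_algebra.intro ring_qsym vsp_qsym qsym_smult_mult qmonom_closed lin_qco qco_qmonom)
 fix r assume "r \<in> carrier qA"
 then obtain f where f: "f \<in> FS UNIV" "r = qp f" by (auto simp: qsym_simps)
 have l: "lin (fsm UNIV) qA (lext qA (qmonom q))" by (rule lin_lext[OF vsp_qsym]) simp
 have "lext qA (qmonom q) (Phi f) = qp f"
 proof (rule lin_fsm_eqI[OF vsp_qsym lin_comp[OF lin_Phi l] lin_qp _ f(1)])
  fix w show "lext qA (qmonom q) (Phi (dl w)) = qp (dl w)"
   using lin_smult[OF l, of "dl (cnt w)" "tau q w"] by (simp add: Phi_dl qp_word vsp_qsym)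
 qed
 then show "lext qA (qmonom q) (qco r) = r" using f by (simp add: qco_qp)
qed

end

section \<open>The Koszul resolution\<close>

declare One_nat_def [simp del]

text \<open>The basis principle for scalar-valued functions. \<open>scalars\<close> is a ring record
  and not a module record, so the ground field is represented by the functions on
  \<open>unit\<close>.\<close>

lemma functional_eqI:
 fixes \<phi> \<psi> :: "('i => 'k::field) => 'k"
 assumes "\<And>f g. f \<in> FS I ==> g \<in> FS I ==> \<phi> (\<lambda>i. f i + g i) = \<phi> f + \<phi> g"
  "\<And>f c. f \<in> FS I ==> \<phi> (\<lambda>i. c * f i) = c * \<phi> f"
  "\<And>f g. f \<in> FS I ==> g \<in> FS I ==> \<psi> (\<lambda>i. f i + g i) = \<psi> f + \<psi> g"
  "\<And>f c. f \<in> FS I ==> \<psi> (\<lambda>i. c * f i) = c * \<psi> f"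
  "\<And>i. i \<in> I ==> \<phi> (dl i) = \<psi> (dl i)" and f: "f \<in> FS I"
 shows "\<phi> f = \<psi> f"
proof -
 have "(\<lambda>_::unit. \<phi> f) = (\<lambda>_. \<psi> f)"
  by (rule lin_fsm_eqI[of "fsm UNIV" I "\<lambda>f _. \<phi> f" "\<lambda>f _. \<psi> f"])
   (use assms in \<open>auto intro!: linI simp: carrier_fsm\<close>)
 then show ?thesis by (simp add: fun_eq_iff)
qed

abbreviation XE where "XE \<equiv> ext_exponents"

lemma finite_ext_exponents [simp]: "finite (XE m :: ('n::finite => nat) set)"
proof (rule finite_subset)
 show "(XE m :: ('n => nat) set) \<subseteq> PiE UNIV (\<lambda>_. {0, 1})"
  unfolding ext_exponents_def by (intro subsetI PiE_I) auto
qed (simp add: finite_PiE)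

lemma ext_01: "be \<in> XE m ==> be i = 0 \<or> be i = 1"
 by (auto simp: ext_exponents_def)

lemma ext_up: "be i = 0 ==> be(i := 1) \<in> XE (Suc m) \<longleftrightarrow> be \<in> XE m"
proof -
 assume i: "be i = 0"
 have "(\<Sum>j\<in>UNIV. (be(i := 1)) j) = 1 + (\<Sum>j\<in>UNIV - {i}. (be(i := 1)) j)"
  by (subst sum.remove[of UNIV i]) auto
 also have "(\<Sum>j\<in>UNIV - {i}. (be(i := 1)) j) = (\<Sum>j\<in>UNIV - {i}. be j)" by (rule sum.cong) auto
 also have "\<dots> = (\<Sum>j\<in>UNIV. be j)" using i sum.remove[of UNIV i be] by simp
 finally have "(\<Sum>j\<in>UNIV. (be(i := 1)) j) = 1 + (\<Sum>j\<in>UNIV. be j)" .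
 moreover have "(\<forall>j. (be(i := 1)) j \<in> {0, 1}) \<longleftrightarrow> (\<forall>j. be j \<in> {0, 1})"
  using i by (metis fun_upd_other fun_upd_same insertCI)
 ultimately show ?thesis unfolding ext_exponents_def mem_Collect_eq by simp
qed

lemma ext_down: "be i = 1 ==> be(i := 0) \<in> XE m \<longleftrightarrow> be \<in> XE (Suc m)"
 using ext_up[of "be(i := 0)" i m] by (metis fun_upd_same fun_upd_triv fun_upd_upd)

lemma ext_0: "XE 0 = {\<lambda>_. 0 :: nat}"
 by (auto simp: ext_exponents_def)

type_synonym 'n expo = "'n => nat"

text \<open>The Koszul sign: the parity of the number of exterior factors standing before position
  \<open>i\<close>.\<close>

definition sg :: "'n::{finite,linorder} expo => 'n => 'k::field" where
 "sg be i = (-1) ^ (\<Sum>s\<in>{..<i}. be s)"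

lemma sg_sq [simp]: "sg be i * sg be i = 1"
 by (simp add: sg_def power_mult_distrib[symmetric])

lemma sg_upd_same [simp]: "sg (be(i := k)) i = (sg be i :: 'k::field)"
 unfolding sg_def by (rule arg_cong[of _ _ "power (-1)"], rule sum.cong) auto

lemma sg_upd:
 assumes "be i = 0"
 shows "(sg (be(i := 1)) j :: 'k::field) = (if i < j then - sg be j else sg be j)"
proof (cases "i < j")
 case True
 then have "(\<Sum>s\<in>{..<j}. (be(i := 1)) s) = 1 + (\<Sum>s\<in>{..<j} - {i}. (be(i := 1)) s)"
  by (subst sum.remove[of _ i]) auto
 also have "(\<Sum>s\<in>{..<j} - {i}. (be(i := 1)) s) = (\<Sum>s\<in>{..<j} - {i}. be s)" by (rule sum.cong) auto
 also have "\<dots> = (\<Sum>s\<in>{..<j}. be s)" using True assms sum.remove[of "{..<j}" i be] by simp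
 finally show ?thesis using True by (simp add: sg_def power_add)
next
 case False
 then have "(\<Sum>s\<in>{..<j}. (be(i := 1)) s) = (\<Sum>s\<in>{..<j}. be s)" by (intro sum.cong) auto
 then show ?thesis using False by (simp add: sg_def)
qed

lemma sg_anti:
 assumes "i \<noteq> j" "be i = 0" "be j = 0"
 shows "sg be i * (sg (be(i := 1)) j :: 'k::field) = - (sg be j * sg (be(j := 1)) i)"
 using assms by (cases "i < j") (auto simp: sg_upd[of be i j] sg_upd[of be j i])

text \<open>Inserting \<open>j\<close> and removing \<open>i\<close> in the two possible orders
  gives opposite signs. The mixed terms of both contractions, on the resolution and on cochains, are
  handled by this.\<close>

lemma sg_swap:
 assumes "j \<noteq> i" "be i = 1" "be j = 0"
 shows "sg be j * sg (be(j := 1)) i = - (sg be i * (sg (be(i := 0)) j :: 'k::field))"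
proof -
 have up: "be(i := 0, i := 1) = be" using assms by (simp add: fun_upd_idem)
 have 1: "sg be j = (if i < j then - sg (be(i := 0)) j else sg (be(i := 0)) j :: 'k)"
  using sg_upd[of "be(i := 0)" i j, where 'k = 'k] up by simp
 have 2: "sg (be(j := 1)) i = (if j < i then - sg be i else sg be i :: 'k)"
  using sg_upd[of be j i, where 'k = 'k] assms by simp
 show ?thesis unfolding 1 2 using assms(1) by (cases "i < j") (auto simp: mult.commute)
qed

text \<open>
 After rescaling, multiplication by \<open>x\<^sub>i \<otimes> 1 - 1 \<otimes> x\<^sub>i\<close> is the operator \<open>mulT i\<close> on the coefficients of
 \<open>x\<^sup>a \<otimes> x\<^sup>b\<close>, and \<open>mulU i\<close> divides by \<open>x\<^sub>i \<otimes> 1 - 1 \<otimes> x\<^sub>i\<close> with remainder \<open>mulP i\<close>.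
\<close>

definition mulT :: "'n => ('n expo => 'n expo => 'k::field) => 'n expo => 'n expo => 'k" where
 "mulT i f a b = (if 1 \<le> a i then f (a(i := a i - 1)) b else 0) - (if 1 \<le> b i then f a (b(i := b i - 1)) else 0)"

definition mulU :: "'n => ('n expo => 'n expo => 'k::field) => 'n expo => 'n expo => 'k" where
 "mulU i f a b = (\<Sum>t\<le>b i. f (a(i := a i + 1 + b i - t)) (b(i := t)))"

definition mulP :: "'n => ('n expo => 'n expo => 'k::field) => 'n expo => 'n expo => 'k" where
 "mulP i f a b = (if a i = 0 then \<Sum>t\<le>b i. f (a(i := b i - t)) (b(i := t)) else 0)"

lemma mulT_comm: "mulT i (mulT j f) a b = mulT j (mulT i f) a b"
 by (cases "i = j") (auto simp: mulT_def fun_upd_twist)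

lemma mulT_mulU_comm: "i \<noteq> j ==> mulT j (mulU i f) a b = mulU i (mulT j f) a b"
 by (auto simp: mulT_def mulU_def fun_upd_twist sum_subtractf sum_negf)

text \<open>Polynomial division in one variable. For \<open>a i > 0\<close> the two sums differ in
  the term \<open>t = b i\<close> only, which is \<open>f a b\<close>. For \<open>a i = 0\<close>
  only the second sum is present, and completing it produces the remainder.\<close>

lemma mulT_mulU: "mulT i (mulU i f) a b = f a b - mulP i f a b"
proof (cases "a i")
 case 0
 then show ?thesis by (cases "b i") (auto simp: mulT_def mulU_def mulP_def fun_upd_idem plus_1_eq_Suc)
next
 case (Suc k)
 then show ?thesis by (cases "b i") (auto simp: mulT_def mulU_def mulP_def fun_upd_idem)
qed

lemma mulU_mulT: "mulU i (mulT i f) a b = f a b"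
proof -
 \<comment> \<open>\<open>H\<close> lists the coefficients along the line on which
   \<open>a i + b i\<close> is constant; the sum telescopes along it.\<close>
 define H where "H t = f (a(i := a i + b i - t)) (b(i := t))" for t
 have "mulU i (mulT i f) a b = (\<Sum>t\<le>b i. H t - (if t = 0 then 0 else H (t - 1)))"
  unfolding mulU_def by (rule sum.cong) (auto simp: mulT_def H_def ac_simps)
 also have "\<dots> = H (b i)"
 proof -
  have "(\<Sum>t\<le>n. H t - (if t = 0 then 0 else H (t - 1))) = H n" for n by (induction n) auto
  then show ?thesis .
 qed
 finally show ?thesis by (simp add: H_def)
qed

lemma mul_sum:
 "mulT i (\<lambda>a b. \<Sum>j\<in>S. c j * f j a b) a b = (\<Sum>j\<in>S. c j * mulT i (f j) a b)"
 "mulU i (\<lambda>a b. \<Sum>j\<in>S. c j * f j a b) a b = (\<Sum>j\<in>S. c j * mulU i (f j) a b)"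
 by (simp_all add: mulT_def mulU_def right_diff_distrib sum_subtractf sum_distrib_left sum_negf sum.swap[of _ S])

lemma mul_scale: "mulT i (\<lambda>a b. c * f a b) a b = c * mulT i f a b" "mulU i (\<lambda>a b. c * f a b) a b = c * mulU i f a b"
 by (simp_all add: mulT_def mulU_def right_diff_distrib sum_distrib_left)

text \<open>The Koszul boundary for the commuting elements
  \<open>x_i \<otimes> 1 - 1 \<otimes> x_i\<close> of a commutative polynomial ring, with
  \<open>F be a b\<close> the coefficient of \<open>x^a \<otimes> x^b\<close> over the exterior
  monomial \<open>be\<close>. The twisted complex becomes this one after rescaling by
  \<open>Cc\<close>.\<close>

definition bnd :: "('n::{finite,linorder} expo => 'n expo => 'n expo => 'k::field) => 'n expo => 'n expo => 'n expo => 'k" where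
 "bnd F be a b = (\<Sum>i | be i = 0. sg be i * mulT i (F (be(i := 1))) a b)"

definition hom_i :: "'n::{finite,linorder} => ('n expo => 'n expo => 'n expo => 'k::field) => 'n expo => 'n expo => 'n expo => 'k" where
 "hom_i i F be a b = (if be i = 1 then sg be i * mulU i (F (be(i := 0))) a b else 0)"

definition prj_i :: "'n => ('n expo => 'n expo => 'n expo => 'k::field) => 'n expo => 'n expo => 'n expo => 'k" where
 "prj_i i F be a b = (if be i = 0 then mulP i (F be) a b else 0)"

lemma mulT_zero: "mulT i (\<lambda>a b. 0) a b = 0" by (simp add: mulT_def)

text \<open>If \<open>be i = 0\<close>, only the direction \<open>j = i\<close> contributes, by
  division with remainder. If \<open>be i = 1\<close>, the direction \<open>i\<close> returns
  \<open>F\<close> because division undoes multiplication, and for \<open>j \<noteq> i\<close> the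
  operators commute while the signs are opposite.\<close>

lemma bnd_homotopy:
 assumes "be i = 0 \<or> be i = 1"
 shows "bnd (hom_i i F) be a b + hom_i i (bnd F) be a b = F be a b - prj_i i F be a b"
proof (cases "be i = 0")
 case True
 have "bnd (hom_i i F) be a b = (\<Sum>j | be j = 0. if j = i then F be a b - prj_i i F be a b else 0)"
  unfolding bnd_def
 proof (rule sum.cong[OF refl])
  fix j assume "j \<in> {j. be j = 0}"
  show "sg be j * mulT j (hom_i i F (be(j := 1))) a b = (if j = i then F be a b - prj_i i F be a b else 0)"
  proof (cases "j = i")
   case j: True
   have "be(i := 0) = be" using True by (simp add: fun_upd_idem)
   then have "hom_i i F (be(i := 1)) = (\<lambda>a b. sg be i * mulU i (F be) a b)" by (intro ext) (simp add: hom_i_def)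
   then show ?thesis using j True by (simp add: mul_scale mulT_mulU prj_i_def mult.assoc[symmetric])
  next
   case False
   then have "hom_i i F (be(j := 1)) = (\<lambda>a b. 0)" using True by (simp add: hom_i_def fun_eq_iff)
   then show ?thesis using False by (simp add: mulT_zero)
  qed
 qed
 also have "\<dots> = F be a b - prj_i i F be a b" using True by simp
 finally show ?thesis using True by (simp add: hom_i_def)
next
 case False
 then have b1: "be i = 1" using assms by simp
 let ?be = "be(i := 0)"
 have up: "?be(i := 1) = be" using b1 by (simp add: fun_upd_idem)
 have "hom_i i (bnd F) be a b = sg be i * (\<Sum>j | ?be j = 0. sg ?be j * mulU i (mulT j (F (?be(j := 1)))) a b)"
  using b1 unfolding hom_i_def bnd_def[abs_def] by (simp add: mul_sum)
 also have "{j. ?be j = 0} = insert i {j. be j = 0}" by auto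
 also have "(\<Sum>j\<in>insert i {j. be j = 0}. sg ?be j * mulU i (mulT j (F (?be(j := 1)))) a b) =
   sg be i * F be a b + (\<Sum>j | be j = 0. sg ?be j * mulU i (mulT j (F (?be(j := 1)))) a b)"
  using b1 up by (subst sum.insert) (auto simp: mulU_mulT)
 finally have 1: "hom_i i (bnd F) be a b = F be a b + sg be i * (\<Sum>j | be j = 0. sg ?be j * mulU i (mulT j (F (?be(j := 1)))) a b)"
  by (simp add: distrib_left mult.assoc[symmetric])
 have 2: "bnd (hom_i i F) be a b = (\<Sum>j | be j = 0. - (sg be i * (sg ?be j * mulU i (mulT j (F (?be(j := 1)))) a b)))"
  unfolding bnd_def
 proof (rule sum.cong[OF refl])
  fix j assume j: "j \<in> {j. be j = 0}"
  then have ji: "j \<noteq> i" using b1 by auto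
  have e: "be(j := 1, i := 0) = ?be(j := 1)" using ji by (simp add: fun_upd_twist)
  have "hom_i i F (be(j := 1)) = (\<lambda>a b. sg (be(j := 1)) i * mulU i (F (?be(j := 1))) a b)"
   using b1 ji by (simp add: hom_i_def fun_eq_iff e)
  then have "sg be j * mulT j (hom_i i F (be(j := 1))) a b =
    (sg be j * sg (be(j := 1)) i) * mulU i (mulT j (F (?be(j := 1)))) a b"
   using ji by (simp add: mul_scale mulT_mulU_comm)
  also have "sg be j * sg (be(j := 1)) i = - (sg be i * (sg ?be j :: 'b))"
   using ji j b1 by (intro sg_swap) auto
  finally show "sg be j * mulT j (hom_i i F (be(j := 1))) a b =
    - (sg be i * (sg ?be j * mulU i (mulT j (F (?be(j := 1)))) a b))"
   by (simp only: mult.assoc mult_minus_left)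
 qed
 show ?thesis unfolding 1 2 using b1 by (simp add: prj_i_def sum_negf sum_distrib_left)
qed

lemma bnd_bnd: "bnd (bnd F) be a b = (0 :: 'k::field_char_0)"
proof -
 define t where "t i j = sg be i * sg (be(i := 1)) j * mulT i (mulT j (F (be(i := 1, j := 1)))) a b" for i j
 let ?Z = "{i. be i = 0}"
 have "bnd (bnd F) be a b = (\<Sum>i\<in>?Z. \<Sum>j | (be(i := 1)) j = 0. t i j)"
  unfolding bnd_def[abs_def] by (simp add: mul_sum t_def sum_distrib_left mult.assoc)
 also have "\<dots> = (\<Sum>i\<in>?Z. \<Sum>j\<in>?Z. if i \<noteq> j then t i j else 0)"
 proof (rule sum.cong[OF refl])
  fix i assume "i \<in> ?Z"
  have "{j. (be(i := 1)) j = 0} = {j \<in> ?Z. i \<noteq> j}" by auto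
  then show "(\<Sum>j | (be(i := 1)) j = 0. t i j) = (\<Sum>j\<in>?Z. if i \<noteq> j then t i j else 0)"
   by (simp add: sum.inter_filter[symmetric])
 qed
 finally have 1: "bnd (bnd F) be a b = (\<Sum>i\<in>?Z. \<Sum>j\<in>?Z. if i \<noteq> j then t i j else 0)" .
 have ta: "t i j = - t j i" if "i \<noteq> j" "be i = 0" "be j = 0" for i j
  using sg_anti[OF that, where 'k = 'k] that(1) by (simp add: t_def mulT_comm[of i j] fun_upd_twist)
 have anti: "(if i \<noteq> j then t i j else 0) = - (if j \<noteq> i then t j i else 0)" if "i \<in> ?Z" "j \<in> ?Z" for i j
  using that ta[of i j] by (cases "i = j") simp_all
 define g where "g i j = (if i \<noteq> j then t i j else 0)" for i j
 have "(\<Sum>i\<in>?Z. \<Sum>j\<in>?Z. g i j) = (\<Sum>i\<in>?Z. \<Sum>j\<in>?Z. - g j i)"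
  by (rule sum.cong[OF refl], rule sum.cong[OF refl], unfold g_def, rule anti)
 then have 2: "(\<Sum>i\<in>?Z. \<Sum>j\<in>?Z. g i j) = - (\<Sum>i\<in>?Z. \<Sum>j\<in>?Z. g j i)"
  unfolding sum_negf .
 have 3: "(\<Sum>i\<in>?Z. \<Sum>j\<in>?Z. g i j) = (\<Sum>i\<in>?Z. \<Sum>j\<in>?Z. g j i)"
  by (rule sum.swap)
 \<comment> \<open>Exchanging \<open>i\<close> and \<open>j\<close> shows that the double sum equals
   its negative; in characteristic 0 it is zero.\<close>
 have "x = - y ==> x = y ==> x = 0" for x y :: 'k by simp
 from this[OF 2 3] show ?thesis unfolding 1 g_def .
qed

definition kfun :: "nat => ('n::{finite,linorder} expo => 'n expo => 'n expo => 'k::field) => bool" where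
 "kfun m F \<longleftrightarrow> (\<lambda>(be, a, b). F be a b) \<in> FS (XE m \<times> UNIV \<times> UNIV)"

lemma kfunD: "kfun m F ==> F be a b \<noteq> 0 ==> be \<in> XE m"
 using fsmD(2)[of "\<lambda>(be, a, b). F be a b" _ "(be, a, b)"] by (auto simp: kfun_def)

lemma kfun_zero: "kfun m F ==> be \<notin> XE m ==> F be = (\<lambda>a b. 0)"
 using kfunD by (metis ext)

lemma kfunI: "finite A ==> (\<And>be a b. F be a b \<noteq> 0 ==> be \<in> XE m \<and> (be, a, b) \<in> A) ==> kfun m F"
 unfolding kfun_def by (rule fsmI[of "A \<inter> (XE m \<times> UNIV \<times> UNIV)"]) auto

lemma kfun_finite: "kfun m F ==> finite {(be, a, b). F be a b \<noteq> 0}"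
 by (auto simp: kfun_def carrier_fsm case_prod_unfold)

lemma bnd_outside:
 assumes F: "kfun (Suc m) F" and be: "be \<notin> XE m"
 shows "bnd F be a b = 0"
 unfolding bnd_def
proof (rule sum.neutral, rule ballI)
 fix i assume "i \<in> {i. be i = 0}"
 then have "be(i := 1) \<notin> XE (Suc m)" using ext_up[of be i m] be by simp
 then show "sg be i * mulT i (F (be(i := 1))) a b = 0" by (simp add: kfun_zero[OF F] mulT_zero)
qed

lemma bnd_kfun:
 assumes F: "kfun (Suc m) F"
 shows "kfun m (bnd F)"
proof -
 let ?S = "{(be, a, b). F be a b \<noteq> 0}"
 define A where "A = (\<Union>i. (\<lambda>(be, a, b). (be(i := 0), a(i := Suc (a i)), b)) ` ?S \<union> (\<lambda>(be, a, b). (be(i := 0), a, b(i := Suc (b i)))) ` ?S)"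
 show ?thesis
 proof (rule kfunI)
  show "finite A" unfolding A_def using kfun_finite[OF F] by auto
  fix be a b assume nz: "bnd F be a b \<noteq> 0"
  obtain i where "i \<in> {i. be i = 0}" "sg be i * mulT i (F (be(i := 1))) a b \<noteq> 0"
   by (rule sum.not_neutral_contains_not_neutral[OF nz[unfolded bnd_def]])
  then have i: "be i = 0" "mulT i (F (be(i := 1))) a b \<noteq> 0" by auto
  then have "(1 \<le> a i \<and> F (be(i := 1)) (a(i := a i - 1)) b \<noteq> 0) \<or> (1 \<le> b i \<and> F (be(i := 1)) a (b(i := b i - 1)) \<noteq> 0)"
   by (auto simp: mulT_def split: if_splits)
  then have "(be, a, b) \<in> A"
  proof
   assume *: "1 \<le> a i \<and> F (be(i := 1)) (a(i := a i - 1)) b \<noteq> 0"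
   have "(be, a, b) = (\<lambda>(be, a, b). (be(i := 0), a(i := Suc (a i)), b)) (be(i := 1), a(i := a i - 1), b)"
    using * i by (simp add: fun_upd_idem)
   then show ?thesis unfolding A_def using * by blast
  next
   assume *: "1 \<le> b i \<and> F (be(i := 1)) a (b(i := b i - 1)) \<noteq> 0"
   have "(be, a, b) = (\<lambda>(be, a, b). (be(i := 0), a, b(i := Suc (b i)))) (be(i := 1), a, b(i := b i - 1))"
    using * i by (simp add: fun_upd_idem)
   then show ?thesis unfolding A_def using * by blast
  qed
  then show "be \<in> XE m \<and> (be, a, b) \<in> A" using bnd_outside[OF F] nz by blast
 qed
qed

lemma hom_i_kfun:
 assumes F: "kfun m F"
 shows "kfun (Suc m) (hom_i i F)"
proof -
 let ?S = "{(be, a, b). F be a b \<noteq> 0}"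
 \<comment> \<open>Division lowers \<open>a i + b i\<close> by 1, so the new exponents at
   \<open>i\<close> are bounded by the sum of the old ones.\<close>
 define A where "A = (\<Union>(be, a, b)\<in>?S. (\<lambda>(k, l). (be(i := 1), a(i := k), b(i := l))) ` ({..a i + b i} \<times> {..a i + b i}))"
 show ?thesis
 proof (rule kfunI)
  show "finite A" unfolding A_def using kfun_finite[OF F] by auto
  fix be a b assume "hom_i i F be a b \<noteq> 0"
  then have be: "be i = 1" and nz: "mulU i (F (be(i := 0))) a b \<noteq> 0" by (auto simp: hom_i_def split: if_splits)
  obtain t where "t \<in> {..b i}" "F (be(i := 0)) (a(i := a i + 1 + b i - t)) (b(i := t)) \<noteq> 0"
   by (rule sum.not_neutral_contains_not_neutral[OF nz[unfolded mulU_def]])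
  then have t: "t \<le> b i" "F (be(i := 0)) (a(i := a i + 1 + b i - t)) (b(i := t)) \<noteq> 0" by auto
  have "be \<in> XE (Suc m)" using kfunD[OF F t(2)] ext_down[of be i m] be by blast
  moreover have "(be, a, b) \<in> A"
   unfolding A_def
  proof (rule UN_I[of "(be(i := 0), a(i := a i + 1 + b i - t), b(i := t))"])
   show "(be, a, b) \<in> (case (be(i := 0), a(i := a i + 1 + b i - t), b(i := t)) of (be, a, b) =>
     (\<lambda>(k, l). (be(i := 1), a(i := k), b(i := l))) ` ({..a i + b i} \<times> {..a i + b i}))"
    unfolding prod.case by (rule image_eqI[of _ _ "(a i, b i)"]) (use be t(1) in \<open>auto simp: fun_upd_idem\<close>)
  qed (use t in simp)
  ultimately show "be \<in> XE (Suc m) \<and> (be, a, b) \<in> A" by blast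
 qed
qed

lemma mulT_add: "mulT i (\<lambda>a b. f a b + g a b) a b = mulT i f a b + mulT i g a b"
 by (simp add: mulT_def)

lemma mulT_diff: "mulT i (\<lambda>a b. f a b - g a b) a b = mulT i f a b - mulT i g a b"
 by (simp add: mulT_def)

lemma bnd_add: "bnd (\<lambda>be a b. F be a b + G be a b) be a b = bnd F be a b + bnd G be a b"
 by (simp add: bnd_def mulT_add distrib_left sum.distrib)

lemma bnd_diff: "bnd (\<lambda>be a b. F be a b - G be a b) be a b = bnd F be a b - bnd G be a b"
 by (simp add: bnd_def mulT_diff right_diff_distrib sum_subtractf)

lemma kfun_plus: "kfun m F ==> kfun m G ==> kfun m (\<lambda>be a b. F be a b + G be a b)"
 using fsm_plus[of "\<lambda>(be, a, b). F be a b" _ "\<lambda>(be, a, b). G be a b"] by (simp add: kfun_def case_prod_unfold)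

lemma kfun_minus: "kfun m F ==> kfun m G ==> kfun m (\<lambda>be a b. F be a b - G be a b)"
 using fsm_plus[OF _ fsm_scale[of "\<lambda>(be, a, b). G be a b" _ "-1"], of "\<lambda>(be, a, b). F be a b"]
 by (simp add: kfun_def case_prod_unfold)

text \<open>A cycle is homologous to one supported on \<open>be = 0\<close>, \<open>a = 0\<close>: remove one variable at a time.\<close>

lemma cycle_normal_form:
 fixes F :: "'n::{finite,linorder} expo => 'n expo => 'n expo => 'k::field_char_0"
 assumes F: "kfun m F" "\<And>be a b. bnd F be a b = 0"
 shows "\<exists>Y. kfun (Suc m) Y \<and> (\<forall>be a b. F be a b - bnd Y be a b \<noteq> 0 --> (\<forall>i\<in>T. be i = 0 \<and> a i = 0))"
proof -
 have "finite T" by simp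
 then show ?thesis
 proof (induction rule: finite_induct)
  case empty
  have "kfun (Suc m) (\<lambda>be a b. 0 :: 'k)" by (rule kfunI[of "{}"]) auto
  then show ?case by auto
 next
  case (insert i T)
  then obtain Y where Y: "kfun (Suc m) Y" "\<And>be a b. F be a b - bnd Y be a b \<noteq> 0 ==> \<forall>i\<in>T. be i = 0 \<and> a i = 0"
   by blast
  define G where "G be a b = F be a b - bnd Y be a b" for be a b
  have G: "kfun m G" unfolding G_def[abs_def] by (rule kfun_minus[OF F(1) bnd_kfun[OF Y(1)]])
  have dG: "bnd G = (\<lambda>be a b. 0)" unfolding G_def[abs_def] by (simp add: fun_eq_iff bnd_diff F(2) bnd_bnd)
  have hz: "hom_i i (\<lambda>be a b. 0) be a b = (0 :: 'k)" for be a b by (simp add: hom_i_def mulU_def)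
  \<comment> \<open>As \<open>G\<close> is a cycle, the homotopy identity leaves
    \<open>G - bnd (hom_i i G) = prj_i i G\<close>, which is supported on \<open>be i = 0\<close>
    and \<open>a i = 0\<close>.\<close>
  define Y' where "Y' be a b = Y be a b + hom_i i G be a b" for be a b
  have main: "be j = 0 \<and> a j = 0" if j: "j \<in> insert i T" and nz: "F be a b - bnd Y' be a b \<noteq> 0" for be a b j
  proof -
   have e: "F be a b - bnd Y' be a b = G be a b - bnd (hom_i i G) be a b"
    by (simp add: Y'_def[abs_def] bnd_add G_def)
   have "be \<in> XE m"
   proof (rule ccontr)
    assume "be \<notin> XE m"
    then have "G be a b = 0" "bnd (hom_i i G) be a b = 0"
     using kfunD[OF G] kfunD[OF bnd_kfun[OF hom_i_kfun[OF G]]] by blast+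
    then show False using nz e by simp
   qed
   then have "be i = 0 \<or> be i = 1" by (rule ext_01)
   from bnd_homotopy[of be i G a b, OF this] have "prj_i i G be a b \<noteq> 0" using nz e by (simp add: dG hz)
   then have be: "be i = 0" "a i = 0" and nz': "(\<Sum>t\<le>b i. G be (a(i := b i - t)) (b(i := t))) \<noteq> 0"
    by (auto simp: prj_i_def mulP_def split: if_splits)
   obtain t where "G be (a(i := b i - t)) (b(i := t)) \<noteq> 0"
    by (rule sum.not_neutral_contains_not_neutral[OF nz'])
   \<comment> \<open>The remainder involves shifts of exponents at \<open>i\<close> only, so what
     has been achieved for \<open>T\<close> survives.\<close>
   then have "\<forall>j\<in>T. be j = 0 \<and> (a(i := b i - t)) j = 0" unfolding G_def by (rule Y(2))
   then show ?thesis using be j by (cases "j = i") auto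
  qed
  have "kfun (Suc m) Y'" unfolding Y'_def[abs_def] by (rule kfun_plus[OF Y(1) hom_i_kfun[OF G]])
  then show ?case
  proof (intro exI[of _ Y'] conjI allI impI ballI)
   fix be a b j assume "F be a b - bnd Y' be a b \<noteq> 0" "j \<in> insert i T"
   then show "be j = 0" "a j = 0" using main[of j be a b] by simp_all
  qed
 qed
qed

text \<open>In positive degree there is no index \<open>be = 0\<close>, so the normal form leaves no
  remainder.\<close>

lemma cycle_boundary:
 fixes F :: "'n::{finite,linorder} expo => 'n expo => 'n expo => 'k::field_char_0"
 assumes F: "kfun (Suc m) F" "\<And>be a b. bnd F be a b = 0"
 shows "\<exists>Y. kfun (Suc (Suc m)) Y \<and> bnd Y = F"
proof -
 obtain Y where Y: "kfun (Suc (Suc m)) Y" "\<And>be a b. F be a b - bnd Y be a b \<noteq> 0 ==> \<forall>i\<in>UNIV. be i = 0 \<and> a i = 0"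
  using cycle_normal_form[OF F, of UNIV] by blast
 have "F be a b - bnd Y be a b = 0" for be a b
 proof (rule ccontr)
  assume nz: "F be a b - bnd Y be a b \<noteq> 0"
  then have "be = (\<lambda>i. 0)" using Y(2) by auto
  moreover have "be \<in> XE (Suc m)"
   using nz kfunD[OF kfun_minus[OF F(1) bnd_kfun[OF Y(1)]]] by blast
  ultimately show False by (simp add: ext_exponents_def)
 qed
 then have "bnd Y = F" by (simp add: fun_eq_iff)
 then show ?thesis using Y(1) by blast
qed

declare UNIV_Times_UNIV [simp del]

locale quantum0 = quantum q for q :: "'n::{finite,linorder} => 'n => 'k::field_char_0"
begin

text \<open>The scalars in the differential are values of the bicharacter: the factor at
  \<open>s = i\<close> is 1, and reversing the indices inverts the others.\<close>

lemma kcoef1: "(\<Prod>s\<in>{..i}. q s i ^ be s) = inverse (sig q (unitv i) be)"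
proof -
 have "(\<Prod>s\<in>{..i}. q s i ^ be s) = (\<Prod>s\<in>{..<i}. q s i ^ be s)"
  by (simp add: q_diag lessThan_Suc_atMost[symmetric] ivl_disj_un(2)[symmetric])
 also have "\<dots> = (\<Prod>s\<in>{..<i}. inverse (q i s ^ be s))"
  by (rule prod.cong) (simp_all add: q_inverse[of i] power_inverse)
 finally show ?thesis by (simp add: sig_unit_left prod_inversef[unfolded comp_def])
qed

lemma kcoef2: "(\<Prod>s\<in>{i..}. q i s ^ be s) = inverse (sig q be (unitv i))"
proof -
 have "{i..} = insert i {i<..}" by auto
 then have "(\<Prod>s\<in>{i..}. q i s ^ be s) = (\<Prod>s\<in>{i<..}. q i s ^ be s)"
  by (simp add: q_diag)
 also have "\<dots> = (\<Prod>s\<in>{i<..}. inverse (q s i ^ be s))"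
  by (rule prod.cong) (simp_all add: q_inverse[of _ i] power_inverse)
 finally show ?thesis by (simp add: sig_unit_right prod_inversef[unfolded comp_def])
qed

lemma ksign: "be i = 0 ==> (-1) ^ (\<Sum>s\<in>{..i}. be s) = sg be i"
proof -
 assume "be i = 0"
 moreover have "{..i} = insert i {..<i}" by auto
 ultimately show ?thesis by (simp add: sg_def)
qed

text \<open>One summand of the Koszul differential, as an endomorphism of \<open>M\<close> depending
  on \<open>i\<close> and \<open>be\<close>. Linearity and naturality are proved for it and then
  summed.\<close>

definition kterm :: "('k, ('n list => 'k) set, 'm) bimodule => 'n => 'n expo => 'm => 'm" where
 "kterm M i be v = sg be i \<odot>\<^bsub>M\<^esub> (inverse (sig q (unitv i) be) \<odot>\<^bsub>M\<^esub> lact M (X i) v \<ominus>\<^bsub>M\<^esub>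
   inverse (sig q be (unitv i)) \<odot>\<^bsub>M\<^esub> ract M v (X i))"

lemma koszul_diff_kterm:
 "koszul_diff q M m u = (\<lambda>be'\<in>XE (Suc m). \<Oplus>\<^bsub>M\<^esub>i\<in>{i. be' i = 1}. kterm M i (be'(i := 0)) (u (be'(i := 0))))"
 unfolding koszul_diff_def Let_def kterm_def kcoef1 kcoef2 by (simp only: ksign fun_upd_same)

lemma lin_kterm: "bimodule qA M ==> lin M M (kterm M i be)"
 unfolding kterm_def[abs_def]
 by (intro lin_scale lin_diff lin_lact[of qA] lin_ract[of qA] bim_vsp[of qA]) simp_all

lemma kterm_comp:
 assumes M: "bimodule qA M" and N: "bimodule qA N" and f: "bhom qA M N f" and v: "v \<in> carrier M"
 shows "f (kterm M i be v) = kterm N i be (f v)"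
proof -
 note vM = bim_vsp[OF M] and vN = bim_vsp[OF N]
 have c: "lact M (X i) v \<in> carrier M" "ract M v (X i) \<in> carrier M" using bim_closed[OF M] v by simp_all
 show ?thesis
  using c v vM by (simp add: kterm_def lin_smult[OF bhom_lin[OF f]] lin_minus[OF vM vN bhom_lin[OF f]] bhom_lact[OF f] bhom_ract[OF f])
qed

lemma ext_sub: "be' \<in> XE (Suc m) ==> be' i = 1 ==> be'(i := 0) \<in> XE m"
 using ext_down by blast

lemma koszul_diff_closed:
 assumes M: "bimodule qA M" and u: "\<And>be. be \<in> XE m ==> u be \<in> carrier M" and be: "be' \<in> XE (Suc m)"
 shows "koszul_diff q M m u be' \<in> carrier M"
 using be u ext_sub[OF be] lin_closed[OF lin_kterm[OF M]]
 by (auto simp: koszul_diff_kterm intro!: vs_finsum[OF bim_vsp[OF M]])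

lemma koszul_diff_comp:
 assumes M: "bimodule qA M" and N: "bimodule qA N" and f: "bhom qA M N f"
  and u: "\<And>be. be \<in> XE m ==> u be \<in> carrier M" and be: "be' \<in> XE (Suc m)"
 shows "koszul_diff q N m (\<lambda>be\<in>XE m. f (u be)) be' = f (koszul_diff q M m u be')"
 using be u ext_sub[OF be] lin_closed[OF lin_kterm[OF M]] bhom_closed[OF f] lin_closed[OF lin_kterm[OF N]]
 by (auto simp: koszul_diff_kterm lin_finsum[OF bim_vsp[OF M] bim_vsp[OF N] bhom_lin[OF f]] kterm_comp[OF M N f]
   intro!: vs_finsum_cong[OF bim_vsp[OF N]])

section \<open>The twisted Koszul resolution and its exactness\<close>

definition kos :: "nat => ('k, ('n list => 'k) set, 'n expo \<times> 'n expo \<times> 'n expo => 'k) bimodule" where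
 "kos m = A.free_bim (XE m)"

definition kgen :: "'n expo => 'n expo \<times> 'n expo \<times> 'n expo => 'k" where
 "kgen be = A.ten be \<one>\<^bsub>qA\<^esub> \<one>\<^bsub>qA\<^esub>"

text \<open>As for the bar resolution, the cochain differential is applied to the universal cochain,
  here the family of free generators.\<close>

definition kd :: "nat => ('n expo \<times> 'n expo \<times> 'n expo => 'k) => ('n expo \<times> 'n expo \<times> 'n expo => 'k)" where
 "kd m = A.fext (kos m) (koszul_diff q (kos m) m (\<lambda>be\<in>XE m. kgen be))"

definition kaug :: "('n expo \<times> 'n expo \<times> 'n expo => 'k) => ('n list => 'k) set" where
 "kaug = A.fext (regular qA) (\<lambda>be. \<one>\<^bsub>qA\<^esub>)"

lemma bimodule_kos: "bimodule qA (kos m)" by (simp add: kos_def A.bimodule_free)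
lemma projective_kos: "projective qA (kos m)" by (simp add: kos_def A.projective_free)
lemma carrier_kos: "carrier (kos m) = FS (XE m \<times> UNIV \<times> UNIV)" by (simp add: kos_def)
lemma vsp_kos: "vsp (kos m)" by (simp add: kos_def)
lemma kos_simps [simp]:
 "\<zero>\<^bsub>kos m\<^esub> = (\<lambda>_. 0)" "f \<oplus>\<^bsub>kos m\<^esub> g = (\<lambda>i. f i + g i)" "c \<odot>\<^bsub>kos m\<^esub> f = (\<lambda>i. c * f i)"
 by (simp_all add: kos_def)

lemma kos_minus: "f \<in> carrier (kos m) ==> g \<in> carrier (kos m) ==> f \<ominus>\<^bsub>kos m\<^esub> g = (\<lambda>i. f i - g i)"
 by (simp add: vs_minus_eq[OF vsp_kos])

lemma kgen_closed: "be \<in> XE m ==> kgen be \<in> carrier (kos m)"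
 by (simp add: carrier_kos kgen_def A.ten_closed)

lemma kdiff_gen_closed: "koszul_diff q (kos m) m (\<lambda>be\<in>XE m. kgen be) \<in> XE (Suc m) \<rightarrow> carrier (kos m)"
 by (intro funcsetI koszul_diff_closed[OF bimodule_kos]) (simp_all add: kgen_closed)

lemma bhom_kd: "bhom qA (kos (Suc m)) (kos m) (kd m)"
 unfolding kd_def kos_def[of "Suc m"] by (rule A.bhom_fext[OF bimodule_kos kdiff_gen_closed])

lemma kd_gen: "be' \<in> XE (Suc m) ==>
  kd m (kgen be') = koszul_diff q (kos m) m (\<lambda>be\<in>XE m. kgen be) be'"
 unfolding kd_def kgen_def by (rule A.fext_gen[OF bimodule_kos kdiff_gen_closed[unfolded kgen_def]])

lemma one_in_regular: "(\<lambda>be. \<one>\<^bsub>qA\<^esub>) \<in> XE 0 \<rightarrow> carrier (regular qA)" by simp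

lemma bhom_kaug: "bhom qA (kos 0) (regular qA) kaug"
 unfolding kaug_def kos_def by (rule A.bhom_fext[OF A.bimodule_regular one_in_regular])

lemma kaug_ten: "be \<in> XE 0 ==> r \<in> carrier qA ==> s \<in> carrier qA ==> kaug (A.ten be r s) = r \<otimes>\<^bsub>qA\<^esub> s"
 unfolding kaug_def by (simp add: A.fext_ten[OF A.bimodule_regular one_in_regular])

lemma ten_smult:
 "r \<in> carrier qA ==> A.ten be (c \<odot>\<^bsub>qA\<^esub> r) s = (\<lambda>z. c * A.ten be r s z)"
 "s \<in> carrier qA ==> A.ten be r (c \<odot>\<^bsub>qA\<^esub> s) = (\<lambda>z. c * A.ten be r s z)"
 by (auto simp: A.ten_def A.co_smult fun_eq_iff)

lemma kd_dl:
 assumes be: "be' \<in> XE (Suc m)"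
 shows "kd m (dl (be', a, b)) = (\<lambda>z. \<Sum>i | be' i = 1. sg (be'(i := 0)) i *
   (inverse (sig q (unitv i) (be'(i := 0))) * (sig q a (unitv i) * dl (be'(i := 0), plusv a (unitv i), b) z) -
   inverse (sig q (be'(i := 0)) (unitv i)) * (sig q (unitv i) b * dl (be'(i := 0), a, plusv (unitv i) b) z)))"
proof -
 note v = vsp_kos[of m] and bm = bimodule_kos[of m]
 let ?I = "XE m \<times> UNIV \<times> UNIV"
 have lr: "lin (kos m) (kos m) (\<lambda>v. ract (kos m) (lact (kos m) (qmonom q a) v) (qmonom q b))"
  by (rule lin_comp[OF lin_lact[OF bm] lin_ract[OF bm]]) simp_all
 have t: "ract (kos m) (lact (kos m) (qmonom q a) (kterm (kos m) i be (kgen be))) (qmonom q b) = (\<lambda>z. sg be i *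
   (inverse (sig q (unitv i) be) * (sig q a (unitv i) * dl (be, plusv a (unitv i), b) z) -
   inverse (sig q be (unitv i)) * (sig q (unitv i) b * dl (be, a, plusv (unitv i) b) z)))" (is "?l = ?r")
  if b': "be \<in> XE m" for be i
 proof -
  have c: "lact (kos m) (X i) (kgen be) \<in> carrier (kos m)" "ract (kos m) (kgen be) (X i) \<in> carrier (kos m)"
   using bim_closed[OF bm] kgen_closed[OF b'] by simp_all
  have l: "lact (kos m) (X i) (kgen be) = A.ten be (X i) \<one>\<^bsub>qA\<^esub>" "ract (kos m) (kgen be) (X i) = A.ten be \<one>\<^bsub>qA\<^esub> (X i)"
   using b' by (simp_all add: kos_def kgen_def A.free_lact_ten A.free_ract_ten)
  have 1: "ract (kos m) (lact (kos m) (qmonom q a) (lact (kos m) (X i) (kgen be))) (qmonom q b) =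
    (\<lambda>z. sig q a (unitv i) * dl (be, plusv a (unitv i), b) z)"
   using b' unfolding l
   by (simp add: kos_def A.free_lact_ten A.free_ract_ten)
    (simp add: qmonom_unitv[symmetric] qmonom_mult ten_smult A.ten_b)
  have 2: "ract (kos m) (lact (kos m) (qmonom q a) (ract (kos m) (kgen be) (X i))) (qmonom q b) =
    (\<lambda>z. sig q (unitv i) b * dl (be, a, plusv (unitv i) b) z)"
   using b' unfolding l
   by (simp add: kos_def A.free_lact_ten A.free_ract_ten)
    (simp add: qmonom_unitv[symmetric] qmonom_mult ten_smult A.ten_b)
  have "?l = sg be i \<odot>\<^bsub>kos m\<^esub> (inverse (sig q (unitv i) be) \<odot>\<^bsub>kos m\<^esub> (\<lambda>z. sig q a (unitv i) * dl (be, plusv a (unitv i), b) z) \<ominus>\<^bsub>kos m\<^esub>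
    inverse (sig q be (unitv i)) \<odot>\<^bsub>kos m\<^esub> (\<lambda>z. sig q (unitv i) b * dl (be, a, plusv (unitv i) b) z))"
   unfolding kterm_def using c v by (simp only: lin_smult[OF lr] lin_minus[OF v v lr] vs_smult vs_minus 1 2)
  also have "\<dots> = ?r"
   using b' by (simp add: kos_minus carrier_kos fsm_scale)
  finally show ?thesis .
 qed
 have d: "dl (be', a, b) = ract (kos (Suc m)) (lact (kos (Suc m)) (qmonom q a) (kgen be')) (qmonom q b)"
  using be by (simp add: kos_def kgen_def A.free_lact_ten A.free_ract_ten A.ten_b)
 have kc: "lact (kos (Suc m)) (qmonom q a) (kgen be') \<in> carrier (kos (Suc m))"
  by (rule bimodule.lact_closed[OF bimodule_kos]) (simp_all add: kgen_closed be)
 have tc: "kterm (kos m) i (be'(i := 0)) (kgen (be'(i := 0))) \<in> carrier (kos m)" if "be' i = 1" for i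
  by (rule lin_closed[OF lin_kterm[OF bm] kgen_closed[OF ext_sub[OF be that]]])
 have "kd m (dl (be', a, b)) = ract (kos m) (lact (kos m) (qmonom q a) (kd m (kgen be'))) (qmonom q b)"
  unfolding d using kc kgen_closed[OF be] by (simp add: bhom_ract[OF bhom_kd] bhom_lact[OF bhom_kd])
 also have "kd m (kgen be') = (\<Oplus>\<^bsub>kos m\<^esub>i\<in>{i. be' i = 1}. kterm (kos m) i (be'(i := 0)) (kgen (be'(i := 0))))"
  unfolding kd_gen[OF be] koszul_diff_kterm using be ext_sub[OF be] tc
  by (auto intro!: vs_finsum_cong[OF v])
 also have "ract (kos m) (lact (kos m) (qmonom q a) (\<Oplus>\<^bsub>kos m\<^esub>i\<in>{i. be' i = 1}. kterm (kos m) i (be'(i := 0)) (kgen (be'(i := 0))))) (qmonom q b)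
   = (\<Oplus>\<^bsub>kos m\<^esub>i\<in>{i. be' i = 1}. ract (kos m) (lact (kos m) (qmonom q a) (kterm (kos m) i (be'(i := 0)) (kgen (be'(i := 0))))) (qmonom q b))"
  by (rule lin_finsum[OF v v lr]) (use tc in auto)
 also have "\<dots> = finsum (fsm ?I) (\<lambda>i. ract (kos m) (lact (kos m) (qmonom q a) (kterm (kos m) i (be'(i := 0)) (kgen (be'(i := 0))))) (qmonom q b)) {i. be' i = 1}"
  using tc lin_closed[OF lr] by (intro finsum_cong_struct[OF vsp_fsm v]) (auto simp: carrier_kos)
 also have "\<dots> = (\<lambda>z. \<Sum>i | be' i = 1. ract (kos m) (lact (kos m) (qmonom q a) (kterm (kos m) i (be'(i := 0)) (kgen (be'(i := 0))))) (qmonom q b) z)"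
  using tc lin_closed[OF lr] by (intro finsum_fsm) (auto simp: carrier_kos)
 finally show ?thesis using t[OF ext_sub[OF be]] by simp
qed

text \<open>The scalar with \<open>x^a x^be x^b = Cc be a b x^(a+be+b)\<close>.\<close>

definition Cc :: "'n expo => 'n expo => 'n expo => 'k" where
 "Cc be a b = sig q a be * sig q a b * sig q be b"

lemma Cc_nonzero: "Cc be a b \<noteq> 0" by (simp add: Cc_def sig_nonzero)

text \<open>Reflects associativity: an \<open>x_i\<close> next to the middle factor may be counted
  with the left monomial or with the middle one. Here and in \<open>Cc_right\<close> the result is
  the same scalar \<open>Cc (be + [i]) a b\<close>, so all \<open>q\<close> cancel in the rescaled
  differential.\<close>

lemma Cc_left: "Cc be (plusv a (unitv i)) b * (inverse (sig q (unitv i) be) * sig q a (unitv i)) = Cc (plusv be (unitv i)) a b"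
 by (simp add: Cc_def sig_plus sig_nonzero field_simps)

lemma Cc_right: "Cc be a (plusv (unitv i) b) * (inverse (sig q be (unitv i)) * sig q (unitv i) b) = Cc (plusv be (unitv i)) a b"
 by (simp add: Cc_def sig_plus sig_nonzero field_simps)

lemma plusv_comm: "plusv al be = plusv be al" for al :: "'n expo" by (simp add: plusv_def add.commute)

lemma plusv_unitv_iff: "a = plusv a' (unitv i) \<longleftrightarrow> 1 \<le> a i \<and> a' = a(i := a i - 1)" for a :: "'n expo"
 by (auto simp: plusv_def unitv_def fun_eq_iff)

lemma upd_plusv: "be i = 0 ==> be(i := 1) = plusv be (unitv i)" for be :: "'n expo"
 by (auto simp: plusv_def unitv_def fun_eq_iff)

lemma bnd_scale: "bnd (\<lambda>be a b. c * F be a b) be a b = c * bnd F be a b"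
 by (simp add: bnd_def mul_scale sum_distrib_left mult.left_commute)

lemma kd_formula:
 assumes f: "f \<in> carrier (kos (Suc m))" and be: "be \<in> XE m"
 shows "Cc be a b * kd m f (be, a, b) = bnd (\<lambda>be a b. Cc be a b * f (be, a, b)) be a b"
proof (rule functional_eqI[of "XE (Suc m) \<times> UNIV \<times> UNIV" "\<lambda>f. Cc be a b * kd m f (be, a, b)"
   "\<lambda>f. bnd (\<lambda>be a b. Cc be a b * f (be, a, b)) be a b"])
 note l = bhom_lin[OF bhom_kd[of m]]
 show "f \<in> FS (XE (Suc m) \<times> UNIV \<times> UNIV)" using f by (simp add: carrier_kos)
 fix f g :: "'n expo \<times> 'n expo \<times> 'n expo => 'k" assume fg: "f \<in> FS (XE (Suc m) \<times> UNIV \<times> UNIV)" "g \<in> FS (XE (Suc m) \<times> UNIV \<times> UNIV)"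
 show "Cc be a b * kd m (\<lambda>i. f i + g i) (be, a, b) = Cc be a b * kd m f (be, a, b) + Cc be a b * kd m g (be, a, b)"
  using lin_add[OF l, of f g] fg by (simp add: carrier_kos distrib_left)
 show "bnd (\<lambda>be a b. Cc be a b * (f (be, a, b) + g (be, a, b))) be a b =
   bnd (\<lambda>be a b. Cc be a b * f (be, a, b)) be a b + bnd (\<lambda>be a b. Cc be a b * g (be, a, b)) be a b"
  by (simp add: distrib_left bnd_add)
next
 note l = bhom_lin[OF bhom_kd[of m]]
 fix f :: "'n expo \<times> 'n expo \<times> 'n expo => 'k" and c assume f: "f \<in> FS (XE (Suc m) \<times> UNIV \<times> UNIV)"
 show "Cc be a b * kd m (\<lambda>i. c * f i) (be, a, b) = c * (Cc be a b * kd m f (be, a, b))"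
  using lin_smult[OF l, of f c] f by (simp add: carrier_kos)
 have "(\<lambda>be a b. Cc be a b * (c * f (be, a, b))) = (\<lambda>be a b. c * (Cc be a b * f (be, a, b)))" by (simp add: fun_eq_iff)
 then show "bnd (\<lambda>be a b. Cc be a b * (c * f (be, a, b))) be a b = c * bnd (\<lambda>be a b. Cc be a b * f (be, a, b)) be a b"
  by (simp only: bnd_scale)
next
 fix y :: "'n expo \<times> 'n expo \<times> 'n expo" assume "y \<in> XE (Suc m) \<times> (UNIV :: 'n expo set) \<times> (UNIV :: 'n expo set)"
 then obtain be' a' b' where y: "y = (be', a', b')" "be' \<in> XE (Suc m)" by auto
 \<comment> \<open>One side is a sum over positions of \<open>be'\<close>, the other over positions
   of \<open>be\<close>. Padded with zeros, both run over all \<open>i\<close> and can be compared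
   termwise; they are nonzero only where \<open>be'\<close> is \<open>be + [i]\<close>.\<close>
 define L where "L i = (if be' i = 1 then Cc be a b * (sg (be'(i := 0)) i *
   (inverse (sig q (unitv i) (be'(i := 0))) * (sig q a' (unitv i) * dl (be'(i := 0), plusv a' (unitv i), b') (be, a, b)) -
   inverse (sig q (be'(i := 0)) (unitv i)) * (sig q (unitv i) b' * dl (be'(i := 0), a', plusv (unitv i) b') (be, a, b)))) else 0)" for i
 define R where "R i = (if be i = 0 then sg be i * mulT i (\<lambda>a b. Cc (be(i := 1)) a b * dl y (be(i := 1), a, b)) a b else 0)" for i
 have "L i = R i" for i
 proof (cases "be i = 0 \<and> be' = be(i := 1)")
  case True
  then have i: "be i = 0" "be' = be(i := 1)" by auto
  have e: "be'(i := 0) = be" "be' i = 1" using i by (auto simp: fun_upd_idem)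
  have 1: "Cc be a b * (inverse (sig q (unitv i) be) * sig q a' (unitv i)) * dl (be, plusv a' (unitv i), b') (be, a, b) =
    (if 1 \<le> a i then Cc be' (a(i := a i - 1)) b * dl y (be', a(i := a i - 1), b) else 0)"
  proof (cases "a = plusv a' (unitv i) \<and> b = b'")
   case ab: True
   then have a: "1 \<le> a i" "a(i := a i - 1) = a'" using plusv_unitv_iff[of a a' i] by auto
   have "Cc be a b * (inverse (sig q (unitv i) be) * sig q a' (unitv i)) = Cc be' a' b"
    using Cc_left[of be a' i b] ab i upd_plusv[of be i] by simp
   moreover have "dl (be, plusv a' (unitv i), b') (be, a, b) = (1 :: 'k)" using ab by simp
   moreover have "dl y (be', a', b) = (1 :: 'k)" using ab by (simp add: y)
   ultimately show ?thesis unfolding a(2) using a(1) by simp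
  next
   case False
   then have "\<not> (1 \<le> a i \<and> a' = a(i := a i - 1) \<and> b = b')" using plusv_unitv_iff[of a a' i] by auto
   then show ?thesis using False by (auto simp: y dl_def)
  qed
  have 2: "Cc be a b * (inverse (sig q be (unitv i)) * sig q (unitv i) b') * dl (be, a', plusv (unitv i) b') (be, a, b) =
    (if 1 \<le> b i then Cc be' a (b(i := b i - 1)) * dl y (be', a, b(i := b i - 1)) else 0)"
  proof (cases "b = plusv b' (unitv i) \<and> a = a'")
   case ab: True
   then have b: "1 \<le> b i" "b(i := b i - 1) = b'" using plusv_unitv_iff[of b b' i] by auto
   have "Cc be a b * (inverse (sig q be (unitv i)) * sig q (unitv i) b') = Cc be' a b'"
    using Cc_right[of be a' i b'] ab i upd_plusv[of be i] by (simp add: plusv_comm[of "unitv i" b'])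
   moreover have "dl (be, a', plusv (unitv i) b') (be, a, b) = (1 :: 'k)" using ab by (simp add: plusv_comm[of "unitv i" b'])
   moreover have "dl y (be', a, b') = (1 :: 'k)" using ab by (simp add: y)
   ultimately show ?thesis unfolding b(2) using b(1) by simp
  next
   case False
   then have "\<not> (1 \<le> b i \<and> b' = b(i := b i - 1) \<and> a = a')" using plusv_unitv_iff[of b b' i] by auto
   then show ?thesis using False by (auto simp: y dl_def plusv_comm[of "unitv i" b'])
  qed
  have "L i = sg be i * (Cc be a b * (inverse (sig q (unitv i) be) * sig q a' (unitv i)) * dl (be, plusv a' (unitv i), b') (be, a, b) -
    Cc be a b * (inverse (sig q be (unitv i)) * sig q (unitv i) b') * dl (be, a', plusv (unitv i) b') (be, a, b))"
   unfolding L_def e by (simp add: algebra_simps)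
  then show ?thesis unfolding 1 2 using i by (simp add: R_def mulT_def)
 next
  case False
  have "L i = 0"
  proof (cases "be' i = 1")
   case True
   then have "be'(i := 0) \<noteq> be" using False by (auto simp: fun_upd_idem)
   then show ?thesis by (simp add: L_def dl_def)
  qed (simp add: L_def)
  moreover have "R i = 0"
  proof (cases "be i = 0")
   case True
   then have "be(i := 1) \<noteq> be'" using False by auto
   then show ?thesis by (simp add: R_def y dl_def mulT_def)
  qed (simp add: R_def)
  ultimately show ?thesis by simp
 qed
 then have "(\<Sum>i\<in>UNIV. L i) = (\<Sum>i\<in>UNIV. R i)" by simp
 moreover have "(\<Sum>i\<in>UNIV. L i) = Cc be a b * kd m (dl y) (be, a, b)"
  unfolding y(1) kd_dl[OF y(2)] sum_distrib_left L_def by (rule sum.mono_neutral_cong_right) auto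
 moreover have "(\<Sum>i\<in>UNIV. R i) = bnd (\<lambda>be a b. Cc be a b * dl y (be, a, b)) be a b"
  unfolding bnd_def R_def by (rule sum.mono_neutral_cong_right) auto
 ultimately show "Cc be a b * kd m (dl y) (be, a, b) = bnd (\<lambda>be a b. Cc be a b * dl y (be, a, b)) be a b" by simp
qed

definition twist_in where "twist_in f = (\<lambda>be a b. Cc be a b * f (be, a, b))"
definition twist_out where "twist_out F = (\<lambda>(be, a, b). F be a b / Cc be a b)"

lemma twist_in_kfun: "f \<in> carrier (kos m) ==> kfun m (twist_in f)"
proof -
 assume f: "f \<in> carrier (kos m)"
 then have "finite {z. f z \<noteq> 0}" "\<And>be a b. f (be, a, b) \<noteq> 0 ==> be \<in> XE m"
  by (auto simp: carrier_kos carrier_fsm subset_iff)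
 then show ?thesis by (intro kfunI[of "{z. f z \<noteq> 0}"]) (auto simp: twist_in_def)
qed

lemma twist_out_closed: "kfun m F ==> twist_out F \<in> carrier (kos m)"
proof -
 assume F: "kfun m F"
 show ?thesis
  unfolding carrier_kos
  by (rule fsmI[of "{(be, a, b). F be a b \<noteq> 0}"]) (use kfun_finite[OF F] kfunD[OF F] in \<open>auto simp: twist_out_def\<close>)
qed

lemma twist_in_out: "twist_in (twist_out F) = F"
 by (simp add: twist_in_def twist_out_def Cc_nonzero fun_eq_iff)

lemma twist_in_inj: "twist_in f = twist_in g ==> f = g"
 by (auto simp: twist_in_def Cc_nonzero fun_eq_iff)

text \<open>Off \<open>XE m\<close> both sides vanish, so the coordinate formula extends to an
  equality of functions and exactness can be carried over from \<open>bnd\<close>.\<close>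

lemma twist_kd:
 assumes f: "f \<in> carrier (kos (Suc m))"
 shows "twist_in (kd m f) = bnd (twist_in f)"
proof (intro ext)
 fix be a b
 show "twist_in (kd m f) be a b = bnd (twist_in f) be a b"
 proof (cases "be \<in> XE m")
  case True
  then show ?thesis using kd_formula[OF f] by (simp add: twist_in_def)
 next
  case False
  then have "twist_in (kd m f) be a b = 0"
   using kfunD[OF twist_in_kfun[OF bhom_closed[OF bhom_kd f]]] by blast
  then show ?thesis using bnd_outside[OF twist_in_kfun[OF f] False] by simp
 qed
qed

lemma twist_zero: "twist_in (\<lambda>_. 0) = (\<lambda>_ _ _. 0)" by (simp add: twist_in_def)

lemma kd_kd: "f \<in> carrier (kos (Suc (Suc m))) ==> kd m (kd (Suc m) f) = \<zero>\<^bsub>kos m\<^esub>"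
 by (rule twist_in_inj) (simp add: twist_kd bhom_closed[OF bhom_kd] twist_zero bnd_bnd fun_eq_iff)

lemma kaug_kd: "f \<in> carrier (kos (Suc 0)) ==> kaug (kd 0 f) = \<zero>\<^bsub>qA\<^esub>"
proof -
 assume f: "f \<in> carrier (kos (Suc 0))"
 note R = A.bimodule_regular
 have "kaug (kd 0 f) = \<zero>\<^bsub>regular qA\<^esub>"
 proof (rule A.free_hom_eqI[OF R, of "XE (Suc 0)" "\<lambda>f. kaug (kd 0 f)" "\<lambda>_. \<zero>\<^bsub>regular qA\<^esub>"])
  show "bhom qA (A.free_bim (XE (Suc 0))) (regular qA) (\<lambda>f. kaug (kd 0 f))"
   using bhom_comp[OF bhom_kd[of 0] bhom_kaug] by (simp add: kos_def)
  show "bhom qA (A.free_bim (XE (Suc 0))) (regular qA) (\<lambda>_. \<zero>\<^bsub>regular qA\<^esub>)"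
   by (rule bhom_zero[OF A.bimodule_free R])
  fix be' :: "'n expo" assume be: "be' \<in> XE (Suc 0)"
  have c: "kterm (kos 0) i (be'(i := 0)) (kgen (be'(i := 0))) \<in> carrier (kos 0)" if "be' i = 1" for i
   by (rule lin_closed[OF lin_kterm[OF bimodule_kos] kgen_closed[OF ext_sub[OF be that]]])
  have "kaug (kd 0 (kgen be')) = kaug (\<Oplus>\<^bsub>kos 0\<^esub>i\<in>{i. be' i = 1}. kterm (kos 0) i (be'(i := 0)) (kgen (be'(i := 0))))"
   unfolding kd_gen[OF be] koszul_diff_kterm using be ext_sub[OF be] c
   by (auto intro!: arg_cong[of _ _ kaug] vs_finsum_cong[OF vsp_kos])
  also have "\<dots> = (\<Oplus>\<^bsub>regular qA\<^esub>i\<in>{i. be' i = 1}. kaug (kterm (kos 0) i (be'(i := 0)) (kgen (be'(i := 0)))))"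
   by (rule lin_finsum[OF vsp_kos bim_vsp[OF R] bhom_lin[OF bhom_kaug]]) (use c in auto)
  also have "\<dots> = \<zero>\<^bsub>regular qA\<^esub>"
  proof (rule vs_finsum_zero[OF bim_vsp[OF R]])
   fix i assume "i \<in> {i. be' i = 1}"
   then have i: "be'(i := 0) \<in> XE 0" using ext_sub[OF be] by simp
   then have z: "be'(i := 0) = (\<lambda>_. 0)" by (simp add: ext_0)
   have g: "kaug (kgen (be'(i := 0))) = \<one>\<^bsub>qA\<^esub>" using kaug_ten[OF i] by (simp add: kgen_def)
   have "kaug (kterm (kos 0) i (be'(i := 0)) (kgen (be'(i := 0)))) = kterm (regular qA) i (be'(i := 0)) \<one>\<^bsub>qA\<^esub>"
    using kterm_comp[OF bimodule_kos R bhom_kaug kgen_closed[OF i]] g by simp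
   also have "\<dots> = sg (be'(i := 0)) i \<odot>\<^bsub>regular qA\<^esub> (X i \<ominus>\<^bsub>regular qA\<^esub> X i)"
    using vs_smult_one[OF vsp_qsym, of "X i"] by (simp add: kterm_def z sig_zero)
   also have "\<dots> = \<zero>\<^bsub>regular qA\<^esub>"
    by (subst vs_minus_self[OF bim_vsp[OF R]]) (simp, rule vs_smult_zero_right[OF bim_vsp[OF R]])
   finally show "kaug (kterm (kos 0) i (be'(i := 0)) (kgen (be'(i := 0)))) = \<zero>\<^bsub>regular qA\<^esub>" .
  qed
  finally show "kaug (kd 0 (A.ten be' \<one>\<^bsub>qA\<^esub> \<one>\<^bsub>qA\<^esub>)) = \<zero>\<^bsub>regular qA\<^esub>" by (simp add: kgen_def)
 qed (use f in \<open>simp add: carrier_kos\<close>)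
 then show ?thesis by simp
qed

text \<open>Modulo boundaries \<open>z\<close> is supported on
  \<open>1 \<otimes> 1 \<otimes> x^b\<close>, that is, on \<open>be = 0\<close> and
  \<open>a = 0\<close>. There the augmentation is injective, as it sends these vectors to distinct
  monomials.\<close>

lemma kaug_exact:
 assumes z: "z \<in> carrier (kos 0)" and k: "kaug z = \<zero>\<^bsub>qA\<^esub>"
 shows "z \<in> kd 0 ` carrier (kos (Suc 0))"
proof -
 \<comment> \<open>In degree 0 nothing lies over an index containing a 1, so \<open>z\<close> counts
   as a cycle for \<open>bnd\<close> and the normal form applies.\<close>
 have "bnd (twist_in z) be a b = 0" for be a b
  unfolding bnd_def
 proof (rule sum.neutral, rule ballI)
  fix i assume "i \<in> {i. be i = 0}"
  have "be(i := 1) \<notin> XE 0" by (auto simp: ext_0 fun_eq_iff)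
  then show "sg be i * mulT i (twist_in z (be(i := 1))) a b = 0"
   by (simp add: kfun_zero[OF twist_in_kfun[OF z]] mulT_zero)
 qed
 then obtain Y where Y: "kfun (Suc 0) Y"
   "\<And>be a b. twist_in z be a b - bnd Y be a b \<noteq> 0 ==> \<forall>i\<in>UNIV. be i = 0 \<and> a i = 0"
  using cycle_normal_form[OF twist_in_kfun[OF z], of UNIV] by blast
 define y where "y = twist_out Y"
 have y: "y \<in> carrier (kos (Suc 0))" unfolding y_def by (rule twist_out_closed[OF Y(1)])
 note dy = bhom_closed[OF bhom_kd y]
 define g where "g = z \<ominus>\<^bsub>kos 0\<^esub> kd 0 y"
 have g: "g \<in> carrier (kos 0)" unfolding g_def using z dy by (simp add: vsp_kos)
 have ge: "g = (\<lambda>w. z w - kd 0 y w)"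
  unfolding g_def using z dy by (simp add: kos_minus)
 have supp: "be = (\<lambda>_. 0) \<and> a = (\<lambda>_. 0)" if "g (be, a, b) \<noteq> 0" for be a b
 proof -
  have "twist_in z be a b - bnd Y be a b = twist_in z be a b - twist_in (kd 0 y) be a b"
   by (simp add: twist_kd[OF y]) (simp add: y_def twist_in_out)
  also have "\<dots> = Cc be a b * g (be, a, b)" by (simp add: twist_in_def ge right_diff_distrib)
  finally have "twist_in z be a b - bnd Y be a b \<noteq> 0" using that by (simp add: Cc_nonzero)
  from Y(2)[OF this] show ?thesis by auto
 qed
 have kg: "kaug g = \<zero>\<^bsub>qA\<^esub>"
  unfolding g_def using z dy kaug_kd[OF y] k vs_minus_self[OF bim_vsp[OF A.bimodule_regular], of "\<zero>\<^bsub>qA\<^esub>"]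
  by (simp add: lin_minus[OF vsp_kos bim_vsp[OF A.bimodule_regular] bhom_lin[OF bhom_kaug]])
 let ?I = "(XE 0 :: 'n expo set) \<times> (UNIV :: 'n expo set) \<times> (UNIV :: 'n expo set)"
 define h where "h = (\<lambda>b. g ((\<lambda>_. 0), (\<lambda>_. 0), b))"
 have h: "h \<in> FS UNIV"
  using g inj_on_finite[of "\<lambda>b. ((\<lambda>_. 0) :: 'n expo, (\<lambda>_. 0) :: 'n expo, b)" "{b. h b \<noteq> 0}" "{z. g z \<noteq> 0}"]
  by (auto simp: carrier_kos carrier_fsm h_def inj_on_def)
 define \<iota> :: "('n expo => 'k) => 'n expo \<times> 'n expo \<times> 'n expo => 'k"
  where "\<iota> = lext (fsm ?I) (\<lambda>b. dl ((\<lambda>_. 0), (\<lambda>_. 0), b))"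
 have \<iota>: "lin (fsm UNIV) (fsm ?I) \<iota>" unfolding \<iota>_def by (rule lin_lext) (simp_all add: ext_0)
 have "\<iota> h = (\<lambda>z. \<Sum>b | h b \<noteq> 0. h b * dl ((\<lambda>_. 0), (\<lambda>_. 0), b) z)"
  unfolding \<iota>_def by (rule lext_fsm[OF _ h]) (simp add: ext_0)
 also have "\<dots> = g"
 proof
  fix w :: "'n expo \<times> 'n expo \<times> 'n expo" obtain be a b where w: "w = (be, a, b)" by (metis prod_cases3)
  have "(\<Sum>b' | h b' \<noteq> 0. h b' * dl ((\<lambda>_. 0), (\<lambda>_. 0), b') w) =
    (\<Sum>b' | h b' \<noteq> 0. if b' = b then (if be = (\<lambda>_. 0) \<and> a = (\<lambda>_. 0) then h b else 0) else 0)"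
   by (rule sum.cong) (auto simp: w dl_def)
  also have "\<dots> = (if h b \<noteq> 0 \<and> be = (\<lambda>_. 0) \<and> a = (\<lambda>_. 0) then h b else 0)"
   using fsmD(1)[OF h] by simp
  also have "\<dots> = g w"
  proof (cases "be = (\<lambda>_. 0) \<and> a = (\<lambda>_. 0)")
   case True
   then show ?thesis by (simp add: w h_def)
  next
   case False
   then have "g w = 0" using supp[of be a b] unfolding w by blast
   then show ?thesis using False by auto
  qed
  finally show "(\<Sum>b' | h b' \<noteq> 0. h b' * dl ((\<lambda>_. 0), (\<lambda>_. 0), b') w) = g w" .
 qed
 finally have \<iota>h: "\<iota> h = g" .
 have lk: "lin (fsm ?I) qA kaug" using bhom_lin[OF bhom_kaug] by (simp add: kos_def lin_def)
 \<comment> \<open>\<open>qco\<close> after \<open>kaug\<close> inverts the embedding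
   \<open>\<iota>\<close> of the vectors \<open>1 \<otimes> 1 \<otimes> x^b\<close>.\<close>
 have "qco (kaug (\<iota> h)) = h"
 proof (rule lin_fsm_eqI[OF vsp_fsm lin_comp[OF lin_comp[OF \<iota> lk] lin_qco] lin_id _ h])
  fix b :: "'n expo"
  have "kaug (A.ten (\<lambda>_. 0) (qmonom q (\<lambda>_. 0)) (qmonom q b)) = qmonom q b"
   by (subst kaug_ten) (simp_all add: ext_0 qmonom_zero)
  then have "kaug (dl ((\<lambda>_. 0), (\<lambda>_. 0), b)) = qmonom q b" by (simp add: A.ten_b)
  moreover have "\<iota> (dl b) = dl ((\<lambda>_. 0), (\<lambda>_. 0), b)" unfolding \<iota>_def by (rule lext_dl) (simp_all add: ext_0)
  ultimately show "qco (kaug (\<iota> (dl b))) = dl b" by (simp add: qco_qmonom)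
 qed
 then have "h = (\<lambda>_. 0)" using \<iota>h kg lin_zero[OF vsp_qsym vsp_fsm lin_qco] by simp
 then have h0: "g ((\<lambda>_. 0), (\<lambda>_. 0), b) = 0" for b by (simp add: h_def fun_eq_iff)
 have "g w = 0" for w
 proof (rule ccontr)
  assume nz: "g w \<noteq> 0"
  obtain be a b where w: "w = (be, a, b)" by (metis prod_cases3)
  then have "be = (\<lambda>_. 0)" "a = (\<lambda>_. 0)" using supp[of be a b] nz by blast+
  then show False using nz h0 w by simp
 qed
 then have "z = kd 0 y" using ge by (auto simp: fun_eq_iff)
 then show ?thesis using y by blast
qed

lemma kd_exact:
 assumes z: "z \<in> carrier (kos (Suc m))" and k: "kd m z = \<zero>\<^bsub>kos m\<^esub>"
 shows "z \<in> kd (Suc m) ` carrier (kos (Suc (Suc m)))"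
proof -
 have "bnd (twist_in z) be a b = 0" for be a b
  using twist_kd[OF z] by (simp add: k twist_zero fun_eq_iff)
 then obtain Y where Y: "kfun (Suc (Suc m)) Y" "bnd Y = twist_in z"
  using cycle_boundary[OF twist_in_kfun[OF z]] by blast
 have y: "twist_out Y \<in> carrier (kos (Suc (Suc m)))" by (rule twist_out_closed[OF Y(1)])
 have "twist_in (kd (Suc m) (twist_out Y)) = twist_in z" by (simp add: twist_kd[OF y] twist_in_out Y)
 then have "z = kd (Suc m) (twist_out Y)" using twist_in_inj by metis
 then show ?thesis using y by blast
qed

lemma resolution_kos: "resolution qA kos kd kaug"
proof -
 have 1: "kaug ` carrier (kos 0) = carrier qA"
 proof
  show "carrier qA \<subseteq> kaug ` carrier (kos 0)"
  proof
   fix r assume r: "r \<in> carrier qA"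
   then show "r \<in> kaug ` carrier (kos 0)"
    by (intro image_eqI[of _ _ "A.ten (\<lambda>_. 0) r \<one>\<^bsub>qA\<^esub>"]) (simp_all add: kaug_ten ext_0 carrier_kos A.ten_closed)
  qed
 qed (use bhom_closed[OF bhom_kaug] in auto)
 have 2: "{x \<in> carrier (kos 0). kaug x = \<zero>\<^bsub>qA\<^esub>} = kd 0 ` carrier (kos (Suc 0))"
  using kaug_exact kaug_kd bhom_closed[OF bhom_kd[of 0]] by blast
 have 3: "{x \<in> carrier (kos (Suc n)). kd n x = \<zero>\<^bsub>kos n\<^esub>} = kd (Suc n) ` carrier (kos (Suc (Suc n)))" for n
  using kd_exact[of _ n] kd_kd[of _ n] bhom_closed[OF bhom_kd[of "Suc n"]] by blast
 show ?thesis
  unfolding resolution_def using bimodule_kos bhom_kd bhom_kaug 1 2 3 by (simp add: One_nat_def)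
qed

section \<open>Koszul cochains and the comparison with an arbitrary resolution\<close>

lemma koszul_complex_simps [simp]:
 "carrier (koszul_complex M m) = (\<Pi>\<^sub>E be\<in>XE m. carrier M)"
 "\<zero>\<^bsub>koszul_complex M m\<^esub> = (\<lambda>be\<in>XE m. \<zero>\<^bsub>M\<^esub>)"
 "f \<oplus>\<^bsub>koszul_complex M m\<^esub> g = (\<lambda>be\<in>XE m. f be \<oplus>\<^bsub>M\<^esub> g be)"
 "c \<odot>\<^bsub>koszul_complex M m\<^esub> f = (\<lambda>be\<in>XE m. c \<odot>\<^bsub>M\<^esub> f be)"
 by (auto simp: koszul_complex_def direct_sum_def)

lemma vsp_koszul_complex: "vsp M ==> vsp (koszul_complex M m)"
 unfolding koszul_complex_def by (rule vsp_direct_sum)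

definition keval where "keval m f = (\<lambda>be\<in>XE m. f (kgen be))"

lemma keval_closed: "f \<in> bimod_hom qA (kos m) M ==> be \<in> XE m ==> f (kgen be) \<in> carrier M"
 by (rule bhom_closed[OF bimod_hom_bhom kgen_closed])

lemma keval_bij:
 fixes M :: "('k, ('n list => 'k) set, 'm) bimodule"
 assumes M: "bimodule qA M"
 shows "bij_betw (keval m) (bimod_hom qA (kos m) M) (\<Pi>\<^sub>E be\<in>XE m. carrier M)"
proof (rule bij_betw_imageI)
 show "inj_on (keval m) (bimod_hom qA (kos m) M)"
 proof (rule inj_onI)
  fix f g assume f: "f \<in> bimod_hom qA (kos m) M" and g: "g \<in> bimod_hom qA (kos m) M" and eq: "keval m f = keval m g"
  have "f z = g z" if "z \<in> carrier (kos m)" for z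
  proof (rule A.free_hom_eqI[OF M, of "XE m"])
   fix be :: "'n expo" assume "be \<in> XE m"
   then show "f (A.ten be \<one>\<^bsub>qA\<^esub> \<one>\<^bsub>qA\<^esub>) = g (A.ten be \<one>\<^bsub>qA\<^esub> \<one>\<^bsub>qA\<^esub>)"
    using fun_cong[OF eq, of be] by (simp add: keval_def kgen_def)
  qed (use f g that bimod_hom_bhom[of _ qA "kos m" M] in \<open>auto simp: kos_def\<close>)
  then show "f = g" using f g by (intro extensionalityI[of f "carrier (kos m)"]) (auto simp: bimod_hom_iff)
 qed
 show "keval m ` bimod_hom qA (kos m) M = (\<Pi>\<^sub>E be\<in>XE m. carrier M)"
 proof
  show "(\<Pi>\<^sub>E be\<in>XE m. carrier M) \<subseteq> keval m ` bimod_hom qA (kos m) M"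
  proof
   fix u :: "'n expo => 'm" assume u: "u \<in> (\<Pi>\<^sub>E be\<in>XE m. carrier M)"
   then have u': "u \<in> XE m \<rightarrow> carrier M" by auto
   have "u = keval m (\<lambda>x\<in>carrier (kos m). A.fext M u x)"
    using u by (intro extensionalityI[of u "XE m"])
     (auto simp: keval_def kgen_closed PiE_def, simp add: kgen_def A.fext_gen[OF M u'])
   moreover have "(\<lambda>x\<in>carrier (kos m). A.fext M u x) \<in> bimod_hom qA (kos m) M"
    by (rule bimod_homI[OF bimodule_kos]) (simp add: kos_def A.bhom_fext[OF M u'])
   ultimately show "u \<in> keval m ` bimod_hom qA (kos m) M" by blast
  qed
 qed (auto simp: keval_def keval_closed)
qed

lemma keval_lin: "bimodule qA M ==> lin (hom_complex qA kos M m) (koszul_complex M m) (keval m)"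
 by (rule linI)
  (auto simp: hom_complex_def keval_def kgen_closed keval_closed intro!: restrict_ext)

lemma keval_diff:
 assumes M: "bimodule qA M" and f: "f \<in> bimod_hom qA (kos m) M"
 shows "keval (Suc m) (hom_diff kos kd m f) = koszul_diff q M m (keval m f)"
proof (rule extensionalityI[of _ "XE (Suc m)"])
 fix be :: "'n expo" assume be: "be \<in> XE (Suc m)"
 have "koszul_diff q M m (keval m f) be = f (koszul_diff q (kos m) m (\<lambda>be\<in>XE m. kgen be) be)"
  using koszul_diff_comp[OF bimodule_kos M bimod_hom_bhom[OF f] _ be, of "\<lambda>be\<in>XE m. kgen be"]
  by (simp add: keval_def kgen_closed cong: restrict_cong)
 then show "keval (Suc m) (hom_diff kos kd m f) be = koszul_diff q M m (keval m f) be"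
  using be by (simp add: keval_def hom_diff_def kgen_closed kd_gen)
qed (auto simp: keval_def koszul_diff_def)

lemma
 assumes M: "bimodule qA M"
 shows koszul_cplx: "cplx (koszul_complex M) (koszul_diff q M)"
  and keval_quasi: "quasi (hom_complex qA kos M) (hom_diff kos kd) (koszul_complex M) (koszul_diff q M) m (keval m)"
proof -
 note C = hom_cplx[OF resolution_kos M]
 have 1: "bij_betw (keval m) (carrier (hom_complex qA kos M m)) (carrier (koszul_complex M m))" for m
  using keval_bij[OF M] by (simp add: hom_complex_def)
 have 2: "keval (Suc m) (hom_diff kos kd m x) = koszul_diff q M m (keval m x)" if "x \<in> carrier (hom_complex qA kos M m)" for m x
  using that keval_diff[OF M] by (simp add: hom_complex_def)
 show "cplx (koszul_complex M) (koszul_diff q M)" "quasi (hom_complex qA kos M) (hom_diff kos kd) (koszul_complex M) (koszul_diff q M) m (keval m)"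
  by (rule quasi_iso[where C = "hom_complex qA kos M" and \<delta> = "hom_diff kos kd" and \<theta> = keval];
    intro C vsp_koszul_complex bim_vsp[OF M] keval_lin[OF M] 1 2; assumption)+
qed

text \<open>\<open>p\<close> holds the images of the free generators under one chain map and is
  fixed before \<open>M\<close>, in parallel with the bar complex.\<close>

theorem koszul_comparison_iso:
 assumes P: "projective_resolution qA P d \<epsilon>"
 shows "\<exists>p. koszul_comparison q P d \<epsilon> p \<and> (\<forall>M. bimodule qA M --> (\<forall>m. lin_iso (HH qA P d M m)
  (koszul_cohomology q M m) (to_koszul q P d p M m)))"
proof -
 note res = projective_resolutionD(1)[OF P] and proj = projective_resolutionD(2)[OF P]
 obtain \<phi> where \<phi>: "chain_map qA kos kd kaug P d \<epsilon> \<phi>"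
  using A.chain_map_exists[OF resolution_kos projective_kos res] by blast
 then have ph: "bhom qA (kos m) (P m) (\<phi> m)" for m by (simp add: chain_map_def)
 define p where "p m = (\<lambda>be\<in>XE m. \<phi> m (kgen be))" for m
 have "koszul_comparison q P d \<epsilon> p"
  unfolding koszul_comparison_def
 proof (intro conjI allI ballI)
  show "p m \<in> carrier (koszul_complex (P m) m)" for m
   by (auto simp: p_def intro!: bhom_closed[OF ph] kgen_closed)
  have z: "((\<lambda>i. 0) :: 'n expo) \<in> XE 0" by (simp add: ext_0)
  show "\<epsilon> (p 0 (\<lambda>i. 0)) = \<one>\<^bsub>qA\<^esub>"
   using \<phi> kgen_closed[OF z] kaug_ten[OF z A.one_closed A.one_closed] z by (simp add: p_def chain_map_def kgen_def)
 next
  fix m and be :: "'n expo" assume be: "be \<in> XE (Suc m)"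
  have "koszul_diff q (P m) m (p m) be = \<phi> m (koszul_diff q (kos m) m (\<lambda>be\<in>XE m. kgen be) be)"
   using koszul_diff_comp[OF bimodule_kos res_bim[OF res] ph _ be, of "\<lambda>be\<in>XE m. kgen be"]
   by (simp add: p_def kgen_closed cong: restrict_cong)
  then show "d m (p (Suc m) be) = koszul_diff q (P m) m (p m) be"
   using \<phi> be kgen_closed[OF be] kd_gen[OF be] by (simp add: p_def chain_map_def)
 qed
 moreover have "lin_iso (HH qA P d M m) (koszul_cohomology q M m) (to_koszul q P d p M m)"
  if M: "bimodule qA M" for M :: "('k, ('n list => 'k) set, 'm) bimodule" and m
  unfolding HH_def to_koszul_def koszul_cohomology_def
 proof (rule quasi_lin_iso[OF hom_cplx[OF res M] koszul_cplx[OF M] quasi_cong[OF hom_cplx[OF res M]]])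
  show "quasi (hom_complex qA P M) (hom_diff P d) (koszul_complex M) (koszul_diff q M) m (\<lambda>f. keval m (pull kos \<phi> m f))"
   by (rule quasi_comp[OF cplx_vsp[OF hom_cplx[OF res M]] hom_cplx[OF resolution_kos M] koszul_cplx[OF M]
      A.comparison_quasi[OF res proj resolution_kos projective_kos \<phi> M] keval_quasi[OF M]])
 qed (auto simp: keval_def pull_def p_def kgen_closed intro!: restrict_ext)
 ultimately show ?thesis by blast
qed

end

section \<open>Koszul cohomology of diagonal bimodules\<close>

text \<open>The unique family in \<open>is_basis\<close> is a unique preimage under
  \<open>lext\<close>, so being a basis is bijectivity of a linear map.\<close>

lemma is_basis_iff:
 assumes V: "vsp V" and b: "b \<in> J \<rightarrow> carrier V"
 shows "is_basis V J b \<longleftrightarrow> bij_betw (lext V b) (FS J) (carrier V)"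
proof -
 have 1: "finite {j. c j \<noteq> 0} \<and> {j. c j \<noteq> 0} \<subseteq> J \<and> v = (\<Oplus>\<^bsub>V\<^esub>j\<in>{j. c j \<noteq> 0}. c j \<odot>\<^bsub>V\<^esub> b j) \<longleftrightarrow>
   c \<in> FS J \<and> v = lext V b c" for c v
  by (auto simp: carrier_fsm lext_def)
 have 2: "lext V b c \<in> carrier V" if "c \<in> FS J" for c by (rule lext_closed[OF V b that])
 have "is_basis V J b \<longleftrightarrow> (\<forall>v\<in>carrier V. \<exists>!c. c \<in> FS J \<and> v = lext V b c)"
  using b unfolding is_basis_def 1 by auto
 also have "\<dots> \<longleftrightarrow> bij_betw (lext V b) (FS J) (carrier V)"
 proof
  assume "\<forall>v\<in>carrier V. \<exists>!c. c \<in> FS J \<and> v = lext V b c"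
  then show "bij_betw (lext V b) (FS J) (carrier V)"
   using 2 by (intro bij_betw_imageI inj_onI) (blast, blast)
 next
  assume "bij_betw (lext V b) (FS J) (carrier V)"
  then show "\<forall>v\<in>carrier V. \<exists>!c. c \<in> FS J \<and> v = lext V b c"
   unfolding bij_betw_def inj_on_def by blast
 qed
 finally show ?thesis .
qed

lemma is_basisI:
 assumes V: "vsp V" and L: "lin (fsm J) V L" and bij: "bij_betw L (FS J) (carrier V)"
  and b: "\<And>j. j \<in> J ==> b j = L (dl j)"
 shows "is_basis V J b"
proof -
 have bc: "b \<in> J \<rightarrow> carrier V" using b lin_closed[OF L] by auto
 have "L c = lext V b c" if "c \<in> FS J" for c
  by (rule lin_fsm_eqI[OF V L lin_lext[OF V bc] _ that]) (use bc in \<open>auto simp: b[symmetric] lext_dl[OF V] Pi_iff\<close>)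
 then have "bij_betw (lext V b) (FS J) (carrier V)"
  using bij by (subst bij_betw_cong[of _ _ L]) auto
 then show ?thesis using is_basis_iff[OF V bc] by simp
qed

lemma fsm_restrict: "f \<in> FS I ==> (\<lambda>i. if i \<in> J then f i else 0) \<in> FS (I \<inter> J)"
 by (rule fsmI[of "{i. f i \<noteq> 0} \<inter> J"]) (auto simp: carrier_fsm split: if_splits)

lemma fsm_subset: "I \<subseteq> J ==> FS I \<subseteq> FS J"
 by (auto simp: carrier_fsm)

text \<open>The common form of \<open>A_g\<close> and of the whole skew group algebra:
  \<open>T\<close> is \<open>{g}\<close> in the first case and the group in the second, and
  \<open>bb t al\<close> is \<open>x^al # t\<close>. The cohomology of both is computed here at one
  stroke.\<close>

locale diag_bimodule = quantum0 q for q :: "'n::{finite,linorder} => 'n => 'k::field_char_0" +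
 fixes M :: "('k, ('n list => 'k) set, 'm) bimodule" and T :: "'g set" and bb :: "'g => 'n expo => 'm"
  and lam :: "'g => 'n => 'k"
 assumes M: "bimodule qA M"
  and bb: "t \<in> T ==> bb t al \<in> carrier M"
  and bb_bij: "bij_betw (lext M (\<lambda>(t, al). bb t al)) (FS (T \<times> UNIV)) (carrier M)"
  and lact_bb: "t \<in> T ==> lact M (X i) (bb t al) = sig q (unitv i) al \<odot>\<^bsub>M\<^esub> bb t (plusv al (unitv i))"
  and ract_bb: "t \<in> T ==> ract M (bb t al) (X i) = (lam t i * sig q al (unitv i)) \<odot>\<^bsub>M\<^esub> bb t (plusv al (unitv i))"
begin

definition kap :: "('g \<times> 'n expo => 'k) => 'm" where
 "kap = lext M (\<lambda>(t, al). bb t al)"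

lemma vM: "vsp M" by (rule bim_vsp[OF M])

lemma lin_kap: "lin (fsm (T \<times> UNIV)) M kap"
 unfolding kap_def by (rule lin_lext[OF vM]) (auto simp: bb)

lemma kap_dl: "t \<in> T ==> kap (dl (t, al)) = bb t al"
 unfolding kap_def using lext_dl[OF vM, of "\<lambda>(t, al). bb t al" "(t, al)"] bb by simp

definition idx :: "nat => ('g \<times> 'n expo \<times> 'n expo) set" where
 "idx m = T \<times> XE m \<times> UNIV"

definition slice :: "('g \<times> 'n expo \<times> 'n expo => 'k) => 'n expo => 'g \<times> 'n expo => 'k" where
 "slice f be = (\<lambda>(t, al). f (t, be, al))"

lemma slice_closed:
 assumes f: "f \<in> FS (idx m)"
 shows "slice f be \<in> FS (T \<times> UNIV)"
proof (rule fsmI[of "(\<lambda>(t, be, al). (t, al)) ` {z. f z \<noteq> 0}"])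
 fix i assume i: "slice f be i \<noteq> 0"
 obtain t al where "i = (t, al)" by (cases i)
 then show "i \<in> (\<lambda>(t, be, al). (t, al)) ` {z. f z \<noteq> 0}"
  using i by (intro image_eqI[of _ _ "(t, be, al)"]) (auto simp: slice_def)
qed (use f in \<open>auto simp: carrier_fsm idx_def subset_iff\<close>)

definition kapm :: "nat => ('g \<times> 'n expo \<times> 'n expo => 'k) => 'n expo => 'm" where
 "kapm m f = (\<lambda>be\<in>XE m. kap (slice f be))"

lemma lin_kapm: "lin (fsm (idx m)) (koszul_complex M m) (kapm m)"
proof (rule linI)
 fix f g :: "'g \<times> 'n expo \<times> 'n expo => 'k"
 assume fg: "f \<in> FS (idx m)" "g \<in> FS (idx m)"
 have "slice (\<lambda>i. f i + g i) be = (\<lambda>i. slice f be i + slice g be i)" for be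
  by (auto simp: slice_def fun_eq_iff)
 then show "kapm m (f \<oplus>\<^bsub>fsm (idx m)\<^esub> g) = kapm m f \<oplus>\<^bsub>koszul_complex M m\<^esub> kapm m g"
  using lin_add[OF lin_kap slice_closed[OF fg(1)] slice_closed[OF fg(2)]]
  by (auto simp: kapm_def intro!: restrict_ext)
next
 fix f :: "'g \<times> 'n expo \<times> 'n expo => 'k" and c
 assume f: "f \<in> FS (idx m)"
 have "slice (\<lambda>i. c * f i) be = (\<lambda>i. c * slice f be i)" for be
  by (auto simp: slice_def fun_eq_iff)
 then show "kapm m (c \<odot>\<^bsub>fsm (idx m)\<^esub> f) = c \<odot>\<^bsub>koszul_complex M m\<^esub> kapm m f"
  using lin_smult[OF lin_kap slice_closed[OF f]] by (auto simp: kapm_def intro!: restrict_ext)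
qed (auto simp: kapm_def lin_closed[OF lin_kap slice_closed])

lemma kapm_bij: "bij_betw (kapm m) (FS (idx m)) (carrier (koszul_complex M m))"
proof (rule bij_betw_imageI)
 have kb: "bij_betw kap (FS (T \<times> UNIV)) (carrier M)" using bb_bij by (simp add: kap_def)
 show "inj_on (kapm m) (FS (idx m))"
 proof (rule inj_onI)
  fix f g :: "'g \<times> 'n expo \<times> 'n expo => 'k"
  assume f: "f \<in> FS (idx m)" and g: "g \<in> FS (idx m)" and eq: "kapm m f = kapm m g"
  have fg: "f (t, be, al) = g (t, be, al)" for t be al
  proof (cases "be \<in> XE m")
   case True
   then have "kap (slice f be) = kap (slice g be)" using fun_cong[OF eq, of be] by (simp add: kapm_def)
   then have "slice f be = slice g be"
    using kb slice_closed[OF f] slice_closed[OF g] by (auto simp: bij_betw_def inj_on_def)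
   then show ?thesis by (auto simp: slice_def fun_eq_iff)
  next
   case False
   then have "(t, be, al) \<notin> idx m" by (simp add: idx_def)
   then have "f (t, be, al) = 0" "g (t, be, al) = 0" using fsmD(2)[OF f, of "(t, be, al)"] fsmD(2)[OF g, of "(t, be, al)"] by blast+
   then show ?thesis by simp
  qed
  then show "f = g" using fg by (intro ext) (simp only: split_paired_all)
 qed
 show "kapm m ` FS (idx m) = carrier (koszul_complex M m)"
 proof
  show "carrier (koszul_complex M m) \<subseteq> kapm m ` FS (idx m)"
  proof
   fix u :: "'n expo => 'm" assume u: "u \<in> carrier (koszul_complex M m)"
   define k where "k be = inv_into (FS (T \<times> UNIV)) kap (u be)" for be
   have k: "k be \<in> FS (T \<times> UNIV) \<and> kap (k be) = u be" if "be \<in> XE m" for be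
   proof -
    have "u be \<in> kap ` FS (T \<times> UNIV)" using u that kb by (auto simp: bij_betw_def)
    then show ?thesis unfolding k_def by (simp add: inv_into_into f_inv_into_f)
   qed
   define f where "f = (\<lambda>(t, be, al). if be \<in> XE m then k be (t, al) else 0)"
   have f: "f \<in> FS (idx m)"
   proof (rule fsmI[of "\<Union>be\<in>XE m. (\<lambda>(t, al). (t, be, al)) ` {i. k be i \<noteq> 0}"])
    show "finite (\<Union>be\<in>XE m. (\<lambda>(t, al). (t, be, al)) ` {i. k be i \<noteq> 0})"
     using k fsmD(1) by auto
    show "(\<Union>be\<in>XE m. (\<lambda>(t, al). (t, be, al)) ` {i. k be i \<noteq> 0}) \<subseteq> idx m"
     using k by (auto simp: idx_def carrier_fsm subset_iff)
   qed (force simp: f_def split: if_splits)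
   have "slice f be = k be" if "be \<in> XE m" for be using that by (auto simp: slice_def f_def fun_eq_iff)
   then have "u = kapm m f"
    using u k by (intro extensionalityI[of u "XE m"]) (auto simp: kapm_def PiE_def)
   then show "u \<in> kapm m ` FS (idx m)" using f by blast
  qed
 qed (use lin_closed[OF lin_kapm] in blast)
qed

text \<open>The scalar, up to the Koszul sign, with which \<open>kterm\<close> sends
  \<open>bb t al\<close> over \<open>be\<close> to \<open>bb t (al + [i])\<close>.\<close>

definition ww :: "'g => 'n => 'n expo => 'n expo => 'k" where
 "ww t i be al = inverse (sig q (unitv i) be) * sig q (unitv i) al - lam t i * (inverse (sig q be (unitv i)) * sig q al (unitv i))"

text \<open>Only ratios of values of a bicharacter at \<open>al\<close> and \<open>be\<close> occur,
  so the weight depends on \<open>al - be\<close> alone. The complex splits along this difference,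
  and on each piece the weights are constant.\<close>

lemma ww_plus: "ww t i (plusv be \<gamma>) (plusv al \<gamma>) = ww t i be al"
 by (simp add: ww_def sig_plus sig_nonzero field_simps)

text \<open>Subtraction is truncated at 0, which is the reason for the guards
  \<open>1 \<le> al i\<close> in \<open>shift\<close> and \<open>dd_eq\<close>.\<close>

definition dn :: "'n => 'n expo => 'n expo" where "dn i al = al(i := al i - 1)"

lemma plusv_dn: "1 \<le> al i ==> plusv (dn i al) (unitv i) = al"
 using plusv_unitv_iff[of al "dn i al" i] by (simp add: dn_def)

lemma dn_plusv: "dn i (plusv al (unitv i)) = al"
 using plusv_unitv_iff[of "plusv al (unitv i)" al i] by (simp add: dn_def)

definition shift :: "'n => 'n expo => ('g \<times> 'n expo => 'k) => 'g \<times> 'n expo => 'k" where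
 "shift i be h = (\<lambda>(t, al). if 1 \<le> al i then sg be i * ww t i be (dn i al) * h (t, dn i al) else 0)"

lemma lin_shift: "lin (fsm (T \<times> UNIV)) (fsm (T \<times> UNIV)) (shift i be)"
proof (rule linI)
 fix h :: "'g \<times> 'n expo => 'k" assume h: "h \<in> FS (T \<times> UNIV)"
 show "shift i be h \<in> FS (T \<times> UNIV)"
 proof (rule fsmI[of "(\<lambda>(t, al). (t, plusv al (unitv i))) ` {z. h z \<noteq> 0}"])
  fix z assume z: "shift i be h z \<noteq> 0"
  obtain t al where e: "z = (t, al)" by (cases z)
  then have "1 \<le> al i" "h (t, dn i al) \<noteq> 0" using z by (auto simp: shift_def split: if_splits)
  then show "z \<in> (\<lambda>(t, al). (t, plusv al (unitv i))) ` {z. h z \<noteq> 0}"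
   using e by (intro image_eqI[of _ _ "(t, dn i al)"]) (auto simp: plusv_dn)
 qed (use h in \<open>auto simp: carrier_fsm\<close>)
qed (auto simp: shift_def fun_eq_iff algebra_simps)

lemma kterm_kap:
 assumes h: "h \<in> FS (T \<times> UNIV)"
 shows "kterm M i be (kap h) = kap (shift i be h)"
proof (rule lin_fsm_eqI[OF vM lin_comp[OF lin_kap lin_kterm[OF M]] lin_comp[OF lin_shift lin_kap] _ h])
 fix z :: "'g \<times> 'n expo" assume "z \<in> T \<times> UNIV"
 then obtain t al where z: "z = (t, al)" and t: "t \<in> T" by auto
 let ?b = "bb t (plusv al (unitv i))"
 have "shift i be (dl z) = (\<lambda>y. (sg be i * ww t i be al) * dl (t, plusv al (unitv i)) y)"
 proof
  fix y :: "'g \<times> 'n expo"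
  obtain t' al' where y: "y = (t', al')" by (cases y)
  show "shift i be (dl z) y = (sg be i * ww t i be al) * dl (t, plusv al (unitv i)) y"
  proof (cases "y = (t, plusv al (unitv i))")
   case True
   then have "1 \<le> plusv al (unitv i) i" by (simp add: plusv_def unitv_def)
   then show ?thesis using True by (simp add: shift_def z dn_plusv)
  next
   case False
   then have "\<not> (1 \<le> al' i \<and> t' = t \<and> dn i al' = al)" using plusv_dn[of al' i] y by auto
   then show ?thesis using False by (auto simp: shift_def z y dl_def)
  qed
 qed
 then have "kap (shift i be (dl z)) = (sg be i * ww t i be al) \<odot>\<^bsub>M\<^esub> ?b"
  using lin_smult[OF lin_kap, of "dl (t, plusv al (unitv i))" "sg be i * ww t i be al"] t by (simp add: kap_dl)
 also have "\<dots> = kterm M i be (kap (dl z))"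
  using t bb[OF t] vM
  by (simp add: kterm_def z kap_dl lact_bb ract_bb vs_smult_smult vs_minus_eq ww_def
    vs_smult_l_distr[symmetric] right_diff_distrib) (simp add: algebra_simps)
 finally show "kterm M i be (kap (dl z)) = kap (shift i be (dl z))" by simp
qed

definition dd :: "('g \<times> 'n expo \<times> 'n expo => 'k) => 'g \<times> 'n expo \<times> 'n expo => 'k" where
 "dd f = (\<lambda>(t, be, al). \<Sum>i | be i = 1. shift i (be(i := 0)) (slice f (be(i := 0))) (t, al))"

lemma dd_eq: "dd f (t, be, al) = (\<Sum>i | be i = 1. if 1 \<le> al i then
  sg be i * ww t i (be(i := 0)) (dn i al) * f (t, be(i := 0), dn i al) else 0)"
 unfolding dd_def by (auto simp: shift_def slice_def intro!: sum.cong)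

lemma dd_closed:
 assumes f: "f \<in> FS (idx m)"
 shows "dd f \<in> FS (idx (Suc m))"
proof (rule fsmI[of "(\<lambda>(i, t, be, al). (t, be(i := 1), plusv al (unitv i))) ` (UNIV \<times> {z. f z \<noteq> 0}) \<inter> idx (Suc m)"])
 fix z :: "'g \<times> 'n expo \<times> 'n expo" assume nz: "dd f z \<noteq> 0"
 obtain t be al where z: "z = (t, be, al)" by (metis prod_cases3)
 obtain i where "i \<in> {i. be i = 1}" and n: "(if 1 \<le> al i then
  sg be i * ww t i (be(i := 0)) (dn i al) * f (t, be(i := 0), dn i al) else 0) \<noteq> 0"
  by (rule sum.not_neutral_contains_not_neutral[OF nz[unfolded z dd_eq]])
 then have i: "be i = 1" "1 \<le> al i" "f (t, be(i := 0), dn i al) \<noteq> 0" by (auto split: if_splits)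
 have "(t, be(i := 0), dn i al) \<in> idx m" by (rule fsmD(2)[OF f i(3)])
 then have "z \<in> idx (Suc m)" using ext_down[of be i m] i(1) by (simp add: z idx_def)
 moreover have "z \<in> (\<lambda>(i, t, be, al). (t, be(i := 1), plusv al (unitv i))) ` (UNIV \<times> {z. f z \<noteq> 0})"
  using i by (intro image_eqI[of _ _ "(i, t, be(i := 0), dn i al)"]) (auto simp: z plusv_dn fun_upd_idem)
 ultimately show "z \<in> (\<lambda>(i, t, be, al). (t, be(i := 1), plusv al (unitv i))) ` (UNIV \<times> {z. f z \<noteq> 0}) \<inter> idx (Suc m)" by blast
qed (use f in \<open>auto simp: carrier_fsm\<close>)

lemma koszul_diff_kapm:
 assumes f: "f \<in> FS (idx m)"
 shows "koszul_diff q M m (kapm m f) = kapm (Suc m) (dd f)"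
proof (rule extensionalityI[of _ "XE (Suc m)"])
 fix be :: "'n expo" assume be: "be \<in> XE (Suc m)"
 have c: "shift i (be(i := 0)) (slice f (be(i := 0))) \<in> FS (T \<times> UNIV)" for i
  by (rule lin_closed[OF lin_shift slice_closed[OF f]])
 have "koszul_diff q M m (kapm m f) be = (\<Oplus>\<^bsub>M\<^esub>i\<in>{i. be i = 1}. kap (shift i (be(i := 0)) (slice f (be(i := 0)))))"
  using be ext_sub[OF be] lin_closed[OF lin_kap c]
  by (auto simp: koszul_diff_kterm kapm_def kterm_kap[OF slice_closed[OF f]] intro!: vs_finsum_cong[OF vM])
 also have "\<dots> = kap (\<Oplus>\<^bsub>fsm (T \<times> UNIV)\<^esub>i\<in>{i. be i = 1}. shift i (be(i := 0)) (slice f (be(i := 0))))"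
  by (rule lin_finsum[OF vsp_fsm vM lin_kap, symmetric]) (use c in auto)
 also have "(\<Oplus>\<^bsub>fsm (T \<times> UNIV)\<^esub>i\<in>{i. be i = 1}. shift i (be(i := 0)) (slice f (be(i := 0)))) = slice (dd f) be"
  using c by (subst finsum_fsm[where I = "T \<times> UNIV"]) (simp_all add: slice_def dd_def fun_eq_iff)
 finally show "koszul_diff q M m (kapm m f) be = kapm (Suc m) (dd f) be" using be by (simp add: kapm_def[of "Suc m"])
qed (auto simp: koszul_diff_def kapm_def)

section \<open>Weights, the index set \<open>C_g\<close> and the contraction of the rest\<close>

definition chi :: "'n => ('n => int) => 'k" where "chi i \<gamma> = (\<Prod>s\<in>UNIV. q i s powi \<gamma> s)"

definition dif :: "'n expo => 'n expo => 'n => int" where "dif al be = (\<lambda>i. int (al i) - int (be i))"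

text \<open>\<open>sig q (unitv i) al\<close> collects the powers of \<open>q i s\<close> for
  \<open>s < i\<close>, and \<open>sig q al (unitv i)\<close> the inverses of those for
  \<open>s > i\<close>. Their ratio is the full product over \<open>s\<close>, and
  \<open>chi\<close> is the quotient of this ratio for \<open>al\<close> by that for
  \<open>be\<close>.\<close>

lemma chi_dif: "chi i (dif al be) * (sig q al (unitv i) * sig q (unitv i) be) = sig q (unitv i) al * sig q be (unitv i)"
proof -
 have one: "(\<Prod>s\<in>UNIV. q i s ^ \<delta> s) * sig q \<delta> (unitv i) = sig q (unitv i) \<delta>" for \<delta> :: "'n expo"
 proof -
  have U: "UNIV = {..<i} \<union> insert i {i<..}" by auto
  have "(\<Prod>s\<in>UNIV. q i s ^ \<delta> s) = (\<Prod>s\<in>{..<i}. q i s ^ \<delta> s) * (\<Prod>s\<in>insert i {i<..}. q i s ^ \<delta> s)"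
   unfolding U by (rule prod.union_disjoint) auto
  also have "(\<Prod>s\<in>insert i {i<..}. q i s ^ \<delta> s) = (\<Prod>s\<in>{i<..}. q i s ^ \<delta> s)" by (simp add: q_diag)
  also have "\<dots> = (\<Prod>s\<in>{i<..}. inverse (q s i ^ \<delta> s))"
   by (rule prod.cong) (simp_all add: q_inverse[of _ i] power_inverse)
  also have "\<dots> = inverse (sig q \<delta> (unitv i))" by (simp add: sig_unit_right prod_inversef[unfolded comp_def])
  finally show ?thesis by (simp add: sig_unit_left sig_nonzero)
 qed
 have "chi i (dif al be) * (\<Prod>s\<in>UNIV. q i s ^ be s) = (\<Prod>s\<in>UNIV. q i s ^ al s)"
  unfolding chi_def dif_def prod.distrib[symmetric]
  by (rule prod.cong) (simp_all add: power_int_diff q_nonzero)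
 then have "(\<Prod>s\<in>UNIV. q i s ^ al s) * sig q al (unitv i) * sig q be (unitv i) =
   chi i (dif al be) * sig q al (unitv i) * ((\<Prod>s\<in>UNIV. q i s ^ be s) * sig q be (unitv i))"
  by (simp add: algebra_simps)
 then show ?thesis unfolding one by (simp add: algebra_simps)
qed

lemma ww_zero_iff: "ww t i be al = 0 \<longleftrightarrow> chi i (dif al be) = lam t i"
proof -
 have 1: "sig q (unitv i) al * sig q be (unitv i) = chi i (dif al be) * (sig q al (unitv i) * sig q (unitv i) be)"
  by (simp add: chi_dif)
 have "ww t i be al = 0 \<longleftrightarrow> sig q (unitv i) al * sig q be (unitv i) = lam t i * (sig q al (unitv i) * sig q (unitv i) be)"
  by (simp add: ww_def sig_nonzero field_simps)
 then show ?thesis unfolding 1 by (simp add: sig_nonzero)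
qed

text \<open>Membership in \<open>C_set\<close> apart from the bound
  \<open>\<gamma> i \<ge> -1\<close>, which is automatic for \<open>al - be\<close> when
  \<open>be\<close> has entries 0 and 1.\<close>

definition good :: "'g => ('n => int) => bool" where
 "good t \<gamma> \<longleftrightarrow> (\<forall>i. chi i \<gamma> = lam t i \<or> \<gamma> i = -1)"

lemma sym_exponents_good: "be \<in> XE m ==> al \<in> sym_exponents q lam t be \<longleftrightarrow> good t (dif al be)"
proof -
 assume be: "be \<in> XE m"
 have "int (al i) - int (be i) \<ge> -1" for i using ext_01[OF be, of i] by auto
 then show ?thesis by (simp add: sym_exponents_def C_set_def good_def chi_def dif_def)
qed

definition gidx :: "nat => ('g \<times> 'n expo \<times> 'n expo) set" where
 "gidx m = (SIGMA t:T. SIGMA be:XE m. sym_exponents q lam t be)"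

lemma gidx_iff: "(t, be, al) \<in> gidx m \<longleftrightarrow> (t, be, al) \<in> idx m \<and> good t (dif al be)"
 using sym_exponents_good by (auto simp: gidx_def idx_def)

lemma dif_dn: "be i = 1 ==> 1 \<le> al i ==> dif (dn i al) (be(i := 0)) = dif al be"
 by (auto simp: dif_def dn_def fun_eq_iff)

text \<open>The differential starts at \<open>be i = 0\<close>, hence at
  \<open>\<gamma> i \<ge> 0\<close>. This excludes the alternative \<open>\<gamma> i = -1\<close>,
  so the weight vanishes.\<close>

lemma dd_good:
 assumes f: "f \<in> FS (gidx m)"
 shows "dd f = (\<lambda>_. 0)"
proof
 fix z :: "'g \<times> 'n expo \<times> 'n expo" obtain t be al where z: "z = (t, be, al)" by (metis prod_cases3)
 show "dd f z = 0"
  unfolding z dd_eq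
 proof (rule sum.neutral, rule ballI)
  fix i assume i: "i \<in> {i. be i = 1}"
  have "ww t i (be(i := 0)) (dn i al) = 0" if "f (t, be(i := 0), dn i al) \<noteq> 0"
  proof -
   have "good t (dif (dn i al) (be(i := 0)))" using fsmD(2)[OF f that] by (simp add: gidx_iff)
   moreover have "dif (dn i al) (be(i := 0)) i \<noteq> -1" by (simp add: dif_def)
   ultimately show ?thesis unfolding ww_zero_iff good_def by blast
  qed
  then show "(if 1 \<le> al i then sg be i * ww t i (be(i := 0)) (dn i al) * f (t, be(i := 0), dn i al) else 0) = 0" by auto
 qed
qed

text \<open>The same seen from the target: \<open>be i = 1\<close> and \<open>1 \<le> al i\<close>
  again give \<open>\<gamma> i \<ge> 0\<close>. Together with \<open>dd_good\<close>, no nonzero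
  weight leads out of or into a good index.\<close>

lemma dd_at_good:
 assumes "good t (dif al be)"
 shows "dd f (t, be, al) = 0"
 unfolding dd_eq
proof (rule sum.neutral, rule ballI)
 fix i assume i: "i \<in> {i. be i = 1}"
 have "ww t i (be(i := 0)) (dn i al) = 0" if "1 \<le> al i"
 proof -
  have "dif al be i \<noteq> -1" using i that by (simp add: dif_def)
  then show ?thesis using assms i that dif_dn[of be i al] unfolding ww_zero_iff good_def by auto
 qed
 then show "(if 1 \<le> al i then sg be i * ww t i (be(i := 0)) (dn i al) * f (t, be(i := 0), dn i al) else 0) = 0" by auto
qed

text \<open>Off \<open>good\<close>, contract in a direction that depends only on \<open>t\<close> and \<open>al - be\<close>.\<close>

definition dir :: "'g => ('n => int) => 'n" where
 "dir t \<gamma> = (SOME i. chi i \<gamma> \<noteq> lam t i \<and> \<gamma> i \<noteq> -1)"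

lemma dir: "\<not> good t \<gamma> ==> chi (dir t \<gamma>) \<gamma> \<noteq> lam t (dir t \<gamma>) \<and> \<gamma> (dir t \<gamma>) \<noteq> -1"
 unfolding dir_def good_def by (rule someI_ex) blast

definition hh :: "('g \<times> 'n expo \<times> 'n expo => 'k) => 'g \<times> 'n expo \<times> 'n expo => 'k" where
 "hh f = (\<lambda>(t, be, al). let i = dir t (dif al be) in
   if \<not> good t (dif al be) \<and> be i = 0 then sg be i * inverse (ww t i be al) * f (t, be(i := 1), plusv al (unitv i)) else 0)"

lemma hh_closed:
 assumes f: "f \<in> FS (idx (Suc m))"
 shows "hh f \<in> FS (idx m)"
proof (rule fsmI[of "(\<lambda>(i, t, be, al). (t, be(i := 0), dn i al)) ` (UNIV \<times> {z. f z \<noteq> 0}) \<inter> idx m"])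
 fix z :: "'g \<times> 'n expo \<times> 'n expo" assume nz: "hh f z \<noteq> 0"
 obtain t be al where z: "z = (t, be, al)" by (metis prod_cases3)
 define i where "i = dir t (dif al be)"
 have i: "be i = 0" "f (t, be(i := 1), plusv al (unitv i)) \<noteq> 0"
  using nz by (auto simp: hh_def z i_def[symmetric] Let_def split: if_splits)
 have "(t, be(i := 1), plusv al (unitv i)) \<in> idx (Suc m)" by (rule fsmD(2)[OF f i(2)])
 then have "z \<in> idx m" using ext_up[of be i m] i(1) by (simp add: z idx_def)
 moreover have "z \<in> (\<lambda>(i, t, be, al). (t, be(i := 0), dn i al)) ` (UNIV \<times> {z. f z \<noteq> 0})"
  using i by (intro image_eqI[of _ _ "(i, t, be(i := 1), plusv al (unitv i))"]) (auto simp: z dn_plusv fun_upd_idem)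
 ultimately show "z \<in> (\<lambda>(i, t, be, al). (t, be(i := 0), dn i al)) ` (UNIV \<times> {z. f z \<noteq> 0}) \<inter> idx m" by blast
qed (use f in \<open>auto simp: carrier_fsm\<close>)

text \<open>The homotopy identity for cocycles only, with \<open>dd f = 0\<close> in place of the
  second term. If \<open>be i = 1\<close> in the chosen direction, all terms but
  \<open>j = i\<close> vanish and the weight cancels. If \<open>be i = 0\<close>, the cocycle
  equation at \<open>be + [i]\<close> expresses \<open>f\<close> through the other terms.\<close>

lemma dd_hh:
 assumes be: "\<And>i. be i = 0 \<or> be i = 1" and bad: "\<not> good t (dif al be)"
  and cyc: "dd f = (\<lambda>_. 0)"
 shows "dd (hh f) (t, be, al) = f (t, be, al)"
proof -
 define \<gamma> where "\<gamma> = dif al be"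
 define i where "i = dir t \<gamma>"
 have d: "chi i \<gamma> \<noteq> lam t i" "\<gamma> i \<noteq> -1" using dir[OF bad] by (simp_all add: i_def \<gamma>_def)
 have w: "ww t i be al \<noteq> 0" using d(1) by (simp add: ww_zero_iff \<gamma>_def)
 have hh: "hh f (t, be', al') = (if be' i = 0 then sg be' i * inverse (ww t i be' al') * f (t, be'(i := 1), plusv al' (unitv i)) else 0)"
  if "dif al' be' = \<gamma>" for al' be'
  using bad that by (simp add: hh_def Let_def i_def \<gamma>_def)
 \<comment> \<open>The neighbours have the same difference \<open>\<gamma>\<close>, hence the same
   direction \<open>i\<close> and the same weight.\<close>
 have low: "hh f (t, be(j := 0), dn j al) = (if j = i \<or> be i = 0 then
   sg (be(j := 0)) i * inverse (ww t i be al) * f (t, be(j := 0, i := 1), plusv (dn j al) (unitv i)) else 0)"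
  if j: "be j = 1" "1 \<le> al j" for j
 proof -
  have "plusv (be(j := 0)) (unitv j) = be" using upd_plusv[of "be(j := 0)" j] j by (simp add: fun_upd_idem)
  then have "ww t i (be(j := 0)) (dn j al) = ww t i be al"
   using ww_plus[of t i "be(j := 0)" "unitv j" "dn j al"] plusv_dn[of al j] j by simp
  then show ?thesis using hh[of "dn j al" "be(j := 0)"] dif_dn[of be j al] j by (auto simp: \<gamma>_def)
 qed
 show ?thesis
 proof (cases "be i = 1")
  case True
  \<comment> \<open>Here \<open>\<gamma> i \<noteq> -1\<close> enters: together with
    \<open>be i = 1\<close> it makes \<open>dn i al\<close> a true predecessor, so the term
    \<open>j = i\<close> is present.\<close>
  then have ai: "1 \<le> al i" using d(2) by (simp add: \<gamma>_def dif_def)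
  have "dd (hh f) (t, be, al) = (\<Sum>j | be j = 1. if j = i then f (t, be, al) else 0)"
   unfolding dd_eq
  proof (rule sum.cong[OF refl])
   fix j assume j: "j \<in> {j. be j = 1}"
   show "(if 1 \<le> al j then sg be j * ww t j (be(j := 0)) (dn j al) * hh f (t, be(j := 0), dn j al) else 0) =
     (if j = i then f (t, be, al) else 0)"
   proof (cases "j = i")
    case ji: True
    have "plusv (be(i := 0)) (unitv i) = be" using upd_plusv[of "be(i := 0)" i] True by (simp add: fun_upd_idem)
    then have "ww t i (be(i := 0)) (dn i al) = ww t i be al"
     using ww_plus[of t i "be(i := 0)" "unitv i" "dn i al"] plusv_dn[of al i] ai by simp
    moreover have "be(i := 1) = be" using True by (simp add: fun_upd_idem)
    moreover have "sg be i * ww t i be al * (sg be i * inverse (ww t i be al) * x) = x" for x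
     using w sg_sq[of be i, where 'a = 'k] by (simp add: field_simps)
    ultimately show ?thesis using ji ai low[OF True ai] by (simp add: plusv_dn[of al i])
   next
    case False
    then show ?thesis using low[of j] j True by simp
   qed
  qed
  then show ?thesis using True by simp
 next
  case False
  then have b0: "be i = 0" using be[of i] by simp
  let ?be = "be(i := 1)" and ?al = "plusv al (unitv i)"
  define S where "S = (\<Sum>j | be j = 1. if 1 \<le> al j then sg ?be j * ww t j (be(j := 0)) (dn j al) * f (t, be(j := 0, i := 1), plusv (dn j al) (unitv i)) else 0)"
  have set: "{j. ?be j = 1} = insert i {j. be j = 1}" by auto
  \<comment> \<open>The cocycle equation one step further in direction \<open>i\<close>; its term
    \<open>j = i\<close> isolates \<open>f (t, be, al)\<close>.\<close>
  have "0 = dd f (t, ?be, ?al)" using cyc by simp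
  also have "\<dots> = sg be i * ww t i be al * f (t, be, al) + S"
  proof -
   have ai: "1 \<le> ?al i" by (simp add: plusv_def unitv_def)
   have bu: "be(i := 0) = be" using b0 by (simp add: fun_upd_idem)
   have "(\<Sum>j | be j = 1. if 1 \<le> ?al j then sg ?be j * ww t j (?be(j := 0)) (dn j ?al) * f (t, ?be(j := 0), dn j ?al) else 0) = S"
    unfolding S_def
   proof (rule sum.cong[OF refl])
    fix j assume j: "j \<in> {j. be j = 1}"
    then have ji: "j \<noteq> i" using b0 by auto
    then have a: "?al j = al j" "dn j ?al = plusv (dn j al) (unitv i)" "?be(j := 0) = be(j := 0, i := 1)"
     by (auto simp: plusv_def unitv_def dn_def fun_eq_iff)
    have "(be(j := 0)) i = 0" using ji b0 by simp
    then have "be(j := 0, i := 1) = plusv (be(j := 0)) (unitv i)" by (rule upd_plusv)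
    then have "ww t j (be(j := 0, i := 1)) (plusv (dn j al) (unitv i)) = ww t j (be(j := 0)) (dn j al)"
     by (simp only: ww_plus)
    then show "(if 1 \<le> ?al j then sg ?be j * ww t j (?be(j := 0)) (dn j ?al) * f (t, ?be(j := 0), dn j ?al) else 0) =
     (if 1 \<le> al j then sg ?be j * ww t j (be(j := 0)) (dn j al) * f (t, be(j := 0, i := 1), plusv (dn j al) (unitv i)) else 0)"
     unfolding a by simp
   qed
   then show ?thesis
    unfolding dd_eq set using b0 ai by (subst sum.insert) (simp_all add: bu dn_plusv)
  qed
  finally have S: "f (t, be, al) = - (sg be i * inverse (ww t i be al) * S)"
  proof -
   assume e: "0 = sg be i * ww t i be al * f (t, be, al) + S"
   have "sg be i * inverse (ww t i be al) * (sg be i * ww t i be al * f (t, be, al)) = f (t, be, al)"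
    using w sg_sq[of be i, where 'a = 'k] by (simp add: field_simps)
   moreover have "sg be i * ww t i be al * f (t, be, al) = - S" using e by (simp add: eq_neg_iff_add_eq_0)
   ultimately show ?thesis by simp
  qed
  have "dd (hh f) (t, be, al) = (\<Sum>j | be j = 1. - (sg be i * inverse (ww t i be al) *
   (if 1 \<le> al j then sg ?be j * ww t j (be(j := 0)) (dn j al) * f (t, be(j := 0, i := 1), plusv (dn j al) (unitv i)) else 0)))"
   unfolding dd_eq
  proof (rule sum.cong[OF refl])
   fix j assume j: "j \<in> {j. be j = 1}"
   then have ji: "j \<noteq> i" using b0 by auto
   have sgn: "sg be j * sg (be(j := 0)) i = - (sg be i * (sg ?be j :: 'k))"
    using sg_swap[of i j be, where 'k = 'k] ji j b0 by simp
   show "(if 1 \<le> al j then sg be j * ww t j (be(j := 0)) (dn j al) * hh f (t, be(j := 0), dn j al) else 0) =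
    - (sg be i * inverse (ww t i be al) *
   (if 1 \<le> al j then sg ?be j * ww t j (be(j := 0)) (dn j al) * f (t, be(j := 0, i := 1), plusv (dn j al) (unitv i)) else 0))"
   proof (cases "1 \<le> al j")
    case True
    let ?W = "ww t j (be(j := 0)) (dn j al)" and ?V = "inverse (ww t i be al)"
     and ?F = "f (t, be(j := 0, i := 1), plusv (dn j al) (unitv i))"
    have "sg be j * ?W * (sg (be(j := 0)) i * ?V * ?F) = (sg be j * sg (be(j := 0)) i) * (?V * ?W * ?F)"
     by (simp only: mult_ac)
    also have "\<dots> = - (sg be i * ?V * (sg ?be j * ?W * ?F))"
     unfolding sgn by (simp only: mult_ac mult_minus_left mult_minus_right)
    finally have e: "sg be j * ?W * (sg (be(j := 0)) i * ?V * ?F) = - (sg be i * ?V * (sg ?be j * ?W * ?F))" .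
    have "hh f (t, be(j := 0), dn j al) = sg (be(j := 0)) i * ?V * ?F" using low[of j] j True b0 by simp
    with e True show ?thesis by (simp only: if_True)
   qed simp
  qed
  also have "\<dots> = - (sg be i * inverse (ww t i be al) * S)"
   unfolding S_def sum_negf sum_distrib_left ..
  finally show ?thesis using S by simp
 qed
qed

lemma gidx_sub: "gidx m \<subseteq> idx m"
proof
 fix z assume "z \<in> gidx m"
 then show "z \<in> idx m" using gidx_iff by (cases z) auto
qed

lemma cocycle_decompose:
 assumes f: "f \<in> FS (idx m)" and cyc: "dd f = (\<lambda>_. 0)"
 shows "(\<lambda>z. f z - (if z \<in> gidx m then f z else 0)) = dd (hh f)"
proof
 fix z :: "'g \<times> 'n expo \<times> 'n expo" obtain t be al where z: "z = (t, be, al)" by (metis prod_cases3)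
 show "f z - (if z \<in> gidx m then f z else 0) = dd (hh f) z"
 proof (cases "z \<in> idx m")
  case True
  then have be: "be \<in> XE m" by (simp add: z idx_def)
  show ?thesis
  proof (cases "good t (dif al be)")
   case g: True
   then show ?thesis using True dd_at_good[OF g] by (simp add: z gidx_iff)
  next
   case g: False
   then show ?thesis using dd_hh[OF ext_01[OF be] g cyc] by (simp add: z gidx_iff)
  qed
 next
  case False
  then have "f z = 0" using fsmD(2)[OF f] by blast
  moreover have "dd (hh f) z = 0"
  proof (cases m)
   case 0
   \<comment> \<open>In degree 0 the function \<open>f\<close> lives over \<open>be = 0\<close>
     only, while \<open>hh\<close> evaluates it at indices containing a 1.\<close>
   have hh0: "hh f y = 0" for y
   proof -
    obtain t be al where y: "y = (t, be, al)" by (metis prod_cases3)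
    have "f (t, be(i := 1), al') = 0" for i al'
    proof (rule ccontr)
     assume "f (t, be(i := 1), al') \<noteq> 0"
     from fsmD(2)[OF f this] have "be(i := 1) \<in> XE 0" using 0 by (simp add: idx_def)
     then have "(be(i := 1)) i = 0" by (simp add: ext_0 del: fun_upd_apply)
     then show False by simp
    qed
    then show ?thesis by (simp add: hh_def y Let_def)
   qed
   show ?thesis unfolding z dd_eq hh0 by (intro sum.neutral ballI) (simp only: mult_zero_right if_cancel)
  next
   case (Suc n)
   have "dd (hh f) \<in> FS (idx m)" using dd_closed[OF hh_closed] f Suc by blast
   from fsmD(2)[OF this, of z] show ?thesis using False by blast
  qed
  ultimately show ?thesis by simp
 qed
qed

abbreviation "KC \<equiv> koszul_complex M"
abbreviation "KD \<equiv> koszul_diff q M"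

lemma KC: "cplx KC KD" by (rule koszul_cplx[OF M])

lemma kapm_zero: "kapm m (\<lambda>_. 0) = \<zero>\<^bsub>KC m\<^esub>"
 using lin_zero[OF vsp_fsm cplx_vsp[OF KC] lin_kapm, of m] by simp

lemma kapm_inj: "f \<in> FS (idx m) ==> g \<in> FS (idx m) ==> kapm m f = kapm m g \<longleftrightarrow> f = g"
 using kapm_bij[of m] by (auto simp: bij_betw_def inj_on_def)

lemma kapm_surj: "u \<in> carrier (KC m) ==> \<exists>f\<in>FS (idx m). u = kapm m f"
 using kapm_bij[of m] unfolding bij_betw_def by blast

lemma cocycle_iff: "f \<in> FS (idx m) ==> kapm m f \<in> cocycles KC KD m \<longleftrightarrow> dd f = (\<lambda>_. 0)"
 using lin_closed[OF lin_kapm] kapm_inj[OF dd_closed, of f m "\<lambda>_. 0"] vs_zero[OF vsp_fsm, of "idx (Suc m)"]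
 by (simp only: cocycles_def mem_Collect_eq koszul_diff_kapm kapm_zero[symmetric] fsm_simps) simp

lemma coboundary_dd: "f \<in> FS (idx n) ==> kapm (Suc n) (dd f) \<in> coboundaries KC KD (Suc n)"
 using lin_closed[OF lin_kapm] by (simp only: coboundaries_def nat.case koszul_diff_kapm[symmetric]) blast

text \<open>Coboundaries vanish at good indices, because every weight leading into such an index is
  zero. This gives the independence of the classes.\<close>

lemma coboundary_good:
 assumes f: "f \<in> FS (idx m)" and b: "kapm m f \<in> coboundaries KC KD m" and z: "z \<in> gidx m"
 shows "f z = 0"
proof (cases m)
 case 0
 then have "kapm m f = kapm m (\<lambda>_. 0)" using b by (simp only: coboundaries_def kapm_zero nat.case singleton_iff)
 then have "f = (\<lambda>_. 0)" using kapm_inj[OF f, of "\<lambda>_. 0"] vs_zero[OF vsp_fsm, of "idx m"] by simp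
 then show ?thesis by simp
next
 case (Suc n)
 then obtain u where "u \<in> carrier (KC n)" "kapm m f = KD n u" using b by (auto simp: coboundaries_def simp del: koszul_complex_simps)
 then obtain g where g: "g \<in> FS (idx n)" "kapm m f = KD n (kapm n g)" using kapm_surj by blast
 then have "f = dd g" using kapm_inj[OF f, of "dd g"] dd_closed[OF g(1)] by (simp add: Suc koszul_diff_kapm)
 then show ?thesis using z dd_at_good gidx_iff by (cases z) auto
qed

definition kclass :: "nat => ('g \<times> 'n expo \<times> 'n expo => 'k) => ('n expo => 'm) set" where
 "kclass m f = koszul_class q M m (kapm m f)"

lemma kapm_dl:
 assumes "t \<in> T" "be \<in> XE m"
 shows "kapm m (dl (t, be, al)) = ext_tensor M m (bb t al) be"
proof (rule ext)
 fix be'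
 have "slice (dl (t, be, al)) be' = (if be' = be then dl (t, al) else (\<lambda>_. 0))"
  by (auto simp: slice_def dl_def fun_eq_iff)
 then show "kapm m (dl (t, be, al)) be' = ext_tensor M m (bb t al) be be'"
  using assms lin_zero[OF vsp_fsm vM lin_kap] by (auto simp: kapm_def ext_tensor_def kap_dl)
qed

text \<open>Cochains supported on good indices are cocycles and, unless zero, no coboundaries; by
  the contraction every cocycle is cohomologous to its good part.\<close>

theorem koszul_basis:
 "is_basis (koszul_cohomology q M m) (gidx m) (\<lambda>(t, be, al). koszul_class q M m (ext_tensor M m (bb t al) be))"
proof (rule is_basisI[where L = "kclass m"])
 note coh = vsp_cohomology[OF KC, of m] cohomology_carrier[OF KC, of m]
 let ?V = "koszul_cohomology q M m"
 have V: "?V = cohomology KC KD m" by (simp add: koszul_cohomology_def)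
 show "vsp ?V" unfolding V by (rule coh)
 have in_idx: "f \<in> FS (idx m)" if "f \<in> FS (gidx m)" for f
  using that fsm_subset[OF gidx_sub] by blast
 have cyc: "kapm m f \<in> cocycles KC KD m" if "f \<in> FS (gidx m)" for f
  using cocycle_iff[OF in_idx[OF that]] dd_good[OF that] by simp
 show lin: "lin (fsm (gidx m)) ?V (kclass m)"
  unfolding V
 proof (rule linI)
  fix f :: "'g \<times> 'n expo \<times> 'n expo => 'k" assume f: "f \<in> FS (gidx m)"
  show "kclass m f \<in> carrier (cohomology KC KD m)"
   using cyc[OF f] unfolding coh kclass_def koszul_class_def by blast
  show "kclass m (c \<odot>\<^bsub>fsm (gidx m)\<^esub> f) = c \<odot>\<^bsub>cohomology KC KD m\<^esub> kclass m f" for c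
   using lin_smult[OF lin_kapm in_idx[OF f], of c] cohomology_smult[OF KC cyc[OF f], of c]
   by (simp add: kclass_def koszul_class_def del: koszul_complex_simps)
  fix g :: "'g \<times> 'n expo \<times> 'n expo => 'k" assume g: "g \<in> FS (gidx m)"
  show "kclass m (f \<oplus>\<^bsub>fsm (gidx m)\<^esub> g) = kclass m f \<oplus>\<^bsub>cohomology KC KD m\<^esub> kclass m g"
   using lin_add[OF lin_kapm in_idx[OF f] in_idx[OF g]] cohomology_add[OF KC cyc[OF f] cyc[OF g]]
   by (simp add: kclass_def koszul_class_def del: koszul_complex_simps)
 qed
 have diff: "kapm m f \<ominus>\<^bsub>KC m\<^esub> kapm m g = kapm m (\<lambda>z. f z - g z)"
  if "f \<in> FS (idx m)" "g \<in> FS (idx m)" for f g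
  using lin_minus[OF vsp_fsm cplx_vsp[OF KC] lin_kapm that] vs_minus_eq[OF vsp_fsm that] by simp
 show "bij_betw (kclass m) (FS (gidx m)) (carrier ?V)"
 proof (rule bij_betw_imageI)
  show "inj_on (kclass m) (FS (gidx m))"
  proof (rule inj_onI)
   fix f g :: "'g \<times> 'n expo \<times> 'n expo => 'k" assume f: "f \<in> FS (gidx m)" and g: "g \<in> FS (gidx m)" and eq: "kclass m f = kclass m g"
   note fi = in_idx[OF f] and gi = in_idx[OF g]
   have "kapm m f \<ominus>\<^bsub>KC m\<^esub> kapm m g \<in> coboundaries KC KD m"
    using eq cohomology_eq_iff[OF KC cyc[OF f] cyc[OF g]] by (simp add: kclass_def koszul_class_def)
   then have "kapm m (\<lambda>z. f z - g z) \<in> coboundaries KC KD m" by (simp only: diff[OF fi gi])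
   moreover have "(\<lambda>z. f z - g z) \<in> FS (idx m)"
    using fsm_plus[OF fi fsm_scale[OF gi, of "-1"]] by simp
   ultimately have "f z - g z = 0" if "z \<in> gidx m" for z using coboundary_good[of "\<lambda>z. f z - g z"] that by blast
   moreover have "f z = 0 \<and> g z = 0" if "z \<notin> gidx m" for z using fsmD(2)[OF f] fsmD(2)[OF g] that by blast
   ultimately show "f = g" by (intro ext) (metis eq_iff_diff_eq_0)
  qed
  show "kclass m ` FS (gidx m) = carrier ?V"
  proof
   show "carrier ?V \<subseteq> kclass m ` FS (gidx m)"
   proof
    fix v assume "v \<in> carrier ?V"
    then obtain u where u: "u \<in> cocycles KC KD m" "v = koszul_class q M m u"
     unfolding V coh koszul_class_def by blast
    obtain f where f: "f \<in> FS (idx m)" "u = kapm m f" using kapm_surj[OF cocyclesD[OF u(1)]] by blast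
    have ddf: "dd f = (\<lambda>_. 0)" using cocycle_iff[OF f(1)] u f by simp
    define g where "g = (\<lambda>z. if z \<in> gidx m then f z else 0)"
    have g: "g \<in> FS (gidx m)"
     using fsm_restrict[OF f(1), of "gidx m"] gidx_sub[of m] by (simp add: g_def Int_absorb1)
    have e: "(\<lambda>z. f z - g z) = dd (hh f)" unfolding g_def by (rule cocycle_decompose[OF f(1) ddf])
    have "kapm m (dd (hh f)) \<in> coboundaries KC KD m"
    proof (cases m)
     case (Suc n)
     then show ?thesis using coboundary_dd[OF hh_closed, of f n] f by simp
    next
     case 0
     \<comment> \<open>In degree 0 the only coboundary is zero, so \<open>f\<close> has to equal its
       good part exactly; it does, since the sum defining \<open>dd\<close> over
       \<open>be = 0\<close> is empty.\<close>
     have "f z - g z = 0" for z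
     proof (cases "z \<in> idx m")
      case True
      then obtain t al where z: "z = (t, (\<lambda>_. 0), al)" by (cases z) (auto simp: idx_def 0 ext_0)
      have "dd (hh f) z = 0" by (simp add: z dd_eq)
      then show ?thesis using fun_cong[OF e, of z] by simp
     next
      case False
      then have "f z = 0" using fsmD(2)[OF f(1)] by blast
      then show ?thesis by (simp add: g_def)
     qed
     then have "dd (hh f) = (\<lambda>_. 0)" using e by (simp add: fun_eq_iff)
     then show ?thesis using subsp_coboundaries[OF KC, of m] by (simp only: kapm_zero subsp_def)
    qed
    then have "kapm m f \<ominus>\<^bsub>KC m\<^esub> kapm m g \<in> coboundaries KC KD m"
     by (simp only: diff[OF f(1) in_idx[OF g]] e)
    then have "koszul_class q M m (kapm m f) = koszul_class q M m (kapm m g)"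
     using cohomology_eq_iff[OF KC _ cyc[OF g]] u(1) f(2) unfolding koszul_class_def by blast
    then have "v = kclass m g" using u(2) f(2) by (simp add: kclass_def)
    then show "v \<in> kclass m ` FS (gidx m)" using g by blast
   qed
  qed (use lin_closed[OF lin] in blast)
 qed
 fix j assume "j \<in> gidx m"
 then obtain t be al where j: "j = (t, be, al)" "(t, be, al) \<in> idx m" using gidx_sub by (metis prod_cases3 subsetD)
 then show "(case j of (t, be, al) => koszul_class q M m (ext_tensor M m (bb t al) be)) = kclass m (dl j)"
  by (simp add: kclass_def kapm_dl idx_def)
qed

end

section \<open>Skew group algebras\<close>

text \<open>The passage to the skew group algebra is carried out for any algebra with a basis on
  which a finite group acts by automorphisms; the quantum relations return in
  \<open>diagonal_action\<close>.\<close>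

locale skew_algebra = A: based_algebra A J b co + G: group G
 for A :: "('k::field_char_0, 'a) module" and J :: "'j set" and b :: "'j => 'a" and co :: "'a => 'j => 'k"
  and G :: "'g monoid" (structure) +
 fixes act :: "'g => 'a => 'a"
 assumes fin: "finite (carrier G)"
  and act_lin: "h \<in> carrier G ==> lin A A (act h)"
  and act_mult: "h \<in> carrier G ==> a \<in> carrier A ==> c \<in> carrier A ==> act h (a \<otimes>\<^bsub>A\<^esub> c) = act h a \<otimes>\<^bsub>A\<^esub> act h c"
  and act_one: "h \<in> carrier G ==> act h \<one>\<^bsub>A\<^esub> = \<one>\<^bsub>A\<^esub>"
  and act_id: "a \<in> carrier A ==> act \<one> a = a"
  and act_comp: "h \<in> carrier G ==> h' \<in> carrier G ==> a \<in> carrier A ==> act (h \<otimes> h') a = act h (act h' a)"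
begin

abbreviation S where "S \<equiv> skew G A act"
abbreviation hsh where "hsh \<equiv> hash G A"

lemma act_closed [simp]: "h \<in> carrier G ==> a \<in> carrier A ==> act h a \<in> carrier A"
 by (rule lin_closed[OF act_lin])

lemma act_zero: "h \<in> carrier G ==> act h \<zero>\<^bsub>A\<^esub> = \<zero>\<^bsub>A\<^esub>"
 by (rule lin_zero[OF A.vs A.vs act_lin])

lemma S_simps:
 "carrier S = (\<Pi>\<^sub>E g\<in>carrier G. carrier A)" "\<zero>\<^bsub>S\<^esub> = (\<lambda>g\<in>carrier G. \<zero>\<^bsub>A\<^esub>)"
 "\<phi> \<oplus>\<^bsub>S\<^esub> \<psi> = (\<lambda>g\<in>carrier G. \<phi> g \<oplus>\<^bsub>A\<^esub> \<psi> g)" "c \<odot>\<^bsub>S\<^esub> \<phi> = (\<lambda>g\<in>carrier G. c \<odot>\<^bsub>A\<^esub> \<phi> g)"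
 "\<phi> \<otimes>\<^bsub>S\<^esub> \<psi> = (\<lambda>k\<in>carrier G. \<Oplus>\<^bsub>A\<^esub>h\<in>carrier G. \<phi> h \<otimes>\<^bsub>A\<^esub> act h (\<psi> (inv h \<otimes> k)))"
 "\<one>\<^bsub>S\<^esub> = hsh \<one>\<^bsub>A\<^esub> \<one>"
 using fin by (auto simp: skew_def direct_sum_def pointwise_def)

lemma vsp_S: "vsp S"
 by (rule vsp_cong[OF vsp_direct_sum[of "carrier G" "\<lambda>_. A"]]) (simp_all add: A.vs skew_def)

lemma S_at [simp]: "\<phi> \<in> carrier S ==> g \<in> carrier G ==> \<phi> g \<in> carrier A"
 by (auto simp: S_simps(1))

lemma S_eqI: "\<phi> \<in> carrier S ==> \<psi> \<in> carrier S ==> (\<And>g. g \<in> carrier G ==> \<phi> g = \<psi> g) ==> \<phi> = \<psi>"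
 unfolding S_simps(1) by (rule PiE_ext)

lemma lin_at: "g \<in> carrier G ==> lin S A (\<lambda>\<phi>. \<phi> g)"
 by (rule linI) (auto simp: S_simps(1,3,4))

lemma S_finsum: "f \<in> I \<rightarrow> carrier S ==> g \<in> carrier G ==> finsum S f I g = (\<Oplus>\<^bsub>A\<^esub>i\<in>I. f i g)"
 using lin_finsum[OF vsp_S A.vs lin_at] .

lemma term_closed [simp]: "\<phi> \<in> carrier S ==> \<psi> \<in> carrier S ==> h \<in> carrier G ==> k \<in> carrier G ==>
  \<phi> h \<otimes>\<^bsub>A\<^esub> act h (\<psi> (inv h \<otimes> k)) \<in> carrier A"
 by simp

lemma mult_closed: "\<phi> \<in> carrier S ==> \<psi> \<in> carrier S ==> \<phi> \<otimes>\<^bsub>S\<^esub> \<psi> \<in> carrier S"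
 unfolding S_simps(5) by (subst S_simps(1)) (auto intro!: vs_finsum[OF A.vs])

lemma mult_at: "k \<in> carrier G ==> (\<phi> \<otimes>\<^bsub>S\<^esub> \<psi>) k = (\<Oplus>\<^bsub>A\<^esub>h\<in>carrier G. \<phi> h \<otimes>\<^bsub>A\<^esub> act h (\<psi> (inv h \<otimes> k)))"
 by (simp add: S_simps(5))

lemma hash_at: "k \<in> carrier G ==> hsh a g k = (if k = g then a else \<zero>\<^bsub>A\<^esub>)"
 by (simp add: hash_def)

lemma hash_closed [simp]: "a \<in> carrier A ==> hsh a g \<in> carrier S"
 by (auto simp: S_simps(1) hash_def)

lemma lin_hash: "g \<in> carrier G ==> lin A S (\<lambda>a. hsh a g)"
 by (rule linI) (simp, auto simp: S_simps(3,4) hash_def vs_smult_zero_right[OF A.vs] intro!: restrict_ext)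

lemma inv_mult_eq: "g \<in> carrier G ==> h \<in> carrier G ==> k \<in> carrier G ==> inv g \<otimes> k = h \<longleftrightarrow> k = g \<otimes> h"
 using G.inv_solve_left[of h g k] by auto

lemma hash_mult:
 assumes g: "g \<in> carrier G" "h \<in> carrier G" and a: "a \<in> carrier A" "c \<in> carrier A"
 shows "hsh a g \<otimes>\<^bsub>S\<^esub> hsh c h = hsh (a \<otimes>\<^bsub>A\<^esub> act g c) (g \<otimes> h)"
proof (rule S_eqI)
 fix k assume k: "k \<in> carrier G"
 have "(hsh a g \<otimes>\<^bsub>S\<^esub> hsh c h) k = hsh a g g \<otimes>\<^bsub>A\<^esub> act g (hsh c h (inv g \<otimes> k))"
  unfolding mult_at[OF k] using g a k fin
  by (intro vs_finsum_single[OF A.vs]) (simp_all add: hash_at act_zero)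
 then show "(hsh a g \<otimes>\<^bsub>S\<^esub> hsh c h) k = hsh (a \<otimes>\<^bsub>A\<^esub> act g c) (g \<otimes> h) k"
  using g a k by (simp add: hash_at inv_mult_eq act_zero)
qed (use g a in \<open>simp_all add: mult_closed\<close>)

lemma hash_expand: "\<phi> \<in> carrier S ==> (\<Oplus>\<^bsub>S\<^esub>g\<in>carrier G. hsh (\<phi> g) g) = \<phi>"
proof (rule S_eqI)
 fix k assume \<phi>: "\<phi> \<in> carrier S" and k: "k \<in> carrier G"
 have "(\<Oplus>\<^bsub>S\<^esub>g\<in>carrier G. hsh (\<phi> g) g) k = (\<Oplus>\<^bsub>A\<^esub>g\<in>carrier G. hsh (\<phi> g) g k)"
  using \<phi> k by (intro S_finsum) auto
 also have "\<dots> = hsh (\<phi> k) k k"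
  using \<phi> k fin by (intro vs_finsum_single[OF A.vs]) (simp_all add: hash_at)
 finally show "(\<Oplus>\<^bsub>S\<^esub>g\<in>carrier G. hsh (\<phi> g) g) k = \<phi> k" using k by (simp add: hash_at)
qed (auto intro!: vs_finsum[OF vsp_S])

lemma lin_mult_S:
 assumes "\<phi> \<in> carrier S"
 shows "lin S S (\<lambda>\<psi>. \<phi> \<otimes>\<^bsub>S\<^esub> \<psi>)" "lin S S (\<lambda>\<psi>. \<psi> \<otimes>\<^bsub>S\<^esub> \<phi>)"
proof -
 have 1: "lin S A (\<lambda>\<psi>. (\<phi> \<otimes>\<^bsub>S\<^esub> \<psi>) k)" if "k \<in> carrier G" for k
  unfolding mult_at[OF that] using assms that
  by (intro lin_sum[OF vsp_S A.vs] lin_comp[OF lin_comp[OF lin_at act_lin] A.lin_mult_left]) auto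
 have 2: "lin S A (\<lambda>\<psi>. (\<psi> \<otimes>\<^bsub>S\<^esub> \<phi>) k)" if "k \<in> carrier G" for k
  unfolding mult_at[OF that] using assms that
  by (intro lin_sum[OF vsp_S A.vs] lin_comp[OF lin_at A.lin_mult_right]) auto
 note at = lin_add[OF lin_at] lin_smult[OF lin_at]
 show "lin S S (\<lambda>\<psi>. \<phi> \<otimes>\<^bsub>S\<^esub> \<psi>)" "lin S S (\<lambda>\<psi>. \<psi> \<otimes>\<^bsub>S\<^esub> \<phi>)"
  using assms
  by (auto intro!: linI S_eqI vs_add[OF vsp_S] vs_smult[OF vsp_S] mult_closed
    simp: mult_closed at lin_add[OF 1] lin_smult[OF 1] lin_add[OF 2] lin_smult[OF 2])
qed

lemma S_lin_eqI:
 assumes W: "vsp W" and F: "lin S W F" "lin S W F'" and \<phi>: "\<phi> \<in> carrier S"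
  and eq: "\<And>a g. a \<in> carrier A ==> g \<in> carrier G ==> F (hsh a g) = F' (hsh a g)"
 shows "F \<phi> = F' \<phi>"
proof -
 have h: "(\<lambda>g. hsh (\<phi> g) g) \<in> carrier G \<rightarrow> carrier S" using \<phi> by auto
 have "F (\<Oplus>\<^bsub>S\<^esub>g\<in>carrier G. hsh (\<phi> g) g) = F' (\<Oplus>\<^bsub>S\<^esub>g\<in>carrier G. hsh (\<phi> g) g)"
  unfolding lin_finsum[OF vsp_S W F(1) h] lin_finsum[OF vsp_S W F(2) h]
  using \<phi> lin_closed[OF F(2)] by (intro vs_finsum_cong[OF W]) (auto simp: eq)
 then show ?thesis by (simp only: hash_expand[OF \<phi>])
qed

text \<open>Both sides are linear in each factor, so elements \<open>a # g\<close> suffice; for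
  these it is associativity in \<open>A\<close> and in \<open>G\<close> together with
  multiplicativity of the action.\<close>

lemma mult_assoc_S:
 assumes S: "\<phi> \<in> carrier S" "\<psi> \<in> carrier S" "\<chi> \<in> carrier S"
 shows "(\<phi> \<otimes>\<^bsub>S\<^esub> \<psi>) \<otimes>\<^bsub>S\<^esub> \<chi> = \<phi> \<otimes>\<^bsub>S\<^esub> (\<psi> \<otimes>\<^bsub>S\<^esub> \<chi>)"
proof (rule S_lin_eqI[OF vsp_S lin_comp[OF lin_mult_S(2) lin_mult_S(2)] lin_mult_S(2) S(1)])
 fix a g assume a: "a \<in> carrier A" "g \<in> carrier G"
 show "(hsh a g \<otimes>\<^bsub>S\<^esub> \<psi>) \<otimes>\<^bsub>S\<^esub> \<chi> = hsh a g \<otimes>\<^bsub>S\<^esub> (\<psi> \<otimes>\<^bsub>S\<^esub> \<chi>)"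
 proof (rule S_lin_eqI[OF vsp_S lin_comp[OF lin_mult_S(1) lin_mult_S(2)] lin_comp[OF lin_mult_S(2) lin_mult_S(1)] S(2)])
  fix c h assume c: "c \<in> carrier A" "h \<in> carrier G"
  show "(hsh a g \<otimes>\<^bsub>S\<^esub> hsh c h) \<otimes>\<^bsub>S\<^esub> \<chi> = hsh a g \<otimes>\<^bsub>S\<^esub> (hsh c h \<otimes>\<^bsub>S\<^esub> \<chi>)"
   by (rule S_lin_eqI[OF vsp_S lin_mult_S(1) lin_comp[OF lin_mult_S(1) lin_mult_S(1)] S(3)])
    (use a c in \<open>simp_all add: mult_closed hash_mult act_mult act_comp A.m_assoc G.m_assoc\<close>)
 qed (use a S in simp_all)
qed (use S in \<open>simp_all add: mult_closed\<close>)

lemma ring_S: "Ring.ring S"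
proof (rule ringI)
 have one: "\<one>\<^bsub>S\<^esub> \<in> carrier S" by (simp add: S_simps(6))
 show "monoid S"
 proof (rule monoidI)
  fix \<phi> assume \<phi>: "\<phi> \<in> carrier S"
  show "\<one>\<^bsub>S\<^esub> \<otimes>\<^bsub>S\<^esub> \<phi> = \<phi>"
   by (rule S_lin_eqI[OF vsp_S lin_mult_S(1)[OF one] lin_id \<phi>]) (simp add: S_simps(6) hash_mult act_id)
  show "\<phi> \<otimes>\<^bsub>S\<^esub> \<one>\<^bsub>S\<^esub> = \<phi>"
   by (rule S_lin_eqI[OF vsp_S lin_mult_S(2)[OF one] lin_id \<phi>]) (simp add: S_simps(6) hash_mult act_one)
 qed (simp_all add: mult_closed mult_assoc_S one)
qed (simp_all add: vsp_abelian_group[OF vsp_S] lin_add[OF lin_mult_S(1)] lin_add[OF lin_mult_S(2)])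

definition bS :: "'g \<times> 'j => 'g => 'a" where "bS = (\<lambda>(g, j). hsh (b j) g)"
definition coS :: "('g => 'a) => 'g \<times> 'j => 'k" where "coS \<phi> = (\<lambda>(g, j). if g \<in> carrier G then co (\<phi> g) j else 0)"

lemma based_S: "based_algebra S (carrier G \<times> J) bS coS"
proof (intro based_algebra.intro ring_S vsp_S)
 show bS: "bS i \<in> carrier S" if "i \<in> carrier G \<times> J" for i using that A.b by (auto simp: bS_def)
 show co: "lin S (fsm (carrier G \<times> J)) coS"
 proof (rule linI)
  fix \<phi> assume \<phi>: "\<phi> \<in> carrier S"
  show "coS \<phi> \<in> FS (carrier G \<times> J)"
  proof (rule fsmI[of "SIGMA g:carrier G. {j. co (\<phi> g) j \<noteq> 0}"])
   show "finite (SIGMA g:carrier G. {j. co (\<phi> g) j \<noteq> 0})"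
    using fin fsmD(1)[OF A.co_fsm] \<phi> by (intro finite_SigmaI) auto
   show "(SIGMA g:carrier G. {j. co (\<phi> g) j \<noteq> 0}) \<subseteq> carrier G \<times> J"
    by (auto dest: fsmD(2)[OF A.co_fsm[OF S_at[OF \<phi>]]])
  qed (auto simp: coS_def split: if_splits)
 qed (auto simp: coS_def fun_eq_iff lin_add[OF lin_at] lin_smult[OF lin_at] A.co_add A.co_smult)
 show "coS (bS i) = dl i" if "i \<in> carrier G \<times> J" for i
  using that by (auto simp: coS_def bS_def fun_eq_iff hash_at A.co_b A.co_zero dl_def split: if_splits)
 fix \<phi> assume \<phi>: "\<phi> \<in> carrier S"
 have L: "lin (fsm (carrier G \<times> J)) S (lext S bS)" using bS by (intro lin_lext[OF vsp_S]) auto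
 have one: "lext S bS (coS (hsh a g)) = hsh a g" if g: "g \<in> carrier G" and a: "a \<in> carrier A" for a g
 proof (rule A.R_eqI[OF vsp_S lin_comp[OF lin_comp[OF lin_hash[OF g] co] L] lin_hash[OF g] _ a])
  fix j assume j: "j \<in> J"
  have "coS (hsh (b j) g) = dl (g, j)"
   using g j by (auto simp: coS_def fun_eq_iff hash_at A.co_b A.co_zero dl_def)
  then show "lext S bS (coS (hsh (b j) g)) = hsh (b j) g" using lext_dl[OF vsp_S, of bS "(g, j)"] bS[of "(g, j)"] g j by (simp add: bS_def)
 qed
 have "lext S bS (coS (\<Oplus>\<^bsub>S\<^esub>g\<in>carrier G. hsh (\<phi> g) g)) = (\<Oplus>\<^bsub>S\<^esub>g\<in>carrier G. lext S bS (coS (hsh (\<phi> g) g)))"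
  using \<phi> by (intro lin_finsum[OF vsp_S vsp_S lin_comp[OF co L]]) auto
 also have "\<dots> = (\<Oplus>\<^bsub>S\<^esub>g\<in>carrier G. hsh (\<phi> g) g)"
  using \<phi> one by (intro vs_finsum_cong[OF vsp_S]) auto
 finally show "lext S bS (coS \<phi>) = \<phi>" by (simp only: hash_expand[OF \<phi>])
qed (simp_all add: lin_smult[OF lin_mult_S(1)] lin_smult[OF lin_mult_S(2)])

sublocale S: based_algebra S "carrier G \<times> J" bS coS by (rule based_S)

end

section \<open>Cohomology of skew group algebras\<close>

text \<open>The running products \<open>k\<close>, \<open>k g_0\<close>, \<open>k g_0 g_1\<close>,
  and so on, without the total product: each entry is twisted by what stands strictly before
  it.\<close>

primrec pl :: "'g monoid => 'g => 'g list => 'g list" where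
 "pl G k [] = []" | "pl G k (g # gs) = k # pl G (k \<otimes>\<^bsub>G\<^esub> g) gs"

lemma length_pl [simp]: "length (pl G k gs) = length gs"
 by (induction gs arbitrary: k) auto

lemma pl_append: "pl G k (gs @ gs') = pl G k gs @ pl G (foldl (mult G) k gs) gs'"
 by (induction gs arbitrary: k) auto

lemma mlin_map:
 assumes f: "mlin R n M f" and e: "lin A R e"
 shows "mlin A n M (\<lambda>as. f (map e as))"
 unfolding mlin_def
proof (intro allI impI)
 fix as i assume as: "length as = n" "set as \<subseteq> carrier A" "i < n"
 then have "length (map e as) = n" "set (map e as) \<subseteq> carrier R" using lin_closed[OF e] by auto
 then have "lin R M (\<lambda>x. f ((map e as)[i := x]))" using f as(3) unfolding mlin_def by blast
 then show "lin A M (\<lambda>a. f (map e (as[i := a])))" unfolding map_update by (rule lin_comp[OF e])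
qed

lemma mlin_map2:
 assumes f: "mlin R n M f" and e: "\<And>g. g \<in> H ==> lin A R (e g)" and gs: "length gs = n" "set gs \<subseteq> H"
 shows "mlin A n M (\<lambda>as. f (map2 e gs as))"
 unfolding mlin_def
proof (intro allI impI)
 fix as i assume as: "length as = n" "set as \<subseteq> carrier A" "i < n"
 have upd: "map2 e gs (as[i := a]) = (map2 e gs as)[i := e (gs ! i) a]" for a
  using as gs by (intro nth_equalityI) (auto simp: nth_list_update)
 have "set (map2 e gs as) \<subseteq> carrier R"
  using as gs by (auto elim!: in_set_zipE intro!: lin_closed[OF e])
 then have 1: "lin R M (\<lambda>x. f ((map2 e gs as)[i := x]))" using f as gs by (simp add: mlin_def)
 have 2: "lin A R (e (gs ! i))" using as gs by (intro e) auto
 show "lin A M (\<lambda>a. f (map2 e gs (as[i := a])))" unfolding upd by (rule lin_comp[OF 2 1])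
qed

lemma face_map:
 assumes "length as = Suc (Suc n)" "i \<le> n" "set as \<subseteq> carrier R"
  and "\<And>a c. a \<in> carrier R ==> c \<in> carrier R ==> e (a \<otimes>\<^bsub>R\<^esub> c) = e a \<otimes>\<^bsub>R'\<^esub> e c"
 shows "face R' i (map e as) = map e (face R i as)"
proof -
 have "as ! i \<in> carrier R" "as ! Suc i \<in> carrier R" using assms(1-3) by (auto simp: subset_iff)
 then show ?thesis using assms by (simp add: face_def take_map drop_map)
qed

text \<open>The common reason why restriction to \<open>A\<close>, the action of \<open>G\<close>
  and extension to \<open>S\<close> commute with the bar differential: each carries faces to faces,
  up to a linear map \<open>L\<close> on values.\<close>

lemma bar_diff_natural:
 assumes N: "vsp N" and N': "vsp N'" and L: "lin N N' L"
  and ss: "ss \<in> bar_args R' (Suc m)" and ts: "ts \<in> bar_args R (Suc m)"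
  and eq: "\<And>i. i \<le> Suc m ==> f' (face R' i ss) = L (f (face R i ts))"
  and c: "\<And>i. i \<le> Suc m ==> f (face R i ts) \<in> carrier N"
 shows "bar_diff R' N' m f' ss = L (bar_diff R N m f ts)"
proof -
 have "L (bar_diff R N m f ts) = (\<Oplus>\<^bsub>N'\<^esub>i\<in>{..Suc m}. L ((-1) ^ i \<odot>\<^bsub>N\<^esub> f (face R i ts)))"
  using ts c N unfolding bar_diff_face by (simp del: atMost_Suc) (rule lin_finsum[OF N N' L], auto)
 also have "\<dots> = (\<Oplus>\<^bsub>N'\<^esub>i\<in>{..Suc m}. (-1) ^ i \<odot>\<^bsub>N'\<^esub> f' (face R' i ss))"
  using c N' lin_closed[OF L] by (intro vs_finsum_cong[OF N']) (auto simp: eq lin_smult[OF L])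
 finally show ?thesis using ss unfolding bar_diff_face by (simp del: atMost_Suc)
qed

lemma split_ends:
 assumes "length xs = m + 2"
 obtains x ys y where "xs = x # ys @ [y]" "length ys = m"
proof -
 obtain x zs where x: "xs = x # zs" using assms by (cases xs) auto
 then obtain ys y where "zs = ys @ [y]" using assms by (cases zs rule: rev_cases) auto
 then show ?thesis using x assms by (intro that) auto
qed

section \<open>Lists of group-labelled entries, restriction and extension of bar cochains\<close>

context skew_algebra
begin

abbreviation pr where "pr \<equiv> foldl (mult G)"
abbreviation u where "u \<equiv> hsh \<one>\<^bsub>A\<^esub>"
abbreviation e where "e a \<equiv> hsh a \<one>"

definition hs :: "'g list => 'a list => ('g => 'a) list" where "hs gs as = map2 (\<lambda>g a. hsh a g) gs as"

text \<open>\<open>(a\<^sub>0 # g\<^sub>0)\<cdots>(a\<^sub>n # g\<^sub>n)\<close> is the product of the entries of \<open>tw \<one> gs as\<close>, times \<open>pr \<one> gs\<close>.\<close>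

definition tw :: "'g => 'g list => 'a list => 'a list" where "tw k gs as = map2 act (pl G k gs) as"

lemma hs_simps [simp]: "hs [] as = []" "hs (g # gs) (a # as) = hsh a g # hs gs as"
 and tw_simps [simp]: "tw k [] as = []" "tw k (g # gs) (a # as) = act k a # tw (k \<otimes> g) gs as"
 by (simp_all add: hs_def tw_def)

lemma hs_append: "length as = length gs ==> hs (gs @ gs') (as @ as') = hs gs as @ hs gs' as'"
 by (simp add: hs_def)

lemma tw_append: "length as = length gs ==> tw k (gs @ gs') (as @ as') = tw k gs as @ tw (pr k gs) gs' as'"
 by (simp add: tw_def pl_append)

lemma length_hs [simp]: "length (hs gs as) = min (length gs) (length as)"
 and length_tw [simp]: "length (tw k gs as) = min (length gs) (length as)"
 by (simp_all add: hs_def tw_def)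

lemma pr_closed [simp]: "k \<in> carrier G ==> set gs \<subseteq> carrier G ==> pr k gs \<in> carrier G"
 by (induction gs arbitrary: k) auto

lemma pr_mult: "g \<in> carrier G ==> k \<in> carrier G ==> set gs \<subseteq> carrier G ==> pr (g \<otimes> k) gs = g \<otimes> pr k gs"
 by (induction gs arbitrary: k) (auto simp: G.m_assoc)

lemma pl_closed: "k \<in> carrier G ==> set gs \<subseteq> carrier G ==> set (pl G k gs) \<subseteq> carrier G"
 by (induction gs arbitrary: k) auto

lemma hs_args: "as \<in> bar_args A m ==> length gs = m + 2 ==> hs gs as \<in> bar_args S m"
 unfolding bar_args_iff by (simp add: hs_def)

lemma tw_args: "as \<in> bar_args A m ==> length gs = m + 2 ==> set gs \<subseteq> carrier G ==> k \<in> carrier G ==> tw k gs as \<in> bar_args A m"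
 using pl_closed[of k gs] unfolding bar_args_iff by (auto simp: tw_def subset_iff)

lemma map_tw: "g \<in> carrier G ==> k \<in> carrier G ==> set gs \<subseteq> carrier G ==> set as \<subseteq> carrier A ==> length as = length gs ==>
  map (act g) (tw k gs as) = tw (g \<otimes> k) gs as"
proof (induction gs arbitrary: k as)
 case (Cons h gs)
 then show ?case by (cases as) (auto simp: act_comp G.m_assoc)
qed simp

lemma tw_replicate: "set as \<subseteq> carrier A ==> tw \<one> (replicate (length as) \<one>) as = as"
 by (induction as) (auto simp: act_id)

lemma hs_replicate: "hs (replicate (length as) \<one>) as = map e as"
 by (induction as) auto

lemma pr_replicate: "pr \<one> (replicate n \<one>) = \<one>"
 by (induction n) auto

text \<open>By \<open>(a # g)(c # h) = a(^gc) # gh\<close>, merging two neighbours multiplies the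
  corresponding entries of \<open>tw\<close> and preserves the product of all group elements. The
  witnesses are the two merged lists.\<close>

lemma face_hs:
 assumes "Suc i < length gs" "length as = length gs" "set gs \<subseteq> carrier G" "set as \<subseteq> carrier A" "k \<in> carrier G"
 shows "\<exists>gs' as'. length gs' = length gs - 1 \<and> length as' = length gs - 1 \<and> set gs' \<subseteq> carrier G \<and> set as' \<subseteq> carrier A \<and>
  face S i (hs gs as) = hs gs' as' \<and> tw k gs' as' = face A i (tw k gs as) \<and> pr k gs' = pr k gs"
 using assms
proof (induction i arbitrary: gs as k)
 case 0
 then obtain g g' gs2 where gs: "gs = g # g' # gs2" by (cases gs rule: list.exhaust; cases "tl gs") auto
 obtain a c as2 where as: "as = a # c # as2" using 0 gs by (cases as rule: list.exhaust; cases "tl as") auto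
 show ?case
  by (intro exI[of _ "(g \<otimes> g') # gs2"] exI[of _ "(a \<otimes>\<^bsub>A\<^esub> act g c) # as2"])
   (use 0 in \<open>auto simp: gs as face_def hash_mult act_mult act_comp G.m_assoc\<close>)
next
 case (Suc i)
 then obtain g gs2 where gs: "gs = g # gs2" by (cases gs) auto
 obtain a as2 where as: "as = a # as2" using Suc gs by (cases as) auto
 obtain gs' as' where *: "length gs' = length gs2 - 1" "length as' = length gs2 - 1" "set gs' \<subseteq> carrier G" "set as' \<subseteq> carrier A"
  "face S i (hs gs2 as2) = hs gs' as'" "tw (k \<otimes> g) gs' as' = face A i (tw (k \<otimes> g) gs2 as2)"
  "pr (k \<otimes> g) gs' = pr (k \<otimes> g) gs2"
  using Suc.IH[of gs2 as2 "k \<otimes> g"] Suc.prems by (auto simp: gs as)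
 then show ?case
  by (intro exI[of _ "g # gs'"] exI[of _ "a # as'"]) (use Suc.prems in \<open>auto simp: gs as S.face_cons A.face_cons\<close>)
qed

lemma ue: "g \<in> carrier G ==> a \<in> carrier A ==> u g \<otimes>\<^bsub>S\<^esub> e a = hsh (act g a) g"
 and eu: "g \<in> carrier G ==> a \<in> carrier A ==> e a \<otimes>\<^bsub>S\<^esub> u g = hsh a g"
 and uu: "g \<in> carrier G ==> h \<in> carrier G ==> u g \<otimes>\<^bsub>S\<^esub> u h = u (g \<otimes> h)"
 and ee: "a \<in> carrier A ==> c \<in> carrier A ==> e a \<otimes>\<^bsub>S\<^esub> e c = e (a \<otimes>\<^bsub>A\<^esub> c)"
 and uh: "g \<in> carrier G ==> h \<in> carrier G ==> a \<in> carrier A ==> u g \<otimes>\<^bsub>S\<^esub> hsh a h = hsh (act g a) (g \<otimes> h)"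
 by (simp_all add: hash_mult act_one act_id)

lemma lin_e: "lin A S (\<lambda>a. e a)" by (simp add: lin_hash)

text \<open>Restriction of scalars along the embedding of \<open>A\<close> by
  \<open>a \<mapsto> a # 1\<close>.\<close>

definition resb :: "('k, 'g => 'a, 'm) bimodule => ('k, 'a, 'm) bimodule" where
 "resb M = bimod (module.truncate M) (\<lambda>a. lact M (e a)) (\<lambda>m a. ract M m (e a))"

lemma resb_simps [simp]:
 "carrier (resb M) = carrier M" "\<zero>\<^bsub>resb M\<^esub> = \<zero>\<^bsub>M\<^esub>" "x \<oplus>\<^bsub>resb M\<^esub> y = x \<oplus>\<^bsub>M\<^esub> y" "c \<odot>\<^bsub>resb M\<^esub> x = c \<odot>\<^bsub>M\<^esub> x"
 "lact (resb M) a x = lact M (e a) x" "ract (resb M) x a = ract M x (e a)"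
 by (simp_all add: resb_def module.defs)

lemma lin_resb [simp]: "lin (resb M) W f = lin M W f" "lin U (resb M) g = lin U M g"
 by (simp_all add: lin_def)

lemma mlin_resb [simp]: "mlin R n (resb M) f = mlin R n M f"
 by (simp add: mlin_def)

lemma vsp_resb: "vsp M ==> vsp (resb M)"
 by (rule vsp_cong) auto

lemma bimodule_resb:
 assumes M: "bimodule S M"
 shows "bimodule A (resb M)"
proof -
 interpret bimodule S M by (rule M)
 show ?thesis
  by (intro bimodule.intro bimodule_axioms.intro vsp_resb bim_vsp[OF M])
   (simp_all add: lact_closed ract_closed lact_add ract_add lact_ract lact_smult ract_smult
    lin_add[OF lin_e] lin_smult[OF lin_e] add_lact add_ract smult_lact smult_ract
    ee[symmetric] lact_mult ract_mult S_simps(6)[symmetric] lact_one ract_one)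
qed

lemma bhom_resb: "bhom S M N p ==> bhom A (resb M) (resb N) p"
 by (auto simp: bhom_def)

definition res :: "nat => (('g => 'a) list => 'm) => 'a list => 'm" where
 "res m f = (\<lambda>as\<in>bar_args A m. f (map e as))"

text \<open>The action of \<open>g\<close> on cochains of \<open>A\<close> with coefficients in any
  bimodule over \<open>S\<close>, by conjugation with \<open>1 # g\<close>. For the regular bimodule
  it is \<open>bar_action\<close>; general \<open>M\<close> are required for the naturality of
  \<open>E\<close>.\<close>

definition ga :: "('k, 'g => 'a, 'm) bimodule => nat => 'g => ('a list => 'm) => 'a list => 'm" where
 "ga M m g f = (\<lambda>as\<in>bar_args A m. ract M (lact M (u g) (f (map (act (inv g)) as))) (u (inv g)))"

text \<open>The extension prescribed on free generators, whose ends are 1: middle entries are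
  twisted, and the group elements are collected on the right. As a map on a free bimodule it is a
  homomorphism by construction; the closed formula for all lists is \<open>psi_hs\<close>.\<close>

definition psi :: "('k, 'g => 'a, 'm) bimodule => ('a list => 'm) => (('g \<times> 'j) list \<times> ('g \<times> 'j) \<times> 'g \<times> 'j => 'k) => 'm" where
 "psi M h = S.fext M (\<lambda>w. ract M (h (\<one>\<^bsub>A\<^esub> # tw \<one> (map fst w) (map (\<lambda>i. b (snd i)) w) @ [\<one>\<^bsub>A\<^esub>]))
   (u (pr \<one> (map fst w))))"

definition Psi :: "('k, 'g => 'a, 'm) bimodule => nat => ('a list => 'm) => ('g => 'a) list => 'm" where
 "Psi M m h = (\<lambda>ss\<in>bar_args S m. psi M h (S.ub m ss))"

lemma hs_eqI:
 assumes M: "vsp M" and f: "mlin S (m + 2) M f" and f': "mlin S (m + 2) M f'"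
  and eq: "\<And>gs as. length gs = m + 2 ==> set gs \<subseteq> carrier G ==> as \<in> bar_args A m ==> f (hs gs as) = f' (hs gs as)"
  and ss: "ss \<in> bar_args S m"
 shows "f ss = f' ss"
proof (rule S.mlin_eqI[OF M f f' _ ss])
 fix v assume v: "length v = m + 2" "set v \<subseteq> carrier G \<times> J"
 have "map bS v = hs (map fst v) (map (\<lambda>i. b (snd i)) v)"
  by (intro nth_equalityI) (auto simp: hs_def bS_def case_prod_unfold)
 moreover have "f (hs (map fst v) (map (\<lambda>i. b (snd i)) v)) = f' (hs (map fst v) (map (\<lambda>i. b (snd i)) v))"
  using v A.b by (intro eq) (auto simp: bar_args_def subset_iff)
 ultimately show "f (map bS v) = f' (map bS v)" by simp
qed

lemma hs_cochain_eqI: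
 assumes M: "bimodule S M" and f: "f \<in> bar_cochains S M m" and f': "f' \<in> bar_cochains S M m"
  and eq: "\<And>gs as. length gs = m + 2 ==> set gs \<subseteq> carrier G ==> as \<in> bar_args A m ==> f (hs gs as) = f' (hs gs as)"
 shows "f = f'"
 by (rule extensionalityI[OF S.bar_cochainsD(4)[OF f] S.bar_cochainsD(4)[OF f']])
  (rule hs_eqI[OF bim_vsp[OF M] S.bar_cochainsD(1)[OF f] S.bar_cochainsD(1)[OF f'] eq])

context
 fixes M :: "('k, 'g => 'a, 'm) bimodule" and m :: nat
 assumes M: "bimodule S M"
begin

lemma S_cochain_closed: "f \<in> bar_cochains S M m ==> ss \<in> bar_args S m ==> f ss \<in> carrier M"
 using mlin_closed[OF S.bar_cochainsD(1)] by blast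

lemma A_cochain_closed: "h \<in> bar_cochains A (resb M) m ==> as \<in> bar_args A m ==> h as \<in> carrier M"
 using mlin_closed[OF A.bar_cochainsD(1), of h "resb M" m as] by simp

lemma map_act_args: "g \<in> carrier G ==> as \<in> bar_args A m ==> map (act g) as \<in> bar_args A m"
 by (auto simp: bar_args_def)

lemma map_e_args: "as \<in> bar_args A m ==> map e as \<in> bar_args S m"
 by (auto simp: bar_args_def)

lemma map_act_act: "g \<in> carrier G ==> h \<in> carrier G ==> as \<in> bar_args A m ==> map (act g) (map (act h) as) = map (act (g \<otimes> h)) as"
 by (auto simp: bar_args_def act_comp)

lemma map_act_one: "as \<in> bar_args A m ==> map (act \<one>) as = as"
 by (intro map_idI) (auto simp: bar_args_def act_id)

lemma res_cochain:
 assumes f: "f \<in> bar_cochains S M m"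
 shows "res m f \<in> bar_cochains A (resb M) m"
 unfolding res_def
proof (rule A.restrict_cochain)
 show "mlin A (m + 2) (resb M) (\<lambda>as. f (map e as))"
  using mlin_map[OF S.bar_cochainsD(1)[OF f] lin_e] by simp
 fix as r assume as: "as \<in> bar_args A m" and r: "r \<in> carrier A"
 then have c: "as ! 0 \<in> carrier A" "as ! (m + 1) \<in> carrier A" "length as = m + 2" by (auto simp: bar_args_iff)
 show "f (map e (as[0 := r \<otimes>\<^bsub>A\<^esub> as ! 0])) = lact (resb M) r (f (map e as))"
  using S.bar_cochainsD(2)[OF f map_e_args[OF as] hash_closed[OF r, of "\<one>"]] c r by (simp add: map_update ee)
 show "f (map e (as[m + 1 := as ! (m + 1) \<otimes>\<^bsub>A\<^esub> r])) = ract (resb M) (f (map e as)) r"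
  using S.bar_cochainsD(3)[OF f map_e_args[OF as] hash_closed[OF r, of "\<one>"]] c r by (simp add: map_update ee)
qed

lemma ga_cochain:
 assumes h: "h \<in> bar_cochains A (resb M) m" and g: "g \<in> carrier G"
 shows "ga M m g h \<in> bar_cochains A (resb M) m"
 unfolding ga_def
proof (rule A.restrict_cochain)
 let ?i = "inv g"
 have i: "?i \<in> carrier G" using g by simp
 note bm = bimodule.lact_closed[OF M] bimodule.ract_closed[OF M]
 have "mlin A (m + 2) M (\<lambda>as. h (map (act ?i) as))"
  using mlin_map[OF A.bar_cochainsD(1)[OF h] act_lin[OF i]] by simp
 then show "mlin A (m + 2) (resb M) (\<lambda>as. ract M (lact M (u g) (h (map (act ?i) as))) (u ?i))"
  using A.mlin_comp[OF _ lin_comp[OF lin_lact[OF M] lin_ract[OF M]], of "m + 2" _ "u g" "u ?i"] by simp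
 fix as r assume as: "as \<in> bar_args A m" and r: "r \<in> carrier A"
 then have c: "as ! 0 \<in> carrier A" "as ! (m + 1) \<in> carrier A" "length as = m + 2" by (auto simp: bar_args_iff)
 let ?x = "h (map (act ?i) as)"
 have x: "?x \<in> carrier M" by (rule A_cochain_closed[OF h map_act_args[OF i as]])
 have "lact M (u g) (lact M (e (act ?i r)) ?x) = lact M (e r) (lact M (u g) ?x)"
  using x g r bimodule.lact_mult[OF M, symmetric]
  by (simp add: ue eu act_comp[symmetric] act_id)
 moreover have "h (map (act ?i) (as[0 := r \<otimes>\<^bsub>A\<^esub> as ! 0])) = lact M (e (act ?i r)) ?x"
  using A.bar_cochainsD(2)[OF h map_act_args[OF i as] act_closed[OF i r]] c r i by (simp add: map_update act_mult)
 ultimately show "ract M (lact M (u g) (h (map (act ?i) (as[0 := r \<otimes>\<^bsub>A\<^esub> as ! 0])))) (u ?i) =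
   lact (resb M) r (ract M (lact M (u g) ?x) (u ?i))"
  using x g r bm by (simp add: bimodule.lact_ract[OF M])
 have "ract M (ract M (lact M (u g) ?x) (e (act ?i r))) (u ?i) = ract M (ract M (lact M (u g) ?x) (u ?i)) (e r)"
  using x g r bm bimodule.ract_mult[OF M, symmetric] by (simp add: ue eu)
 moreover have "h (map (act ?i) (as[m + 1 := as ! (m + 1) \<otimes>\<^bsub>A\<^esub> r])) = ract M ?x (e (act ?i r))"
  using A.bar_cochainsD(3)[OF h map_act_args[OF i as] act_closed[OF i r]] c r i by (simp add: map_update act_mult)
 ultimately show "ract M (lact M (u g) (h (map (act ?i) (as[m + 1 := as ! (m + 1) \<otimes>\<^bsub>A\<^esub> r])))) (u ?i) =
   ract (resb M) (ract M (lact M (u g) ?x) (u ?i)) r"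
  using x g r bm by (simp add: bimodule.lact_ract[OF M])
qed

lemma lin_ga:
 assumes g: "g \<in> carrier G"
 shows "lin (bar_complex A (resb M) m) (bar_complex A (resb M) m) (ga M m g)"
proof -
 have L: "lin M M (\<lambda>x. ract M (lact M (u g) x) (u (inv g)))"
  using lin_comp[OF lin_lact[OF M] lin_ract[OF M], of "u g" "u (inv g)"] by simp
 show ?thesis
  using g by (intro linI) (simp_all add: ga_cochain,
   auto simp: ga_def lin_add[OF L] lin_smult[OF L] A_cochain_closed map_act_args intro!: restrict_ext)
qed

lemma ga_comp:
 assumes h: "h \<in> bar_cochains A (resb M) m" and g: "g \<in> carrier G" "k \<in> carrier G"
 shows "ga M m g (ga M m k h) = ga M m (g \<otimes> k) h"
 unfolding ga_def
proof (rule restrict_ext)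
 note bm = bimodule.lact_closed[OF M] bimodule.ract_closed[OF M]
 fix as assume as: "as \<in> bar_args A m"
 let ?y = "h (map (act (inv k \<otimes> inv g)) as)"
 have y: "?y \<in> carrier M" using g as by (intro A_cochain_closed[OF h] map_act_args) auto
 have "ract M (lact M (u g) (ract M (lact M (u k) ?y) (u (inv k)))) (u (inv g)) =
   ract M (lact M (u g \<otimes>\<^bsub>S\<^esub> u k) ?y) (u (inv k) \<otimes>\<^bsub>S\<^esub> u (inv g))"
  using g y bm by (simp add: bimodule.lact_mult[OF M] bimodule.ract_mult[OF M] bimodule.lact_ract[OF M])
 then show "ract M (lact M (u g) ((\<lambda>as\<in>bar_args A m. ract M (lact M (u k) (h (map (act (inv k)) as))) (u (inv k)))
   (map (act (inv g)) as))) (u (inv g)) =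
  ract M (lact M (u (g \<otimes> k)) (h (map (act (inv (g \<otimes> k))) as))) (u (inv (g \<otimes> k)))"
  using g as map_act_args[of "inv g" as] map_act_act[of "inv k" "inv g" as] by (simp add: uu G.inv_mult_group del: map_map)
qed

text \<open>Invariance as it is used: \<open>1 # g\<close> moves from the left of a value of
  \<open>h\<close> to the right at the price of twisting the arguments by \<open>g\<close>.\<close>

lemma ga_fixed:
 assumes h: "h \<in> bar_cochains A (resb M) m" and g: "g \<in> carrier G" and fx: "ga M m g h = h" and as: "as \<in> bar_args A m"
 shows "lact M (u g) (h as) = ract M (h (map (act g) as)) (u g)"
proof -
 note bm = bimodule.lact_closed[OF M] bimodule.ract_closed[OF M]
 have "h (map (act g) as) = ract M (lact M (u g) (h as)) (u (inv g))"
  using fun_cong[OF fx, of "map (act g) as"] map_act_args[OF g as] map_act_act[of "inv g" g as] map_act_one[OF as] g as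
  by (simp add: ga_def del: map_map)
 also have "ract M \<dots> (u g) = ract M (lact M (u g) (h as)) (u (inv g) \<otimes>\<^bsub>S\<^esub> u g)"
  using g bm A_cochain_closed[OF h as] by (simp add: bimodule.ract_mult[OF M])
 finally show ?thesis
  using g bm A_cochain_closed[OF h as] bimodule.ract_one[OF M] by (simp add: uu S_simps(6)[symmetric])
qed

end

end

section \<open>Averaging over the group and extension of invariant cochains\<close>

context skew_algebra
begin

lemma res_diff:
 assumes M: "bimodule S M" and f: "f \<in> bar_cochains S M m"
 shows "res (Suc m) (bar_diff S M m f) = bar_diff A (resb M) m (res m f)"
proof (rule extensionalityI[of _ "bar_args A (Suc m)"])
 fix as assume as: "as \<in> bar_args A (Suc m)"
 note c = face_args[OF A.ring as]
 have fm: "face S i (map e as) = map e (face A i as)" if "i \<le> Suc m" for i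
  using as that by (intro face_map[of as "Suc m" i A]) (auto simp: bar_args_def ee)
 have "bar_diff A (resb M) m (res m f) as = bar_diff S M m f (map e as)"
  by (rule bar_diff_natural[OF bim_vsp[OF M] vsp_resb[OF bim_vsp[OF M]], of "\<lambda>x. x"])
   (use as c map_e_args[OF M as] in \<open>auto simp: lin_id fm res_def intro: S_cochain_closed[OF M f] map_e_args[OF M]\<close>)
 then show "res (Suc m) (bar_diff S M m f) as = bar_diff A (resb M) m (res m f) as" using as by (simp add: res_def)
qed (auto simp: res_def bar_diff_def)

lemma ga_diff:
 assumes M: "bimodule S M" and h: "h \<in> bar_cochains A (resb M) m" and g: "g \<in> carrier G"
 shows "ga M (Suc m) g (bar_diff A (resb M) m h) = bar_diff A (resb M) m (ga M m g h)"
proof (rule extensionalityI[of _ "bar_args A (Suc m)"])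
 fix as assume as: "as \<in> bar_args A (Suc m)"
 let ?k = "inv g"
 have k: "?k \<in> carrier G" using g by simp
 note c = face_args[OF A.ring as]
 have fm: "face A i (map (act ?k) as) = map (act ?k) (face A i as)" if "i \<le> Suc m" for i
  using as that by (intro face_map[of as "Suc m" i A]) (auto simp: bar_args_def act_mult[OF k])
 have L: "lin (resb M) (resb M) (\<lambda>x. ract M (lact M (u g) x) (u ?k))"
  using lin_comp[OF lin_lact[OF M] lin_ract[OF M], of "u g" "u ?k"] by simp
 have "bar_diff A (resb M) m (ga M m g h) as = ract M (lact M (u g) (bar_diff A (resb M) m h (map (act ?k) as))) (u ?k)"
  by (rule bar_diff_natural[OF vsp_resb[OF bim_vsp[OF M]] vsp_resb[OF bim_vsp[OF M]] L])
   (use as c map_act_args[OF M k] in \<open>auto simp: fm ga_def map_act_args[OF M k as] intro: A_cochain_closed[OF M h]\<close>)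
 then show "ga M (Suc m) g (bar_diff A (resb M) m h) as = bar_diff A (resb M) m (ga M m g h) as" using as by (simp add: ga_def)
qed (auto simp: ga_def bar_diff_def)

definition avg :: "('k, 'g => 'a, 'm) bimodule => nat => ('a list => 'm) => 'a list => 'm" where
 "avg M m h = inverse (of_nat (card (carrier G))) \<odot>\<^bsub>bar_complex A (resb M) m\<^esub>
   (\<Oplus>\<^bsub>bar_complex A (resb M) m\<^esub>g\<in>carrier G. ga M m g h)"

lemma card_nonzero: "(of_nat (card (carrier G)) :: 'k) \<noteq> 0"
 using fin G.one_closed by (auto simp: card_eq_0_iff)

context
 fixes M :: "('k, 'g => 'a, 'm) bimodule" and m :: nat
 assumes M: "bimodule S M"
begin

abbreviation C where "C \<equiv> bar_complex A (resb M)"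

lemma vC: "vsp (C m)" by (rule A.vsp_bar_complex[OF bimodule_resb[OF M]])

lemma ga_sum_closed: "h \<in> carrier (C m) ==> (\<lambda>g. ga M m g h) \<in> carrier G \<rightarrow> carrier (C m)"
 using ga_cochain[OF M] by auto

lemma avg_closed: "h \<in> carrier (C m) ==> avg M m h \<in> carrier (C m)"
 unfolding avg_def by (intro vs_smult[OF vC] vs_finsum[OF vC] ga_sum_closed)

lemma ga_avg:
 assumes h: "h \<in> carrier (C m)" and k: "k \<in> carrier G"
 shows "ga M m k (avg M m h) = avg M m h"
proof -
 note L = lin_ga[OF M k, of m]
 have "ga M m k (\<Oplus>\<^bsub>C m\<^esub>g\<in>carrier G. ga M m g h) = (\<Oplus>\<^bsub>C m\<^esub>g\<in>carrier G. ga M m k (ga M m g h))"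
  by (rule lin_finsum[OF vC vC L ga_sum_closed[OF h]])
 also have "\<dots> = (\<Oplus>\<^bsub>C m\<^esub>g\<in>carrier G. ga M m (k \<otimes> g) h)"
  using h k ga_cochain[OF M] ga_comp[OF M] by (intro vs_finsum_cong[OF vC]) auto
 \<comment> \<open>Left translation by \<open>k\<close> permutes the summands.\<close>
 also have "\<dots> = (\<Oplus>\<^bsub>C m\<^esub>g\<in>carrier G. ga M m g h)"
 proof -
  have "inj_on (\<lambda>l. k \<otimes> l) (carrier G)" using k by (auto simp: inj_on_def)
  then show ?thesis
   using vs_finsum_reindex[OF vC, of "\<lambda>g. ga M m g h" "\<lambda>l. k \<otimes> l" "carrier G"] ga_sum_closed[OF h]
   by (simp only: G.surj_const_mult[OF k])
 qed
 finally show ?thesis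
  unfolding avg_def by (subst lin_smult[OF L]) (simp_all only: vs_finsum[OF vC] ga_sum_closed[OF h])
qed

lemma avg_fixed:
 assumes h: "h \<in> carrier (C m)" and fx: "\<And>g. g \<in> carrier G ==> ga M m g h = h"
 shows "avg M m h = h"
proof -
 have "(\<Oplus>\<^bsub>C m\<^esub>g\<in>carrier G. ga M m g h) = (\<Oplus>\<^bsub>C m\<^esub>g\<in>carrier G. 1 \<odot>\<^bsub>C m\<^esub> h)"
  using h fx vs_smult_one[OF vC h] by (intro vs_finsum_cong[OF vC]) auto
 also have "\<dots> = of_nat (card (carrier G)) \<odot>\<^bsub>C m\<^esub> h"
  using vs_finsum_scalars[OF vC fin h, of "\<lambda>_. 1"] by simp
 finally show ?thesis
  unfolding avg_def using vs_smult_smult[OF vC h] vs_smult_one[OF vC h] card_nonzero by simp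
qed

lemma avg_diff:
 assumes h: "h \<in> carrier (C m)"
 shows "avg M (Suc m) (bar_diff A (resb M) m h) = bar_diff A (resb M) m (avg M m h)"
proof -
 note cx = A.bar_cplx[OF bimodule_resb[OF M]]
 note L = cplx_lin[OF cx, of m]
 have "bar_diff A (resb M) m (\<Oplus>\<^bsub>C m\<^esub>g\<in>carrier G. ga M m g h) =
   (\<Oplus>\<^bsub>C (Suc m)\<^esub>g\<in>carrier G. bar_diff A (resb M) m (ga M m g h))"
  by (rule lin_finsum[OF vC cplx_vsp[OF cx] L ga_sum_closed[OF h]])
 also have "\<dots> = (\<Oplus>\<^bsub>C (Suc m)\<^esub>g\<in>carrier G. ga M (Suc m) g (bar_diff A (resb M) m h))"
  using h ga_diff[OF M] ga_cochain[OF M lin_closed[OF L h, unfolded A.bar_complex_simps]]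
  by (intro vs_finsum_cong[OF cplx_vsp[OF cx]]) auto
 finally show ?thesis
  unfolding avg_def by (subst lin_smult[OF L]) (simp_all only: vs_finsum[OF vC] ga_sum_closed[OF h])
qed

context
 fixes h assumes h: "h \<in> bar_cochains A (resb M) m" and fx: "\<And>g. g \<in> carrier G ==> ga M m g h = h"
begin

abbreviation val where "val \<equiv> \<lambda>w. ract M (h (\<one>\<^bsub>A\<^esub> # tw \<one> (map fst w) (map (\<lambda>i. b (snd i)) w) @ [\<one>\<^bsub>A\<^esub>]))
   (u (pr \<one> (map fst w)))"

lemma tw_one_args:
 assumes "length gs = m" "set gs \<subseteq> carrier G" "length as = m" "set as \<subseteq> carrier A" "g \<in> carrier G" "a \<in> carrier A" "c \<in> carrier A"
 shows "a # tw g gs as @ [c] \<in> bar_args A m"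
proof -
 have "tw g gs as ! i \<in> carrier A" if "i < m" for i
  using assms that pl_closed[of g gs] by (auto simp: tw_def subset_iff)
 then have "set (tw g gs as) \<subseteq> carrier A" using assms by (auto simp: in_set_conv_nth)
 then show ?thesis using assms by (auto simp: bar_args_def)
qed

lemma val_closed: "val \<in> S.words m \<rightarrow> carrier M"
proof
 fix w assume "w \<in> S.words m"
 then have "length w = m" "set (map fst w) \<subseteq> carrier G" "set (map (\<lambda>i. b (snd i)) w) \<subseteq> carrier A"
  using A.b by (auto simp: S.words_def subset_iff)
 then show "val w \<in> carrier M"
  by (intro bimodule.ract_closed[OF M] A_cochain_closed[OF M h] tw_one_args) simp_all
qed

lemma bhom_psi: "bhom S (S.bar_mod m) M (psi M h)"
 unfolding psi_def S.bar_mod_def by (rule S.bhom_fext[OF M val_closed])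

text \<open>Both sides are multilinear, so basis entries suffice. Invariance of \<open>h\<close>
  enters because the first entry \<open>b c # g\<close> acts from the left, and its group part has
  to cross the value of \<open>h\<close> to reach the other group elements.\<close>

lemma psi_hs:
 assumes gs: "length gs = m + 2" "set gs \<subseteq> carrier G" and as: "as \<in> bar_args A m"
 shows "psi M h (S.ub m (hs gs as)) = ract M (h (tw \<one> gs as)) (u (pr \<one> gs))"
proof (rule A.mlin_eqI[OF bim_vsp[OF M] _ _ _ as, of "\<lambda>as. psi M h (S.ub m (hs gs as))"])
 show "mlin A (m + 2) M (\<lambda>as. psi M h (S.ub m (hs gs as)))"
  unfolding hs_def by (rule mlin_map2[OF S.mlin_comp[OF S.mlin_ub bhom_lin[OF bhom_psi]] lin_hash gs])
 have "mlin A (m + 2) M (\<lambda>as. ract M (h as) (u (pr \<one> gs)))"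
  using A.mlin_comp[OF A.bar_cochainsD(1)[OF h], of M "\<lambda>x. ract M x (u (pr \<one> gs))"] lin_ract[OF M] by simp
 then show "mlin A (m + 2) M (\<lambda>as. ract M (h (tw \<one> gs as)) (u (pr \<one> gs)))"
  unfolding tw_def by (rule mlin_map2[OF _ act_lin]) (use gs pl_closed in auto)
 fix v assume v: "length v = m + 2" "set v \<subseteq> J"
 obtain c w c' where v': "v = c # w @ [c']" "length w = m" by (rule split_ends[OF v(1)])
 obtain g hs' g' where gs': "gs = g # hs' @ [g']" "length hs' = m" by (rule split_ends[OF gs(1)])
 have J: "c \<in> J" "c' \<in> J" "set w \<subseteq> J" and G: "g \<in> carrier G" "g' \<in> carrier G" "set hs' \<subseteq> carrier G"
  using v v' gs gs' by auto
 note bc = A.b[OF J(1)] A.b[OF J(2)]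
 have bw: "set (map b w) \<subseteq> carrier A" using J A.b by auto
 \<comment> \<open>Pairs the middle group elements with the middle basis indices; \<open>z\<close>
   labels a free generator of the bar module of \<open>S\<close>.\<close>
 define z where "z = zip hs' w"
 have "map snd z = w" using v' gs' by (simp add: z_def)
 then have "map (\<lambda>i. b (snd i)) z = map b w" using map_map[of b snd z] by (simp add: comp_def)
 then have z: "z \<in> S.words m" "map fst z = hs'" "map (\<lambda>i. b (snd i)) z = map b w"
  using v' gs' J G by (simp_all add: z_def S.words_def) (auto elim!: in_set_zipE)
 have "map bS z = hs hs' (map b w)"
  using v' gs' by (intro nth_equalityI) (auto simp: z_def hs_def bS_def)
 then have ub: "S.ub m (hs gs (map b v)) = S.ten z (hsh (b c) g) (hsh (b c') g')"
  using S.ub_word[of z m "hsh (b c) g" "hsh (b c') g'"] z(1) v' gs' by (simp add: hs_append S.words_def)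
 let ?p = "pr \<one> hs'"
 let ?T = "\<lambda>g a c. a # tw g hs' (map b w) @ [c]"
 have p: "?p \<in> carrier G" using G by simp
 have Tc: "h (?T g a c) \<in> carrier M" if "g \<in> carrier G" "a \<in> carrier A" "c \<in> carrier A" for g a c
  using that v' gs' G bw by (intro A_cochain_closed[OF M h] tw_one_args) auto
 have Ta: "?T g a c \<in> bar_args A m" if "g \<in> carrier G" "a \<in> carrier A" "c \<in> carrier A" for g a c
  using that v' gs' G bw by (intro tw_one_args) auto
 note bm = bimodule.lact_closed[OF M] bimodule.ract_closed[OF M]
 have act_g: "lact M (u g) (h (?T \<one> \<one>\<^bsub>A\<^esub> \<one>\<^bsub>A\<^esub>)) = ract M (h (?T g \<one>\<^bsub>A\<^esub> \<one>\<^bsub>A\<^esub>)) (u g)"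
  using ga_fixed[OF M h G(1) fx[OF G(1)] Ta[of "\<one>" "\<one>\<^bsub>A\<^esub>" "\<one>\<^bsub>A\<^esub>"]] G bw v' gs' map_tw[of g "\<one>" hs' "map b w"]
  by (simp add: act_one del: map_map)
 have left: "lact M (e (b c)) (h (?T g \<one>\<^bsub>A\<^esub> \<one>\<^bsub>A\<^esub>)) = h (?T g (b c) \<one>\<^bsub>A\<^esub>)"
  using A.bar_cochainsD(2)[OF h Ta[of g "\<one>\<^bsub>A\<^esub>" "\<one>\<^bsub>A\<^esub>"] bc(1)] G bc by simp
 let ?q = "act (g \<otimes> ?p) (b c')"
 have qc: "?q \<in> carrier A" using G p bc by simp
 have right: "ract M (h (?T g (b c) \<one>\<^bsub>A\<^esub>)) (e ?q) = h (?T g (b c) ?q)"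
  using A.bar_cochainsD(3)[OF h Ta[of g "b c" "\<one>\<^bsub>A\<^esub>"] qc, folded Suc_eq_plus1] G bc qc v' gs' by (simp add: nth_append list_update_append)
 have one: "lact M (hsh (b c) g) (val z) = ract M (ract M (h (?T g (b c) \<one>\<^bsub>A\<^esub>)) (u g)) (u ?p)"
 proof -
  have "lact M (hsh (b c) g) (val z) = lact M (e (b c)) (lact M (u g) (ract M (h (?T \<one> \<one>\<^bsub>A\<^esub> \<one>\<^bsub>A\<^esub>)) (u ?p)))"
   using G p bc Tc bm by (simp add: bimodule.lact_mult[OF M, symmetric] eu z)
  also have "\<dots> = ract M (ract M (lact M (e (b c)) (h (?T g \<one>\<^bsub>A\<^esub> \<one>\<^bsub>A\<^esub>))) (u g)) (u ?p)"
   using G p bc Tc bm act_g by (simp add: bimodule.lact_ract[OF M])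
  finally show ?thesis by (simp only: left)
 qed
 have "psi M h (S.ub m (hs gs (map b v))) = ract M (lact M (hsh (b c) g) (val z)) (hsh (b c') g')"
  unfolding ub psi_def using bc z(1) by (intro S.fext_ten[OF M val_closed]) auto
 also have "\<dots> = ract M (h (?T g (b c) \<one>\<^bsub>A\<^esub>)) (u g \<otimes>\<^bsub>S\<^esub> (u ?p \<otimes>\<^bsub>S\<^esub> hsh (b c') g'))"
  unfolding one using G p bc Tc bm by (simp add: bimodule.ract_mult[OF M])
 \<comment> \<open>All group elements are gathered on the right. The last entry \<open>b c'\<close>
   passes to their left and is twisted by \<open>g \<otimes> ?p\<close>, as \<open>tw\<close>
   prescribes.\<close>
 also have "u g \<otimes>\<^bsub>S\<^esub> (u ?p \<otimes>\<^bsub>S\<^esub> hsh (b c') g') = e ?q \<otimes>\<^bsub>S\<^esub> u (g \<otimes> ?p \<otimes> g')"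
  using G p bc qc by (simp add: uh eu act_comp G.m_assoc)
 also have "ract M (h (?T g (b c) \<one>\<^bsub>A\<^esub>)) \<dots> = ract M (h (?T g (b c) ?q)) (u (g \<otimes> ?p \<otimes> g'))"
  using G p bc qc Tc bm right by (simp add: bimodule.ract_mult[OF M])
 finally show "psi M h (S.ub m (hs gs (map b v))) = ract M (h (tw \<one> gs (map b v))) (u (pr \<one> gs))"
  using G bc v' gs' pr_mult[of g "\<one>" hs'] by (simp add: tw_append act_id)
qed

lemma Psi_cochain: "Psi M m h \<in> bar_cochains S M m"
 using S.beval_closed[OF bimod_homI[OF S.bimodule_bar bhom_psi]]
 by (simp add: Psi_def S.beval_def S.carrier_bar S.ub_closed cong: restrict_cong)

lemma Psi_hs:
 assumes "length gs = m + 2" "set gs \<subseteq> carrier G" "as \<in> bar_args A m"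
 shows "Psi M m h (hs gs as) = ract M (h (tw \<one> gs as)) (u (pr \<one> gs))"
 using psi_hs[OF assms] hs_args[OF assms(3,1)] by (simp add: Psi_def)

text \<open>For trivial group elements nothing is twisted and the collected product is 1.\<close>

lemma res_Psi: "res m (Psi M m h) = h"
proof (rule extensionalityI[of _ "bar_args A m"])
 fix as assume as: "as \<in> bar_args A m"
 then have l: "length as = m + 2" "set as \<subseteq> carrier A" by (auto simp: bar_args_def)
 have "Psi M m h (map e as) = ract M (h as) (u \<one>)"
  using Psi_hs[of "replicate (m + 2) \<one>" as, OF _ _ as] tw_replicate[OF l(2)] hs_replicate[of as]
  unfolding l(1) pr_replicate by (metis G.one_closed empty_subsetI insert_subset length_replicate set_replicate_conv_if)
 then show "res m (Psi M m h) as = h as"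
  using as bimodule.ract_one[OF M A_cochain_closed[OF M h as]] by (simp add: res_def S_simps(6))
qed (use A.bar_cochainsD(4)[OF h] in \<open>auto simp: res_def\<close>)

end

end

end

lemma subsp_finsum:
 assumes V: "vsp V" and B: "subsp V B" and f: "f \<in> I \<rightarrow> B"
 shows "finsum V f I \<in> B"
proof (cases "finite I")
 case True
 then show ?thesis using f
  by (induction rule: finite_induct) (use V B in \<open>auto simp: subsp_def vs_finsum_insert Pi_iff subset_iff\<close>)
next
 case False
 then show ?thesis using B abelian_monoid.finsum_infinite[of V I f] vsp_abelian_group[OF V]
  by (simp add: subsp_def abelian_group.axioms(1))
qed

section \<open>The averaging endomorphism of the bar complex of \<open>S\<close>\<close>

context skew_algebra
begin

lemma Psi_diff:
 assumes M: "bimodule S M" and h: "h \<in> bar_cochains A (resb M) m" and fx: "\<And>g. g \<in> carrier G ==> ga M m g h = h"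
 shows "bar_diff S M m (Psi M m h) = Psi M (Suc m) (bar_diff A (resb M) m h)"
proof -
 have dh: "bar_diff A (resb M) m h \<in> bar_cochains A (resb M) (Suc m)"
  by (rule A.bar_diff_cochain[OF bimodule_resb[OF M] h])
 have dfx: "ga M (Suc m) g (bar_diff A (resb M) m h) = bar_diff A (resb M) m h" if "g \<in> carrier G" for g
  using ga_diff[OF M h that] fx[OF that] by simp
 show ?thesis
 proof (rule hs_cochain_eqI[OF M S.bar_diff_cochain[OF M Psi_cochain[OF M h fx]] Psi_cochain[OF M dh dfx]])
  fix gs as assume gs: "length gs = Suc m + 2" "set gs \<subseteq> carrier G" and as: "as \<in> bar_args A (Suc m)"
  then have l: "length as = length gs" "set as \<subseteq> carrier A" by (auto simp: bar_args_def)
  have "bar_diff S M m (Psi M m h) (hs gs as) =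
    ract M (bar_diff A (resb M) m h (tw \<one> gs as)) (u (pr \<one> gs))"
  proof (rule bar_diff_natural[OF vsp_resb[OF bim_vsp[OF M]] bim_vsp[OF M] _ hs_args[OF as gs(1)] tw_args[OF as gs G.one_closed]])
   show "lin (resb M) M (\<lambda>x. ract M x (u (pr \<one> gs)))" using lin_ract[OF M] by simp
   fix i assume i: "i \<le> Suc m"
   then obtain gs' as' where *: "length gs' = length gs - 1" "length as' = length gs - 1" "set gs' \<subseteq> carrier G" "set as' \<subseteq> carrier A"
    "face S i (hs gs as) = hs gs' as'" "tw \<one> gs' as' = face A i (tw \<one> gs as)" "pr \<one> gs' = pr \<one> gs"
    using face_hs[of i gs as "\<one>"] gs l by auto
   then have "as' \<in> bar_args A m" "length gs' = m + 2" using gs by (auto simp: bar_args_def)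
   then show "Psi M m h (face S i (hs gs as)) = ract M (h (face A i (tw \<one> gs as))) (u (pr \<one> gs))"
    using Psi_hs[OF M h fx, of gs' as'] * by simp
   show "h (face A i (tw \<one> gs as)) \<in> carrier (resb M)"
    using A_cochain_closed[OF M h] face_args[OF A.ring tw_args[OF as gs G.one_closed] i] by simp
  qed
  then show "bar_diff S M m (Psi M m h) (hs gs as) = Psi M (Suc m) (bar_diff A (resb M) m h) (hs gs as)"
   using Psi_hs[OF M dh dfx gs as] by simp
 qed
qed

text \<open>An endomorphism of the bar cochains of \<open>S\<close>, natural in \<open>M\<close>. Being induced by a chain map over
 the identity of \<open>S\<close>, it acts trivially on cohomology.\<close>

definition E :: "('k, 'g => 'a, 'm) bimodule => nat => (('g => 'a) list => 'm) => ('g => 'a) list => 'm" where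
 "E M m f = Psi M m (avg M m (res m f))"

lemma
 assumes M: "bimodule S M" and f: "f \<in> bar_cochains S M m"
 shows avg_res: "avg M m (res m f) \<in> bar_cochains A (resb M) m"
  and ga_avg_res: "g \<in> carrier G ==> ga M m g (avg M m (res m f)) = avg M m (res m f)"
 using avg_closed[OF M] ga_avg[OF M] res_cochain[OF M f] by auto

lemma E_cochain: "bimodule S M ==> f \<in> bar_cochains S M m ==> E M m f \<in> bar_cochains S M m"
 unfolding E_def by (intro Psi_cochain avg_res ga_avg_res)

lemma E_hs:
 assumes M: "bimodule S M" and f: "f \<in> bar_cochains S M m"
  and "length gs = m + 2" "set gs \<subseteq> carrier G" "as \<in> bar_args A m"
 shows "E M m f (hs gs as) = ract M (avg M m (res m f) (tw \<one> gs as)) (u (pr \<one> gs))"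
 unfolding E_def by (rule Psi_hs[OF M avg_res[OF M f] ga_avg_res[OF M f] assms(3-5)])

lemma E_diff:
 assumes M: "bimodule S M" and f: "f \<in> bar_cochains S M m"
 shows "E M (Suc m) (bar_diff S M m f) = bar_diff S M m (E M m f)"
 using Psi_diff[OF M avg_res[OF M f] ga_avg_res[OF M f]] avg_diff[OF M, of "res m f" m] res_cochain[OF M f] res_diff[OF M f]
 by (simp add: E_def)

lemma avg_nat:
 assumes M: "bimodule S M" and N: "bimodule S N" and p: "bhom S M N p" and h: "h \<in> bar_cochains A (resb M) m"
 shows "avg N m (\<lambda>as\<in>bar_args A m. p (h as)) = (\<lambda>as\<in>bar_args A m. p (avg M m h as))"
proof -
 let ?L = "\<lambda>f. \<lambda>as\<in>bar_args A m. p (f as)"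
 note c = A_cochain_closed[OF M] map_act_args[OF M]
 have L: "lin (bar_complex A (resb M) m) (bar_complex A (resb N) m) ?L"
  using A.bar_cochain_comp[OF bimodule_resb[OF M] _ bhom_resb[OF p]]
  by (intro linI) (auto simp: lin_add[OF bhom_lin[OF p]] lin_smult[OF bhom_lin[OF p]] c intro!: restrict_ext)
 have ga: "?L (ga M m g h) = ga N m g (?L h)" if g: "g \<in> carrier G" for g
  using g by (auto simp: ga_def A_cochain_closed[OF M h] map_act_args[OF M] bhom_lact[OF p] bhom_ract[OF p] bimodule.lact_closed[OF M] intro!: restrict_ext)
 have Lh: "?L h \<in> carrier (bar_complex A (resb N) m)" using lin_closed[OF L, of h] h by simp
 have "?L (\<Oplus>\<^bsub>bar_complex A (resb M) m\<^esub>g\<in>carrier G. ga M m g h) = (\<Oplus>\<^bsub>bar_complex A (resb N) m\<^esub>g\<in>carrier G. ?L (ga M m g h))"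
  by (rule lin_finsum[OF vC[OF M] vC[OF N] L]) (use h ga_sum_closed[OF M, of h m] in auto)
 also have "\<dots> = (\<Oplus>\<^bsub>bar_complex A (resb N) m\<^esub>g\<in>carrier G. ga N m g (?L h))"
  by (rule vs_finsum_cong[OF vC[OF N] ga ga_sum_closed[OF N Lh]])
 finally have s: "?L (\<Oplus>\<^bsub>bar_complex A (resb M) m\<^esub>g\<in>carrier G. ga M m g h) = (\<Oplus>\<^bsub>bar_complex A (resb N) m\<^esub>g\<in>carrier G. ga N m g (?L h))" .
 have "(\<Oplus>\<^bsub>bar_complex A (resb M) m\<^esub>g\<in>carrier G. ga M m g h) \<in> carrier (bar_complex A (resb M) m)"
  using h by (intro vs_finsum[OF vC[OF M]] ga_sum_closed[OF M]) simp
 from lin_smult[OF L this, of "inverse (of_nat (card (carrier G)))"] show ?thesis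
  unfolding avg_def s by (rule sym)
qed

text \<open>Naturality in the coefficients turns \<open>E\<close> into a chain map: its value
  \<open>em\<close> at the universal cochain determines it for all coefficients.\<close>

lemma E_nat:
 assumes M: "bimodule S M" and N: "bimodule S N" and p: "bhom S M N p" and f: "f \<in> bar_cochains S M m"
 shows "E N m (\<lambda>ss\<in>bar_args S m. p (f ss)) = (\<lambda>ss\<in>bar_args S m. p (E M m f ss))"
proof -
 note pf = S.bar_cochain_comp[OF M f p]
 show ?thesis
 proof (rule hs_cochain_eqI[OF N E_cochain[OF N pf] S.bar_cochain_comp[OF M E_cochain[OF M f] p]])
  fix gs as assume gs: "length gs = m + 2" "set gs \<subseteq> carrier G" and as: "as \<in> bar_args A m"
  have "res m (\<lambda>ss\<in>bar_args S m. p (f ss)) = (\<lambda>as\<in>bar_args A m. p (res m f as))"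
   using map_e_args[OF M] by (auto simp: res_def intro!: restrict_ext)
  then have "avg N m (res m (\<lambda>ss\<in>bar_args S m. p (f ss))) = (\<lambda>as\<in>bar_args A m. p (avg M m (res m f) as))"
   using avg_nat[OF M N p res_cochain[OF M f]] by simp
  then show "E N m (\<lambda>ss\<in>bar_args S m. p (f ss)) (hs gs as) = (\<lambda>ss\<in>bar_args S m. p (E M m f ss)) (hs gs as)"
   using E_hs[OF N pf gs as] E_hs[OF M f gs as] hs_args[OF as gs(1)] tw_args[OF as gs G.one_closed]
    A_cochain_closed[OF M avg_res[OF M f]] gs
   by (simp add: bhom_ract[OF p])
 qed
qed

text \<open>The multiplication cochain is invariant and is its own extension. Translated to
  \<open>em\<close>, this says that \<open>em\<close> respects the augmentation, so it lies over the
  identity of \<open>S\<close>.\<close>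

lemma E_product: "E (regular S) 0 (\<lambda>ss\<in>bar_args S 0. ss ! 0 \<otimes>\<^bsub>S\<^esub> ss ! 1) = (\<lambda>ss\<in>bar_args S 0. ss ! 0 \<otimes>\<^bsub>S\<^esub> ss ! 1)" (is "E _ 0 ?\<mu> = _")
proof -
 note M = S.bimodule_regular and \<mu> = S.baug_cochain
 have r: "res 0 ?\<mu> as = e (as ! 0 \<otimes>\<^bsub>A\<^esub> as ! 1)" if "as \<in> bar_args A 0" for as
  using that map_e_args[OF M that] by (auto simp: res_def bar_args_iff ee)
 have "avg (regular S) 0 (res 0 ?\<mu>) = res 0 ?\<mu>"
 proof (rule avg_fixed[OF M])
  fix g assume g: "g \<in> carrier G"
  show "ga (regular S) 0 g (res 0 ?\<mu>) = res 0 ?\<mu>"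
  proof (rule extensionalityI[of _ "bar_args A 0"])
   fix as assume as: "as \<in> bar_args A 0"
   then have c: "as ! 0 \<in> carrier A" "as ! 1 \<in> carrier A" "length as = 2" by (auto simp: bar_args_iff)
   have k: "inv g \<in> carrier G" using g by simp
   show "ga (regular S) 0 g (res 0 ?\<mu>) as = res 0 ?\<mu> as"
    using as c g r[OF as] r[OF map_act_args[OF M k as]]
    by (simp add: ga_def act_mult[OF k, symmetric] ue act_comp[symmetric] act_id hash_mult act_one del: One_nat_def)
  qed (auto simp: ga_def res_def)
 qed (use res_cochain[OF M \<mu>] in simp)
 then show ?thesis
 proof (intro hs_cochain_eqI[OF M E_cochain[OF M \<mu>] \<mu>])
  fix gs as assume av: "avg (regular S) 0 (res 0 ?\<mu>) = res 0 ?\<mu>"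
   and gs: "length gs = 0 + 2" "set gs \<subseteq> carrier G" and as: "as \<in> bar_args A 0"
  obtain g g' where g: "gs = [g, g']" using gs by (auto simp: length_Suc_conv numeral_2_eq_2)
  obtain a c where a: "as = [a, c]" using as by (auto simp: bar_args_def length_Suc_conv numeral_2_eq_2)
  have c: "a \<in> carrier A" "c \<in> carrier A" "g \<in> carrier G" "g' \<in> carrier G" using gs as g a by (auto simp: bar_args_def)
  show "E (regular S) 0 ?\<mu> (hs gs as) = ?\<mu> (hs gs as)"
   using E_hs[OF M \<mu> gs as] r[OF tw_args[OF as gs G.one_closed]] hs_args[OF as gs(1)] av c
   by (simp add: g a act_id eu hash_mult)
 qed
qed

definition ubr where "ubr m = (\<lambda>ss\<in>bar_args S m. S.ub m ss)"
definition em where "em m = S.bext (S.bar_mod m) (E (S.bar_mod m) m (ubr m))"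

lemma ubr: "ubr m \<in> bar_cochains S (S.bar_mod m) m" unfolding ubr_def by (rule S.ub_cochain)

lemma bhom_em: "bhom S (S.bar_mod m) (S.bar_mod m) (em m)"
 unfolding em_def by (rule S.bhom_bext[OF S.bimodule_bar E_cochain[OF S.bimodule_bar ubr]])

lemma em_ub: "ss \<in> bar_args S m ==> em m (S.ub m ss) = E (S.bar_mod m) m (ubr m) ss"
 unfolding em_def by (rule S.bext_ub[OF S.bimodule_bar E_cochain[OF S.bimodule_bar ubr]])

text \<open>A Yoneda argument: a homomorphism \<open>p\<close> corresponds to the cochain obtained
  from the universal one, and by naturality precomposition with \<open>em\<close> corresponds to
  \<open>E\<close>.\<close>

lemma bhom_em_E:
 assumes N: "bimodule S N" and p: "bhom S (S.bar_mod m) N p" and ss: "ss \<in> bar_args S m"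
 shows "p (em m (S.ub m ss)) = E N m (\<lambda>ss\<in>bar_args S m. p (S.ub m ss)) ss"
proof -
 have "(\<lambda>ss\<in>bar_args S m. p (S.ub m ss)) = (\<lambda>ss\<in>bar_args S m. p (ubr m ss))" by (auto simp: ubr_def intro!: restrict_ext)
 then show ?thesis using E_nat[OF S.bimodule_bar N p ubr] ss by (simp add: em_ub)
qed

lemma chain_map_em: "chain_map S S.bar_mod S.bd S.baug S.bar_mod S.bd S.baug em"
 unfolding chain_map_def
proof (intro conjI allI ballI bhom_em)
 fix x assume x: "x \<in> carrier (S.bar_mod 0)"
 show "S.baug (em 0 x) = S.baug x"
 proof (rule S.bar_lin_eqI[OF bim_vsp[OF S.bimodule_regular] bhom_lin[OF bhom_comp[OF bhom_em S.bhom_baug]] bhom_lin[OF S.bhom_baug] _ x])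
  fix ss assume ss: "ss \<in> bar_args S 0"
  have "(\<lambda>ss\<in>bar_args S 0. S.baug (S.ub 0 ss)) = (\<lambda>ss\<in>bar_args S 0. ss ! 0 \<otimes>\<^bsub>S\<^esub> ss ! 1)"
   by (rule restrict_ext) (rule S.baug_ub)
  then show "S.baug (em 0 (S.ub 0 ss)) = S.baug (S.ub 0 ss)"
   using bhom_em_E[OF S.bimodule_regular S.bhom_baug ss] fun_cong[OF E_product, of ss] S.baug_ub[OF ss] ss by simp
 qed
next
 fix m x assume x: "x \<in> carrier (S.bar_mod (Suc m))"
 note B = S.bimodule_bar[of m]
 show "S.bd m (em (Suc m) x) = em m (S.bd m x)"
 proof (rule S.bar_lin_eqI[OF bim_vsp[OF B] bhom_lin[OF bhom_comp[OF bhom_em S.bhom_bd]] bhom_lin[OF bhom_comp[OF S.bhom_bd bhom_em]] _ x])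
  fix ss assume ss: "ss \<in> bar_args S (Suc m)"
  note du = S.bar_diff_cochain[OF B ubr]
  have bd: "S.bd m (S.ub (Suc m) ss) = bar_diff S (S.bar_mod m) m (ubr m) ss" if "ss \<in> bar_args S (Suc m)" for ss
   using S.bd_ub[OF that] by (simp add: ubr_def)
  have "(\<lambda>ss\<in>bar_args S (Suc m). S.bd m (S.ub (Suc m) ss)) = bar_diff S (S.bar_mod m) m (ubr m)"
   using bd S.bar_cochainsD(4)[OF du] by (intro extensionalityI[of _ "bar_args S (Suc m)"]) auto
  then have "S.bd m (em (Suc m) (S.ub (Suc m) ss)) = bar_diff S (S.bar_mod m) m (E (S.bar_mod m) m (ubr m)) ss"
   using bhom_em_E[OF B S.bhom_bd ss] E_diff[OF B ubr] by simp
  also have "E (S.bar_mod m) m (ubr m) = (\<lambda>ss\<in>bar_args S m. em m (ubr m ss))"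
   using S.bar_cochainsD(4)[OF E_cochain[OF B ubr]]
   by (intro extensionalityI[of _ "bar_args S m"]) (auto simp: em_ub ubr_def)
  also have "bar_diff S (S.bar_mod m) m \<dots> ss = em m (S.bd m (S.ub (Suc m) ss))"
   using S.bar_diff_comp[OF B B ubr bhom_em ss] bd[OF ss] by simp
  finally show "S.bd m (em (Suc m) (S.ub (Suc m) ss)) = em m (S.bd m (S.ub (Suc m) ss))" .
 qed
qed

text \<open>\<open>em\<close> and the identity are chain maps of the bar resolution of
  \<open>S\<close> over the identity, so their pullbacks of a cocycle differ by a coboundary;
  \<open>beval\<close> translates this into bar cochains.\<close>

lemma E_homotopic:
 assumes M: "bimodule S M" and f: "f \<in> cocycles (bar_complex S M) (bar_diff S M) m"
 shows "E M m f \<ominus>\<^bsub>bar_complex S M m\<^esub> f \<in> coboundaries (bar_complex S M) (bar_diff S M) m"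
proof -
 let ?H = "hom_complex S S.bar_mod M"
 note HC = hom_cplx[OF S.resolution_bar M] and BC = S.bar_cplx[OF M]
 have fc: "f \<in> bar_cochains S M m" using cocyclesD[OF f] by simp
 have "f \<in> S.beval m ` bimod_hom S (S.bar_mod m) M" using S.beval_bij[OF M, of m] fc by (simp add: bij_betw_def)
 then obtain F where F1: "f = S.beval m F" "F \<in> bimod_hom S (S.bar_mod m) M" by (rule imageE)
 note F = F1(2) F1(1)[symmetric]
 have F': "F \<in> carrier (?H m)" using F by (simp add: hom_complex_def)
 have bF: "bhom S (S.bar_mod m) M F" by (rule bimod_hom_bhom[OF F(1)])
 \<comment> \<open>The cocycle condition comes back from bar cochains because \<open>beval\<close>
   is injective in degree \<open>m + 1\<close>.\<close>
 have "F \<in> cocycles ?H (hom_diff S.bar_mod S.bd) m"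
 proof -
  have z: "\<zero>\<^bsub>?H (Suc m)\<^esub> \<in> bimod_hom S (S.bar_mod (Suc m)) M"
   "hom_diff S.bar_mod S.bd m F \<in> bimod_hom S (S.bar_mod (Suc m)) M"
   using vs_zero[OF cplx_vsp[OF HC], of "Suc m"] lin_closed[OF cplx_lin[OF HC] F'] by (simp_all add: hom_complex_def)
  have "S.beval (Suc m) (hom_diff S.bar_mod S.bd m F) = S.beval (Suc m) \<zero>\<^bsub>?H (Suc m)\<^esub>"
   using S.beval_diff[OF M F(1)] f F(2) lin_zero[OF cplx_vsp[OF HC] cplx_vsp[OF BC] S.beval_lin[OF M]]
   by (simp add: cocycles_def)
  then show ?thesis using S.beval_bij[OF M, of "Suc m"] z F' by (auto simp: cocycles_def bij_betw_def inj_on_def)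
 qed
 note D = S.pull_difference[OF S.resolution_bar S.projective_bar S.resolution_bar chain_map_em chain_map_id M this]
 have pc: "pull S.bar_mod em m F \<in> carrier (?H m)" "pull S.bar_mod (\<lambda>n x. x) m F \<in> carrier (?H m)"
  unfolding pull_def using bimod_homI[OF S.bimodule_bar bhom_comp[OF bhom_em bF]] bimod_homI[OF S.bimodule_bar bF]
  by (simp_all add: hom_complex_def)
 have "S.beval m (pull S.bar_mod em m F) = E M m f"
  using S.bar_cochainsD(4)[OF E_cochain[OF M fc]] F(2)
  by (intro extensionalityI[of _ "bar_args S m"])
   (auto simp: S.beval_def pull_def S.carrier_bar S.ub_closed bhom_em_E[OF M bF])
 moreover have "S.beval m (pull S.bar_mod (\<lambda>n x. x) m F) = f"
  unfolding F(2)[symmetric] by (auto simp: S.beval_def pull_def S.carrier_bar S.ub_closed intro!: restrict_ext)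
 ultimately have "S.beval m (pull S.bar_mod em m F \<ominus>\<^bsub>?H m\<^esub> pull S.bar_mod (\<lambda>n x. x) m F) = E M m f \<ominus>\<^bsub>bar_complex S M m\<^esub> f"
  using lin_minus[OF cplx_vsp[OF HC] cplx_vsp[OF BC] S.beval_lin[OF M] pc] by simp
 then show ?thesis using D S.beval_quasi[OF M, of m] unfolding quasi_def by metis
qed

end

lemma finsum_bimod [simp]: "finsum (bimod V l r) = finsum V"
proof -
 have eq: "carrier (bimod V l r) = carrier V" "add (bimod V l r) = add V" "zero (bimod V l r) = zero V"
  by (simp_all add: bimod_def module.defs bimodule.defs)
 show ?thesis unfolding finsum_def finprod_def by (rule ext)+ (simp add: eq del: bimod_simps)
qed

lemma truncate_regular: "module.truncate (regular S) = S"
 by (cases S) (simp add: regular_def module.defs bimodule.defs)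

section \<open>Invariant classes and the cohomology of the skew group algebra\<close>

context skew_algebra
begin

text \<open>Invariance of a class is tested on the image of a whole coset. This image is again a
  coset because \<open>ga\<close> maps the coboundaries onto themselves; the inverse of
  \<open>g\<close> supplies surjectivity.\<close>

lemma ga_coset:
 assumes M: "bimodule S M" and g: "g \<in> carrier G" and z: "z \<in> carrier (bar_complex A (resb M) m)"
 shows "ga M m g ` (coboundaries (bar_complex A (resb M)) (bar_diff A (resb M)) m +>\<^bsub>bar_complex A (resb M) m\<^esub> z) =
  coboundaries (bar_complex A (resb M)) (bar_diff A (resb M)) m +>\<^bsub>bar_complex A (resb M) m\<^esub> ga M m g z"
proof -
 let ?C = "bar_complex A (resb M)" and ?d = "bar_diff A (resb M)"
 let ?B = "coboundaries ?C ?d m"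
 note cx = A.bar_cplx[OF bimodule_resb[OF M]]
 note L = lin_ga[OF M]
 have Bc: "x \<in> carrier (?C m)" if "x \<in> ?B" for x by (rule coboundariesD[OF cx that])
 have B: "ga M m k x \<in> ?B" if x: "x \<in> ?B" and k: "k \<in> carrier G" for x k
 proof (cases m)
  case 0
  then show ?thesis using x lin_zero[OF cplx_vsp[OF cx] cplx_vsp[OF cx] L[OF k, of m]] by (simp add: coboundaries_def)
 next
  case (Suc n)
  then obtain y where y: "y \<in> bar_cochains A (resb M) n" "x = ?d n y" using x by (auto simp: coboundaries_def)
  then show ?thesis using ga_diff[OF M y(1) k] ga_cochain[OF M y(1) k] by (auto simp: Suc coboundaries_def)
 qed
 have "ga M m g ` ?B = ?B"
 proof
  show "?B \<subseteq> ga M m g ` ?B"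
  proof
   fix x assume x: "x \<in> ?B"
   have "ga M m g (ga M m (inv g) x) = ga M m \<one> x"
    using ga_comp[OF M _ g, of x m "inv g"] Bc[OF x] g by simp
   also have "\<dots> = x"
   proof (rule extensionalityI[of _ "bar_args A m"])
    fix as assume as: "as \<in> bar_args A m"
    then show "ga M m \<one> x as = x as"
     using A_cochain_closed[OF M _ as, of x] Bc[OF x] map_act_one[OF M as] bimodule.lact_one[OF M] bimodule.ract_one[OF M]
     by (simp add: ga_def S_simps(6)[symmetric])
   qed (use Bc[OF x] A.bar_cochainsD(4)[of x "resb M" m] in \<open>auto simp: ga_def\<close>)
   finally show "x \<in> ga M m g ` ?B" using B[OF x, of "inv g"] g by (metis G.inv_closed imageI)
  qed
 qed (use B g in blast)
 then have "ga M m g ` (\<lambda>x. x \<oplus>\<^bsub>?C m\<^esub> z) ` ?B = (\<lambda>x. x \<oplus>\<^bsub>?C m\<^esub> ga M m g z) ` ?B"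
  using lin_add[OF L[OF g] Bc z] by (metis (no_types, lifting) image_cong image_image)
 then show ?thesis unfolding a_r_coset_eq .
qed

theorem skew_cohomology:
 assumes M: "bimodule S M"
 shows "cohomology (bar_complex S M) (bar_diff S M) m \<cong>\<^sub>k
  (cohomology (bar_complex A (resb M)) (bar_diff A (resb M)) m)
   \<lparr>carrier := {X \<in> carrier (cohomology (bar_complex A (resb M)) (bar_diff A (resb M)) m). \<forall>g\<in>carrier G. ga M m g ` X = X}\<rparr>"
proof -
 let ?C = "bar_complex S M" and ?d = "bar_diff S M" and ?C' = "bar_complex A (resb M)" and ?d' = "bar_diff A (resb M)"
 let ?H = "cohomology ?C ?d m" and ?H' = "cohomology ?C' ?d' m"
 let ?B = "coboundaries ?C ?d m" and ?B' = "coboundaries ?C' ?d' m"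
 let ?c = "\<lambda>z. ?B +>\<^bsub>?C m\<^esub> z" and ?c' = "\<lambda>z. ?B' +>\<^bsub>?C' m\<^esub> z"
 note cx = S.bar_cplx[OF M] and cx' = A.bar_cplx[OF bimodule_resb[OF M]]
 note v = cplx_vsp[OF cx, of m] and v' = cplx_vsp[OF cx', of m]
 note sB' = subsp_coboundaries[OF cx', of m]
 have res: "lin (?C n) (?C' n) (res n)" for n
  using res_cochain[OF M] map_e_args[OF M] by (intro linI) (auto, auto simp: res_def intro!: restrict_ext)
 have dr: "res (Suc n) (?d n f) = ?d' n (res n f)" if "f \<in> carrier (?C n)" for n f
  using res_diff[OF M] that by simp
 have rB: "res m z \<in> ?B'" if "z \<in> ?B" for z
  using that lin_zero[OF cplx_vsp[OF cx] cplx_vsp[OF cx'] res] lin_closed[OF res] dr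
  by (cases m) (auto simp: coboundaries_def simp del: A.bar_complex_simps S.bar_complex_simps)
 have rZ: "res m z \<in> cocycles ?C' ?d' m" if "z \<in> cocycles ?C ?d m" for z
  using that lin_zero[OF cplx_vsp[OF cx] cplx_vsp[OF cx'] res] lin_closed[OF res] dr[symmetric]
  by (auto simp: cocycles_def simp del: A.bar_complex_simps S.bar_complex_simps)
 define L where "L = cohomology_map ?C ?d ?C' ?d' m (res m)"
 have L: "L (?c z) = ?c' (res m z)" if "z \<in> cocycles ?C ?d m" for z
  unfolding L_def by (rule cohomology_map_eq[OF cx cx' res rB that])
 have Hc: "carrier ?H = ?c ` cocycles ?C ?d m" by (rule cohomology_carrier[OF cx])
 have Hc': "carrier ?H' = ?c' ` cocycles ?C' ?d' m" by (rule cohomology_carrier[OF cx'])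
 have linL: "lin ?H ?H' L"
 proof (rule linI)
  fix X assume "X \<in> carrier ?H"
  then obtain z where z: "z \<in> cocycles ?C ?d m" "X = ?c z" unfolding Hc by blast
  note zc = cocyclesD[OF z(1)]
  show "L X \<in> carrier ?H'" using rZ[OF z(1)] unfolding Hc' z L[OF z(1)] by blast
  have cz: "a \<odot>\<^bsub>?C m\<^esub> z \<in> cocycles ?C ?d m" for a using subsp_cocycles[OF cx, of m] z(1) by (simp add: subsp_def)
  show "L (a \<odot>\<^bsub>?H\<^esub> X) = a \<odot>\<^bsub>?H'\<^esub> L X" for a
   unfolding z cohomology_smult[OF cx z(1)] L[OF z(1)] L[OF cz] cohomology_smult[OF cx' rZ[OF z(1)]] lin_smult[OF res zc] ..
  fix Y assume "Y \<in> carrier ?H"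
  then obtain y where y: "y \<in> cocycles ?C ?d m" "Y = ?c y" unfolding Hc by blast
  have zy: "z \<oplus>\<^bsub>?C m\<^esub> y \<in> cocycles ?C ?d m" using subsp_cocycles[OF cx, of m] z(1) y(1) by (simp add: subsp_def)
  show "L (X \<oplus>\<^bsub>?H\<^esub> Y) = L X \<oplus>\<^bsub>?H'\<^esub> L Y"
   unfolding z y cohomology_add[OF cx z(1) y(1)] L[OF z(1)] L[OF y(1)] L[OF zy] cohomology_add[OF cx' rZ[OF z(1)] rZ[OF y(1)]]
    lin_add[OF res zc cocyclesD[OF y(1)]] ..
 qed
 \<comment> \<open>Injectivity: if the restriction of \<open>z\<close> is the coboundary of
   \<open>w\<close>, then \<open>E M m z\<close> is the coboundary of the extension of the averaged
   \<open>w\<close>, and \<open>z\<close> differs from it by a coboundary. In degree 0 the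
   restriction itself is zero.\<close>
 have z0: "z \<in> ?B" if z: "z \<in> cocycles ?C ?d m" and r: "res m z \<in> ?B'" for z
 proof -
  note zc = cocyclesD[OF z] note zb = zc[simplified]
  have "E M m z \<in> ?B"
  proof (cases m)
   case 0
   have r0: "res m z = \<zero>\<^bsub>?C' m\<^esub>" using r by (simp add: 0 coboundaries_def)
   have "avg M m (res m z) = \<zero>\<^bsub>?C' m\<^esub>"
    unfolding r0 by (rule avg_fixed[OF M]) (use lin_zero[OF v' v' lin_ga[OF M]] vs_zero[OF v'] in auto)
   then have "E M m z = \<zero>\<^bsub>?C m\<^esub>"
    using E_hs[OF M zb] tw_args[OF _ _ _ G.one_closed] vs_zero[OF v] lin_zero[OF bim_vsp[OF M] bim_vsp[OF M] lin_ract[OF M]] hs_args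
    by (intro hs_cochain_eqI[OF M E_cochain[OF M zb]]) auto
   then show ?thesis by (simp add: 0 coboundaries_def)
  next
   case (Suc n)
   then obtain w where w: "w \<in> carrier (?C' n)" "res m z = ?d' n w" using r by (auto simp: coboundaries_def)
   note wa = avg_closed[OF M w(1), simplified] ga_avg[OF M w(1)]
   have "avg M m (res m z) = ?d' n (avg M n w)" using avg_diff[OF M w(1)] by (simp only: w(2) Suc[symmetric])
   then have "E M m z = ?d n (Psi M n (avg M n w))"
    by (simp only: E_def Psi_diff[OF M wa] Suc[symmetric])
   then show ?thesis using Psi_cochain[OF M wa] by (auto simp: Suc coboundaries_def)
  qed
  from subsp_minus[OF v subsp_coboundaries[OF cx] this E_homotopic[OF M z]]
  have "E M m z \<ominus>\<^bsub>?C m\<^esub> (E M m z \<ominus>\<^bsub>?C m\<^esub> z) \<in> ?B" .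
  moreover have "E M m z \<ominus>\<^bsub>?C m\<^esub> (E M m z \<ominus>\<^bsub>?C m\<^esub> z) = z"
   using vs_eq_minus_iff[OF v, of "E M m z" "E M m z \<ominus>\<^bsub>?C m\<^esub> z" z] zc E_cochain[OF M zb] vs_minus[OF v]
    vs_minus_add_cancel(2)[OF v, of "E M m z" z] vs_comm[OF v] by simp
  ultimately show ?thesis by simp
 qed
 have inj: "inj_on L (carrier ?H)"
 proof (rule inj_onI)
  fix X Y assume "X \<in> carrier ?H" "Y \<in> carrier ?H" and eq: "L X = L Y"
  then obtain z y where z: "z \<in> cocycles ?C ?d m" "X = ?c z" and y: "y \<in> cocycles ?C ?d m" "Y = ?c y" unfolding Hc by blast
  have "res m z \<ominus>\<^bsub>?C' m\<^esub> res m y \<in> ?B'"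
   using eq unfolding z y L[OF z(1)] L[OF y(1)] cohomology_eq_iff[OF cx' rZ[OF z(1)] rZ[OF y(1)]] .
  then have "res m (z \<ominus>\<^bsub>?C m\<^esub> y) \<in> ?B'" by (simp only: lin_minus[OF v v' res cocyclesD[OF z(1)] cocyclesD[OF y(1)]])
  then have "z \<ominus>\<^bsub>?C m\<^esub> y \<in> ?B" by (rule z0[OF subsp_minus[OF v subsp_cocycles[OF cx] z(1) y(1)]])
  then show "X = Y" unfolding z y cohomology_eq_iff[OF cx z(1) y(1)] .
 qed
 \<comment> \<open>Up to coboundaries \<open>z\<close> may be replaced by \<open>E M m z\<close>,
   whose restriction is an average and so is invariant as a cochain.\<close>
 have inv: "ga M m g ` L X = L X" if X: "X \<in> carrier ?H" and g: "g \<in> carrier G" for X g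
 proof -
  obtain z where z: "z \<in> cocycles ?C ?d m" "X = ?c z" using X unfolding Hc by blast
  note zb = cocyclesD[OF z(1), simplified]
  have h: "avg M m (res m z) \<in> carrier (?C' m)" using avg_res[OF M zb] by simp
  have "E M m z \<ominus>\<^bsub>?C m\<^esub> z \<in> ?B" by (rule E_homotopic[OF M z(1)])
  then have "res m (E M m z \<ominus>\<^bsub>?C m\<^esub> z) \<in> ?B'" by (rule rB)
  moreover have "E M m z \<in> carrier (?C m)" using E_cochain[OF M zb] by simp
  ultimately have "res m (E M m z) \<ominus>\<^bsub>?C' m\<^esub> res m z \<in> ?B'"
   by (simp only: lin_minus[OF v v' res _ cocyclesD[OF z(1)]])
  then have "?c' (res m (E M m z)) = ?c' (res m z)"
   using coset_eq_iff[OF v' sB'] lin_closed[OF res] E_cochain[OF M zb] cocyclesD[OF z(1)] by simp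
  also have "res m (E M m z) = avg M m (res m z)"
   unfolding E_def by (rule res_Psi[OF M avg_res[OF M zb] ga_avg_res[OF M zb]])
  finally have "L X = ?c' (avg M m (res m z))" using L[OF z(1)] z(2) by simp
  then show ?thesis using ga_coset[OF M g h] ga_avg_res[OF M zb g] by simp
 qed
 \<comment> \<open>An invariant class comes with a representative \<open>h\<close> that need not be
   invariant. Each \<open>ga M m g h\<close> differs from \<open>h\<close> by a coboundary, hence so
   does the average, which is invariant and extends to \<open>S\<close>.\<close>
 have surj: "X \<in> L ` carrier ?H" if X: "X \<in> carrier ?H'" and inv: "\<And>g. g \<in> carrier G ==> ga M m g ` X = X" for X
 proof -
  obtain h where h: "h \<in> cocycles ?C' ?d' m" "X = ?c' h" using X unfolding Hc' by blast
  note hc = cocyclesD[OF h(1)]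
  note a = avg_closed[OF M hc] and gs = ga_sum_closed[OF M hc]
  have D: "ga M m g h \<ominus>\<^bsub>?C' m\<^esub> h \<in> ?B'" if g: "g \<in> carrier G" for g
  proof -
   have "?c' (ga M m g h) = ?c' h" using inv[OF g] ga_coset[OF M g hc] h(2) by simp
   then show ?thesis using coset_eq_iff[OF v' sB' _ hc, of "ga M m g h"] gs g by (auto simp: Pi_iff)
  qed
  let ?s = "inverse (of_nat (card (carrier G))) :: 'k"
  let ?D = "\<Oplus>\<^bsub>?C' m\<^esub>g\<in>carrier G. ga M m g h \<ominus>\<^bsub>?C' m\<^esub> h"
  have DB: "?D \<in> ?B'" by (rule subsp_finsum[OF v' sB']) (use D in auto)
  have "(\<Oplus>\<^bsub>?C' m\<^esub>g\<in>carrier G. ga M m g h) = (\<Oplus>\<^bsub>?C' m\<^esub>g\<in>carrier G. (ga M m g h \<ominus>\<^bsub>?C' m\<^esub> h) \<oplus>\<^bsub>?C' m\<^esub> 1 \<odot>\<^bsub>?C' m\<^esub> h)"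
   using gs hc vs_smult_one[OF v' hc] vs_minus[OF v'] vs_minus_add_cancel(1)[OF v'] by (intro vs_finsum_cong[OF v']) (auto simp: Pi_iff simp del: A.bar_complex_simps)
  also have "\<dots> = ?D \<oplus>\<^bsub>?C' m\<^esub> (\<Oplus>\<^bsub>?C' m\<^esub>g\<in>carrier G. 1 \<odot>\<^bsub>?C' m\<^esub> h)"
   using gs hc vs_minus[OF v'] vs_smult[OF v'] by (intro vs_finsum_add[OF v']) (auto simp: Pi_iff simp del: A.bar_complex_simps)
  also have "(\<Oplus>\<^bsub>?C' m\<^esub>g\<in>carrier G. 1 \<odot>\<^bsub>?C' m\<^esub> h) = of_nat (card (carrier G)) \<odot>\<^bsub>?C' m\<^esub> h"
   using vs_finsum_scalars[OF v' fin hc, of "\<lambda>_. 1"] by simp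
  finally have "avg M m h = ?s \<odot>\<^bsub>?C' m\<^esub> (?D \<oplus>\<^bsub>?C' m\<^esub> of_nat (card (carrier G)) \<odot>\<^bsub>?C' m\<^esub> h)" by (simp only: avg_def)
  also have "\<dots> = ?s \<odot>\<^bsub>?C' m\<^esub> ?D \<oplus>\<^bsub>?C' m\<^esub> h"
   using vs_smult_r_distr[OF v' coboundariesD[OF cx' DB] vs_smult[OF v' hc], of ?s "of_nat (card (carrier G))"]
    vs_smult_smult[OF v' hc] vs_smult_one[OF v' hc] by (simp only: left_inverse[OF card_nonzero])
  finally have "avg M m h \<ominus>\<^bsub>?C' m\<^esub> h = ?s \<odot>\<^bsub>?C' m\<^esub> ?D"
   using vs_minus_add_cancel(3)[OF v' vs_smult[OF v' coboundariesD[OF cx' DB]] hc] by simp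
  then have "avg M m h \<ominus>\<^bsub>?C' m\<^esub> h \<in> ?B'" using sB' DB by (simp add: subsp_def)
  then have eq: "?c' (avg M m h) = ?c' h" using coset_eq_iff[OF v' sB' a hc] by simp
  note a' = a[simplified] ga_avg[OF M hc]
  have z: "\<zero>\<^bsub>?C' (Suc m)\<^esub> \<in> bar_cochains A (resb M) (Suc m)" using vs_zero[OF cplx_vsp[OF cx'], of "Suc m"] by simp
  have zg: "ga M (Suc m) g \<zero>\<^bsub>?C' (Suc m)\<^esub> = \<zero>\<^bsub>?C' (Suc m)\<^esub>" if "g \<in> carrier G" for g
   by (rule lin_zero[OF cplx_vsp[OF cx'] cplx_vsp[OF cx'] lin_ga[OF M that]])
  have "?d' m (avg M m h) = avg M (Suc m) \<zero>\<^bsub>?C' (Suc m)\<^esub>"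
   using avg_diff[OF M hc] h(1) by (simp add: cocycles_def)
  also have "\<dots> = \<zero>\<^bsub>?C' (Suc m)\<^esub>" using avg_fixed[OF M _ zg] z by simp
  finally have "?d m (Psi M m (avg M m h)) = Psi M (Suc m) \<zero>\<^bsub>?C' (Suc m)\<^esub>" by (simp only: Psi_diff[OF M a'])
  also have "\<dots> = \<zero>\<^bsub>?C (Suc m)\<^esub>"
   using Psi_hs[OF M z zg] tw_args[OF _ _ _ G.one_closed] vs_zero[OF cplx_vsp[OF cx], of "Suc m"]
    lin_zero[OF bim_vsp[OF M] bim_vsp[OF M] lin_ract[OF M]] hs_args
   by (intro hs_cochain_eqI[OF M Psi_cochain[OF M z zg]]) auto
  finally have P: "Psi M m (avg M m h) \<in> cocycles ?C ?d m" using Psi_cochain[OF M a'] by (simp add: cocycles_def)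
  have "res m (Psi M m (avg M m h)) = avg M m h" by (rule res_Psi[OF M a'])
  then have "X = L (?c (Psi M m (avg M m h)))" by (simp only: L[OF P] eq h(2))
  then show ?thesis using P unfolding Hc by blast
 qed
 show ?thesis
 proof (rule isomorphicI[OF vsp_cohomology[OF cx]])
  show "lin ?H (?H'\<lparr>carrier := {X \<in> carrier ?H'. \<forall>g\<in>carrier G. ga M m g ` X = X}\<rparr>) L"
   using linL inv by (auto simp: lin_def Pi_iff)
  show "bij_betw L (carrier ?H) (carrier (?H'\<lparr>carrier := {X \<in> carrier ?H'. \<forall>g\<in>carrier G. ga M m g ` X = X}\<rparr>))"
   using inj inv surj lin_closed[OF linL] by (auto simp: bij_betw_def)
 qed
qed

lemma skew_bimod_eq: "skew_bimod G A act = bimod S (\<lambda>a \<phi>. \<lambda>g\<in>carrier G. a \<otimes>\<^bsub>A\<^esub> \<phi> g) (\<lambda>\<phi> a. \<lambda>g\<in>carrier G. \<phi> g \<otimes>\<^bsub>A\<^esub> act g a)"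
 by (simp add: skew_bimod_def bimod_def)

lemma resb_regular: "resb (regular S) = bimod S (\<lambda>a \<phi>. e a \<otimes>\<^bsub>S\<^esub> \<phi>) (\<lambda>\<phi> a. \<phi> \<otimes>\<^bsub>S\<^esub> e a)"
proof -
 have "lact (regular S) = mult S" "ract (regular S) = mult S"
  by (simp_all add: regular_def module.defs bimodule.defs)
 then show ?thesis by (simp only: resb_def truncate_regular)
qed

lemma
 assumes a: "a \<in> carrier A" and \<phi>: "\<phi> \<in> carrier S"
 shows e_mult: "e a \<otimes>\<^bsub>S\<^esub> \<phi> = (\<lambda>g\<in>carrier G. a \<otimes>\<^bsub>A\<^esub> \<phi> g)"
  and mult_e: "\<phi> \<otimes>\<^bsub>S\<^esub> e a = (\<lambda>g\<in>carrier G. \<phi> g \<otimes>\<^bsub>A\<^esub> act g a)"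
proof -
 have "(\<Oplus>\<^bsub>A\<^esub>h\<in>carrier G. e a h \<otimes>\<^bsub>A\<^esub> act h (\<phi> (inv h \<otimes> k))) = a \<otimes>\<^bsub>A\<^esub> \<phi> k" if k: "k \<in> carrier G" for k
  using vs_finsum_single[OF A.vs fin G.one_closed, of "\<lambda>h. e a h \<otimes>\<^bsub>A\<^esub> act h (\<phi> (inv h \<otimes> k))"] a \<phi> k
  by (simp add: hash_at act_id)
 then show "e a \<otimes>\<^bsub>S\<^esub> \<phi> = (\<lambda>g\<in>carrier G. a \<otimes>\<^bsub>A\<^esub> \<phi> g)" unfolding S_simps(5) by (intro restrict_ext)
 have "(\<Oplus>\<^bsub>A\<^esub>h\<in>carrier G. \<phi> h \<otimes>\<^bsub>A\<^esub> act h (e a (inv h \<otimes> k))) = \<phi> k \<otimes>\<^bsub>A\<^esub> act k a" if k: "k \<in> carrier G" for k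
  using vs_finsum_single[OF A.vs fin k, of "\<lambda>h. \<phi> h \<otimes>\<^bsub>A\<^esub> act h (e a (inv h \<otimes> k))"] a \<phi> k
  by (auto simp: hash_at inv_mult_eq act_zero)
 then show "\<phi> \<otimes>\<^bsub>S\<^esub> e a = (\<lambda>g\<in>carrier G. \<phi> g \<otimes>\<^bsub>A\<^esub> act g a)" unfolding S_simps(5) by (intro restrict_ext)
qed

lemma bimodule_skew_bimod: "bimodule A (skew_bimod G A act)"
proof -
 interpret bimodule A "resb (regular S)" by (rule bimodule_resb[OF S.bimodule_regular])
 note r = resb_regular
 show ?thesis
  unfolding skew_bimod_eq
  using lact_closed ract_closed lact_add ract_add add_lact add_ract lact_mult ract_mult lact_one ract_one lact_ract
   smult_lact lact_smult smult_ract ract_smult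
  by (intro bimodule.intro bimodule_axioms.intro vsp_bimod vsp_S)
   (simp_all add: r e_mult[symmetric] mult_e[symmetric] vs_add[OF vsp_S] vs_smult[OF vsp_S] vs_smult[OF A.vs])
qed

text \<open>\<open>skew_bimod\<close> is the regular bimodule of \<open>S\<close> restricted to
  \<open>A\<close>. The actions of the two records are compared on carriers, which is all that
  cochains see, so the complexes are equal and not just isomorphic.\<close>

lemma bar_skew_bimod:
 "bar_complex A (resb (regular S)) = bar_complex A (skew_bimod G A act)"
 "bar_diff A (resb (regular S)) = bar_diff A (skew_bimod G A act)"
proof -
 have "f \<in> bar_cochains A (resb (regular S)) m \<longleftrightarrow> f \<in> bar_cochains A (skew_bimod G A act) m" for f m
 proof -
  have "mlin A (m + 2) (resb (regular S)) f = mlin A (m + 2) S f" "mlin A (m + 2) (skew_bimod G A act) f = mlin A (m + 2) S f"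
   unfolding resb_regular skew_bimod_eq by (simp_all add: mlin_def)
  then show ?thesis
   using mlin_closed[of A m S f] unfolding bar_cochains_iff[OF A.vs]
   by (auto simp: resb_regular skew_bimod_eq e_mult mult_e)
 qed
 then have "bar_cochains A (resb (regular S)) m = bar_cochains A (skew_bimod G A act) m" for m by blast
 then show "bar_complex A (resb (regular S)) = bar_complex A (skew_bimod G A act)"
  by (simp add: bar_complex_def pointwise_def resb_regular skew_bimod_eq fun_eq_iff)
 show "bar_diff A (resb (regular S)) = bar_diff A (skew_bimod G A act)"
  by (simp add: bar_diff_def resb_regular skew_bimod_eq fun_eq_iff)
qed

lemma ga_regular: "ga (regular S) m g = bar_action G A act g m"
 by (simp add: ga_def bar_action_def fun_eq_iff)

text \<open>\<open>HH_invariants\<close> is by definition the preimage under \<open>to_bar\<close>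
  of the invariant classes of bar cochains, so the isomorphism of \<open>skew_cohomology\<close> is
  carried back through the inverse of \<open>to_bar\<close>.\<close>

theorem HH_skew:
 assumes P: "projective_resolution A P d \<epsilon>" and Q: "projective_resolution S Q d' \<epsilon>'"
  and iso: "lin_iso (HH A P d (skew_bimod G A act) m)
   (cohomology (bar_complex A (skew_bimod G A act)) (bar_diff A (skew_bimod G A act)) m) (to_bar A P d \<psi> (skew_bimod G A act) m)"
 shows "HH S Q d' (regular S) m \<cong>\<^sub>k HH_invariants G A act P d \<psi> m"
proof -
 let ?M = "skew_bimod G A act"
 let ?T = "to_bar A P d \<psi> ?M m" and ?V = "HH A P d ?M m" and ?W = "cohomology (bar_complex A ?M) (bar_diff A ?M) m"
 let ?I = "{X \<in> carrier ?W. \<forall>g\<in>carrier G. bar_action G A act g m ` X = X}"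
 have vV: "vsp ?V" unfolding HH_def by (rule vsp_cohomology[OF hom_cplx[OF projective_resolutionD(1)[OF P] bimodule_skew_bimod]])
 have T: "lin ?V ?W ?T" "bij_betw ?T (carrier ?V) (carrier ?W)" using iso lin_hom_lin by (auto simp: lin_iso_def)
 note inv = lin_inv[OF vV T] and bij = bij_betw_inv_into[OF T(2)]
 let ?U = "inv_into (carrier ?V) ?T"
 have TU: "?T (?U X) = X" "?U X \<in> carrier ?V" if "X \<in> carrier ?W" for X
  using that T(2) by (auto simp: bij_betw_def f_inv_into_f inv_into_into)
 have UT: "?U (?T Y) = Y" "?T Y \<in> carrier ?W" if "Y \<in> carrier ?V" for Y
  using that T(2) by (auto simp: bij_betw_def)
 obtain \<chi> where \<chi>: "\<forall>M :: ('k, 'g => 'a, 'g => 'a) bimodule. bimodule S M -->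
   (\<forall>m. lin_iso (HH S Q d' M m) (cohomology (bar_complex S M) (bar_diff S M) m) (to_bar S Q d' \<chi> M m))"
  using S.bar_comparison_iso[OF Q] by (elim exE conjE) (rule that)
 let ?H = "cohomology (bar_complex S (regular S)) (bar_diff S (regular S)) m"
 have vH: "vsp ?H" by (rule vsp_cohomology[OF S.bar_cplx[OF S.bimodule_regular]])
 have "?H \<cong>\<^sub>k ?W\<lparr>carrier := ?I\<rparr>"
  using skew_cohomology[OF S.bimodule_regular] unfolding bar_skew_bimod ga_regular .
 then obtain f where f: "lin ?H (?W\<lparr>carrier := ?I\<rparr>) f" "bij_betw f (carrier ?H) ?I"
  by (rule isomorphicE) auto
 have fI: "f x \<in> ?I" if "x \<in> carrier ?H" for x using f(2) that by (auto simp: bij_betw_def)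
 have fU: "lin ?H ?W f" using f(1) by (auto simp: lin_def Pi_iff)
 have "?H \<cong>\<^sub>k HH_invariants G A act P d \<psi> m"
 proof (rule isomorphicI[OF vH])
  show "lin ?H (HH_invariants G A act P d \<psi> m) (\<lambda>x. ?U (f x))"
   using lin_comp[OF fU inv] fI TU by (auto simp: lin_def Pi_iff HH_invariants_def)
  have "bij_betw ?U ?I (carrier (HH_invariants G A act P d \<psi> m))"
  proof (rule bij_betw_imageI)
   show "inj_on ?U ?I" using bij by (auto simp: bij_betw_def inj_on_def)
   show "?U ` ?I = carrier (HH_invariants G A act P d \<psi> m)"
   proof
    show "carrier (HH_invariants G A act P d \<psi> m) \<subseteq> ?U ` ?I"
    proof
     fix Y assume "Y \<in> carrier (HH_invariants G A act P d \<psi> m)"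
     then have Y: "Y \<in> carrier ?V" "?T Y \<in> ?I" using UT by (auto simp: HH_invariants_def)
     show "Y \<in> ?U ` ?I" using UT(1)[OF Y(1), symmetric] Y(2) by (rule image_eqI)
    qed
    show "?U ` ?I \<subseteq> carrier (HH_invariants G A act P d \<psi> m)"
    proof (rule image_subsetI)
     fix X assume X: "X \<in> ?I"
     then have "?T (?U X) = X" "?U X \<in> carrier ?V" using TU by blast+
     then show "?U X \<in> carrier (HH_invariants G A act P d \<psi> m)" using X by (simp add: HH_invariants_def)
    qed
   qed
  qed
  then show "bij_betw (\<lambda>x. ?U (f x)) (carrier ?H) (carrier (HH_invariants G A act P d \<psi> m))"
   using bij_betw_trans[OF f(2)] by (simp add: comp_def)
 qed
 moreover have "HH S Q d' (regular S) m \<cong>\<^sub>k ?H"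
  unfolding isomorphic_def by (rule exI) (rule \<chi>[rule_format, OF S.bimodule_regular])
 moreover have "vsp (HH S Q d' (regular S) m)"
  unfolding HH_def by (rule vsp_cohomology[OF hom_cplx[OF projective_resolutionD(1)[OF Q] S.bimodule_regular]])
 ultimately show ?thesis using isomorphic_trans by blast
qed

end

section \<open>Direct sums of lines\<close>

lemma is_basis_iso_fsm:
 assumes V: "vsp V" and B: "is_basis V J b"
 shows "V \<cong>\<^sub>k fsm J"
proof -
 have b: "b \<in> J \<rightarrow> carrier V" using B by (auto simp: is_basis_def)
 note L = lin_lext[OF V b] and bij = B[unfolded is_basis_iff[OF V b]]
 show ?thesis by (rule isomorphicI[OF V lin_inv[OF vsp_fsm L bij] bij_betw_inv_into[OF bij]])
qed

lemma vsp_line: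
 assumes W: "vsp W" and w: "w \<in> carrier W"
 shows "vsp (line W w)"
 by (rule vsp_image[OF W, of "{c \<odot>\<^bsub>W\<^esub> w | c. True}" _ "\<lambda>x. x"])
  (use W w vs_smult_zero[OF W w] vs_smult_l_distr[OF W w, symmetric] vs_smult_smult[OF W w] in \<open>auto simp: line_def, metis\<close>)

text \<open>It suffices that each \<open>w a\<close> is nonzero, so that its line is
  one-dimensional; independence is built into the external direct sum. The lines may therefore be
  taken in the cochain space.\<close>

lemma fsm_iso_lines:
 assumes W: "vsp W" and w: "\<And>a. a \<in> K ==> w a \<in> carrier W" "\<And>a. a \<in> K ==> w a \<noteq> \<zero>\<^bsub>W\<^esub>"
 shows "fsm K \<cong>\<^sub>k direct_sum K (\<lambda>a. line W (w a))"
proof (rule isomorphicI[OF vsp_fsm])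
 let ?D = "direct_sum K (\<lambda>a. line W (w a))"
 define F where "F f = (\<lambda>a\<in>K. f a \<odot>\<^bsub>W\<^esub> w a)" for f
 have z: "c \<odot>\<^bsub>W\<^esub> w a = \<zero>\<^bsub>W\<^esub> \<longleftrightarrow> c = 0" if "a \<in> K" for a c
 proof
  assume "c \<odot>\<^bsub>W\<^esub> w a = \<zero>\<^bsub>W\<^esub>"
  then have "(inverse c * c) \<odot>\<^bsub>W\<^esub> w a = \<zero>\<^bsub>W\<^esub>" using vs_smult_smult[OF W w(1)[OF that], of "inverse c" c] W by simp
  then show "c = 0" using w[OF that] vs_smult_one[OF W w(1)[OF that]] by (cases "c = 0") auto
 qed (use W w that in simp)
 have Dc: "f \<in> carrier ?D \<longleftrightarrow> f \<in> extensional K \<and> (\<forall>a\<in>K. \<exists>c. f a = c \<odot>\<^bsub>W\<^esub> w a) \<and> finite {a \<in> K. f a \<noteq> \<zero>\<^bsub>W\<^esub>}" for f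
  by (auto simp: direct_sum_def pointwise_def line_def PiE_def)
 have F: "F f \<in> carrier ?D" if f: "f \<in> FS K" for f
 proof -
  have "{a \<in> K. F f a \<noteq> \<zero>\<^bsub>W\<^esub>} = {a \<in> K. f a \<noteq> 0}" using z by (auto simp: F_def)
  then show ?thesis using fsmD(1)[OF f] unfolding Dc by (auto simp: F_def)
 qed
 show "lin (fsm K) ?D F"
  by (rule linI) (auto simp: F, auto simp: F_def direct_sum_def line_def vs_smult_l_distr[OF W w(1)] vs_smult_smult[OF W w(1)] intro!: restrict_ext)
 show "bij_betw F (FS K) (carrier ?D)"
 proof (rule bij_betw_imageI)
  show "inj_on F (FS K)"
  proof (rule inj_onI)
   fix f g assume f: "f \<in> FS K" and g: "g \<in> FS K" and eq: "F f = F g"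
   show "f = g"
   proof
    fix a show "f a = g a"
    proof (cases "a \<in> K")
     case True
     have "(f a - g a) \<odot>\<^bsub>W\<^esub> w a \<oplus>\<^bsub>W\<^esub> g a \<odot>\<^bsub>W\<^esub> w a = \<zero>\<^bsub>W\<^esub> \<oplus>\<^bsub>W\<^esub> g a \<odot>\<^bsub>W\<^esub> w a"
      using fun_cong[OF eq, of a] True W w(1)[OF True] vs_smult_l_distr[OF W w(1)[OF True], symmetric] by (simp add: F_def)
     then have "(f a - g a) \<odot>\<^bsub>W\<^esub> w a = \<zero>\<^bsub>W\<^esub>"
      using vs_cancel[OF W, of "g a \<odot>\<^bsub>W\<^esub> w a" "(f a - g a) \<odot>\<^bsub>W\<^esub> w a" "\<zero>\<^bsub>W\<^esub>"] W w(1)[OF True] by (simp add: vs_comm[OF W])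
     then show ?thesis using z[OF True] by simp
    next
     case False
     then show ?thesis using fsmD(2)[OF f, of a] fsmD(2)[OF g, of a] by (cases "f a = 0"; cases "g a = 0") auto
    qed
   qed
  qed
  show "F ` FS K = carrier ?D"
  proof
   show "carrier ?D \<subseteq> F ` FS K"
   proof
    fix f assume f: "f \<in> carrier ?D"
    then obtain c where c: "\<forall>a\<in>K. f a = c a \<odot>\<^bsub>W\<^esub> w a" unfolding Dc using bchoice[of K "\<lambda>a c. f a = c \<odot>\<^bsub>W\<^esub> w a"] by blast
    define c' where "c' a = (if a \<in> K then c a else 0)" for a
    have "{a. c' a \<noteq> 0} = {a \<in> K. f a \<noteq> \<zero>\<^bsub>W\<^esub>}" using c z by (auto simp: c'_def)
    then have "c' \<in> FS K" using f unfolding Dc carrier_fsm by simp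
    moreover have "f = F c'" using f c unfolding Dc by (intro extensionalityI[of f K]) (auto simp: F_def c'_def)
    ultimately show "f \<in> F ` FS K" by blast
   qed
  qed (use F in blast)
 qed
qed

text \<open>Currying: finite support on pairs means finitely many nonzero rows, each of finite
  support.\<close>

lemma fsm_Sigma_iso:
 "(fsm (SIGMA i:I. K i) :: ('k::field, 'i \<times> 'b => 'k) module) \<cong>\<^sub>k direct_sum I (\<lambda>i. fsm (K i))"
proof (rule isomorphicI[OF vsp_fsm])
 let ?D = "direct_sum I (\<lambda>i. fsm (K i)) :: ('k, 'i => 'b => 'k) module"
 define F where "F f = (\<lambda>i\<in>I. \<lambda>k. f (i, k))" for f :: "'i \<times> 'b => 'k"
 have Dc: "g \<in> carrier ?D \<longleftrightarrow> g \<in> extensional I \<and> (\<forall>i\<in>I. g i \<in> FS (K i)) \<and> finite {i \<in> I. g i \<noteq> (\<lambda>_. 0)}" for g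
  by (auto simp: direct_sum_def PiE_def)
 have F: "F f \<in> carrier ?D" if f: "f \<in> FS (SIGMA i:I. K i)" for f
  unfolding Dc
 proof (intro conjI ballI)
  have "{i \<in> I. F f i \<noteq> (\<lambda>_. 0)} \<subseteq> fst ` {z. f z \<noteq> 0}" by (force simp: F_def)
  then show "finite {i \<in> I. F f i \<noteq> (\<lambda>_. 0)}" using fsmD(1)[OF f] by (meson finite_imageI finite_subset)
  fix i assume i: "i \<in> I"
  show "F f i \<in> FS (K i)"
  proof (rule fsmI[of "snd ` {z. f z \<noteq> 0} \<inter> K i"])
   fix k assume "F f i k \<noteq> 0"
   then have nz: "f (i, k) \<noteq> 0" using i by (simp add: F_def)
   then have "k \<in> K i" using fsmD(2)[OF f nz] by simp
   then show "k \<in> snd ` {z. f z \<noteq> 0} \<inter> K i" using nz by (auto intro!: image_eqI[of k snd "(i, k)"])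
  qed (use fsmD(1)[OF f] in auto)
 qed (simp add: F_def)
 show "lin (fsm (SIGMA i:I. K i)) ?D F"
  by (rule linI) (auto simp: F, auto simp: F_def direct_sum_def intro!: restrict_ext)
 show "bij_betw F (FS (SIGMA i:I. K i)) (carrier ?D)"
 proof (rule bij_betw_imageI)
  show "inj_on F (FS (SIGMA i:I. K i))"
  proof (rule inj_onI)
   fix f g assume f: "f \<in> FS (SIGMA i:I. K i)" and g: "g \<in> FS (SIGMA i:I. K i)" and eq: "F f = F g"
   have "f (i, k) = g (i, k)" for i k
   proof (cases "i \<in> I")
    case True
    then show ?thesis using fun_cong[OF fun_cong[OF eq, of i], of k] by (simp add: F_def)
   next
    case False
    then show ?thesis using fsmD(2)[OF f, of "(i, k)"] fsmD(2)[OF g, of "(i, k)"]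
     by (cases "f (i, k) = 0"; cases "g (i, k) = 0") auto
   qed
   then show "f = g" by (intro ext) (simp only: split_paired_all)
  qed
  show "F ` FS (SIGMA i:I. K i) = carrier ?D"
  proof
   show "carrier ?D \<subseteq> F ` FS (SIGMA i:I. K i)"
   proof
    fix g assume g: "g \<in> carrier ?D"
    define f where "f = (\<lambda>(i, k). if i \<in> I then g i k else 0)"
    have "f \<in> FS (SIGMA i:I. K i)"
    proof (rule fsmI[of "SIGMA i:{i \<in> I. g i \<noteq> (\<lambda>_. 0)}. {k. g i k \<noteq> 0}"])
     show "finite (SIGMA i:{i \<in> I. g i \<noteq> (\<lambda>_. 0)}. {k. g i k \<noteq> 0})"
      using g unfolding Dc by (auto intro!: finite_SigmaI dest: fsmD(1))
     show "(SIGMA i:{i \<in> I. g i \<noteq> (\<lambda>_. 0)}. {k. g i k \<noteq> 0}) \<subseteq> (SIGMA i:I. K i)"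
      using g unfolding Dc by (auto dest: fsmD(2))
    qed (auto simp: f_def split: if_splits)
    moreover have "g = F f" using g unfolding Dc by (intro extensionalityI[of g I]) (auto simp: F_def f_def)
    ultimately show "g \<in> F ` FS (SIGMA i:I. K i)" by blast
   qed
  qed (use F in blast)
 qed
qed

lemma direct_sum_cong_iso:
 assumes V: "\<And>i. i \<in> I ==> vsp (V i)" and W: "\<And>i. i \<in> I ==> vsp (W i)" and iso: "\<And>i. i \<in> I ==> V i \<cong>\<^sub>k W i"
 shows "direct_sum I V \<cong>\<^sub>k direct_sum I W"
proof -
 have "\<forall>i\<in>I. \<exists>f. lin (V i) (W i) f \<and> bij_betw f (carrier (V i)) (carrier (W i))"
  using iso by (blast elim: isomorphicE)
 then obtain f where f: "\<And>i. i \<in> I ==> lin (V i) (W i) (f i) \<and> bij_betw (f i) (carrier (V i)) (carrier (W i))"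
  using bchoice[of I] by metis
 have f0: "f i x = \<zero>\<^bsub>W i\<^esub> \<longleftrightarrow> x = \<zero>\<^bsub>V i\<^esub>" if "i \<in> I" "x \<in> carrier (V i)" for i x
  using f[OF that(1)] lin_zero[OF V W] vs_zero[OF V] that by (metis bij_betw_def inj_on_def)
 define F where "F g = (\<lambda>i\<in>I. f i (g i))" for g
 have supp: "{i \<in> I. f i (g i) \<noteq> \<zero>\<^bsub>W i\<^esub>} = {i \<in> I. g i \<noteq> \<zero>\<^bsub>V i\<^esub>}" if "\<And>i. i \<in> I ==> g i \<in> carrier (V i)" for g
  using f0 that by blast
 have Vc: "g i \<in> carrier (V i)" if "g \<in> carrier (direct_sum I V)" "i \<in> I" for g i
  using that by (auto simp: direct_sum_def)
 have F: "F g \<in> carrier (direct_sum I W)" if g: "g \<in> carrier (direct_sum I V)" for g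
 proof -
  have "{i \<in> I. F g i \<noteq> \<zero>\<^bsub>W i\<^esub>} = {i \<in> I. g i \<noteq> \<zero>\<^bsub>V i\<^esub>}" using supp[OF Vc[OF g]] by (auto simp: F_def)
  moreover have "F g i \<in> carrier (W i)" if "i \<in> I" for i using f[OF that] Vc[OF g that] that by (auto simp: F_def bij_betw_def)
  ultimately show ?thesis using g by (auto simp: direct_sum_def F_def)
 qed
 have "lin (direct_sum I V) (direct_sum I W) F"
 proof (rule linI)
  fix g h assume g: "g \<in> carrier (direct_sum I V)" and h: "h \<in> carrier (direct_sum I V)"
  show "F (g \<oplus>\<^bsub>direct_sum I V\<^esub> h) = F g \<oplus>\<^bsub>direct_sum I W\<^esub> F h"
   using f Vc[OF g] Vc[OF h] by (auto simp: F_def direct_sum_def lin_add intro!: restrict_ext)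
 next
  fix c g assume g: "g \<in> carrier (direct_sum I V)"
  show "F (c \<odot>\<^bsub>direct_sum I V\<^esub> g) = c \<odot>\<^bsub>direct_sum I W\<^esub> F g"
   using f Vc[OF g] by (auto simp: F_def direct_sum_def lin_smult intro!: restrict_ext)
 qed (rule F)
 moreover have "bij_betw F (carrier (direct_sum I V)) (carrier (direct_sum I W))"
 proof (rule bij_betw_imageI)
  show "inj_on F (carrier (direct_sum I V))"
  proof (rule inj_onI)
   fix g h assume g: "g \<in> carrier (direct_sum I V)" and h: "h \<in> carrier (direct_sum I V)" and eq: "F g = F h"
   show "g = h"
   proof (rule extensionalityI[of g I])
    fix i assume i: "i \<in> I"
    have "f i (g i) = f i (h i)" using fun_cong[OF eq, of i] i by (simp add: F_def)
    then show "g i = h i" using f[OF i] Vc[OF g i] Vc[OF h i] by (auto simp: bij_betw_def inj_on_def)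
   qed (use g h in \<open>auto simp: direct_sum_def PiE_def\<close>)
  qed
  show "F ` carrier (direct_sum I V) = carrier (direct_sum I W)"
  proof
   show "carrier (direct_sum I W) \<subseteq> F ` carrier (direct_sum I V)"
   proof
    fix h assume h: "h \<in> carrier (direct_sum I W)"
    define g where "g = (\<lambda>i\<in>I. inv_into (carrier (V i)) (f i) (h i))"
    have g: "g i \<in> carrier (V i)" "f i (g i) = h i" if "i \<in> I" for i
    proof -
     have "h i \<in> f i ` carrier (V i)" using h f[OF that] that by (auto simp: direct_sum_def bij_betw_def)
     then show "g i \<in> carrier (V i)" "f i (g i) = h i" using that by (simp_all add: g_def inv_into_into f_inv_into_f)
    qed
    have "{i \<in> I. f i (g i) \<noteq> \<zero>\<^bsub>W i\<^esub>} = {i \<in> I. h i \<noteq> \<zero>\<^bsub>W i\<^esub>}" by (auto simp: g(2))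
    then have "{i \<in> I. g i \<noteq> \<zero>\<^bsub>V i\<^esub>} = {i \<in> I. h i \<noteq> \<zero>\<^bsub>W i\<^esub>}" by (simp only: supp[OF g(1)])
    then have "g \<in> carrier (direct_sum I V)" using h g by (auto simp: direct_sum_def g_def PiE_def)
    moreover have "h = F g" using h g by (intro extensionalityI[of h I]) (auto simp: F_def direct_sum_def PiE_def)
    ultimately show "h \<in> F ` carrier (direct_sum I V)" by blast
   qed
  qed (use F in blast)
 qed
 moreover have "vsp (direct_sum I V)" by (rule vsp_direct_sum) (rule V)
 ultimately show ?thesis using isomorphicI by blast
qed

lemma isomorphic_refl: "vsp V ==> V \<cong>\<^sub>k V"
 by (rule isomorphicI[OF _ lin_id]) (simp_all add: bij_betw_def)

lemma iso_lines2:
 assumes V: "V \<cong>\<^sub>k fsm (SIGMA i:I. K i)" "vsp V" and W: "vsp W"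
  and w: "\<And>i a. i \<in> I ==> a \<in> K i ==> w i a \<in> carrier W \<and> w i a \<noteq> \<zero>\<^bsub>W\<^esub>"
 shows "V \<cong>\<^sub>k direct_sum I (\<lambda>i. direct_sum (K i) (\<lambda>a. line W (w i a)))"
proof -
 have "direct_sum I (\<lambda>i. fsm (K i)) \<cong>\<^sub>k direct_sum I (\<lambda>i. direct_sum (K i) (\<lambda>a. line W (w i a)))"
  using w by (intro direct_sum_cong_iso vsp_fsm vsp_direct_sum vsp_line[OF W] fsm_iso_lines[OF W]) auto
 then show ?thesis using isomorphic_trans[OF V(2) isomorphic_trans[OF V(2) V(1) fsm_Sigma_iso]] by blast
qed

lemma iso_lines3:
 assumes V: "V \<cong>\<^sub>k fsm (SIGMA g:H. SIGMA i:I. K g i)" "vsp V" and W: "vsp W"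
  and w: "\<And>g i a. g \<in> H ==> i \<in> I ==> a \<in> K g i ==> w g i a \<in> carrier W \<and> w g i a \<noteq> \<zero>\<^bsub>W\<^esub>"
 shows "V \<cong>\<^sub>k direct_sum H (\<lambda>g. direct_sum I (\<lambda>i. direct_sum (K g i) (\<lambda>a. line W (w g i a))))"
proof -
 have "fsm (SIGMA i:I. K g i) \<cong>\<^sub>k direct_sum I (\<lambda>i. direct_sum (K g i) (\<lambda>a. line W (w g i a)))" if "g \<in> H" for g
  using w that by (intro iso_lines2[OF isomorphic_refl[OF vsp_fsm] vsp_fsm W]) auto
 then
 have "direct_sum H (\<lambda>g. fsm (SIGMA i:I. K g i)) \<cong>\<^sub>k direct_sum H (\<lambda>g. direct_sum I (\<lambda>i. direct_sum (K g i) (\<lambda>a. line W (w g i a))))"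
  using w by (intro direct_sum_cong_iso vsp_fsm vsp_direct_sum vsp_line[OF W]) auto
 then show ?thesis using isomorphic_trans[OF V(2) isomorphic_trans[OF V(2) V(1) fsm_Sigma_iso]] by blast
qed

lemma is_basis_reindex:
 fixes V :: "('k::field, 'v, 'x) module_scheme"
 assumes V: "vsp V" and B: "is_basis V (h ` J) b" and h: "inj h"
 shows "is_basis V J (\<lambda>j. b (h j))"
proof -
 have b: "b \<in> h ` J \<rightarrow> carrier V" using B by (auto simp: is_basis_def)
 note L = lin_lext[OF V b] and bij = B[unfolded is_basis_iff[OF V b]]
 define p where "p f = (\<lambda>i. if i \<in> range h then f (inv_into UNIV h i) else 0)" for f :: "_ => 'k"
 have p: "p f (h j) = f j" for f j using h by (simp add: p_def)
 have pc: "p f \<in> FS (h ` J)" if f: "f \<in> FS J" for f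
  by (rule fsmI[of "h ` {j. f j \<noteq> 0}"]) (use fsmD[OF f] h in \<open>auto simp: p_def split: if_splits\<close>)
 have lin: "lin (fsm J) (fsm (h ` J)) p" by (rule linI) (auto simp: pc, auto simp: p_def fun_eq_iff)
 show ?thesis
 proof (rule is_basisI[OF V lin_comp[OF lin L]])
  have "bij_betw p (FS J) (FS (h ` J))"
  proof (rule bij_betw_imageI)
   show "inj_on p (FS J)" using p by (metis inj_onI ext)
   show "p ` FS J = FS (h ` J)"
   proof
    show "FS (h ` J) \<subseteq> p ` FS J"
    proof
     fix f :: "_ => 'k" assume f: "f \<in> FS (h ` J)"
     have "(\<lambda>j. f (h j)) \<in> FS J"
     proof (rule fsmI[of "{j. f (h j) \<noteq> 0}"])
      show "finite {j. f (h j) \<noteq> 0}" using finite_vimageI[OF fsmD(1)[OF f] h] by (simp add: vimage_def)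
      have "j \<in> J" if "f (h j) \<noteq> 0" for j using fsmD(2)[OF f that] inj_image_mem_iff[OF h, of j J] by simp
      then show "{j. f (h j) \<noteq> 0} \<subseteq> J" by blast
     qed simp
     moreover have "f = p (\<lambda>j. f (h j))"
     proof
      fix i show "f i = p (\<lambda>j. f (h j)) i"
      proof (cases "f i = 0")
       case True then show ?thesis by (auto simp: p_def f_inv_into_f)
      next
       case False
       then have "i \<in> range h" using fsmD(2)[OF f False] by auto
       then show ?thesis by (simp add: p_def f_inv_into_f)
      qed
     qed
     ultimately show "f \<in> p ` FS J" by blast
    qed
   qed (use pc in blast)
  qed
  then show "bij_betw (\<lambda>x. lext V b (p x)) (FS J) (carrier V)"
   using bij_betw_trans[OF _ bij] by (simp add: comp_def)
  fix j assume "j \<in> J"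
  have "p (dl j) = dl (h j)" using h by (auto simp: p_def dl_def fun_eq_iff inj_eq)
  moreover have "b (h j) \<in> carrier V" using b \<open>j \<in> J\<close> by blast
  ultimately show "b (h j) = lext V b (p (dl j))" using lext_dl[OF V] by metis
 qed
qed

section \<open>Diagonal actions on quantum symmetric algebras\<close>

lemma (in based_algebra) lext_bij: "bij_betw (lext R b) (FS J) (carrier R)"
proof -
 have L: "lin (fsm J) R (lext R b)" using vs b by (intro lin_lext) auto
 have "co (lext R b f) = f" if "f \<in> FS J" for f
  by (rule lin_fsm_eqI[OF vsp_fsm lin_comp[OF L co_lin] lin_id _ that]) (simp add: vs b co_b)
 then show ?thesis
  using co_fsm lext_co lin_closed[OF L] by (intro bij_betw_byWitness[of _ co]) auto
qed

lemma bimodule_sub: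
 assumes M: "bimodule R M" and V: "vsp (M\<lparr>carrier := Z\<rparr>)" and Z: "Z \<subseteq> carrier M"
  and act: "\<And>r m. r \<in> carrier R ==> m \<in> Z ==> lact M r m \<in> Z \<and> ract M m r \<in> Z"
 shows "bimodule R (M\<lparr>carrier := Z\<rparr>)"
proof -
 interpret bimodule R M by (rule M)
 have c: "m \<in> carrier M" if "m \<in> Z" for m using that Z by blast
 show ?thesis
  by (intro bimodule.intro bimodule_axioms.intro V)
   (simp_all add: act c lact_add ract_add add_lact add_ract lact_mult ract_mult lact_one ract_one lact_ract
    smult_lact lact_smult smult_ract ract_smult)
qed

text \<open>Guarantees that the spans in the direct sums are true lines; the coordinates
  \<open>kapm\<close> separate the cochain from zero.\<close>

lemma (in diag_bimodule) ext_tensor_nonzero: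
 fixes al be :: "'n expo"
 assumes "t \<in> T" "be \<in> XE m"
 shows "ext_tensor M m (bb t al) be \<in> carrier (koszul_complex M m) \<and> ext_tensor M m (bb t al) be \<noteq> \<zero>\<^bsub>koszul_complex M m\<^esub>"
proof -
 have d: "dl (t, be, al) \<in> carrier (fsm (idx m) :: ('k, _) module)" using assms by (simp add: idx_def)
 have "(dl (t, be, al) :: _ => 'k) \<noteq> (\<lambda>_. 0)" using dl_simps(1)[of "(t, be, al)"] by (metis zero_neq_one)
 then have "kapm m (dl (t, be, al)) \<noteq> kapm m (\<lambda>_. 0)"
  using kapm_inj[OF d, of "\<lambda>_. 0"] vs_zero[OF vsp_fsm, of "idx m"] by simp
 then show ?thesis using lin_closed[OF lin_kapm d] unfolding kapm_dl[OF assms] kapm_zero by blast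
qed

locale diagonal_action = quantum0 q + skew_algebra "qsym q" UNIV "qmonom q" qco G act
 for q :: "'n::{finite,linorder} => 'n => 'k::field_char_0" and G :: "'g monoid" and act +
 fixes lam :: "'g => 'n => 'k"
 assumes diagonal: "g \<in> carrier G ==> act g (X i) = lam g i \<odot>\<^bsub>qA\<^esub> X i"
begin

abbreviation B where "B \<equiv> skew_bimod G qA act"
abbreviation Bc where "Bc \<equiv> skew_component G qA act"
abbreviation hq where "hq g al \<equiv> hsh (qmonom q al) g"

lemma B_simps [simp]:
 "carrier B = carrier S" "\<zero>\<^bsub>B\<^esub> = \<zero>\<^bsub>S\<^esub>" "x \<oplus>\<^bsub>B\<^esub> y = x \<oplus>\<^bsub>S\<^esub> y" "c \<odot>\<^bsub>B\<^esub> x = c \<odot>\<^bsub>S\<^esub> x"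
 "lact B a \<phi> = (\<lambda>g\<in>carrier G. a \<otimes>\<^bsub>qA\<^esub> \<phi> g)" "ract B \<phi> a = (\<lambda>g\<in>carrier G. \<phi> g \<otimes>\<^bsub>qA\<^esub> act g a)"
 by (simp_all add: skew_bimod_eq)

lemma lact_hash: "a \<in> carrier qA ==> c \<in> carrier qA ==> (\<lambda>h\<in>carrier G. a \<otimes>\<^bsub>qA\<^esub> hsh c g h) = hsh (a \<otimes>\<^bsub>qA\<^esub> c) g"
 and ract_hash: "g \<in> carrier G ==> a \<in> carrier qA ==> c \<in> carrier qA ==>
  (\<lambda>h\<in>carrier G. hsh c g h \<otimes>\<^bsub>qA\<^esub> act h a) = hsh (c \<otimes>\<^bsub>qA\<^esub> act g a) g"
 by (auto simp: hash_def intro!: restrict_ext)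

lemma hash_smult: "g \<in> carrier G ==> a \<in> carrier qA ==> hsh (c \<odot>\<^bsub>qA\<^esub> a) g = c \<odot>\<^bsub>S\<^esub> hsh a g"
 by (rule lin_smult[OF lin_hash])

text \<open>The diagonal hypothesis enters here. Left and right multiplication by \<open>x_i\<close>
  lead to the same monomial, with the arguments of \<open>sig\<close> exchanged and the factor
  \<open>lam g i\<close> on the right.\<close>

lemma acts_monomial:
 assumes g: "g \<in> carrier G"
 shows "(\<lambda>h\<in>carrier G. X i \<otimes>\<^bsub>qA\<^esub> hq g al h) = sig q (unitv i) al \<odot>\<^bsub>S\<^esub> hq g (plusv al (unitv i))"
  and "(\<lambda>h\<in>carrier G. hq g al h \<otimes>\<^bsub>qA\<^esub> act h (X i)) = (lam g i * sig q al (unitv i)) \<odot>\<^bsub>S\<^esub> hq g (plusv al (unitv i))"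
proof -
 show "(\<lambda>h\<in>carrier G. X i \<otimes>\<^bsub>qA\<^esub> hq g al h) = sig q (unitv i) al \<odot>\<^bsub>S\<^esub> hq g (plusv al (unitv i))"
  unfolding lact_hash[OF X_closed qmonom_closed]
  by (simp add: X_qmonom hash_smult[OF g] plusv_comm[of "unitv i"])
 have "qmonom q al \<otimes>\<^bsub>qA\<^esub> X i = sig q al (unitv i) \<odot>\<^bsub>qA\<^esub> qmonom q (plusv al (unitv i))"
  using qmonom_mult[of al "unitv i"] by (simp add: qmonom_unitv)
 then have "qmonom q al \<otimes>\<^bsub>qA\<^esub> act g (X i) = (lam g i * sig q al (unitv i)) \<odot>\<^bsub>qA\<^esub> qmonom q (plusv al (unitv i))"
  by (simp add: diagonal[OF g] A.mult_smult vs_smult_smult[OF A.vs])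
 then show "(\<lambda>h\<in>carrier G. hq g al h \<otimes>\<^bsub>qA\<^esub> act h (X i)) = (lam g i * sig q al (unitv i)) \<odot>\<^bsub>S\<^esub> hq g (plusv al (unitv i))"
  unfolding ract_hash[OF g X_closed qmonom_closed] by (simp add: hash_smult[OF g])
qed

lemma diag_skew_bimod: "diag_bimodule q B (carrier G) hq lam"
proof (intro diag_bimodule.intro quantum0_axioms diag_bimodule_axioms.intro, goal_cases)
 case 1 show ?case by (rule bimodule_skew_bimod)
next
 case (3)
 have "lext B (\<lambda>(t, al). hq t al) = lext S bS"
  by (simp add: lext_def fun_eq_iff skew_bimod_eq bS_def)
 then show ?case using S.lext_bij by simp
qed (simp_all add: acts_monomial)

lemma component_simps [simp]:
 "carrier (Bc g) = {hsh a g | a. a \<in> carrier qA}" "\<zero>\<^bsub>Bc g\<^esub> = \<zero>\<^bsub>S\<^esub>" "x \<oplus>\<^bsub>Bc g\<^esub> y = x \<oplus>\<^bsub>S\<^esub> y" "c \<odot>\<^bsub>Bc g\<^esub> x = c \<odot>\<^bsub>S\<^esub> x"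
 "lact (Bc g) a \<phi> = (\<lambda>g\<in>carrier G. a \<otimes>\<^bsub>qA\<^esub> \<phi> g)" "ract (Bc g) \<phi> a = (\<lambda>g\<in>carrier G. \<phi> g \<otimes>\<^bsub>qA\<^esub> act g a)"
 by (simp_all add: skew_component_def)

lemma lin_hash_component: "g \<in> carrier G ==> lin qA (Bc g) (\<lambda>a. hsh a g)"
 using lin_hash[of g] by (auto simp: lin_def)

lemma vsp_component:
 assumes g: "g \<in> carrier G"
 shows "vsp (Bc g)"
 by (rule vsp_image[OF A.vs subset_refl, of _ "\<lambda>a. hsh a g"])
  (use lin_add[OF lin_hash[OF g]] lin_smult[OF lin_hash[OF g]] lin_zero[OF A.vs vsp_S lin_hash[OF g]] A.vs in auto)

lemma bimodule_component:
 assumes g: "g \<in> carrier G"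
 shows "bimodule qA (Bc g)"
 unfolding skew_component_def
proof (rule bimodule_sub[OF bimodule_skew_bimod])
 show "vsp (B\<lparr>carrier := {hsh a g |a. a \<in> carrier qA}\<rparr>)" using vsp_component[OF g] by (simp add: skew_component_def)
 fix r m assume r: "r \<in> carrier qA" and "m \<in> {hsh a g |a. a \<in> carrier qA}"
 then obtain a where a: "m = hsh a g" "a \<in> carrier qA" by blast
 have "lact B r m = hsh (r \<otimes>\<^bsub>qA\<^esub> a) g" "ract B m r = hsh (a \<otimes>\<^bsub>qA\<^esub> act g r) g"
  using lact_hash[OF r a(2), of g] ract_hash[OF g r a(2)] a(1) by simp_all
 moreover have "r \<otimes>\<^bsub>qA\<^esub> a \<in> carrier qA" "a \<otimes>\<^bsub>qA\<^esub> act g r \<in> carrier qA" using r a g by simp_all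
 ultimately show "lact B r m \<in> {hsh a g |a. a \<in> carrier qA} \<and> ract B m r \<in> {hsh a g |a. a \<in> carrier qA}" by blast
qed auto

lemma diag_component:
 assumes g: "g \<in> carrier G"
 shows "diag_bimodule q (Bc g) {g} hq lam"
proof (intro diag_bimodule.intro quantum0_axioms diag_bimodule_axioms.intro, goal_cases)
 case 1 show ?case by (rule bimodule_component[OF g])
next
 case 2 then show ?case by auto
next
 case 3
 let ?L = "lext (Bc g) (\<lambda>(t, al). hq t al)"
 note v = vsp_component[OF g]
 have L: "lin (fsm ({g} \<times> UNIV)) (Bc g) ?L" by (rule lin_lext[OF v]) auto
 \<comment> \<open>Reads off the coordinates of the component at \<open>g\<close>; it is the inverse
   of \<open>?L\<close>.\<close>
 define N where "N \<phi> = (\<lambda>(t, al). if t = g then qco (\<phi> g) al else 0)" for \<phi> :: "'g => ('n list => 'k) set"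
 have at: "\<phi> g \<in> carrier qA" if "\<phi> \<in> carrier (Bc g)" for \<phi> using that g by (auto simp: hash_def)
 have N: "lin (Bc g) (fsm ({g} \<times> UNIV)) N"
 proof (rule linI)
  fix \<phi> assume "\<phi> \<in> carrier (Bc g)"
  then show "N \<phi> \<in> FS ({g} \<times> UNIV)"
   using fsmD(1)[OF A.co_fsm[OF at]] by (intro fsmI[of "{g} \<times> {al. qco (\<phi> g) al \<noteq> 0}"]) (auto simp: N_def split: if_splits)
 qed (use g at in \<open>auto simp: N_def fun_eq_iff S_simps(3,4) A.co_add A.co_smult simp del: component_simps(1)\<close>)
 have Nh: "N (hq g al) = dl (g, al)" for al
  using g A.co_b[of al] by (auto simp: N_def hash_def dl_def fun_eq_iff)
 have Lh: "?L (dl (g, al)) = hq g al" for al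
  using lext_dl[OF v, of "\<lambda>(t, al). hq t al" "(g, al)"] lin_closed[OF lin_hash_component[OF g] qmonom_closed[of al]]
  by (simp del: component_simps(1))
 have NL: "N (?L f) = f" if f: "f \<in> FS ({g} \<times> UNIV)" for f
  by (rule lin_fsm_eqI[OF vsp_fsm lin_comp[OF L N] lin_id _ f]) (auto simp: Lh Nh)
 have LN: "?L (N (hsh a g)) = hsh a g" if a: "a \<in> carrier qA" for a
  by (rule A.R_eqI[OF v lin_comp[OF lin_comp[OF lin_hash_component[OF g] N] L] lin_hash_component[OF g] _ a]) (simp add: Nh Lh)
 show ?case
  by (rule bij_betw_byWitness[of _ N]) (use NL LN lin_closed[OF L] lin_closed[OF lin_comp[OF lin_hash_component[OF g] N]] in auto)
qed (use g in \<open>simp_all add: acts_monomial\<close>)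

lemma component_ext_tensor: "ext_tensor (Bc g) m v be = ext_tensor B m v be"
 unfolding ext_tensor_def component_simps(2) B_simps(2) ..

text \<open>For \<open>T = {g}\<close> the first entry of the triples in \<open>gidx\<close> is
  constant; reindexing along \<open>Pair g\<close> removes it. The cochains formed in
  \<open>A_g\<close> and in the whole bimodule coincide because both records have the same
  zero.\<close>

lemma basis_component:
 assumes g: "g \<in> carrier G"
 shows "is_basis (koszul_cohomology q (Bc g) m) (SIGMA be:XE m. sym_exponents q lam g be)
  (\<lambda>(be, al). koszul_class q (Bc g) m (monomial_cochain q G act m g be al))"
proof -
 interpret D: diag_bimodule q "Bc g" "{g}" hq lam by (rule diag_component[OF g])
 have "D.gidx m = Pair g ` (SIGMA be:XE m. sym_exponents q lam g be)"
  by (auto simp: D.gidx_def)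
 then have "is_basis (koszul_cohomology q (Bc g) m) (Pair g ` (SIGMA be:XE m. sym_exponents q lam g be))
   (\<lambda>(t, be, al). koszul_class q (Bc g) m (ext_tensor (Bc g) m (hq t al) be))"
  using D.koszul_basis[of m] by simp
 from is_basis_reindex[OF _ this] show ?thesis
  using vsp_cohomology[OF D.KC] by (simp add: koszul_cohomology_def monomial_cochain_def component_ext_tensor case_prod_unfold inj_def)
qed

lemma basis_skew_bimod:
 "is_basis (koszul_cohomology q B m) (SIGMA g:carrier G. SIGMA be:XE m. sym_exponents q lam g be)
  (\<lambda>(g, be, al). koszul_class q B m (monomial_cochain q G act m g be al))"
proof -
 interpret D: diag_bimodule q B "carrier G" hq lam by (rule diag_skew_bimod)
 show ?thesis using D.koszul_basis[of m] by (simp add: D.gidx_def monomial_cochain_def)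
qed

context
 fixes P :: "nat => ('k, ('n list => 'k) set, 'p) bimodule" and d \<epsilon>
 assumes resolution: "projective_resolution qA P d \<epsilon>"
begin

lemma vsp_HH: "bimodule qA M ==> vsp (HH qA P d M m)"
 unfolding HH_def by (rule vsp_cohomology[OF hom_cplx[OF projective_resolutionD(1)[OF resolution]]])

lemma HH_fsm:
 fixes M :: "('k, ('n list => 'k) set, 'm) bimodule"
 assumes M: "bimodule qA M" and B: "is_basis (koszul_cohomology q M m) J c"
 shows "HH qA P d M m \<cong>\<^sub>k fsm J"
proof -
 obtain p where "\<forall>M :: ('k, ('n list => 'k) set, 'm) bimodule. bimodule qA M -->
   (\<forall>m. lin_iso (HH qA P d M m) (koszul_cohomology q M m) (to_koszul q P d p M m))"
  using koszul_comparison_iso[OF resolution] by (elim exE conjE) (rule that)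
 then have "HH qA P d M m \<cong>\<^sub>k koszul_cohomology q M m" using M unfolding isomorphic_def by blast
 moreover have "vsp (koszul_cohomology q M m)"
  unfolding koszul_cohomology_def by (rule vsp_cohomology[OF koszul_cplx[OF M]])
 ultimately show ?thesis using isomorphic_trans[OF vsp_HH[OF M]] is_basis_iso_fsm[OF _ B] by blast
qed

lemma HH_component:
 assumes g: "g \<in> carrier G"
 shows "HH qA P d (Bc g) m \<cong>\<^sub>k direct_sum (XE m) (\<lambda>be. direct_sum (sym_exponents q lam g be)
  (\<lambda>al. line (koszul_complex (Bc g) m) (monomial_cochain q G act m g be al)))"
proof -
 interpret D: diag_bimodule q "Bc g" "{g}" hq lam by (rule diag_component[OF g])
 show ?thesis
  using D.ext_tensor_nonzero[of g _ m, unfolded component_ext_tensor]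
  by (intro iso_lines2[OF HH_fsm[OF D.M basis_component[OF g]] vsp_HH[OF D.M] cplx_vsp[OF D.KC]])
   (simp only: monomial_cochain_def singletonI simp_thms)
qed

lemma HH_skew_bimod:
 "HH qA P d B m \<cong>\<^sub>k direct_sum (carrier G) (\<lambda>g. direct_sum (XE m) (\<lambda>be. direct_sum (sym_exponents q lam g be)
  (\<lambda>al. line (koszul_complex B m) (monomial_cochain q G act m g be al))))"
proof -
 interpret D: diag_bimodule q B "carrier G" hq lam by (rule diag_skew_bimod)
 show ?thesis
  using D.ext_tensor_nonzero[of _ _ m]
  by (intro iso_lines3[OF HH_fsm[OF D.M basis_skew_bimod] vsp_HH[OF D.M] cplx_vsp[OF D.KC]])
   (simp only: monomial_cochain_def simp_thms)
qed

end

end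

theorem theorem4p1:
  fixes q :: "'n::{finite,linorder} \<Rightarrow> 'n \<Rightarrow> 'k::field_char_0"
    and G :: "'g monoid"
    and act :: "'g \<Rightarrow> ('n list \<Rightarrow> 'k) set \<Rightarrow> ('n list \<Rightarrow> 'k) set"
    and lam :: "'g \<Rightarrow> 'n \<Rightarrow> 'k"
    and P :: "nat \<Rightarrow> ('k, ('n list \<Rightarrow> 'k) set, 'p) bimodule"
    and d :: "nat \<Rightarrow> 'p \<Rightarrow> 'p"
    and \<epsilon> :: "'p \<Rightarrow> ('n list \<Rightarrow> 'k) set"
  assumes q_nonzero: "\<And>i j. q i j \<noteq> 0"
    and q_diag: "\<And>i. q i i = 1"
    and q_inverse: "\<And>i j. q j i = inverse (q i j)"
    and group: "group G" "finite (carrier G)"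
    and action: "graded_action q G act"
    and diagonal: "\<And>g i. g \<in> carrier G \<Longrightarrow> act g (qvar q i) = lam g i \<odot>\<^bsub>qsym q\<^esub> qvar q i"
    and resolution: "projective_resolution (qsym q) P d \<epsilon>"
  shows
    "(\<exists>p. koszul_comparison q P d \<epsilon> p \<and>
       (\<forall>g\<in>carrier G. \<forall>m.
          lin_iso (HH (qsym q) P d (skew_component G (qsym q) act g) m)
            (koszul_cohomology q (skew_component G (qsym q) act g) m)
            (to_koszul q P d p (skew_component G (qsym q) act g) m) \<and>
          is_basis (koszul_cohomology q (skew_component G (qsym q) act g) m)
            (SIGMA \<beta>:ext_exponents m. sym_exponents q lam g \<beta>)
            (\<lambda>(\<beta>, \<alpha>). koszul_class q (skew_component G (qsym q) act g) m
               (monomial_cochain q G act m g \<beta> \<alpha>))) \<and>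
       (\<forall>m.
          lin_iso (HH (qsym q) P d (skew_bimod G (qsym q) act) m)
            (koszul_cohomology q (skew_bimod G (qsym q) act) m)
            (to_koszul q P d p (skew_bimod G (qsym q) act) m) \<and>
          is_basis (koszul_cohomology q (skew_bimod G (qsym q) act) m)
            (SIGMA g:carrier G. SIGMA \<beta>:ext_exponents m. sym_exponents q lam g \<beta>)
            (\<lambda>(g, \<beta>, \<alpha>). koszul_class q (skew_bimod G (qsym q) act) m
               (monomial_cochain q G act m g \<beta> \<alpha>)))) \<and>
     (\<forall>g\<in>carrier G. \<forall>m.
        HH (qsym q) P d (skew_component G (qsym q) act g) m \<cong>\<^sub>k
        direct_sum (ext_exponents m) (\<lambda>\<beta>. direct_sum (sym_exponents q lam g \<beta>) (\<lambda>\<alpha>.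
          line (koszul_complex (skew_component G (qsym q) act g) m)
            (monomial_cochain q G act m g \<beta> \<alpha>)))) \<and>
     (\<forall>m.
        HH (qsym q) P d (skew_bimod G (qsym q) act) m \<cong>\<^sub>k
        direct_sum (carrier G) (\<lambda>g.
          direct_sum (ext_exponents m) (\<lambda>\<beta>. direct_sum (sym_exponents q lam g \<beta>) (\<lambda>\<alpha>.
            line (koszul_complex (skew_bimod G (qsym q) act) m)
              (monomial_cochain q G act m g \<beta> \<alpha>))))) \<and>
     (\<exists>\<psi>. bar_comparison (qsym q) P d \<epsilon> \<psi> \<and>
       (\<forall>m. lin_iso (HH (qsym q) P d (skew_bimod G (qsym q) act) m)
          (cohomology (bar_complex (qsym q) (skew_bimod G (qsym q) act))
             (bar_diff (qsym q) (skew_bimod G (qsym q) act)) m)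
          (to_bar (qsym q) P d \<psi> (skew_bimod G (qsym q) act) m)) \<and>
       (\<forall>(Q :: nat \<Rightarrow> ('k, 'g \<Rightarrow> ('n list \<Rightarrow> 'k) set, 'r) bimodule) d' \<epsilon>'.
          projective_resolution (skew G (qsym q) act) Q d' \<epsilon>' \<longrightarrow>
          (\<forall>m. HH (skew G (qsym q) act) Q d' (regular (skew G (qsym q) act)) m \<cong>\<^sub>k
               HH_invariants G (qsym q) act P d \<psi> m)))"
proof -
 interpret quantum0 q by unfold_locales (fact q_nonzero q_diag q_inverse)+
 have act: "group_action G (carrier qA) act" "\<And>h. h \<in> carrier G ==> act h \<in> ring_hom qA qA" "\<And>h. h \<in> carrier G ==> act h \<in> lin_hom qA qA"
  using action by (auto simp: graded_action_def)
 interpret skew_algebra "qsym q" UNIV "qmonom q" qco G act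
 proof (intro skew_algebra.intro skew_algebra_axioms.intro A.based_algebra_axioms group(1))
  show "finite (carrier G)" by (rule group(2))
  show "lin qA qA (act h)" if "h \<in> carrier G" for h by (rule lin_hom_lin[OF act(3)[OF that]])
  show "act h (a \<otimes>\<^bsub>qA\<^esub> c) = act h a \<otimes>\<^bsub>qA\<^esub> act h c"
   if "h \<in> carrier G" "a \<in> carrier qA" "c \<in> carrier qA" for h a c
   by (rule ring_hom_mult[OF act(2)[OF that(1)] that(2,3)])
  show "act h \<one>\<^bsub>qA\<^esub> = \<one>\<^bsub>qA\<^esub>" if "h \<in> carrier G" for h by (rule ring_hom_one[OF act(2)[OF that]])
  show "act \<one>\<^bsub>G\<^esub> a = a" if "a \<in> carrier qA" for a
   using fun_cong[OF group_action.id_eq_one[OF act(1)], of a] that by simp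
  show "act (h \<otimes>\<^bsub>G\<^esub> h') a = act h (act h' a)" if "h \<in> carrier G" "h' \<in> carrier G" "a \<in> carrier qA" for h h' a
   by (rule group_action.composition_rule[OF act(1) that(3,1,2)])
 qed
 interpret diagonal_action q G act lam
  by (intro diagonal_action.intro quantum0_axioms skew_algebra_axioms diagonal_action_axioms.intro diagonal)
 \<comment> \<open>The \<open>A_g\<close> and the whole skew bimodule share one element type, so a
   single \<open>p\<close>, and below a single \<open>\<psi>\<close>, serves all coefficients in the
   statement.\<close>
 obtain p where p: "koszul_comparison q P d \<epsilon> p"
  "\<forall>M :: ('k, ('n list => 'k) set, 'g => ('n list => 'k) set) bimodule. bimodule qA M -->
   (\<forall>m. lin_iso (HH qA P d M m) (koszul_cohomology q M m) (to_koszul q P d p M m))"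
  using koszul_comparison_iso[OF resolution] by (elim exE conjE) (rule that)
 obtain \<psi> where \<psi>: "bar_comparison qA P d \<epsilon> \<psi>"
  "\<forall>M :: ('k, ('n list => 'k) set, 'g => ('n list => 'k) set) bimodule. bimodule qA M -->
   (\<forall>m. lin_iso (HH qA P d M m) (cohomology (bar_complex qA M) (bar_diff qA M) m) (to_bar qA P d \<psi> M m))"
  using A.bar_comparison_iso[OF resolution] by (elim exE conjE) (rule that)
 note iso = \<psi>(2)[rule_format, OF bimodule_skew_bimod]
 show ?thesis
 proof (rule conjI[OF _ conjI[OF _ conjI]], goal_cases)
  case 1
  show ?case
   by (rule exI[of _ p])
    (intro conjI ballI allI p(1) p(2)[rule_format] bimodule_component bimodule_skew_bimod basis_component basis_skew_bimod; assumption)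
 next
  case 2
  show ?case using HH_component[OF resolution] by blast
 next
  case 3
  show ?case using HH_skew_bimod[OF resolution] by blast
 next
  case 4
  show ?case using \<psi>(1) iso HH_skew[OF resolution _ iso] by blast
 qed
qed

end
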